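(* Let $M$ be a complete connected Riemannian manifold without boundary, $p\in(1,+\infty)$, $Lu=\operatorname{div}A(x,u,\nabla u)$ a weakly-$p$-coercive operator on $M$, and $u\in W^{1,p}_{\mathrm{loc}}(M)$ such that $\Omega_+:=\{x\in M:u(x)>0\}$ has positive measure. Let $B_R$ denote the geodesic ball of radius $R$ centered at a fixed (arbitrary) point of $M$. If $u$ satisfies \[ Lu\ge0\qquad\text{weakly on }\Omega_+ \] and further $A(x,u,\nabla u)\ne0$ on a set $E_0\subseteq\Omega_+$ of positive measure, then for any $q\in(p-1,+\infty)$ \[ \limsup_{R\to+\infty}\frac{1}{R^p}\int_{B_R}u_+^q=+\infty . \] In particular, \[ \limsup_{R\to+\infty}\frac{1}{\log R}\log\int_{B_R}u_+^q\ \ge\ p . \]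
   Context: All integrals over $M$ or its subsets are with respect to the Riemannian volume measure; $\langle\cdot,\cdot\rangle$ is the Riemannian metric, $m=\dim M$; $u_+:=\max\{u,0\}$. $W^{1,p}_{\mathrm{loc}}(M)$ is the space of functions whose restriction to every relatively compact set $\Omega\subseteq M$ belongs to $W^{1,p}(\Omega)$, and $W^{1,p}_c(M)$ is its subspace of compactly supported functions. Integrals of non-negative functions may equal $+\infty$, with $\log(+\infty)=+\infty$. Operators. $A:\mathbb{R}\times TM\to TM$ is a map with $A(x,s,\xi)\in T_xM$ for all $x\in M$, $s\in\mathbb{R}$, $\xi\in T_xM$, whose local representation $\tilde A:\psi(U)\times\mathbb{R}\times\mathbb{R}^m\to\mathbb{R}^m$ in any chart $\psi:U\to\mathbb{R}^m$ satisfies the Carathéodory conditions: $\tilde A(y,\cdot,\cdot)$ is continuous for a.e. $y$, and $\tilde A(\cdot,s,v)$ is measurable for every $(s,v)$. The operator $Lu=\operatorname{div}A(x,u,\nabla u)$ is weakly-$p$-coercive if there is a constant $k>0$ such that for all $x\in M$, $s\in\mathbb{R}$, $\xi\in T_xM$ \[ \langle A(x,s,\xi),\xi\rangle\ge0,\qquad |A(x,s,\xi)|\le k\,\langle A(x,s,\xi),\xi\rangle^{\frac{p-1}{p}} . \] "$Lu\ge0$ weakly on $\Omega_+$" means \[ -\int_M\langle A(x,u,\nabla u),\nabla\varphi\rangle\ \ge\ 0\qquad\forall\,\varphi\in D^+(\Omega_+), \] where $D^+(\Omega_+):=\{\varphi\in W^{1,p}_c(M):\ \varphi\ge0\text{ on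 }M,\ \varphi=0\text{ and }\nabla\varphi=0\text{ a.e. on }M\setminus\Omega_+\}$. *)

theory Defs
  imports "HOL-Analysis.Analysis"
begin

section \<open>Smooth manifolds and tangent vectors\<close>

text \<open>Meaningful only for open \<open>S\<close>.\<close>

primrec Ck_on :: "nat \<Rightarrow> 'a::euclidean_space set \<Rightarrow> ('a \<Rightarrow> 'b::euclidean_space) \<Rightarrow> bool" where
  "Ck_on 0 S f \<longleftrightarrow> continuous_on S f"
| "Ck_on (Suc k) S f \<longleftrightarrow> (\<forall>x\<in>S. f differentiable (at x)) \<and>
     (\<forall>v. Ck_on k S (\<lambda>x. frechet_derivative f (at x) v))"

definition smooth_on :: "'a::euclidean_space set \<Rightarrow> ('a \<Rightarrow> 'b::euclidean_space) \<Rightarrow> bool" where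
  "smooth_on S f \<longleftrightarrow> (\<forall>k. Ck_on k S f)"

text \<open>A chart is a pair of a domain and a coordinate map; the values of the map outside the
  domain are irrelevant. The manifold is the whole type \<^typ>\<open>'a\<close>, its dimension is the
  cardinality of \<^typ>\<open>'n\<close>.\<close>

type_synonym ('a, 'n) chart = "'a set \<times> ('a \<Rightarrow> real ^ 'n)"

abbreviation dom_of :: "('a, 'n::finite) chart \<Rightarrow> 'a set" where "dom_of c \<equiv> fst c"

abbreviation chart_map :: "('a, 'n::finite) chart \<Rightarrow> 'a \<Rightarrow> real ^ 'n" where "chart_map c \<equiv> snd c"

abbreviation chart_inv :: "('a, 'n::finite) chart \<Rightarrow> real ^ 'n \<Rightarrow> 'a" where
  "chart_inv c \<equiv> inv_into (fst c) (snd c)"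

definition is_chart :: "('a::topological_space, 'n::finite) chart \<Rightarrow> bool" where
  "is_chart c \<longleftrightarrow> open (dom_of c) \<and> open (chart_map c ` dom_of c) \<and>
     (\<exists>h. homeomorphism (dom_of c) (chart_map c ` dom_of c) (chart_map c) h)"

definition compatible :: "('a, 'n::finite) chart \<Rightarrow> ('a, 'n) chart \<Rightarrow> bool" where
  "compatible c d \<longleftrightarrow>
     smooth_on (chart_map c ` (dom_of c \<inter> dom_of d)) (chart_map d \<circ> chart_inv c) \<and>
     smooth_on (chart_map d ` (dom_of c \<inter> dom_of d)) (chart_map c \<circ> chart_inv d)"

definition maximal_atlas :: "('a::topological_space, 'n::finite) chart set \<Rightarrow> bool" where
  "maximal_atlas \<A> \<longleftrightarrow> (\<forall>c\<in>\<A>. is_chart c) \<and> (\<Union>c\<in>\<A>. dom_of c) = UNIV \<and>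
     (\<forall>c\<in>\<A>. \<forall>d\<in>\<A>. compatible c d) \<and>
     (\<forall>c. is_chart c \<and> (\<forall>d\<in>\<A>. compatible c d) \<longrightarrow> c \<in> \<A>)"

text \<open>A tangent vector at a point \<open>x\<close> is the family of its coordinate vectors in all charts
  around \<open>x\<close>, related by the differentials of the transition maps. The components for all
  other arguments are set to 0, so that equality of tangent vectors is equality of functions.\<close>

type_synonym ('a, 'n) tvec = "('a, 'n) chart \<Rightarrow> real ^ 'n"

definition tangent_space :: "('a, 'n::finite) chart set \<Rightarrow> 'a \<Rightarrow> ('a, 'n) tvec set" where
  "tangent_space \<A> x = {X.
     (\<forall>c. \<not> (c \<in> \<A> \<and> x \<in> dom_of c) \<longrightarrow> X c = 0) \<and>
     (\<forall>c\<in>\<A>. \<forall>d\<in>\<A>. x \<in> dom_of c \<and> x \<in> dom_of d \<longrightarrow>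
        X d = frechet_derivative (chart_map d \<circ> chart_inv c) (at (chart_map c x)) (X c))}"

definition zero_tvec :: "('a, 'n::finite) tvec" where
  "zero_tvec = (\<lambda>_. 0)"

text \<open>The tangent vector at \<open>x\<close> whose coordinate vector in the chart \<open>c\<close> is \<open>v\<close>.\<close>

definition tvec_of :: "('a, 'n::finite) chart set \<Rightarrow> ('a, 'n) chart \<Rightarrow> 'a \<Rightarrow> real ^ 'n \<Rightarrow> ('a, 'n) tvec" where
  "tvec_of \<A> c x v = (\<lambda>d. if d \<in> \<A> \<and> x \<in> dom_of d
     then frechet_derivative (chart_map d \<circ> chart_inv c) (at (chart_map c x)) v else 0)"

abbreviation coord_field :: "('a, 'n::finite) chart set \<Rightarrow> ('a, 'n) chart \<Rightarrow> 'n \<Rightarrow> 'a \<Rightarrow> ('a, 'n) tvec" where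
  "coord_field \<A> c i x \<equiv> tvec_of \<A> c x (axis i 1)"


section \<open>Riemannian metric, distance and volume\<close>

type_synonym ('a, 'n) metric = "'a \<Rightarrow> ('a, 'n) tvec \<Rightarrow> ('a, 'n) tvec \<Rightarrow> real"

definition riemannian_metric :: "('a, 'n::finite) chart set \<Rightarrow> ('a, 'n) metric \<Rightarrow> bool" where
  "riemannian_metric \<A> g \<longleftrightarrow>
     (\<forall>x. \<forall>X\<in>tangent_space \<A> x. \<forall>Y\<in>tangent_space \<A> x. g x X Y = g x Y X) \<and>
     (\<forall>x. \<forall>X\<in>tangent_space \<A> x. X \<noteq> zero_tvec \<longrightarrow> g x X X > 0) \<and>
     (\<forall>c\<in>\<A>. \<forall>x\<in>dom_of c. bilinear (\<lambda>v w. g x (tvec_of \<A> c x v) (tvec_of \<A> c x w))) \<and>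
     (\<forall>c\<in>\<A>. \<forall>i j. smooth_on (chart_map c ` dom_of c)
        (\<lambda>y. g (chart_inv c y) (coord_field \<A> c i (chart_inv c y)) (coord_field \<A> c j (chart_inv c y))))"

definition riemannian_manifold ::
    "('a::{t2_space, second_countable_topology}, 'n::finite) chart set \<Rightarrow> ('a, 'n) metric \<Rightarrow> bool" where
  "riemannian_manifold \<A> g \<longleftrightarrow> maximal_atlas \<A> \<and> riemannian_metric \<A> g"

definition tnorm :: "('a, 'n::finite) metric \<Rightarrow> 'a \<Rightarrow> ('a, 'n) tvec \<Rightarrow> real" where
  "tnorm g x X = sqrt (g x X X)"

text \<open>The curve is continuous on \<open>[0,1]\<close> and continuously differentiable off a finite set, as
  in \<^const>\<open>piecewise_C1_differentiable_on\<close>. Speeds may be unbounded near exceptional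
  parameters, which does not change the infimum of lengths.\<close>

definition piecewise_C1_curve :: "('a::topological_space, 'n::finite) chart set \<Rightarrow> (real \<Rightarrow> 'a) \<Rightarrow> bool" where
  "piecewise_C1_curve \<A> \<gamma> \<longleftrightarrow> path \<gamma> \<and> (\<exists>S. finite S \<and>
     (\<forall>c\<in>\<A>. (chart_map c \<circ> \<gamma>) C1_differentiable_on {t \<in> {0<..<1} - S. \<gamma> t \<in> dom_of c}))"

definition velocity :: "('a, 'n::finite) chart set \<Rightarrow> (real \<Rightarrow> 'a) \<Rightarrow> real \<Rightarrow> ('a, 'n) tvec" where
  "velocity \<A> \<gamma> t = (\<lambda>c. if c \<in> \<A> \<and> \<gamma> t \<in> dom_of c
     then vector_derivative (chart_map c \<circ> \<gamma>) (at t) else 0)"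

definition curve_length :: "('a, 'n::finite) chart set \<Rightarrow> ('a, 'n) metric \<Rightarrow> (real \<Rightarrow> 'a) \<Rightarrow> ennreal" where
  "curve_length \<A> g \<gamma> = (\<integral>\<^sup>+t\<in>{0..1}. ennreal (tnorm g (\<gamma> t) (velocity \<A> \<gamma> t)) \<partial>lborel)"

text \<open>On a connected manifold the infimum is finite, so the conversion to a real loses nothing.\<close>

definition riemannian_dist ::
    "('a::topological_space, 'n::finite) chart set \<Rightarrow> ('a, 'n) metric \<Rightarrow> 'a \<Rightarrow> 'a \<Rightarrow> real" where
  "riemannian_dist \<A> g x y = enn2real
     (INF \<gamma> \<in> {\<gamma>. piecewise_C1_curve \<A> \<gamma> \<and> pathstart \<gamma> = x \<and> pathfinish \<gamma> = y}. curve_length \<A> g \<gamma>)"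

abbreviation geodesic_ball ::
    "('a::topological_space, 'n::finite) chart set \<Rightarrow> ('a, 'n) metric \<Rightarrow> 'a \<Rightarrow> real \<Rightarrow> 'a set" where
  "geodesic_ball \<A> g \<equiv> Metric_space.mball UNIV (riemannian_dist \<A> g)"

definition complete_manifold :: "('a::topological_space, 'n::finite) chart set \<Rightarrow> ('a, 'n) metric \<Rightarrow> bool" where
  "complete_manifold \<A> g \<longleftrightarrow> Metric_space.mcomplete UNIV (riemannian_dist \<A> g)"

definition gram_det :: "('a, 'n::finite) chart set \<Rightarrow> ('a, 'n) metric \<Rightarrow> ('a, 'n) chart \<Rightarrow> 'a \<Rightarrow> real" where
  "gram_det \<A> g c x = det (\<chi> i j. g x (coord_field \<A> c i x) (coord_field \<A> c j x))"

text \<open>The Riemannian volume measure on the Lebesgue measurable sets of the manifold. Its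
  values on sets inside chart domains determine it, as countably many charts cover.\<close>

definition riemannian_volume ::
    "('a, 'n::finite) chart set \<Rightarrow> ('a, 'n) metric \<Rightarrow> 'a measure \<Rightarrow> bool" where
  "riemannian_volume \<A> g vol \<longleftrightarrow>
     space vol = UNIV \<and>
     sets vol = {B. \<forall>c\<in>\<A>. chart_map c ` (B \<inter> dom_of c) \<in> sets lebesgue} \<and>
     (\<forall>c\<in>\<A>. \<forall>B\<in>sets vol. B \<subseteq> dom_of c \<longrightarrow>
        emeasure vol B =
          (\<integral>\<^sup>+y\<in>chart_map c ` B. ennreal (sqrt (gram_det \<A> g c (chart_inv c y))) \<partial>lebesgue))"


section \<open>Sobolev spaces\<close>

definition test_function :: "(real ^ 'n::finite) set \<Rightarrow> (real ^ 'n \<Rightarrow> real) \<Rightarrow> bool" where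
  "test_function S \<phi> \<longleftrightarrow> smooth_on UNIV \<phi> \<and>
     compact (closure {y. \<phi> y \<noteq> 0}) \<and> closure {y. \<phi> y \<noteq> 0} \<subseteq> S"

text \<open>\<open>X\<close> is the weak gradient of \<open>u\<close> on the open set \<open>\<Omega>\<close>: in each chart the
  covariant components \<open>\<langle>X, \<partial>\<^sub>i\<rangle>\<close> of \<open>X\<close> are the weak partial derivatives of
  the coordinate representation of \<open>u\<close>.\<close>

definition weak_gradient ::
    "('a::topological_space, 'n::finite) chart set \<Rightarrow> ('a, 'n) metric \<Rightarrow> 'a measure \<Rightarrow> 'a set \<Rightarrow>
     ('a \<Rightarrow> real) \<Rightarrow> ('a \<Rightarrow> ('a, 'n) tvec) \<Rightarrow> bool" where
  "weak_gradient \<A> g vol \<Omega> u X \<longleftrightarrow>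
     (\<forall>x\<in>\<Omega>. X x \<in> tangent_space \<A> x) \<and>
     (\<forall>c\<in>\<A>. (\<lambda>x. X x c) \<in> borel_measurable (restrict_space vol (\<Omega> \<inter> dom_of c))) \<and>
     (\<forall>K. compact K \<and> K \<subseteq> \<Omega> \<longrightarrow>
        set_integrable vol K u \<and> set_integrable vol K (\<lambda>x. tnorm g x (X x))) \<and>
     (\<forall>c\<in>\<A>. \<forall>i \<phi>. test_function (chart_map c ` (\<Omega> \<inter> dom_of c)) \<phi> \<longrightarrow>
        (LINT y : chart_map c ` (\<Omega> \<inter> dom_of c) | lebesgue.
           u (chart_inv c y) * frechet_derivative \<phi> (at y) (axis i 1)) =
        - (LINT y : chart_map c ` (\<Omega> \<inter> dom_of c) | lebesgue.
           g (chart_inv c y) (X (chart_inv c y)) (coord_field \<A> c i (chart_inv c y)) * \<phi> y))"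

definition Lp_on :: "'a measure \<Rightarrow> real \<Rightarrow> 'a set \<Rightarrow> ('a \<Rightarrow> real) set" where
  "Lp_on vol p \<Omega> = {f. f \<in> borel_measurable (restrict_space vol \<Omega>) \<and>
     integrable (restrict_space vol \<Omega>) (\<lambda>x. \<bar>f x\<bar> powr p)}"

definition W1p ::
    "('a::topological_space, 'n::finite) chart set \<Rightarrow> ('a, 'n) metric \<Rightarrow> 'a measure \<Rightarrow> real \<Rightarrow> 'a set \<Rightarrow>
     ('a \<Rightarrow> real) set" where
  "W1p \<A> g vol p \<Omega> = {u. u \<in> Lp_on vol p \<Omega> \<and>
     (\<exists>X. weak_gradient \<A> g vol \<Omega> u X \<and> (\<lambda>x. tnorm g x (X x)) \<in> Lp_on vol p \<Omega>)}"

definition W1p_loc ::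
    "('a::topological_space, 'n::finite) chart set \<Rightarrow> ('a, 'n) metric \<Rightarrow> 'a measure \<Rightarrow> real \<Rightarrow>
     ('a \<Rightarrow> real) set" where
  "W1p_loc \<A> g vol p = {u. \<forall>\<Omega>. open \<Omega> \<and> compact (closure \<Omega>) \<longrightarrow> u \<in> W1p \<A> g vol p \<Omega>}"

definition W1p_c ::
    "('a::topological_space, 'n::finite) chart set \<Rightarrow> ('a, 'n) metric \<Rightarrow> 'a measure \<Rightarrow> real \<Rightarrow>
     ('a \<Rightarrow> real) set" where
  "W1p_c \<A> g vol p = {\<phi> \<in> W1p_loc \<A> g vol p.
     \<exists>K. compact K \<and> (AE x in vol. x \<notin> K \<longrightarrow> \<phi> x = 0)}"

text \<open>Weak gradients are unique almost everywhere; this is an arbitrary representative.\<close>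

definition grad ::
    "('a::topological_space, 'n::finite) chart set \<Rightarrow> ('a, 'n) metric \<Rightarrow> 'a measure \<Rightarrow>
     ('a \<Rightarrow> real) \<Rightarrow> 'a \<Rightarrow> ('a, 'n) tvec" where
  "grad \<A> g vol u = (SOME X. weak_gradient \<A> g vol UNIV u X)"


section \<open>Quasilinear operators\<close>

type_synonym ('a, 'n) operator = "'a \<Rightarrow> real \<Rightarrow> ('a, 'n) tvec \<Rightarrow> ('a, 'n) tvec"

definition local_rep ::
    "('a, 'n::finite) chart set \<Rightarrow> ('a, 'n) operator \<Rightarrow> ('a, 'n) chart \<Rightarrow>
     real ^ 'n \<Rightarrow> real \<Rightarrow> real ^ 'n \<Rightarrow> real ^ 'n" where
  "local_rep \<A> A c y s v = A (chart_inv c y) s (tvec_of \<A> c (chart_inv c y) v) c"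

definition caratheodory_operator :: "('a, 'n::finite) chart set \<Rightarrow> ('a, 'n) operator \<Rightarrow> bool" where
  "caratheodory_operator \<A> A \<longleftrightarrow>
     (\<forall>x s. \<forall>\<xi>\<in>tangent_space \<A> x. A x s \<xi> \<in> tangent_space \<A> x) \<and>
     (\<forall>c\<in>\<A>.
        (AE y in lebesgue_on (chart_map c ` dom_of c).
           continuous_on UNIV (\<lambda>(s, v). local_rep \<A> A c y s v)) \<and>
        (\<forall>s v. (\<lambda>y. local_rep \<A> A c y s v) \<in> borel_measurable (lebesgue_on (chart_map c ` dom_of c))))"

definition weakly_coercive ::
    "('a, 'n::finite) chart set \<Rightarrow> ('a, 'n) metric \<Rightarrow> real \<Rightarrow> ('a, 'n) operator \<Rightarrow> bool" where
  "weakly_coercive \<A> g p A \<longleftrightarrow> (\<exists>k>0. \<forall>x s. \<forall>\<xi>\<in>tangent_space \<A> x.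
     g x (A x s \<xi>) \<xi> \<ge> 0 \<and> tnorm g x (A x s \<xi>) \<le> k * g x (A x s \<xi>) \<xi> powr ((p - 1) / p))"

definition D_plus ::
    "('a::topological_space, 'n::finite) chart set \<Rightarrow> ('a, 'n) metric \<Rightarrow> 'a measure \<Rightarrow> real \<Rightarrow> 'a set \<Rightarrow>
     ('a \<Rightarrow> real) set" where
  "D_plus \<A> g vol p \<Omega> = {\<phi> \<in> W1p_c \<A> g vol p. (AE x in vol. \<phi> x \<ge> 0) \<and>
     (AE x in vol. x \<notin> \<Omega> \<longrightarrow> \<phi> x = 0 \<and> grad \<A> g vol \<phi> x = zero_tvec)}"

definition weakly_nonneg_on ::
    "('a::topological_space, 'n::finite) chart set \<Rightarrow> ('a, 'n) metric \<Rightarrow> 'a measure \<Rightarrow> real \<Rightarrow>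
     ('a, 'n) operator \<Rightarrow> ('a \<Rightarrow> real) \<Rightarrow> 'a set \<Rightarrow> bool" where
  "weakly_nonneg_on \<A> g vol p A u \<Omega> \<longleftrightarrow> (\<forall>\<phi>\<in>D_plus \<A> g vol p \<Omega>.
     - (LINT x | vol. g x (A x (u x) (grad \<A> g vol u x)) (grad \<A> g vol \<phi> x)) \<ge> 0)"


definition ln_ennreal :: "ennreal \<Rightarrow> ereal" where
  "ln_ennreal t = (if t = \<infinity> then \<infinity> else if t = 0 then - \<infinity> else ereal (ln (enn2real t)))"

end

theory Submission
  imports Defs
begin

text \<open>Test the inequality with \<open>\<Psi> h(u)\<close>, where \<open>\<Psi>\<close> is a cutoff of the ball of radius \<open>R\<close> with
  \<open>|\<nabla>\<Psi>| \<le> (c/R) \<Psi>\<^bsup>(p-1)/p\<^esup>\<close>, and \<open>h\<close> is a bounded-slope substitute for \<open>u\<^sub>+\<^bsup>q-p+1\<^esup>\<close> with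
  \<open>h(t) \<le> c t\<^bsup>q/p\<^esup> h'(t)\<^bsup>(p-1)/p\<^esup>\<close>. With \<open>F = \<langle>A, \<nabla>u\<rangle>\<close>, weak coercivity and Young's inequality give
  \<open>\<integral> \<Psi> h'(u) F \<le> K \<mu>\<^bsup>p-1\<^esup> R\<^bsup>-p\<^esup> \<integral> u\<^sub>+\<^sup>q + (K/\<mu>) \<integral> \<Psi> h'(u) F\<close> for every \<open>\<mu> > 0\<close>, where the last
  integral is over an annulus. If the growth of \<open>\<integral> u\<^sub>+\<^sup>q\<close> were \<open>O(R\<^sup>p)\<close>, this would first bound the
  integral of \<open>h'(u) F\<close> over \<open>M\<close> and then force it to vanish, so that \<open>A(x, u, \<nabla>u) = 0\<close> almost
  everywhere on \<open>u > 0\<close>.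

  The cutoff is a function of a \<open>C\<^sup>1\<close> approximation of the distance with slope at most 3: local
  mollifications in charts are glued along a finite cover of a closed ball, compact by Hopf--Rinow.\<close>

section \<open>Bump functions and the chain rule for weak derivatives\<close>

text \<open>The exponent (p-1)/p in the bounds for the cutoff and for h is dictated by weak
  coercivity, |A| \<le> k F^((p-1)/p): with it, h(u) |A| |\<nabla>\<Psi>| contains the same power of
  \<Psi> h'(u) F, the very integrand of the left side, and Young's inequality can be applied. A
  cutoff of this kind is a high power of an ordinary one. The weight (\<mu>/R)^p in Young's
  inequality produces R^(-p), and this is the origin of the rate p. The plain power of u_+ with
  exponent q-p+1 is not an admissible test function in general: above 1 its slope is unbounded while
  u is only in W^{1,p}_loc, and up to 1 it is not C^1 at 0. The hypothesis q > p-1 says that this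
  exponent is positive. Gradients are weak and tested chart by chart. The rules for \<Psi> h(u) are
  therefore proved on R^n by difference quotients, and they ask the factor \<Psi> to be C^1; this is
  why the distance, which is only Lipschitz, is smoothed.\<close>

definition flat :: "nat \<Rightarrow> real \<Rightarrow> real" where
  "flat m t = (if t \<le> 0 then 0 else exp (- (1 / t)) / t ^ m)"

lemma flat_tendsto_0: "(flat m \<longlongrightarrow> 0) (at 0)"
proof -
  have 1: "((\<lambda>t::real. (inverse t) ^ m / exp (inverse t)) \<longlongrightarrow> 0) (at_right 0)"
    by (rule filterlim_compose[OF tendsto_power_div_exp_0 filterlim_inverse_at_top_right])
  have r: "(flat m \<longlongrightarrow> 0) (at_right 0)"
    by (rule Lim_transform_eventually[OF 1])
      (auto simp: eventually_at_right_less flat_def exp_minus field_simps intro!: eventually_at_rightI[of 0 1])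
  have l: "(flat m \<longlongrightarrow> 0) (at_left 0)"
    by (rule tendsto_eventually) (auto simp: flat_def intro!: eventually_at_leftI[of "-1"])
  show ?thesis using l r by (simp add: filterlim_at_split)
qed

text \<open>For t > 0 differentiation of exp(-1/t) t^(-m) only raises the negative power, which is
  why the family carries the exponent \<open>m\<close>. At 0 the difference quotient of
  \<open>flat m\<close> is \<open>flat (Suc m)\<close>, which tends to 0.\<close>

lemma flat_has_real_derivative:
  "(flat m has_real_derivative (flat (m+2) t - m * flat (m+1) t)) (at t)"
proof -
  consider "t < 0" | "t = 0" | "t > 0" by linarith
  then show ?thesis
  proof cases
    case 1
    have "((\<lambda>_. 0) has_real_derivative 0) (at t)" by simp
    then have "(flat m has_real_derivative 0) (at t)"
      by (rule has_field_derivative_transform_within_open[where S="{..<0}"])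
         (use 1 in \<open>auto simp: flat_def\<close>)
    then show ?thesis using 1 by (simp add: flat_def)
  next
    case 2
    have eq: "flat (Suc m) h = (flat m (0 + h) - flat m 0) / h" if "h \<noteq> 0" for h
      using that by (auto simp: flat_def field_simps)
    have "((\<lambda>h. (flat m (0 + h) - flat m 0) / h) \<longlongrightarrow> 0) (at 0)"
      by (rule Lim_transform_eventually[OF flat_tendsto_0[of "Suc m"]])
         (auto simp: eventually_at_filter eq)
    then show ?thesis using 2 by (simp add: DERIV_def flat_def)
  next
    case 3
    have "((\<lambda>t. exp (- (1/t)) / t ^ m) has_real_derivative
       ((exp (- (1/t)) * (1 / t^2)) * t^m - exp (- (1/t)) * (m * t^(m-1))) / (t^m * t^m)) (at t)"
      using 3 by (auto intro!: derivative_eq_intros simp: power2_eq_square field_simps)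
    also have "((exp (- (1/t)) * (1 / t^2)) * t^m - exp (- (1/t)) * (m * t^(m-1))) / (t^m * t^m)
        = flat (m+2) t - m * flat (m+1) t"
      using 3 by (cases m) (auto simp: flat_def field_simps power2_eq_square)
    finally show ?thesis
      by (rule has_field_derivative_transform_within_open[where S="{0<..}"])
         (use 3 in \<open>auto simp: flat_def\<close>)
  qed
qed

text \<open>The class is closed under partial derivatives and consists of continuous functions, hence of
  smooth ones; this avoids iterated derivatives of products.\<close>

inductive_set bump_algebra :: "('a::euclidean_space \<Rightarrow> real) set" where
  flat: "bounded_linear l \<Longrightarrow> (\<lambda>x. flat m (l x + c)) \<in> bump_algebra"
| const: "(\<lambda>x. c) \<in> bump_algebra"
| add: "f \<in> bump_algebra \<Longrightarrow> h \<in> bump_algebra \<Longrightarrow> (\<lambda>x. f x + h x) \<in> bump_algebra"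
| mult: "f \<in> bump_algebra \<Longrightarrow> h \<in> bump_algebra \<Longrightarrow> (\<lambda>x. f x * h x) \<in> bump_algebra"

lemma bump_algebra_prod:
  "finite I \<Longrightarrow> (\<And>i. i \<in> I \<Longrightarrow> f i \<in> bump_algebra) \<Longrightarrow> (\<lambda>x. \<Prod>i\<in>I. f i x) \<in> bump_algebra"
  by (induction I rule: finite_induct) (auto intro: bump_algebra.intros)

lemma bump_algebra_derivative:
  assumes "f \<in> bump_algebra"
  shows "\<exists>D. (\<forall>x. (f has_derivative D x) (at x)) \<and> (\<forall>v. (\<lambda>x. D x v) \<in> bump_algebra)"
  using assms
proof induction
  case (flat l m c)
  have "((\<lambda>x. flat m (l x + c)) has_derivative
     (\<lambda>v. (flat (m+2) (l x + c) - m * flat (m+1) (l x + c)) * l v)) (at x)" for x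
  proof -
    have "((\<lambda>x. l x + c) has_derivative l) (at x)"
      using has_derivative_add[OF bounded_linear_imp_has_derivative[OF flat] has_derivative_const] by simp
    from has_derivative_compose[OF this flat_has_real_derivative[unfolded has_field_derivative_def]]
    show ?thesis .
  qed
  moreover have "(\<lambda>x. (flat (m+2) (l x + c) - m * flat (m+1) (l x + c)) * l v) \<in> bump_algebra" for v
  proof -
    have "(\<lambda>x. (flat (m+2) (l x + c) + (- m) * flat (m+1) (l x + c)) * l v) \<in> bump_algebra"
      by (intro bump_algebra.intros flat)
    then show ?thesis by (simp add: algebra_simps)
  qed
  ultimately show ?case by (intro exI[of _ "\<lambda>x v. (flat (m+2) (l x + c) - m * flat (m+1) (l x + c)) * l v"]) blast
next
  case (const c)
  then show ?case by (intro exI[of _ "\<lambda>x v. 0"]) (auto intro: bump_algebra.intros)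
next
  case (add f h)
  then obtain D E where "\<And>x. (f has_derivative D x) (at x)" "\<And>v. (\<lambda>x. D x v) \<in> bump_algebra"
    "\<And>x. (h has_derivative E x) (at x)" "\<And>v. (\<lambda>x. E x v) \<in> bump_algebra" by metis
  then show ?case by (intro exI[of _ "\<lambda>x v. D x v + E x v"]) (auto intro: bump_algebra.intros has_derivative_add)
next
  case (mult f h)
  then obtain D E where "\<And>x. (f has_derivative D x) (at x)" "\<And>v. (\<lambda>x. D x v) \<in> bump_algebra"
    "\<And>x. (h has_derivative E x) (at x)" "\<And>v. (\<lambda>x. E x v) \<in> bump_algebra" by metis
  with mult.hyps show ?case by (intro exI[of _ "\<lambda>x v. f x * E x v + D x v * h x"])
       (auto intro!: bump_algebra.intros has_derivative_mult)
qed

lemma Ck_on_bump_algebra: "f \<in> bump_algebra \<Longrightarrow> Ck_on k UNIV f"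
proof (induction k arbitrary: f)
  case 0
  then show ?case using bump_algebra_derivative[OF 0]
    by (auto simp: continuous_on_eq_continuous_at intro: has_derivative_continuous)
next
  case (Suc k)
  from bump_algebra_derivative[OF Suc.prems] obtain D where
    D: "\<And>x. (f has_derivative D x) (at x)" "\<And>v. (\<lambda>x. D x v) \<in> bump_algebra" by blast
  have "frechet_derivative f (at x) = D x" for x using D(1) frechet_derivative_at by metis
  with D Suc.IH show ?case by (auto simp: differentiable_def)
qed

section \<open>Smooth bumps on boxes and the fundamental lemma of the calculus of variations\<close>

definition box_bump :: "real \<Rightarrow> real^'n \<Rightarrow> real^'n::finite \<Rightarrow> real^'n \<Rightarrow> real" where
  "box_bump k a b x = (\<Prod>i\<in>UNIV. flat 0 (k * (x $ i - a $ i)) * flat 0 (k * (b $ i - x $ i)))"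

lemma box_bump_translate: "box_bump k a b (x + v) = box_bump k (a - v) (b - v) x"
  by (simp add: box_bump_def algebra_simps)

lemma box_bump_in_bump_algebra: "box_bump k a b \<in> bump_algebra"
proof -
  have 1: "(\<lambda>x. flat 0 (k * (x $ i - a $ i))) \<in> bump_algebra" for i
    using bump_algebra.flat[of "\<lambda>x. k * x $ i" 0 "- k * a $ i"]
    by (simp add: bounded_linear_mult_const bounded_linear_const_mult bounded_linear_vec_nth algebra_simps)
  have 2: "(\<lambda>x. flat 0 (k * (b $ i - x $ i))) \<in> bump_algebra" for i
    using bump_algebra.flat[of "\<lambda>x. - k * x $ i" 0 "k * b $ i"]
    by (simp add: bounded_linear_minus bounded_linear_const_mult bounded_linear_vec_nth algebra_simps)
  have "(\<lambda>x. \<Prod>i\<in>UNIV. flat 0 (k * (x $ i - a $ i)) * flat 0 (k * (b $ i - x $ i))) \<in> bump_algebra"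
    by (intro bump_algebra_prod bump_algebra.mult 1 2) simp
  then show ?thesis by (simp add: box_bump_def[abs_def])
qed

lemma flat_0_bounds: "0 \<le> flat 0 t" "flat 0 t \<le> 1"
  by (auto simp: flat_def)

lemma box_bump_bounds: "0 \<le> box_bump k a b x" "box_bump k a b x \<le> 1"
  by (auto simp: box_bump_def intro!: prod_nonneg prod_le_1 mult_le_one flat_0_bounds mult_nonneg_nonneg)

lemma box_bump_eq_0:
  assumes "k > 0" "x \<notin> box a b" shows "box_bump k a b x = 0"
proof -
  from assms obtain i where "x $ i \<le> a $ i \<or> b $ i \<le> x $ i"
    by (auto simp: mem_box_cart not_less)
  then show ?thesis using \<open>k > 0\<close> unfolding box_bump_def
    by (intro prod_zero) (auto simp: flat_def mult_le_0_iff intro!: bexI[of _ i])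
qed

text \<open>For s > 0 the factor exp(-1/(k s)) tends to 1, and off the open box some factor is 0.
  Integrals over boxes are therefore limits of integrals against smooth functions.\<close>

lemma box_bump_tendsto: "(\<lambda>k. box_bump (real (Suc k)) a b x) \<longlonglongrightarrow> indicator (box a b) x"
proof (cases "x \<in> box a b")
  case True
  have *: "(\<lambda>k. flat 0 (real (Suc k) * c)) \<longlonglongrightarrow> 1" if "c > 0" for c
  proof -
    have "(\<lambda>k. exp (- (inverse (real (Suc k)) * (1/c)))) \<longlonglongrightarrow> exp (- (0 * (1/c)))"
      by (intro tendsto_intros LIMSEQ_inverse_real_of_nat)
    also have "(\<lambda>k. exp (- (inverse (real (Suc k)) * (1/c)))) = (\<lambda>k. flat 0 (real (Suc k) * c))"
    proof
      fix k
      have "real (Suc k) * c > 0" using that by simp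
      then show "exp (- (inverse (real (Suc k)) * (1/c))) = flat 0 (real (Suc k) * c)"
        by (simp add: flat_def divide_inverse mult.commute del: of_nat_Suc)
    qed
    finally show ?thesis by simp
  qed
  have "(\<lambda>k. box_bump (real (Suc k)) a b x) \<longlonglongrightarrow> (\<Prod>i\<in>(UNIV::'a set). 1 * 1)"
    unfolding box_bump_def using True by (intro tendsto_intros *) (auto simp: mem_box_cart)
  then show ?thesis using True by simp
next
  case False
  then show ?thesis by (simp add: box_bump_eq_0)
qed

lemma box_bump_test_function:
  assumes "k > 0" "cbox a b \<subseteq> S" shows "test_function S (box_bump k a b)"
proof -
  have "closure {y. box_bump k a b y \<noteq> 0} \<subseteq> cbox a b"
    using box_bump_eq_0[OF \<open>k > 0\<close>, of _ a b] box_subset_cbox[of a b]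
    by (intro closure_minimal) auto
  moreover from this have "compact (closure {y. box_bump k a b y \<noteq> 0})"
    using compact_Int_closed[OF compact_cbox closed_closure, of a b "{y. box_bump k a b y \<noteq> 0}"]
    by (simp add: Int_absorb1)
  ultimately show ?thesis using assms
    by (auto simp: test_function_def smooth_on_def Ck_on_bump_algebra box_bump_in_bump_algebra)
qed

lemma continuous_box_bump: "continuous_on UNIV (box_bump k a b)"
  using Ck_on_bump_algebra[OF box_bump_in_bump_algebra, of 0] by simp

text \<open>Testing with box bumps of growing steepness gives zero integral over every box in
  \<open>V\<close>; Lebesgue's differentiation theorem along cubes then identifies w(x) for almost
  every x. The hypothesis mentions explicit bumps only, so later proofs can compute with
  them.\<close>

lemma fundamental_lemma:
  fixes w :: "real^'n::finite \<Rightarrow> real"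
  assumes w: "integrable lborel w" and "open V"
    and 0: "\<And>k a b. k > 0 \<Longrightarrow> cbox a b \<subseteq> V \<Longrightarrow> (LINT x|lborel. w x * box_bump k a b x) = 0"
  shows "AE x in lborel. x \<in> V \<longrightarrow> w x = 0"
proof -
  have hk: "w integrable_on cbox a b" for a b
  proof -
    have "set_integrable lborel (cbox a b) w"
      using w unfolding set_integrable_def by (intro integrable_mult_indicator) auto
    then show ?thesis by (rule set_borel_integral_eq_integral(1))
  qed
  have z: "integral (cbox a b) w = 0" if "cbox a b \<subseteq> V" for a b
  proof -
    have "(\<lambda>k. LINT x|lborel. w x * box_bump (real (Suc k)) a b x) \<longlonglongrightarrow> (LINT x|lborel. w x * indicator (box a b) x)"
    proof (rule integral_dominated_convergence[where w="\<lambda>x. \<bar>w x\<bar>"])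
      show "(\<lambda>x. w x * box_bump (real (Suc i)) a b x) \<in> borel_measurable lborel" for i
        using borel_measurable_integrable[OF w] borel_measurable_continuous_onI[OF continuous_box_bump]
        by (intro borel_measurable_times) auto
      show "AE x in lborel. (\<lambda>i. w x * box_bump (real (Suc i)) a b x) \<longlonglongrightarrow> w x * indicator (box a b) x"
        using box_bump_tendsto tendsto_mult_left by blast
      show "AE x in lborel. norm (w x * box_bump (real (Suc i)) a b x) \<le> \<bar>w x\<bar>" for i
        using box_bump_bounds[of "real (Suc i)" a b] by (auto simp: abs_mult mult_left_le)
    qed (use w in auto)
    moreover have "(LINT x|lborel. w x * box_bump (real (Suc k)) a b x) = 0" for k
      using that by (intro 0) auto
    ultimately have "(LINT x|lborel. w x * indicator (box a b) x) = 0"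
      by (simp add: LIMSEQ_const_iff)
    then have "set_lebesgue_integral lborel (box a b) w = 0"
      by (simp add: set_lebesgue_integral_def mult.commute)
    moreover have "set_integrable lborel (box a b) w"
      using w unfolding set_integrable_def by (intro integrable_mult_indicator) auto
    ultimately show ?thesis using set_borel_integral_eq_integral(2) integral_open_interval[of a b w] by fastforce
  qed
  \<comment> \<open>Lebesgue differentiation: off the null set \<open>N\<close> the averages over
    the cubes with lower corner x and side h converge to w(x).\<close>
  obtain N where N: "negligible N" "\<And>x e. \<lbrakk>x \<notin> N; 0 < e\<rbrakk> \<Longrightarrow>
       \<exists>d>0. \<forall>h. 0 < h \<and> h < d \<longrightarrow> norm(integral (cbox x (x + h *\<^sub>R One)) w /\<^sub>R h ^ DIM(real^'n) - w x) < e"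
    using integrable_ccontinuous_explicit[of w, OF hk] by metis
  have "w x = 0" if "x \<notin> N" "x \<in> V" for x
  proof (rule ccontr)
    assume "w x \<noteq> 0"
    then obtain d where d: "d > 0" "\<And>h. 0 < h \<Longrightarrow> h < d \<Longrightarrow>
       norm(integral (cbox x (x + h *\<^sub>R One)) w /\<^sub>R h ^ DIM(real^'n) - w x) < \<bar>w x\<bar>"
      using N(2)[OF \<open>x \<notin> N\<close>, of "\<bar>w x\<bar>"] by (meson zero_less_abs_iff)
    obtain e where e: "e > 0" "cball x e \<subseteq> V" using \<open>open V\<close> \<open>x \<in> V\<close> open_contains_cball by blast
    let ?n = "norm (One :: real^'n)"
    have n: "?n > 0" by simp
    \<comment> \<open>The side is below \<open>d\<close> and the diagonal at most \<open>e\<close>,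
      so the cube stays in \<open>V\<close> and its average is 0, although it should differ from
      w(x) by less than |w(x)|.\<close>
    define h where "h = min (d/2) (e / ?n)"
    have h: "0 < h" "h < d" "h * ?n \<le> e" using d(1) e(1) n by (auto simp: h_def min_def field_simps)
    have "cbox x (x + h *\<^sub>R One) \<subseteq> cball x e"
    proof
      fix y assume y: "y \<in> cbox x (x + h *\<^sub>R One)"
      have "norm (y - x) \<le> norm (h *\<^sub>R (One :: real^'n))"
        using y h(1) by (intro norm_le_componentwise) (auto simp: mem_box algebra_simps abs_if)
      then show "y \<in> cball x e" using h by (simp add: dist_norm norm_minus_commute)
    qed
    then have "integral (cbox x (x + h *\<^sub>R One)) w = 0" using e by (intro z) auto
    then show False using d(2)[OF h(1,2)] by simp
  qed
  then have "{x\<in>V. w x \<noteq> 0} \<subseteq> N" by auto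
  then have "negligible {x\<in>V. w x \<noteq> 0}" using N(1) negligible_subset by blast
  then have "AE x in lebesgue. x \<in> V \<longrightarrow> w x = 0"
    by (auto simp: negligible_iff_null_sets eventually_ae_filter intro!: bexI[of _ "{x\<in>V. w x \<noteq> 0}"])
  then show ?thesis by (simp add: AE_completion_iff)
qed

section \<open>Continuity of translation in L^1 and averages along segments\<close>

lemma lborel_integrable_translate:
  fixes f :: "'a::euclidean_space \<Rightarrow> real"
  assumes "integrable lborel f" shows "integrable lborel (\<lambda>x. f (x + v))"
proof -
  have "integrable (distr lborel borel ((+) v)) f" using assms by (simp add: lborel_distr_plus)
  then show ?thesis
    using borel_measurable_integrable[OF assms] by (subst (asm) integrable_distr_eq) (auto simp: add.commute)
qed

lemma lborel_integral_translate:
  fixes f :: "'a::euclidean_space \<Rightarrow> real"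
  assumes "f \<in> borel_measurable borel"
  shows "(LINT x|lborel. f (x + v)) = (LINT x|lborel. f x)"
proof -
  have "(LINT x|lborel. f x) = (LINT x|distr lborel borel ((+) v). f x)" by (simp add: lborel_distr_plus)
  also have "\<dots> = (LINT x|lborel. f (v + x))" using assms by (subst integral_distr) auto
  finally show ?thesis by (simp add: add.commute)
qed

text \<open>Translation invariance of Lebesgue measure makes the translate of f - g as small as f -
  g itself; the three contributions are r/4, r/2 and r/4. The approximant may depend on e, so that
  the lemma serves both the base case and the limit case of an induction over integrable
  functions.\<close>

lemma L1_translate_approx:
  fixes f :: "'a::euclidean_space \<Rightarrow> real"
  assumes f: "integrable lborel f" and v: "(v \<longlonglongrightarrow> 0)"
    and ap: "\<And>e. e > 0 \<Longrightarrow> \<exists>g. integrable lborel g \<and> (LINT x|lborel. \<bar>f x - g x\<bar>) \<le> e \<and>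
       (\<lambda>k. LINT x|lborel. \<bar>g (x + v k) - g x\<bar>) \<longlonglongrightarrow> 0"
  shows "(\<lambda>k. LINT x|lborel. \<bar>f (x + v k) - f x\<bar>) \<longlonglongrightarrow> 0"
proof (rule LIMSEQ_I)
  fix r :: real assume "r > 0"
  then obtain g where g: "integrable lborel g" and gf: "(LINT x|lborel. \<bar>f x - g x\<bar>) \<le> r / 4"
    and gv: "(\<lambda>k. LINT x|lborel. \<bar>g (x + v k) - g x\<bar>) \<longlonglongrightarrow> 0"
    using ap[of "r/4"] by auto
  obtain n where n: "\<And>k. k \<ge> n \<Longrightarrow> norm ((LINT x|lborel. \<bar>g (x + v k) - g x\<bar>) - 0) < r / 2"
    using LIMSEQ_D[OF gv, of "r/2"] \<open>r > 0\<close> by auto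
  have "norm ((LINT x|lborel. \<bar>f (x + v k) - f x\<bar>) - 0) < r" if "k \<ge> n" for k
  proof -
    note i = f g lborel_integrable_translate[OF f, of "v k"] lborel_integrable_translate[OF g, of "v k"]
    have "(LINT x|lborel. \<bar>f (x + v k) - f x\<bar>)
      \<le> (LINT x|lborel. \<bar>f (x + v k) - g (x + v k)\<bar> + (\<bar>g (x + v k) - g x\<bar> + \<bar>f x - g x\<bar>))"
      using i by (intro integral_mono integrable_abs Bochner_Integration.integrable_add Bochner_Integration.integrable_diff) auto
    also have "\<dots> = (LINT x|lborel. \<bar>f (x + v k) - g (x + v k)\<bar>) + ((LINT x|lborel. \<bar>g (x + v k) - g x\<bar>) + (LINT x|lborel. \<bar>f x - g x\<bar>))"
      using i by (simp add: Bochner_Integration.integral_add)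
    also have "(LINT x|lborel. \<bar>f (x + v k) - g (x + v k)\<bar>) = (LINT x|lborel. \<bar>f x - g x\<bar>)"
      using lborel_integral_translate[of "\<lambda>x. \<bar>f x - g x\<bar>" "v k"]
        borel_measurable_integrable[OF f] borel_measurable_integrable[OF g] by simp
    finally have "(LINT x|lborel. \<bar>f (x + v k) - f x\<bar>) \<le> r/4 + ((LINT x|lborel. \<bar>g (x + v k) - g x\<bar>) + r/4)"
      using gf by linarith
    moreover have "(LINT x|lborel. \<bar>g (x + v k) - g x\<bar>) < r/2" using n[OF that] by simp
    moreover have "0 \<le> (LINT x|lborel. \<bar>f (x + v k) - f x\<bar>)" by simp
    ultimately show ?thesis by simp
  qed
  then show "\<exists>no. \<forall>n\<ge>no. norm ((LINT x|lborel. \<bar>f (x + v n) - f x\<bar>) - 0) < r" by blast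
qed

text \<open>The integrand is |c| times 1_U(x+w) + 1_U(x) - 2 1_U(x) 1_U(x+w), so the claim reduces
  to the overlap. Its pointwise limit is only an issue for x in \<open>U\<close>, and an open set
  eventually contains x + v_k.\<close>

lemma L1_translate_open:
  fixes U :: "'a::euclidean_space set"
  assumes U: "open U" "emeasure lborel U < \<infinity>" and v: "v \<longlonglongrightarrow> 0"
  shows "(\<lambda>k. LINT x|lborel. \<bar>indicator U (x + v k) * c - indicator U x * c\<bar>) \<longlonglongrightarrow> (0::real)"
proof -
  let ?I = "indicator U :: 'a \<Rightarrow> real"
  have [measurable]: "U \<in> sets borel" using U by auto
  have I: "integrable lborel ?I" using U by (simp add: integrable_indicator_iff)
  note It = lborel_integrable_translate[OF I]
  have p: "integrable lborel (\<lambda>x. ?I x * ?I (x + w))" for w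
    by (rule Bochner_Integration.integrable_bound[OF I]) (auto simp: indicator_def)
  have eq: "(LINT x|lborel. \<bar>?I (x + w) * c - ?I x * c\<bar>) = 2 * \<bar>c\<bar> * ((LINT x|lborel. ?I x) - (LINT x|lborel. ?I x * ?I (x + w)))" for w
  proof -
    have "(LINT x|lborel. \<bar>?I (x + w) * c - ?I x * c\<bar>)
      = (LINT x|lborel. \<bar>c\<bar> * (?I (x + w) + ?I x - 2 * (?I x * ?I (x + w))))"
      by (intro Bochner_Integration.integral_cong) (auto simp: indicator_def)
    also have "\<dots> = \<bar>c\<bar> * ((LINT x|lborel. ?I (x + w)) + (LINT x|lborel. ?I x) - 2 * (LINT x|lborel. ?I x * ?I (x + w)))"
      using I It[of w] p[of w] by simp
    also have "(LINT x|lborel. ?I (x + w)) = (LINT x|lborel. ?I x)"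
      by (rule lborel_integral_translate) simp
    finally show ?thesis by (simp add: algebra_simps)
  qed
  have "(\<lambda>k. LINT x|lborel. ?I x * ?I (x + v k)) \<longlonglongrightarrow> (LINT x|lborel. ?I x)"
  proof (rule integral_dominated_convergence[where w="?I"])
    show "AE x in lborel. (\<lambda>i. ?I x * ?I (x + v i)) \<longlonglongrightarrow> ?I x"
    proof (rule AE_I2)
      fix x
      show "(\<lambda>i. ?I x * ?I (x + v i)) \<longlonglongrightarrow> ?I x"
      proof (cases "x \<in> U")
        case True
        have "(\<lambda>i. x + v i) \<longlonglongrightarrow> x + 0" by (intro tendsto_intros v)
        then have "\<forall>\<^sub>F i in sequentially. x + v i \<in> U" using U(1) True by (simp add: topological_tendstoD)
        then show ?thesis using True by (intro tendsto_eventually) (auto elim: eventually_mono)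
      qed simp
    qed
  qed (use I in \<open>auto simp: indicator_def\<close>)
  then have "(\<lambda>k. 2 * \<bar>c\<bar> * ((LINT x|lborel. ?I x) - (LINT x|lborel. ?I x * ?I (x + v k)))) \<longlonglongrightarrow>
      2 * \<bar>c\<bar> * ((LINT x|lborel. ?I x) - (LINT x|lborel. ?I x))" by (intro tendsto_intros)
  then show ?thesis by (simp add: eq)
qed

text \<open>Indicators of measurable sets are approximated by indicators of open sets through outer
  regularity; sums and dominated limits follow from the triangle inequality.\<close>

lemma L1_translate_tendsto:
  fixes f :: "'a::euclidean_space \<Rightarrow> real"
  assumes f: "integrable lborel f" and v: "v \<longlonglongrightarrow> 0"
  shows "(\<lambda>k. LINT x|lborel. \<bar>f (x + v k) - f x\<bar>) \<longlonglongrightarrow> 0"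
  using f
proof (induction rule: integrable_induct)
  case (base A c)
  then have A: "A \<in> sets borel" by simp
  have iA: "integrable lborel (\<lambda>x. indicator A x * c)"
    using base by (intro integrable_mult_left) (simp add: integrable_indicator_iff)
  show ?case unfolding real_scaleR_def
  proof (rule L1_translate_approx[OF iA v])
    fix e :: real assume "e > 0"
    \<comment> \<open>The denominator |c| + 1 covers c = 0 and still gives |c| d \<le> e.\<close>
    define d where "d = e / (\<bar>c\<bar> + 1)"
    have "d > 0" using \<open>e > 0\<close> by (simp add: d_def)
    obtain U where U: "open U" "A \<subseteq> U" "emeasure lborel (U - A) < d"
      using outer_regular_lborel[OF A \<open>d > 0\<close>] by metis
    have [measurable]: "U \<in> sets borel" "A \<in> sets borel" using U A by auto
    have "emeasure lborel U \<le> emeasure lborel A + emeasure lborel (U - A)"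
      using emeasure_subadditive[of A lborel "U - A"] U(2) by (simp add: Un_absorb1)
    also have "\<dots> < \<infinity>" using base U(3) by (simp add: less_top[symmetric]) (use order_less_trans in fastforce)
    finally have fU: "emeasure lborel U < \<infinity>" .
    have iU: "integrable lborel (\<lambda>x. indicator U x * c)"
      using fU by (intro integrable_mult_left) (simp add: integrable_indicator_iff)
    have "(LINT x|lborel. \<bar>indicator A x * c - indicator U x * c\<bar>) = (LINT x|lborel. \<bar>c\<bar> * indicator (U - A) x)"
      using U(2) by (intro Bochner_Integration.integral_cong) (auto simp: indicator_def)
    also have "\<dots> = \<bar>c\<bar> * measure lborel (U - A)" by simp
    also have "measure lborel (U - A) \<le> d"
      using U(3) \<open>d > 0\<close> by (simp add: measure_def enn2real_leI)
    also have "\<bar>c\<bar> * d \<le> e" using \<open>e > 0\<close> by (simp add: d_def field_simps)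
    finally have "(LINT x|lborel. \<bar>indicator A x * c - indicator U x * c\<bar>) \<le> e" by (simp add: mult_left_mono)
    then show "\<exists>g. integrable lborel g \<and> (LINT x|lborel. \<bar>indicator A x * c - g x\<bar>) \<le> e \<and>
       (\<lambda>k. LINT x|lborel. \<bar>g (x + v k) - g x\<bar>) \<longlonglongrightarrow> 0"
      using iU L1_translate_open[OF U(1) fU v, of c] by blast
  qed
next
  case (add f g)
  have "(\<lambda>k. (LINT x|lborel. \<bar>f (x + v k) - f x\<bar>) + (LINT x|lborel. \<bar>g (x + v k) - g x\<bar>)) \<longlonglongrightarrow> 0 + 0"
    by (intro tendsto_add add)
  then have l: "(\<lambda>k. (LINT x|lborel. \<bar>f (x + v k) - f x\<bar>) + (LINT x|lborel. \<bar>g (x + v k) - g x\<bar>)) \<longlonglongrightarrow> 0" by simp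
  show ?case
  proof (rule tendsto_sandwich[OF _ _ tendsto_const l])
    show "\<forall>\<^sub>F k in sequentially. (LINT x|lborel. \<bar>f (x + v k) + g (x + v k) - (f x + g x)\<bar>)
       \<le> (LINT x|lborel. \<bar>f (x + v k) - f x\<bar>) + (LINT x|lborel. \<bar>g (x + v k) - g x\<bar>)"
    proof (rule always_eventually, rule allI)
      fix k
      note i = add(1,2) lborel_integrable_translate[OF add(1), of "v k"] lborel_integrable_translate[OF add(2), of "v k"]
      have "(LINT x|lborel. \<bar>f (x + v k) + g (x + v k) - (f x + g x)\<bar>)
        \<le> (LINT x|lborel. \<bar>f (x + v k) - f x\<bar> + \<bar>g (x + v k) - g x\<bar>)"
        using i by (intro integral_mono integrable_abs Bochner_Integration.integrable_add Bochner_Integration.integrable_diff) auto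
      also have "\<dots> = (LINT x|lborel. \<bar>f (x + v k) - f x\<bar>) + (LINT x|lborel. \<bar>g (x + v k) - g x\<bar>)"
        using i by (simp add: Bochner_Integration.integral_add)
      finally show "(LINT x|lborel. \<bar>f (x + v k) + g (x + v k) - (f x + g x)\<bar>)
        \<le> (LINT x|lborel. \<bar>f (x + v k) - f x\<bar>) + (LINT x|lborel. \<bar>g (x + v k) - g x\<bar>)" .
    qed
  qed simp
next
  case (lim f s)
  have *: "(\<lambda>i. LINT x|lborel. \<bar>f x - s i x\<bar>) \<longlonglongrightarrow> (LINT x|(lborel::'a measure). \<bar>f x - f x\<bar>)"
  proof (rule integral_dominated_convergence[where w="\<lambda>x. 3 * \<bar>f x\<bar>"])
    show "AE x in lborel. (\<lambda>i. \<bar>f x - s i x\<bar>) \<longlonglongrightarrow> \<bar>f x - f x\<bar>"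
      using lim(2) by (intro AE_I2 tendsto_intros) auto
    show "AE x in lborel. norm \<bar>f x - s i x\<bar> \<le> 3 * \<bar>f x\<bar>" for i
    proof (rule AE_I2)
      fix x :: 'a assume "x \<in> space lborel"
      then have "norm (s i x) \<le> 2 * norm (f x)" using lim(3) by blast
      then show "norm \<bar>f x - s i x\<bar> \<le> 3 * \<bar>f x\<bar>" by auto
    qed
    show "(\<lambda>x. \<bar>f x - s i x\<bar>) \<in> borel_measurable lborel" for i
      using borel_measurable_integrable[OF lim(1)] borel_measurable_integrable[OF lim(4)] by simp
    show "(\<lambda>x. \<bar>f x - f x\<bar>) \<in> borel_measurable lborel" by simp
  qed (use lim(4) in auto)
  show ?case
  proof (rule L1_translate_approx[OF lim(4) v])
    fix e :: real assume "e > 0"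
    with * have "\<forall>\<^sub>F i in sequentially. (LINT x|lborel. \<bar>f x - s i x\<bar>) < e"
      by (intro order_tendstoD(2)[where y=0]) auto
    then obtain i where "(LINT x|lborel. \<bar>f x - s i x\<bar>) < e" by (auto simp: eventually_sequentially)
    then show "\<exists>g. integrable lborel g \<and> (LINT x|lborel. \<bar>f x - g x\<bar>) \<le> e \<and>
       (\<lambda>k. LINT x|lborel. \<bar>g (x + v k) - g x\<bar>) \<longlonglongrightarrow> 0"
      using lim(1,5) by (intro exI[of _ "s i"]) auto
  qed
qed

text \<open>The parameters of a segment as a measure space of total mass 1, so that Fubini's theorem
  applies to pairs of parameter and point.\<close>

definition unit_lborel :: "real measure" where "unit_lborel = restrict_space lborel {0..1}"

lemma prob_unit_lborel: "emeasure unit_lborel (space unit_lborel) = 1"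
  by (simp add: unit_lborel_def space_restrict_space emeasure_restrict_space)

interpretation unit_lborel: finite_measure unit_lborel
  by standard (simp add: prob_unit_lborel)

interpretation unit_lborel_pair: pair_sigma_finite unit_lborel "lborel::'a::euclidean_space measure" ..

lemma measurable_unit_lborel [measurable]: "(\<lambda>x. x) \<in> borel_measurable unit_lborel"
  by (simp add: unit_lborel_def measurable_restrict_space1)

lemma integrable_segment_translate:
  fixes f :: "'a::euclidean_space \<Rightarrow> real"
  assumes f: "integrable lborel f"
  shows "integrable (unit_lborel \<Otimes>\<^sub>M lborel) (\<lambda>(s, x). f (x + s *\<^sub>R v))"
proof (rule unit_lborel_pair.Fubini_integrable)
  have fm: "f \<in> borel_measurable borel" using borel_measurable_integrable[OF f] by simp
  have "(\<lambda>(s, x). x + s *\<^sub>R v) \<in> borel_measurable (unit_lborel \<Otimes>\<^sub>M lborel)" by measurable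
  from measurable_compose[OF this fm]
  show "(\<lambda>(s, x). f (x + s *\<^sub>R v)) \<in> borel_measurable (unit_lborel \<Otimes>\<^sub>M lborel)"
    by (simp add: case_prod_unfold)
  have "(LINT x|lborel. \<bar>f (x + s *\<^sub>R v)\<bar>) = (LINT x|lborel. \<bar>f x\<bar>)" for s
    using fm by (intro lborel_integral_translate) simp
  then show "integrable unit_lborel (\<lambda>s. LINT x|lborel. norm (case (s, x) of (s, x) \<Rightarrow> f (x + s *\<^sub>R v)))"
    by simp
  show "AE s in unit_lborel. integrable lborel (\<lambda>x. case (s, x) of (s, x) \<Rightarrow> f (x + s *\<^sub>R v))"
    using lborel_integrable_translate[OF f] by simp
qed

text \<open>If f is the derivative of a function in direction v, this average is the increment of
  that function from x to x + v. It connects increments of u with its weak derivative in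
  L^1.\<close>

definition segment_average :: "('a::euclidean_space \<Rightarrow> real) \<Rightarrow> 'a \<Rightarrow> 'a \<Rightarrow> real" where
  "segment_average f v x = (LINT s|unit_lborel. f (x + s *\<^sub>R v))"

lemma integrable_segment_average:
  assumes "integrable lborel f" shows "integrable lborel (segment_average f v)"
  using unit_lborel_pair.integrable_snd[OF integrable_segment_translate[OF assms, of v]]
  by (simp add: segment_average_def[abs_def])

lemma measure_unit_lborel: "measure unit_lborel (space unit_lborel) = 1"
  using prob_unit_lborel by (simp add: measure_def)

text \<open>Fubini's theorem for |f(x + s v) - f(x)|: the L^1 distance of an average is at most the
  average of the L^1 distances. Measurability in s is recorded for the passage to the limit under
  the integral over s.\<close>

lemma L1_segment_average_bound:
  fixes f :: "'a::euclidean_space \<Rightarrow> real"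
  assumes f: "integrable lborel f"
  shows "(LINT x|lborel. \<bar>segment_average f v x - f x\<bar>)
     \<le> (LINT s|unit_lborel. LINT x|lborel. \<bar>f (x + s *\<^sub>R v) - f x\<bar>)" (is "?l \<le> ?r")
    and "(\<lambda>s. LINT x|lborel. \<bar>f (x + s *\<^sub>R v) - f x\<bar>) \<in> borel_measurable unit_lborel"
proof -
  let ?F = "\<lambda>s x. f (x + s *\<^sub>R v) - f x"
  have i: "integrable (unit_lborel \<Otimes>\<^sub>M lborel) (\<lambda>(s, x). ?F s x)"
    using Bochner_Integration.integrable_diff[OF integrable_segment_translate[OF f, of v] integrable_segment_translate[OF f, of 0]]
    by (simp add: case_prod_unfold)
  then have i': "integrable (unit_lborel \<Otimes>\<^sub>M lborel) (\<lambda>(s, x). \<bar>?F s x\<bar>)"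
    using integrable_abs[OF i] by (simp add: case_prod_unfold)
  show "(\<lambda>s. LINT x|lborel. \<bar>f (x + s *\<^sub>R v) - f x\<bar>) \<in> borel_measurable unit_lborel"
    using unit_lborel_pair.integrable_fst[OF i'] by (rule borel_measurable_integrable)
  have ae: "AE x in lborel. integrable unit_lborel (\<lambda>s. f (x + s *\<^sub>R v))"
    using unit_lborel_pair.AE_integrable_snd[OF integrable_segment_translate[OF f, of v]] by simp
  have "?l \<le> (LINT x|lborel. LINT s|unit_lborel. \<bar>?F s x\<bar>)"
  proof (rule integral_mono_AE)
    show "integrable lborel (\<lambda>x. \<bar>segment_average f v x - f x\<bar>)"
      using integrable_segment_average[OF f, of v] f by auto
    show "integrable lborel (\<lambda>x. LINT s|unit_lborel. \<bar>?F s x\<bar>)"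
      using unit_lborel_pair.integrable_snd[OF i'] .
    show "AE x in lborel. \<bar>segment_average f v x - f x\<bar> \<le> (LINT s|unit_lborel. \<bar>?F s x\<bar>)"
      using ae
    proof eventually_elim
      case (elim x)
      have "segment_average f v x - f x = (LINT s|unit_lborel. ?F s x)"
        using elim by (simp add: segment_average_def measure_unit_lborel)
      then show ?case using integral_norm_bound[of unit_lborel "\<lambda>s. ?F s x"] by simp
    qed
  qed
  also have "\<dots> = ?r" using unit_lborel_pair.Fubini_integral[OF i'] by simp
  finally show "?l \<le> ?r" .
qed

text \<open>For each s the inner distance tends to 0 by continuity of translation, and it never
  exceeds twice the L^1 norm of f, so dominated convergence in s applies.\<close>

lemma L1_segment_average_tendsto:
  fixes f :: "'a::euclidean_space \<Rightarrow> real"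
  assumes f: "integrable lborel f" and v: "v \<longlonglongrightarrow> 0"
  shows "(\<lambda>k. LINT x|lborel. \<bar>segment_average f (v k) x - f x\<bar>) \<longlonglongrightarrow> 0"
proof -
  let ?w = "\<lambda>k s. LINT x|lborel. \<bar>f (x + s *\<^sub>R v k) - f x\<bar>"
  have "(\<lambda>k. LINT s|unit_lborel. ?w k s) \<longlonglongrightarrow> (LINT s|unit_lborel. 0)"
  proof (rule integral_dominated_convergence[where w="\<lambda>_. 2 * (LINT x|lborel. \<bar>f x\<bar>)"])
    show "AE s in unit_lborel. (\<lambda>k. ?w k s) \<longlonglongrightarrow> 0"
    proof (rule AE_I2)
      fix s :: real
      have "(\<lambda>k. s *\<^sub>R v k) \<longlonglongrightarrow> s *\<^sub>R 0" by (intro tendsto_intros v)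
      then show "(\<lambda>k. ?w k s) \<longlonglongrightarrow> 0" using L1_translate_tendsto[OF f] by simp
    qed
    show "AE s in unit_lborel. norm (?w k s) \<le> 2 * (LINT x|lborel. \<bar>f x\<bar>)" for k
    proof (rule AE_I2)
      fix s :: real
      note i = f lborel_integrable_translate[OF f, of "s *\<^sub>R v k"]
      have "?w k s \<le> (LINT x|lborel. \<bar>f (x + s *\<^sub>R v k)\<bar> + \<bar>f x\<bar>)"
        using i by (intro integral_mono) auto
      also have "\<dots> = (LINT x|lborel. \<bar>f (x + s *\<^sub>R v k)\<bar>) + (LINT x|lborel. \<bar>f x\<bar>)" using i by simp
      also have "(LINT x|lborel. \<bar>f (x + s *\<^sub>R v k)\<bar>) = (LINT x|lborel. \<bar>f x\<bar>)"
        using borel_measurable_integrable[OF f] by (intro lborel_integral_translate) simp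
      finally show "norm (?w k s) \<le> 2 * (LINT x|lborel. \<bar>f x\<bar>)" by simp
    qed
    show "?w k \<in> borel_measurable unit_lborel" for k by (rule L1_segment_average_bound(2)[OF f])
  qed auto
  then have l: "(\<lambda>k. LINT s|unit_lborel. ?w k s) \<longlonglongrightarrow> 0" by simp
  show ?thesis
    by (rule tendsto_sandwich[OF _ _ tendsto_const l]) (use L1_segment_average_bound(1)[OF f] in auto)
qed

text \<open>Fubini's theorem, followed by a translation by s v for each fixed s.\<close>

lemma segment_average_adjoint:
  fixes f b :: "'a::euclidean_space \<Rightarrow> real"
  assumes f: "integrable lborel f" and b: "b \<in> borel_measurable borel" and B: "\<And>x. \<bar>b x\<bar> \<le> B"
  shows "(LINT x|lborel. segment_average f v x * b x) = (LINT s|unit_lborel. LINT x|lborel. f x * b (x - s *\<^sub>R v))"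
proof -
  have fm: "f \<in> borel_measurable borel" using borel_measurable_integrable[OF f] by simp
  have i: "integrable (unit_lborel \<Otimes>\<^sub>M lborel) (\<lambda>(s, x). f (x + s *\<^sub>R v) * b x)"
  proof (rule Bochner_Integration.integrable_bound[OF integrable_mult_right[OF integrable_segment_translate[OF f, of v], of B]])
    have "(\<lambda>(s, x). b x) \<in> borel_measurable (unit_lborel \<Otimes>\<^sub>M lborel)"
      using measurable_compose[OF _ b, of snd "unit_lborel \<Otimes>\<^sub>M lborel"] by (simp add: case_prod_unfold)
    then show "(\<lambda>(s, x). f (x + s *\<^sub>R v) * b x) \<in> borel_measurable (unit_lborel \<Otimes>\<^sub>M lborel)"
      using borel_measurable_times[OF borel_measurable_integrable[OF integrable_segment_translate[OF f, of v]]]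
      by (simp add: case_prod_unfold)
    have "B \<ge> 0" using B[of 0] by linarith
    then show "AE x in unit_lborel \<Otimes>\<^sub>M lborel. norm (case x of (s, x) \<Rightarrow> f (x + s *\<^sub>R v) * b x) \<le> norm (B * (case x of (s, x) \<Rightarrow> f (x + s *\<^sub>R v)))"
      using B by (auto simp: abs_mult mult.commute intro!: mult_right_mono AE_I2)
  qed
  have "(LINT x|lborel. segment_average f v x * b x) = (LINT x|lborel. LINT s|unit_lborel. f (x + s *\<^sub>R v) * b x)"
    by (simp add: segment_average_def)
  also have "\<dots> = (LINT s|unit_lborel. LINT x|lborel. f (x + s *\<^sub>R v) * b x)"
    using unit_lborel_pair.Fubini_integral[OF i] by simp
  also have "\<dots> = (LINT s|unit_lborel. LINT x|lborel. f x * b (x - s *\<^sub>R v))"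
  proof (rule Bochner_Integration.integral_cong[OF refl])
    fix s
    have "(\<lambda>x. f x * b (x - s *\<^sub>R v)) \<in> borel_measurable borel" using fm b by measurable
    from lborel_integral_translate[OF this, of "s *\<^sub>R v"]
    show "(LINT x|lborel. f (x + s *\<^sub>R v) * b x) = (LINT x|lborel. f x * b (x - s *\<^sub>R v))" by simp
  qed
  finally show ?thesis .
qed

lemma box_bump_derivative:
  assumes "k > 0"
  obtains D B where "\<And>x. (box_bump k a b has_derivative D x) (at x)"
    "continuous_on UNIV (\<lambda>x. D x v)" "\<And>x. \<bar>D x v\<bar> \<le> B"
proof -
  obtain D where D: "\<And>x. (box_bump k a b has_derivative D x) (at x)" "\<And>v. (\<lambda>x. D x v) \<in> bump_algebra"
    using bump_algebra_derivative[OF box_bump_in_bump_algebra, of k a b] by blast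
  have c: "continuous_on UNIV (\<lambda>x. D x v)" using Ck_on_bump_algebra[OF D(2), of 0] by simp
  have z: "D x v = 0" if "x \<notin> cbox a b" for x
  proof -
    have "open (- cbox a b)" by auto
    moreover have "x \<in> - cbox a b" using that by simp
    moreover have "0 = box_bump k a b y" if "y \<in> - cbox a b" for y
    proof -
      have "y \<notin> box a b" using that box_subset_cbox by blast
      then show ?thesis using box_bump_eq_0[OF \<open>k > 0\<close>] by metis
    qed
    ultimately have "(box_bump k a b has_derivative (\<lambda>_. 0)) (at x)"
      by (rule has_derivative_transform_within_open[OF has_derivative_const])
    then have "D x = (\<lambda>_. 0)" using D(1)[of x] has_derivative_unique by blast
    then show ?thesis by simp
  qed
  have "compact ((\<lambda>x. D x v) ` cbox a b)"
    by (rule compact_continuous_image[OF continuous_on_subset[OF c]]) auto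
  then obtain B where B: "\<And>x. x \<in> cbox a b \<Longrightarrow> \<bar>D x v\<bar> \<le> B"
    using compact_imp_bounded bounded_iff by (metis imageI real_norm_def)
  have "\<bar>D x v\<bar> \<le> \<bar>B\<bar>" for x using B[of x] z[of x] by (cases "x \<in> cbox a b") auto
  with D(1) c show ?thesis by (intro that) auto
qed

text \<open>Tested with a box bump b, the increment of u becomes u times b(x - v) - b(x), which the
  fundamental theorem of calculus writes as the integral over s of the derivative of b at x - s v in
  direction -v. After Fubini the weak derivative is applied to each shifted bump, and the adjoint
  identity returns the average of f. The hypothesis on segments keeps the supports of the shifted
  bumps in \<open>U\<close>.\<close>

lemma weak_derivative_segment_average:
  fixes u f :: "real^'n::finite \<Rightarrow> real"
  assumes U: "open V" and u: "integrable lborel u" and f: "integrable lborel f"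
    and weak: "\<And>\<phi>. test_function U \<phi> \<Longrightarrow>
       (LINT x|lborel. u x * frechet_derivative \<phi> (at x) v) = - (LINT x|lborel. f x * \<phi> x)"
    and VU: "\<And>x s. x \<in> V \<Longrightarrow> s \<in> {0..1} \<Longrightarrow> x + s *\<^sub>R v \<in> U"
  shows "AE x in lborel. x \<in> V \<longrightarrow> u (x + v) - u x = segment_average f v x"
proof -
  have um: "u \<in> borel_measurable borel" using borel_measurable_integrable[OF u] by simp
  note iu = lborel_integrable_translate[OF u, of v] and iA = integrable_segment_average[OF f, of v]
  have "AE x in lborel. x \<in> V \<longrightarrow> u (x + v) - u x - segment_average f v x = 0"
  proof (rule fundamental_lemma[OF _ \<open>open V\<close>])
    show "integrable lborel (\<lambda>x. u (x + v) - u x - segment_average f v x)" using u iu iA by auto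
    fix k :: real and a b :: "real^'n" assume k: "k > 0" and ab: "cbox a b \<subseteq> V"
    let ?b = "box_bump k a b"
    obtain D B where D: "\<And>x. (?b has_derivative D x) (at x)"
      and cD: "continuous_on UNIV (\<lambda>x. D x v)" and B: "\<And>x. \<bar>D x v\<bar> \<le> B"
      by (rule box_bump_derivative[OF k]) blast
    have bm: "?b \<in> borel_measurable borel" by (rule borel_measurable_continuous_onI[OF continuous_box_bump])
    have bb: "\<bar>?b x\<bar> \<le> 1" for x using box_bump_bounds[of k a b x] by simp
    have Dm: "(\<lambda>x. D x v) \<in> borel_measurable borel" by (rule borel_measurable_continuous_onI[OF cD])
    have ibd: "integrable lborel (\<lambda>x. h x * c x)" if "integrable lborel h" "c \<in> borel_measurable borel" "\<And>x. \<bar>c x\<bar> \<le> C"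
      for h c :: "real^'n \<Rightarrow> real" and C
    proof (rule Bochner_Integration.integrable_bound[OF integrable_mult_right[OF that(1), of C]])
      show "(\<lambda>x. h x * c x) \<in> borel_measurable lborel"
        using that(2) borel_measurable_integrable[OF that(1)] by simp
      have "C \<ge> 0" using that(3)[of 0] by linarith
      then show "AE x in lborel. norm (h x * c x) \<le> norm (C * h x)"
        using that(3) by (auto simp: abs_mult mult.commute intro!: mult_right_mono AE_I2)
    qed
    have ftc: "(LINT s|unit_lborel. - D (y - s *\<^sub>R v) v) = ?b (y - v) - ?b y" for y
    proof -
      have "has_bochner_integral lborel (\<lambda>s. - D (y - s *\<^sub>R v) v * indicator {0..1} s) (?b (y - 1 *\<^sub>R v) - ?b (y - 0 *\<^sub>R v))"
      proof (rule has_bochner_integral_FTC_Icc_real)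
        fix s :: real
        have l: "((\<lambda>s. y - s *\<^sub>R v) has_derivative (\<lambda>r. - (r *\<^sub>R v))) (at s)"
          by (auto intro!: derivative_eq_intros)
        have lin: "linear (D (y - s *\<^sub>R v))" using D has_derivative_linear by blast
        from has_derivative_compose[OF l D]
        have "((\<lambda>s. ?b (y - s *\<^sub>R v)) has_derivative (\<lambda>r. D (y - s *\<^sub>R v) (- (r *\<^sub>R v)))) (at s)" .
        also have "(\<lambda>r. D (y - s *\<^sub>R v) (- (r *\<^sub>R v))) = (\<lambda>r. (- D (y - s *\<^sub>R v) v) * r)"
          by (simp add: linear_neg[OF lin] linear_cmul[OF lin] fun_eq_iff mult.commute)
        finally show "((\<lambda>s. ?b (y - s *\<^sub>R v)) has_real_derivative (- D (y - s *\<^sub>R v) v)) (at s)"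
          unfolding has_field_derivative_def .
        have "continuous_on UNIV (\<lambda>s. D (y - s *\<^sub>R v) v)"
          by (rule continuous_on_compose2[OF cD]) (auto intro!: continuous_intros)
        then show "isCont (\<lambda>s. - D (y - s *\<^sub>R v) v) s"
          by (simp add: continuous_on_eq_continuous_at)
      qed simp
      then show ?thesis
        by (simp add: unit_lborel_def integral_restrict_space has_bochner_integral_iff mult.commute)
    qed
    have "(LINT x|lborel. (u (x + v) - u x) * ?b x) = (LINT x|lborel. u (x + v) * ?b x) - (LINT x|lborel. u x * ?b x)"
      using ibd[OF iu bm bb] ibd[OF u bm bb] by (simp add: left_diff_distrib)
    also have "(LINT x|lborel. u (x + v) * ?b x) = (LINT x|lborel. u x * ?b (x - v))"
    proof -
      have "(\<lambda>x. u x * ?b (x - v)) \<in> borel_measurable borel" using um bm by measurable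
      from lborel_integral_translate[OF this, of v] show ?thesis by simp
    qed
    also have "\<dots> - (LINT x|lborel. u x * ?b x) = (LINT x|lborel. u x * (?b (x - v) - ?b x))"
    proof -
      have "(\<lambda>x. ?b (x - v)) \<in> borel_measurable borel" using bm by measurable
      from ibd[OF u this bb] ibd[OF u bm bb] show ?thesis by (simp add: right_diff_distrib)
    qed
    also have "\<dots> = (LINT x|lborel. LINT s|unit_lborel. u x * - D (x - s *\<^sub>R v) v)"
      by (simp add: ftc[symmetric])
    also have "\<dots> = (LINT s|unit_lborel. LINT x|lborel. u x * - D (x - s *\<^sub>R v) v)"
    proof -
      have "integrable (unit_lborel \<Otimes>\<^sub>M lborel) (\<lambda>(s, x). u x * - D (x - s *\<^sub>R v) v)"
      proof (rule Bochner_Integration.integrable_bound[OF integrable_mult_right[OF integrable_segment_translate[OF u, of 0], of B]])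
        have "(\<lambda>(s, x). x - s *\<^sub>R v) \<in> borel_measurable (unit_lborel \<Otimes>\<^sub>M lborel)" by measurable
        from measurable_compose[OF this Dm]
        have 1: "(\<lambda>(s, x). - D (x - s *\<^sub>R v) v) \<in> borel_measurable (unit_lborel \<Otimes>\<^sub>M lborel)"
          by (simp add: case_prod_unfold)
        have "(\<lambda>(s, x). u x) \<in> borel_measurable (unit_lborel \<Otimes>\<^sub>M lborel)"
          using measurable_compose[OF _ um, of snd "unit_lborel \<Otimes>\<^sub>M lborel"] by (simp add: case_prod_unfold)
        from borel_measurable_times[OF this 1]
        show "(\<lambda>(s, x). u x * - D (x - s *\<^sub>R v) v) \<in> borel_measurable (unit_lborel \<Otimes>\<^sub>M lborel)"
          by (simp add: case_prod_unfold)
        have "B \<ge> 0" using B[of 0] by linarith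
        then show "AE x in unit_lborel \<Otimes>\<^sub>M lborel. norm (case x of (s, x) \<Rightarrow> u x * - D (x - s *\<^sub>R v) v) \<le> norm (B * (case x of (s, x) \<Rightarrow> u (x + s *\<^sub>R 0)))"
          using B by (auto simp: abs_mult mult.commute[of B] intro!: mult_left_mono AE_I2)
      qed
      from unit_lborel_pair.Fubini_integral[OF this] show ?thesis by simp
    qed
    also have "\<dots> = (LINT s|unit_lborel. LINT x|lborel. f x * ?b (x - s *\<^sub>R v))"
    proof (rule Bochner_Integration.integral_cong[OF refl])
      fix s assume "s \<in> space unit_lborel"
      then have s: "s \<in> {0..1}" by (simp add: unit_lborel_def space_restrict_space)
      \<comment> \<open>A shifted bump is the bump of the shifted box, hence again a test
        function.\<close>
      have tr: "box_bump k (a + s *\<^sub>R v) (b + s *\<^sub>R v) = (\<lambda>x. ?b (x - s *\<^sub>R v))"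
      proof
        fix x
        show "box_bump k (a + s *\<^sub>R v) (b + s *\<^sub>R v) x = ?b (x - s *\<^sub>R v)"
          using box_bump_translate[of k "a + s *\<^sub>R v" "b + s *\<^sub>R v" "x - s *\<^sub>R v" "s *\<^sub>R v"] by simp
      qed
      have "cbox (a + s *\<^sub>R v) (b + s *\<^sub>R v) \<subseteq> U"
      proof
        fix x assume "x \<in> cbox (a + s *\<^sub>R v) (b + s *\<^sub>R v)"
        then have "x - s *\<^sub>R v \<in> cbox a b" by (auto simp: mem_box_cart algebra_simps)
        then show "x \<in> U" using VU[of "x - s *\<^sub>R v" s] ab s by auto
      qed
      then have t: "test_function U (\<lambda>x. ?b (x - s *\<^sub>R v))"
        using box_bump_test_function[OF k] tr by metis
      have "frechet_derivative (\<lambda>x. ?b (x - s *\<^sub>R v)) (at x) = D (x - s *\<^sub>R v)" for x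
      proof -
        have "((\<lambda>x. x - s *\<^sub>R v) has_derivative (\<lambda>r. r)) (at x)" by (auto intro!: derivative_eq_intros)
        from has_derivative_compose[OF this D] show ?thesis using frechet_derivative_at by metis
      qed
      with weak[OF t] show "(LINT x|lborel. u x * - D (x - s *\<^sub>R v) v) = (LINT x|lborel. f x * ?b (x - s *\<^sub>R v))"
        by simp
    qed
    also have "\<dots> = (LINT x|lborel. segment_average f v x * ?b x)"
      by (rule segment_average_adjoint[OF f bm bb, symmetric])
    finally have "(LINT x|lborel. (u (x + v) - u x) * ?b x) = (LINT x|lborel. segment_average f v x * ?b x)" .
    moreover have "integrable lborel (\<lambda>x. (u (x + v) - u x) * ?b x)"
      by (rule ibd[OF _ bm bb]) (use u iu in auto)
    ultimately show "(LINT x|lborel. (u (x + v) - u x - segment_average f v x) * ?b x) = 0"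
      using ibd[OF iA bm bb] by (simp add: left_diff_distrib[of _ "segment_average f v _"])
  qed
  then show ?thesis by simp
qed

section \<open>Chain rule, product rule and uniqueness for weak derivatives on R^n\<close>

lemma integrable_mult_bounded:
  fixes h c :: "'a \<Rightarrow> real"
  assumes "integrable M h" "c \<in> borel_measurable M" "\<And>x. \<bar>c x\<bar> \<le> C"
  shows "integrable M (\<lambda>x. h x * c x)"
proof (rule Bochner_Integration.integrable_bound[OF integrable_mult_right[OF assms(1), of C]])
  show "(\<lambda>x. h x * c x) \<in> borel_measurable M"
    using assms(2) borel_measurable_integrable[OF assms(1)] by simp
  have "C \<ge> 0" using assms(3)[of undefined] by linarith
  then show "AE x in M. norm (h x * c x) \<le> norm (C * h x)"
    using assms(3) by (auto simp: abs_mult mult.commute intro!: mult_right_mono AE_I2)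
qed

text \<open>Filling in h' at a = b makes the factorisation of h a - h b by a - b valid for all a and
  b, preserves bounds on h', and gives continuity in a at b.\<close>

definition diff_quot :: "(real \<Rightarrow> real) \<Rightarrow> (real \<Rightarrow> real) \<Rightarrow> real \<Rightarrow> real \<Rightarrow> real" where
  "diff_quot h h' a b = (if a = b then h' b else (h a - h b) / (a - b))"

lemma diff_quot_mult: "diff_quot h h' a b * (a - b) = h a - h b"
  by (simp add: diff_quot_def)

lemma Lipschitz_of_bounded_derivative:
  fixes h h' :: "real \<Rightarrow> real"
  assumes "\<And>t. (h has_real_derivative h' t) (at t)" "\<And>t. \<bar>h' t\<bar> \<le> C"
  shows "\<bar>h a - h b\<bar> \<le> C * \<bar>a - b\<bar>"
  using field_differentiable_bound[of UNIV h h' C a b] assms by (auto intro: has_field_derivative_at_within)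

lemma diff_quot_bound:
  assumes "\<And>t. (h has_real_derivative h' t) (at t)" "\<And>t. \<bar>h' t\<bar> \<le> C"
  shows "\<bar>diff_quot h h' a b\<bar> \<le> C"
  using Lipschitz_of_bounded_derivative[OF assms, of a b] assms(2)
  by (auto simp: diff_quot_def field_simps)

lemma diff_quot_tendsto:
  assumes "(h has_real_derivative h' b) (at b)" "a \<longlonglongrightarrow> b"
  shows "(\<lambda>k. diff_quot h h' (a k) b) \<longlonglongrightarrow> h' b"
proof -
  have "isCont (\<lambda>x. diff_quot h h' x b) b"
    unfolding continuous_at
  proof (rule Lim_transform_eventually)
    show "((\<lambda>y. (h y - h b) / (y - b)) \<longlongrightarrow> diff_quot h h' b b) (at b)"
      using assms(1) by (simp add: has_field_derivative_iff diff_quot_def)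
    show "\<forall>\<^sub>F y in at b. (h y - h b) / (y - b) = diff_quot h h' y b"
      by (simp add: diff_quot_def eventually_at_filter)
  qed
  from isCont_tendsto_compose[OF this assms(2)] show ?thesis by (simp add: diff_quot_def)
qed

text \<open>Difference quotients in direction e: u(x - t_k e) - u(x) is -t_k times a segment average
  A_k of f, and h turns it into -t_k H_k A_k with |H_k| \<le> C. Since A_k tends to f in L^1 and H_k
  tends to h'(u) almost everywhere along a subsequence, the product converges. The weight
  \<open>\<omega>\<close> is only asked to be differentiable with continuous derivative along e, so
  that it may contain a C^1 factor besides a test function.\<close>

lemma weak_chain_rule:
  fixes u f :: "real^'n::finite \<Rightarrow> real" and \<omega> :: "real^'n \<Rightarrow> real" and D
  assumes U: "open U" and u: "integrable lborel u" and f: "integrable lborel f"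
    and weak: "\<And>\<phi>. test_function U \<phi> \<Longrightarrow>
       (LINT x|lborel. u x * frechet_derivative \<phi> (at x) e) = - (LINT x|lborel. f x * \<phi> x)"
    and h: "\<And>t. (h has_real_derivative h' t) (at t)" "continuous_on UNIV h'" "\<And>t. \<bar>h' t\<bar> \<le> C" "h 0 = 0"
    and \<omega>: "\<And>x. (\<omega> has_derivative D x) (at x)" "continuous_on UNIV (\<lambda>x. D x e)"
    and S: "compact S" "S \<subseteq> U" "\<And>x. x \<notin> S \<Longrightarrow> \<omega> x = 0"
  shows "(LINT x|lborel. h (u x) * D x e) = - (LINT x|lborel. h' (u x) * f x * \<omega> x)"
proof -
  have um[measurable]: "u \<in> borel_measurable borel" and fm[measurable]: "f \<in> borel_measurable borel"
    using borel_measurable_integrable[OF u] borel_measurable_integrable[OF f] by auto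
  have hc: "continuous_on UNIV h"
    using h(1) by (auto simp: continuous_on_eq_continuous_at intro: DERIV_isCont)
  have hm[measurable]: "h \<in> borel_measurable borel" "h' \<in> borel_measurable borel"
    using hc h(2) by (auto intro: borel_measurable_continuous_onI)
  have dqm: "(\<lambda>x. diff_quot h h' (a x) (b x)) \<in> borel_measurable borel"
    if [measurable]: "a \<in> borel_measurable borel" "b \<in> borel_measurable borel" for a b :: "real^'n \<Rightarrow> real"
    unfolding diff_quot_def by measurable
  have \<omega>c: "continuous_on UNIV \<omega>"
    using \<omega>(1) by (auto simp: continuous_on_eq_continuous_at intro: has_derivative_continuous)
  have [measurable]: "\<omega> \<in> borel_measurable borel" "(\<lambda>x. D x e) \<in> borel_measurable borel"
    using \<omega>c \<omega>(2) by (auto intro: borel_measurable_continuous_onI)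
  have C0: "C \<ge> 0" using h(3)[of 0] by linarith
  have Dz: "D x e = 0" if "x \<notin> S" for x
  proof -
    have "open (- S)" using S compact_imp_closed by blast
    then have "(\<omega> has_derivative (\<lambda>_. 0)) (at x)"
      using that S(3) by (intro has_derivative_transform_within_open[OF has_derivative_const[of 0] \<open>open (- S)\<close>]) auto
    then have "D x = (\<lambda>_. 0)" using \<omega>(1) has_derivative_unique by blast
    then show ?thesis by simp
  qed
  obtain B1 where B1: "\<And>x. x \<in> S \<Longrightarrow> \<bar>\<omega> x\<bar> \<le> B1"
    using compact_imp_bounded[OF compact_continuous_image[OF continuous_on_subset[OF \<omega>c] S(1)]]
    unfolding bounded_iff by auto
  obtain B2 where B2: "\<And>x. x \<in> S \<Longrightarrow> \<bar>D x e\<bar> \<le> B2"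
    using compact_imp_bounded[OF compact_continuous_image[OF continuous_on_subset[OF \<omega>(2)] S(1)]]
    unfolding bounded_iff by auto
  define B where "B = \<bar>B1\<bar> + \<bar>B2\<bar>"
  have B\<omega>: "\<bar>\<omega> x\<bar> \<le> B" and BD: "\<bar>D x e\<bar> \<le> B" for x
    using B1[of x] B2[of x] S(3)[of x] Dz[of x] by (cases "x \<in> S"; auto simp: B_def)+
  have B0: "B \<ge> 0" by (simp add: B_def)
  have ih: "integrable lborel (\<lambda>x. h (u x))"
  proof (rule Bochner_Integration.integrable_bound[OF integrable_mult_right[OF u, of C]])
    show "AE x in lborel. norm (h (u x)) \<le> norm (C * u x)"
      using Lipschitz_of_bounded_derivative[OF h(1,3), of _ 0] C0 h(4) by (auto simp: abs_mult)
  qed simp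
  obtain r where r: "r > 0" "(\<Union>x\<in>S. ball x r) \<subseteq> U"
    using compact_subset_open_imp_ball_epsilon_subset[OF S(1) U S(2)] by blast
  \<comment> \<open>A point of the r/2-neighbourhood of \<open>S\<close>, shifted by less than r/2,
    stays in the r-neighbourhood and hence in \<open>U\<close>.\<close>
  define V where "V = (\<Union>x\<in>S. ball x (r/2))"
  have V: "open V" "S \<subseteq> V" using r(1) by (auto simp: V_def)
  have VU: "x + v \<in> U" if "x \<in> V" "norm v < r/2" for x v
  proof -
    from that obtain y where y: "y \<in> S" "dist y x < r/2" by (auto simp: V_def)
    have "dist y (x + v) \<le> dist y x + norm v"
      using norm_triangle_ineq4[of "y - x" v] by (simp add: dist_norm algebra_simps)
    then have "x + v \<in> ball y r" using y that by simp
    then show ?thesis using r(2) y(1) by blast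
  qed
  \<comment> \<open>The denominator norm e + 1 covers e = 0 and keeps the shift by t_k e shorter
    than r/2.\<close>
  define t :: "nat \<Rightarrow> real" where "t k = (r / 2) / (norm e + 1) * inverse (real (Suc k)) " for k
  have tpos: "t k > 0" for k using r(1) by (simp add: t_def add_nonneg_pos)
  have te: "norm (t k *\<^sub>R e) < r/2" for k
  proof -
    have "norm (t k *\<^sub>R e) = (r/2) * (norm e / (norm e + 1)) * inverse (real (Suc k))"
      using r(1) by (simp add: t_def abs_mult add_nonneg_pos)
    also have "\<dots> \<le> (r/2) * (norm e / (norm e + 1)) * 1"
      using r(1) by (intro mult_left_mono) (auto simp: inverse_le_1_iff)
    also have "\<dots> < (r/2) * 1 * 1"
      using r(1) by (intro mult_strict_right_mono mult_strict_left_mono) (auto simp: divide_less_eq_1 add_nonneg_pos)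
    finally show ?thesis by simp
  qed
  have t0: "t \<longlonglongrightarrow> 0"
    unfolding t_def by (rule tendsto_mult_right_zero[OF LIMSEQ_inverse_real_of_nat])
  have te0: "(\<lambda>k. - t k *\<^sub>R e) \<longlonglongrightarrow> 0"
    using tendsto_scaleR[OF tendsto_minus[OF t0] tendsto_const[of e]] by simp
  define A where "A k = segment_average f (- t k *\<^sub>R e)" for k
  have iA: "integrable lborel (A k)" for k unfolding A_def by (rule integrable_segment_average[OF f])
  have key: "AE x in lborel. x \<in> V \<longrightarrow> u (x - t k *\<^sub>R e) - u x = - t k * A k x" for k
  proof -
    have "AE x in lborel. x \<in> V \<longrightarrow> u (x + (- t k *\<^sub>R e)) - u x = segment_average (\<lambda>x. - t k * f x) (- t k *\<^sub>R e) x"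
    proof (rule weak_derivative_segment_average[OF V(1) u _ ])
      show "integrable lborel (\<lambda>x. - t k * f x)" using f by simp
      show "x + s *\<^sub>R - t k *\<^sub>R e \<in> U" if "x \<in> V" "s \<in> {0..1}" for x s
      proof (rule VU[OF that(1)])
        have "norm (s *\<^sub>R - t k *\<^sub>R e) = s * norm (t k *\<^sub>R e)" using that by (simp add: abs_mult)
        also have "\<dots> \<le> 1 * norm (t k *\<^sub>R e)" using that by (intro mult_right_mono) auto
        finally show "norm (s *\<^sub>R - t k *\<^sub>R e) < r/2" using te[of k] by simp
      qed
      fix \<phi> :: "real^'n \<Rightarrow> real" assume \<phi>: "test_function U \<phi>"
      then have "\<phi> differentiable (at x)" for x
        unfolding test_function_def smooth_on_def by (metis Ck_on.simps(2) UNIV_I)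
      then have "frechet_derivative \<phi> (at x) (- t k *\<^sub>R e) = - t k * frechet_derivative \<phi> (at x) e" for x
        using linear_frechet_derivative linear_cmul by (metis real_scaleR_def)
      then have "(LINT x|lborel. u x * frechet_derivative \<phi> (at x) (- t k *\<^sub>R e))
        = (LINT x|lborel. - t k * (u x * frechet_derivative \<phi> (at x) e))" by (simp add: algebra_simps)
      also have "\<dots> = - t k * (LINT x|lborel. u x * frechet_derivative \<phi> (at x) e)"
        by (rule integral_mult_right_zero)
      also have "\<dots> = - t k * - (LINT x|lborel. f x * \<phi> x)" using weak[OF \<phi>] by simp
      also have "\<dots> = - (LINT x|lborel. - t k * (f x * \<phi> x))"
        by (simp only: integral_mult_right_zero)
      finally show "(LINT x|lborel. u x * frechet_derivative \<phi> (at x) (- t k *\<^sub>R e)) = - (LINT x|lborel. - t k * f x * \<phi> x)"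
        by (simp add: algebra_simps)
    qed
    moreover have "segment_average (\<lambda>x. - t k * f x) (- t k *\<^sub>R e) x = - t k * A k x" for x
      unfolding segment_average_def A_def by (rule integral_mult_right_zero)
    ultimately show ?thesis by simp
  qed
  define H where "H k x = diff_quot h h' (u (x - t k *\<^sub>R e)) (u x)" for k x
  have Hm[measurable]: "H k \<in> borel_measurable borel" for k
    unfolding H_def by (intro dqm) measurable
  have HC: "\<bar>H k x\<bar> \<le> C" for k x unfolding H_def by (rule diff_quot_bound[OF h(1,3)])
  \<comment> \<open>Discrete integration by parts: translation invariance moves the difference
    quotient from \<omega> to h(u).\<close>
  have quot: "(LINT x|lborel. h (u x) * ((\<omega> (x + t k *\<^sub>R e) - \<omega> x) / t k)) = - (LINT x|lborel. A k x * (H k x * \<omega> x))" for k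
  proof -
    let ?w = "t k *\<^sub>R e"
    have i1: "integrable lborel (\<lambda>x. h (u x) * \<omega> x)" by (rule integrable_mult_bounded[OF ih _ B\<omega>]) simp
    have i2: "integrable lborel (\<lambda>x. h (u x) * \<omega> (x + ?w))" by (rule integrable_mult_bounded[OF ih _ B\<omega>]) simp
    have i3: "integrable lborel (\<lambda>x. h (u (x - ?w)) * \<omega> x)"
      using lborel_integrable_translate[OF ih, of "- ?w"] by (intro integrable_mult_bounded[OF _ _ B\<omega>]) auto
    have "(\<lambda>x. h (u x) * ((\<omega> (x + ?w) - \<omega> x) / t k)) = (\<lambda>x. (h (u x) * \<omega> (x + ?w) - h (u x) * \<omega> x) / t k)"
      using tpos[of k] by (simp add: fun_eq_iff algebra_simps diff_divide_distrib)
    then have "(LINT x|lborel. h (u x) * ((\<omega> (x + ?w) - \<omega> x) / t k))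
       = ((LINT x|lborel. h (u x) * \<omega> (x + ?w)) - (LINT x|lborel. h (u x) * \<omega> x)) / t k"
      using i1 i2 by simp
    also have "(LINT x|lborel. h (u x) * \<omega> (x + ?w)) = (LINT x|lborel. h (u (x - ?w)) * \<omega> x)"
      using lborel_integral_translate[of "\<lambda>x. h (u (x - ?w)) * \<omega> x" ?w] by simp
    also have "(LINT x|lborel. h (u (x - ?w)) * \<omega> x) - (LINT x|lborel. h (u x) * \<omega> x)
       = (LINT x|lborel. (h (u (x - ?w)) - h (u x)) * \<omega> x)"
      using i1 i3 by (simp add: left_diff_distrib)
    also have "\<dots> = (LINT x|lborel. - t k * (A k x * (H k x * \<omega> x)))"
    proof (rule integral_cong_AE)
      show "(\<lambda>x. - t k * (A k x * (H k x * \<omega> x))) \<in> borel_measurable lborel"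
        using borel_measurable_integrable[OF iA, of k] by simp
      show "AE x in lborel. (h (u (x - ?w)) - h (u x)) * \<omega> x = - t k * (A k x * (H k x * \<omega> x))"
        using key[of k]
      proof eventually_elim
        case (elim x)
        show ?case
        proof (cases "x \<in> S")
          case True
          then have e: "u (x - ?w) - u x = - t k * A k x" using elim V(2) by blast
          have "h (u (x - ?w)) - h (u x) = H k x * (u (x - ?w) - u x)"
            by (simp add: H_def diff_quot_mult)
          then show ?thesis using e by simp
        qed (simp add: S(3))
      qed
    qed simp
    also have "\<dots> = - t k * (LINT x|lborel. A k x * (H k x * \<omega> x))" by (rule integral_mult_right_zero)
    finally show ?thesis using tpos[of k] by simp
  qed
  have lim1: "(\<lambda>k. LINT x|lborel. h (u x) * ((\<omega> (x + t k *\<^sub>R e) - \<omega> x) / t k)) \<longlonglongrightarrow> (LINT x|lborel. h (u x) * D x e)"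
  proof (rule integral_dominated_convergence[where w="\<lambda>x. B * \<bar>h (u x)\<bar>"])
    have line: "((\<lambda>s. \<omega> (x + s *\<^sub>R e)) has_real_derivative D (x + s *\<^sub>R e) e) (at s)" for x s
    proof -
      have l: "((\<lambda>s. x + s *\<^sub>R e) has_derivative (\<lambda>r. r *\<^sub>R e)) (at s)" by (auto intro!: derivative_eq_intros)
      have lin: "linear (D (x + s *\<^sub>R e))" using \<omega>(1) has_derivative_linear by blast
      from has_derivative_compose[OF l \<omega>(1)]
      have "((\<lambda>s. \<omega> (x + s *\<^sub>R e)) has_derivative (\<lambda>r. D (x + s *\<^sub>R e) (r *\<^sub>R e))) (at s)" .
      also have "(\<lambda>r. D (x + s *\<^sub>R e) (r *\<^sub>R e)) = (*) (D (x + s *\<^sub>R e) e)"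
        by (simp add: linear_cmul[OF lin] fun_eq_iff mult.commute)
      finally show ?thesis unfolding has_field_derivative_def .
    qed
    show "AE x in lborel. (\<lambda>k. h (u x) * ((\<omega> (x + t k *\<^sub>R e) - \<omega> x) / t k)) \<longlonglongrightarrow> h (u x) * D x e"
    proof (intro AE_I2 tendsto_mult_left)
      fix x
      have "((\<lambda>s. (\<omega> (x + s *\<^sub>R e) - \<omega> x) / s) \<longlongrightarrow> D x e) (at 0)"
        using line[of x 0] by (simp add: has_field_derivative_iff)
      moreover have "filterlim t (at 0) sequentially"
        using t0 tpos by (auto simp: filterlim_at less_imp_neq[symmetric])
      ultimately show "(\<lambda>k. (\<omega> (x + t k *\<^sub>R e) - \<omega> x) / t k) \<longlonglongrightarrow> D x e"
        by (rule filterlim_compose)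
    qed
    show "AE x in lborel. norm (h (u x) * ((\<omega> (x + t k *\<^sub>R e) - \<omega> x) / t k)) \<le> B * \<bar>h (u x)\<bar>" for k
    proof (rule AE_I2)
      fix x
      have "\<bar>\<omega> (x + t k *\<^sub>R e) - \<omega> (x + 0 *\<^sub>R e)\<bar> \<le> B * \<bar>t k - 0\<bar>"
        by (rule Lipschitz_of_bounded_derivative[OF line BD])
      then have "\<bar>(\<omega> (x + t k *\<^sub>R e) - \<omega> x) / t k\<bar> \<le> B" using tpos[of k] by (simp add: field_simps)
      then show "norm (h (u x) * ((\<omega> (x + t k *\<^sub>R e) - \<omega> x) / t k)) \<le> B * \<bar>h (u x)\<bar>"
        using mult_left_mono[of "\<bar>(\<omega> (x + t k *\<^sub>R e) - \<omega> x) / t k\<bar>" B "\<bar>h (u x)\<bar>"]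
        by (simp only: real_norm_def abs_mult[of "h (u x)"] mult.commute[of B] abs_ge_zero)
    qed
    show "integrable lborel (\<lambda>x. B * \<bar>h (u x)\<bar>)" using ih by simp
    show "(\<lambda>x. h (u x) * ((\<omega> (x + t k *\<^sub>R e) - \<omega> x) / t k)) \<in> borel_measurable lborel" for k by simp
  qed simp
  have AL: "(\<lambda>k. LINT x|lborel. \<bar>A k x - f x\<bar>) \<longlonglongrightarrow> 0"
    unfolding A_def by (rule L1_segment_average_tendsto[OF f te0])
  have "(\<lambda>k. LINT x|lborel. norm (u (x - t k *\<^sub>R e) - u x)) \<longlonglongrightarrow> 0"
    using L1_translate_tendsto[OF u te0] by simp
  moreover have "integrable lborel (\<lambda>x. u (x - t k *\<^sub>R e) - u x)" for k
    using lborel_integrable_translate[OF u, of "- t k *\<^sub>R e"] u by simp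
  \<comment> \<open>Convergence of the translates of u in L^1 yields almost everywhere convergence
    along a subsequence, which the pointwise limit of H_k requires.\<close>
  ultimately obtain \<rho> :: "nat \<Rightarrow> nat" where \<rho>: "strict_mono \<rho>"
    and ae: "AE x in lborel. (\<lambda>n. u (x - t (\<rho> n) *\<^sub>R e) - u x) \<longlonglongrightarrow> 0"
    using tendsto_L1_AE_subseq[of lborel "\<lambda>k x. u (x - t k *\<^sub>R e) - u x"] by blast
  have i4: "integrable lborel (\<lambda>x. A k x * (H k x * \<omega> x))" for k
    using HC B\<omega> C0 by (intro integrable_mult_bounded[OF iA, where C="C * B"]) (auto simp: abs_mult intro!: mult_mono)
  have i5: "integrable lborel (\<lambda>x. f x * (H k x * \<omega> x))" for k
    using HC B\<omega> C0 by (intro integrable_mult_bounded[OF f, where C="C * B"]) (auto simp: abs_mult intro!: mult_mono)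
  \<comment> \<open>Replacing A_k by f costs at most C B times their L^1 distance, because H_k and
    \<omega> are bounded uniformly in k.\<close>
  have "(\<lambda>k. LINT x|lborel. A (\<rho> k) x * (H (\<rho> k) x * \<omega> x) - f x * (H (\<rho> k) x * \<omega> x)) \<longlonglongrightarrow> 0"
  proof (rule Lim_null_comparison[where g="\<lambda>k. C * B * (LINT x|lborel. \<bar>A (\<rho> k) x - f x\<bar>)"])
    show "(\<lambda>k. C * B * (LINT x|lborel. \<bar>A (\<rho> k) x - f x\<bar>)) \<longlonglongrightarrow> 0"
      using tendsto_mult_right_zero[OF LIMSEQ_subseq_LIMSEQ[OF AL \<rho>], of "C * B"] by (simp add: o_def)
    show "\<forall>\<^sub>F k in sequentially. norm (LINT x|lborel. A (\<rho> k) x * (H (\<rho> k) x * \<omega> x) - f x * (H (\<rho> k) x * \<omega> x))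
       \<le> C * B * (LINT x|lborel. \<bar>A (\<rho> k) x - f x\<bar>)"
    proof (rule always_eventually, rule allI)
      fix k
      have "norm (LINT x|lborel. A (\<rho> k) x * (H (\<rho> k) x * \<omega> x) - f x * (H (\<rho> k) x * \<omega> x))
         \<le> (LINT x|lborel. norm (A (\<rho> k) x * (H (\<rho> k) x * \<omega> x) - f x * (H (\<rho> k) x * \<omega> x)))"
        by (rule integral_norm_bound)
      also have "\<dots> \<le> (LINT x|lborel. C * B * \<bar>A (\<rho> k) x - f x\<bar>)"
      proof (rule integral_mono)
        show "integrable lborel (\<lambda>x. norm (A (\<rho> k) x * (H (\<rho> k) x * \<omega> x) - f x * (H (\<rho> k) x * \<omega> x)))"
          using i4 i5 by auto
        show "integrable lborel (\<lambda>x. C * B * \<bar>A (\<rho> k) x - f x\<bar>)" using iA[of "\<rho> k"] f by auto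
        fix x
        have "\<bar>H (\<rho> k) x * \<omega> x\<bar> \<le> C * B" using HC B\<omega> C0 by (auto simp: abs_mult intro!: mult_mono)
        then show "norm (A (\<rho> k) x * (H (\<rho> k) x * \<omega> x) - f x * (H (\<rho> k) x * \<omega> x)) \<le> C * B * \<bar>A (\<rho> k) x - f x\<bar>"
          by (simp only: left_diff_distrib[symmetric] real_norm_def abs_mult mult.commute[of "\<bar>A (\<rho> k) x - f x\<bar>"])
            (rule mult_right_mono, auto simp: abs_mult)
      qed
      also have "\<dots> = C * B * (LINT x|lborel. \<bar>A (\<rho> k) x - f x\<bar>)" by simp
      finally show "norm (LINT x|lborel. A (\<rho> k) x * (H (\<rho> k) x * \<omega> x) - f x * (H (\<rho> k) x * \<omega> x))
         \<le> C * B * (LINT x|lborel. \<bar>A (\<rho> k) x - f x\<bar>)" .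
    qed
  qed
  moreover have "(\<lambda>k. LINT x|lborel. f x * (H (\<rho> k) x * \<omega> x)) \<longlonglongrightarrow> (LINT x|lborel. f x * (h' (u x) * \<omega> x))"
  proof (rule integral_dominated_convergence[where w="\<lambda>x. C * B * \<bar>f x\<bar>"])
    show "AE x in lborel. (\<lambda>k. f x * (H (\<rho> k) x * \<omega> x)) \<longlonglongrightarrow> f x * (h' (u x) * \<omega> x)"
      using ae
    proof eventually_elim
      case (elim x)
      then have "(\<lambda>n. u (x - t (\<rho> n) *\<^sub>R e)) \<longlonglongrightarrow> u x" by (simp add: LIM_zero_iff)
      from diff_quot_tendsto[where h=h and h'=h' and b="u x", OF h(1) this] show ?case unfolding H_def by (intro tendsto_intros)
    qed
    show "AE x in lborel. norm (f x * (H (\<rho> k) x * \<omega> x)) \<le> C * B * \<bar>f x\<bar>" for k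
    proof (rule AE_I2)
      fix x
      have "\<bar>H (\<rho> k) x * \<omega> x\<bar> \<le> C * B" using HC B\<omega> C0 by (auto simp: abs_mult intro!: mult_mono)
      then show "norm (f x * (H (\<rho> k) x * \<omega> x)) \<le> C * B * \<bar>f x\<bar>"
        using mult_left_mono[of "\<bar>H (\<rho> k) x * \<omega> x\<bar>" "C * B" "\<bar>f x\<bar>"]
        by (simp only: real_norm_def abs_mult[of "f x"] mult.commute[of "C * B"] abs_ge_zero)
    qed
    show "(\<lambda>x. f x * (H (\<rho> k) x * \<omega> x)) \<in> borel_measurable lborel" for k by simp
    show "(\<lambda>x. f x * (h' (u x) * \<omega> x)) \<in> borel_measurable lborel" by simp
  qed (use f in auto)
  ultimately have "(\<lambda>k. (LINT x|lborel. A (\<rho> k) x * (H (\<rho> k) x * \<omega> x) - f x * (H (\<rho> k) x * \<omega> x))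
      + (LINT x|lborel. f x * (H (\<rho> k) x * \<omega> x))) \<longlonglongrightarrow> 0 + (LINT x|lborel. f x * (h' (u x) * \<omega> x))"
    by (rule tendsto_add)
  then have "(\<lambda>k. LINT x|lborel. A (\<rho> k) x * (H (\<rho> k) x * \<omega> x)) \<longlonglongrightarrow> (LINT x|lborel. f x * (h' (u x) * \<omega> x))"
    using i4 i5 by simp
  moreover have "(\<lambda>k. - (LINT x|lborel. A (\<rho> k) x * (H (\<rho> k) x * \<omega> x))) \<longlonglongrightarrow> (LINT x|lborel. h (u x) * D x e)"
    using LIMSEQ_subseq_LIMSEQ[OF lim1 \<rho>] unfolding quot o_def .
  ultimately have "- (LINT x|lborel. f x * (h' (u x) * \<omega> x)) = (LINT x|lborel. h (u x) * D x e)"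
    using LIMSEQ_unique tendsto_minus by blast
  then show ?thesis by (simp add: algebra_simps)
qed

lemma test_function_has_derivative:
  assumes "test_function S \<phi>"
  shows "(\<phi> has_derivative frechet_derivative \<phi> (at x)) (at x)"
    and "continuous_on UNIV (\<lambda>x. frechet_derivative \<phi> (at x) e)"
proof -
  have "Ck_on (Suc 0) UNIV \<phi>" using assms unfolding test_function_def smooth_on_def by blast
  then show "(\<phi> has_derivative frechet_derivative \<phi> (at x)) (at x)"
    "continuous_on UNIV (\<lambda>x. frechet_derivative \<phi> (at x) e)"
    using frechet_derivative_works by (auto simp del: One_nat_def)
qed

lemma has_derivative_zero_outside:
  fixes \<phi> :: "'a::real_normed_vector \<Rightarrow> 'b::real_normed_vector"
  assumes "closed S" "\<And>y. y \<notin> S \<Longrightarrow> \<phi> y = 0" "x \<notin> S"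
  shows "(\<phi> has_derivative (\<lambda>_. 0)) (at x)"
proof (rule has_derivative_transform_within_open[OF has_derivative_const[of 0]])
  show "open (- S)" "x \<in> - S" using assms(1,3) by (simp_all add: open_Compl)
  show "0 = \<phi> y" if "y \<in> - S" for y using assms(2)[of y] that by simp
qed

lemma test_function_eq_0:
  assumes "test_function S \<phi>" "x \<notin> closure {y. \<phi> y \<noteq> 0}"
  shows "\<phi> x = 0" "frechet_derivative \<phi> (at x) = (\<lambda>_. 0)"
proof -
  have z: "\<phi> y = 0" if y: "y \<notin> closure {y. \<phi> y \<noteq> 0}" for y
  proof (rule ccontr)
    assume "\<phi> y \<noteq> 0"
    then have "y \<in> closure {y. \<phi> y \<noteq> 0}" by (intro closure_subset[THEN subsetD]) simp
    with y show False by simp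
  qed
  show "\<phi> x = 0" by (rule z[OF assms(2)])
  have "(\<phi> has_derivative (\<lambda>_. 0)) (at x)"
    by (rule has_derivative_zero_outside[OF closed_closure z assms(2)])
  then show "frechet_derivative \<phi> (at x) = (\<lambda>_. 0)" by (rule frechet_derivative_at[symmetric])
qed

lemma test_function_mono: "test_function S \<phi> \<Longrightarrow> S \<subseteq> T \<Longrightarrow> test_function T \<phi>"
  by (auto simp: test_function_def)

text \<open>Passes from the completed measure to Borel functions, for which the translation and
  Fubini arguments are set up.\<close>

lemma borel_representative:
  fixes u :: "'a::euclidean_space \<Rightarrow> real"
  assumes "set_integrable lebesgue K u"
  obtains v where "integrable lborel v" "AE x in lebesgue. v x = indicator K x * u x"
proof -
  let ?f = "\<lambda>x. indicator K x * u x"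
  have f: "integrable lebesgue ?f" using assms by (simp add: set_integrable_def)
  obtain v where v: "v \<in> borel_measurable lborel" "AE x in lborel. ?f x = v x"
    using completion_ex_borel_measurable_real[OF borel_measurable_integrable[OF f]] by auto
  have ae: "AE x in lebesgue. v x = ?f x" using AE_completion[OF v(2)] by (auto elim: eventually_mono)
  have "integrable lebesgue v"
    using f by (rule integrable_cong_AE_imp) (use v ae in \<open>auto intro: measurable_completion\<close>)
  then have "integrable lborel v" using v(1) by (simp add: integrable_completion)
  with ae show ?thesis by (rule that[rotated])
qed

text \<open>The product rule becomes the chain rule with weight \<phi> \<psi>: the derivative of the
  weight splits into \<phi> D\<psi> and \<psi> D\<phi>, and the first summand moves to the right
  side. The data are only locally integrable in \<open>W\<close>, hence the restriction to a compact
  neighbourhood \<open>K\<close> of the support of \<phi>.\<close>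

lemma weak_product_chain_rule:
  fixes u f :: "real^'n::finite \<Rightarrow> real"
  assumes W: "open W"
    and u: "\<And>K. compact K \<Longrightarrow> K \<subseteq> W \<Longrightarrow> set_integrable lebesgue K u"
    and f: "\<And>K. compact K \<Longrightarrow> K \<subseteq> W \<Longrightarrow> set_integrable lebesgue K f"
    and weak: "\<And>\<phi>. test_function W \<phi> \<Longrightarrow>
       (LINT x:W|lebesgue. u x * frechet_derivative \<phi> (at x) e) = - (LINT x:W|lebesgue. f x * \<phi> x)"
    and h: "\<And>t. (h has_real_derivative h' t) (at t)" "continuous_on UNIV h'" "\<And>t. \<bar>h' t\<bar> \<le> C" "h 0 = 0"
    and \<psi>: "\<And>x. x \<in> W \<Longrightarrow> (\<psi> has_derivative D\<psi> x) (at x)" "continuous_on W (\<lambda>x. D\<psi> x e)"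
    and \<phi>: "test_function W \<phi>"
  shows "(LINT x:W|lebesgue. (\<psi> x * h (u x)) * frechet_derivative \<phi> (at x) e)
     = - (LINT x:W|lebesgue. (\<psi> x * (h' (u x) * f x) + h (u x) * D\<psi> x e) * \<phi> x)"
proof -
  define S where "S = closure {y. \<phi> y \<noteq> 0}"
  have S: "compact S" "S \<subseteq> W" "closed S" using \<phi> by (auto simp: test_function_def S_def)
  note \<phi>0 = test_function_eq_0[OF \<phi>, folded S_def]
  obtain r where r: "r > 0" "(\<Union>x\<in>S. cball x r) \<subseteq> W"
    using compact_subset_open_imp_cball_epsilon_subset[OF S(1) W S(2)] by blast
  define K where "K = (\<Union>x\<in>S. cball x r)"
  have K: "compact K" "K \<subseteq> W" using compact_minkowski_sum_cball[OF S(1)] r by (auto simp: K_def)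
  define U where "U = (\<Union>x\<in>S. ball x r)"
  have U: "open U" "S \<subseteq> U" using r(1) by (auto simp: U_def)
  have "U \<subseteq> K" unfolding U_def K_def by (intro UN_mono ball_subset_cball subset_refl)
  with K(2) have U: "open U" "S \<subseteq> U" "U \<subseteq> K" "U \<subseteq> W" using U by simp_all
  obtain u1 where u1: "integrable lborel u1" "AE x in lebesgue. u1 x = indicator K x * u x"
    using borel_representative[OF u[OF K]] by blast
  obtain f1 where f1: "integrable lborel f1" "AE x in lebesgue. f1 x = indicator K x * f x"
    using borel_representative[OF f[OF K]] by blast
  have [measurable]: "u1 \<in> borel_measurable borel" "f1 \<in> borel_measurable borel"
    using borel_measurable_integrable[OF u1(1)] borel_measurable_integrable[OF f1(1)] by auto
  \<comment> \<open>Integrals over \<open>W\<close> of the given data are exchanged for integrals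
    over the whole space of Borel representatives; both integrands vanish off
    \<open>U\<close>.\<close>
  have transfer: "(LINT x:W|lebesgue. a x) = (LINT x|lborel. a1 x)"
    if a1: "a1 \<in> borel_measurable borel" and supp: "\<And>x. x \<notin> U \<Longrightarrow> a x = 0" "\<And>x. x \<notin> U \<Longrightarrow> a1 x = 0"
    and ae: "AE x in lebesgue. x \<in> K \<longrightarrow> a x = a1 x" for a a1 :: "real^'n \<Rightarrow> real"
  proof -
    have "AE x in lebesgue. indicator W x * a x = a1 x"
      using ae
    proof eventually_elim
      case (elim x)
      then show ?case by (cases "x \<in> U") (use supp U K in \<open>auto simp: indicator_def\<close>)
    qed
    then have eq: "AE x in lebesgue. a1 x = indicator W x * a x" by (auto elim: eventually_mono)
    have a1l: "a1 \<in> borel_measurable lebesgue" using a1 by (intro measurable_completion) simp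
    have "(LINT x:W|lebesgue. a x) = (LINT x|lebesgue. a1 x)"
      unfolding set_lebesgue_integral_def real_scaleR_def
      by (rule integral_cong_AE[OF borel_measurable_AE[OF a1l eq] a1l]) (use eq in \<open>auto elim: eventually_mono\<close>)
    also have "\<dots> = (LINT x|lborel. a1 x)" using a1 by (intro integral_completion) simp
    finally show ?thesis .
  qed
  \<comment> \<open>\<psi> is controlled on \<open>W\<close> only. Its products with \<phi> or with
    the derivative of \<phi> vanish off the support \<open>S\<close> and extend by 0 to bounded
    continuous functions.\<close>
  define ext where "ext g x = (if x \<in> U then g x else 0)" for g :: "real^'n \<Rightarrow> real" and x
  have ext: "continuous_on UNIV (ext g)" "\<exists>B. \<forall>x. \<bar>ext g x\<bar> \<le> B" "ext g \<in> borel_measurable borel"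
    if "continuous_on U g" "\<And>x. x \<notin> S \<Longrightarrow> g x = 0" for g
  proof -
    have "continuous_on U (ext g)" using that(1) by (rule continuous_on_eq) (simp add: ext_def)
    moreover have "continuous_on (- S) (ext g)"
      by (rule continuous_on_eq[of _ "\<lambda>_. 0"]) (auto simp: ext_def that(2))
    ultimately have "continuous_on (U \<union> - S) (ext g)"
      using U(1) S(3) by (intro continuous_on_open_Un) auto
    moreover have "U \<union> - S = UNIV" using U(2) by auto
    ultimately show c: "continuous_on UNIV (ext g)" by simp
    then show "ext g \<in> borel_measurable borel" by (rule borel_measurable_continuous_onI)
    obtain B where B: "\<And>x. x \<in> S \<Longrightarrow> \<bar>ext g x\<bar> \<le> B"
      using compact_imp_bounded[OF compact_continuous_image[OF continuous_on_subset[OF c] S(1)]]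
      unfolding bounded_iff by auto
    have "\<bar>ext g x\<bar> \<le> \<bar>B\<bar>" for x using B[of x] that(2)[of x] by (cases "x \<in> S") (auto simp: ext_def)
    then show "\<exists>B. \<forall>x. \<bar>ext g x\<bar> \<le> B" by blast
  qed
  let ?d = "\<lambda>x. frechet_derivative \<phi> (at x)"
  note d\<phi> = test_function_has_derivative[OF \<phi>]
  have \<phi>U: "\<phi> x = 0" "?d x e = 0" if "x \<notin> U" for x
  proof -
    have "x \<notin> S" using that U(2) by blast
    then show "\<phi> x = 0" by (rule \<phi>0(1))
    show "?d x e = 0" by (simp only: \<phi>0(2)[OF \<open>x \<notin> S\<close>])
  qed
  have c\<psi>: "continuous_on U \<psi>"
    using \<psi>(1) U(4) by (intro continuous_at_imp_continuous_on) (auto intro: has_derivative_continuous)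
  have c\<phi>: "continuous_on U \<phi>"
    using d\<phi>(1) by (intro continuous_at_imp_continuous_on) (auto intro: has_derivative_continuous)
  have cd: "continuous_on U (\<lambda>x. ?d x e)" "continuous_on U (\<lambda>x. D\<psi> x e)"
    using d\<phi>(2) \<psi>(2) U(4) continuous_on_subset by blast+
  define P where "P = ext (\<lambda>x. \<psi> x * ?d x e)"
  define Q where "Q = ext (\<lambda>x. \<phi> x * D\<psi> x e)"
  define \<omega> where "\<omega> = ext (\<lambda>x. \<phi> x * \<psi> x)"
  have "continuous_on U (\<lambda>x. \<psi> x * ?d x e)" "continuous_on U (\<lambda>x. \<phi> x * D\<psi> x e)" "continuous_on U (\<lambda>x. \<phi> x * \<psi> x)"
    by (intro continuous_intros c\<psi> c\<phi> cd)+
  then obtain BP BQ B\<omega> where P: "continuous_on UNIV P" "P \<in> borel_measurable borel" "\<And>x. \<bar>P x\<bar> \<le> BP"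
    and Q: "continuous_on UNIV Q" "Q \<in> borel_measurable borel" "\<And>x. \<bar>Q x\<bar> \<le> BQ"
    and \<omega>: "continuous_on UNIV \<omega>" "\<omega> \<in> borel_measurable borel" "\<And>x. \<bar>\<omega> x\<bar> \<le> B\<omega>"
    unfolding P_def Q_def \<omega>_def using ext[of "\<lambda>x. \<psi> x * ?d x e"] ext[of "\<lambda>x. \<phi> x * D\<psi> x e"] ext[of "\<lambda>x. \<phi> x * \<psi> x"] \<phi>0
    by auto
  have hc: "continuous_on UNIV h"
    using h(1) by (auto simp: continuous_on_eq_continuous_at intro: DERIV_isCont)
  have hm[measurable]: "h \<in> borel_measurable borel" "h' \<in> borel_measurable borel"
    using hc h(2) by (auto intro: borel_measurable_continuous_onI)
  note [measurable] = P(2) Q(2) \<omega>(2)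
  have C0: "C \<ge> 0" using h(3)[of 0] by linarith
  have ih: "integrable lborel (\<lambda>x. h (u1 x))"
  proof (rule Bochner_Integration.integrable_bound[OF integrable_mult_right[OF u1(1), of C]])
    show "AE x in lborel. norm (h (u1 x)) \<le> norm (C * u1 x)"
      using Lipschitz_of_bounded_derivative[OF h(1,3), of _ 0] C0 h(4) by (auto simp: abs_mult)
  qed simp
  have i1: "integrable lborel (\<lambda>x. h (u1 x) * P x)" by (rule integrable_mult_bounded[OF ih _ P(3)]) simp
  have i2: "integrable lborel (\<lambda>x. h (u1 x) * Q x)" by (rule integrable_mult_bounded[OF ih _ Q(3)]) simp
  have i3: "integrable lborel (\<lambda>x. f1 x * h' (u1 x) * \<omega> x)"
    by (intro integrable_mult_bounded[OF _ _ \<omega>(3)] integrable_mult_bounded[OF f1(1) _ h(3)]) auto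
  define D where "D x = (if x \<in> U then (\<lambda>v. \<phi> x * D\<psi> x v + ?d x v * \<psi> x) else (\<lambda>_. 0))" for x
  have chain: "(LINT x|lborel. h (u1 x) * D x e) = - (LINT x|lborel. h' (u1 x) * f1 x * \<omega> x)"
  proof (rule weak_chain_rule[OF U(1) u1(1) f1(1) _ h _ _ S(1) U(2)])
    fix \<theta> :: "real^'n \<Rightarrow> real" assume \<theta>: "test_function U \<theta>"
    note \<theta>0 = test_function_eq_0[OF \<theta>]
    have sub: "closure {y. \<theta> y \<noteq> 0} \<subseteq> U" using \<theta> by (simp add: test_function_def)
    have z\<theta>: "\<theta> x = 0" "frechet_derivative \<theta> (at x) e = 0" if "x \<notin> U" for x
    proof -
      have x: "x \<notin> closure {y. \<theta> y \<noteq> 0}" using that sub by blast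
      show "\<theta> x = 0" by (rule \<theta>0(1)[OF x])
      show "frechet_derivative \<theta> (at x) e = 0" by (simp only: \<theta>0(2)[OF x])
    qed
    note d\<theta> = test_function_has_derivative[OF \<theta>]
    have [measurable]: "\<theta> \<in> borel_measurable borel" "(\<lambda>x. frechet_derivative \<theta> (at x) e) \<in> borel_measurable borel"
      using d\<theta>(2) continuous_at_imp_continuous_on[of UNIV \<theta>] has_derivative_continuous[OF d\<theta>(1)]
      by (auto intro!: borel_measurable_continuous_onI)
    have "(LINT x|lborel. u1 x * frechet_derivative \<theta> (at x) e) = (LINT x:W|lebesgue. u x * frechet_derivative \<theta> (at x) e)"
    proof (rule transfer[symmetric])
      show "AE x in lebesgue. x \<in> K \<longrightarrow> u x * frechet_derivative \<theta> (at x) e = u1 x * frechet_derivative \<theta> (at x) e"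
        using u1(2) by eventually_elim simp
    qed (simp_all add: z\<theta>)
    also have "\<dots> = - (LINT x:W|lebesgue. f x * \<theta> x)" by (rule weak[OF test_function_mono[OF \<theta> U(4)]])
    also have "(LINT x:W|lebesgue. f x * \<theta> x) = (LINT x|lborel. f1 x * \<theta> x)"
    proof (rule transfer)
      show "AE x in lebesgue. x \<in> K \<longrightarrow> f x * \<theta> x = f1 x * \<theta> x"
        using f1(2) by eventually_elim simp
    qed (simp_all add: z\<theta>)
    finally show "(LINT x|lborel. u1 x * frechet_derivative \<theta> (at x) e) = - (LINT x|lborel. f1 x * \<theta> x)" .
  next
    show "(\<omega> has_derivative D x) (at x)" for x
    proof (cases "x \<in> U")
      case True
      then have "((\<lambda>x. \<phi> x * \<psi> x) has_derivative D x) (at x)"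
        using d\<phi>(1)[of x] \<psi>(1)[of x] U(4) by (auto simp: D_def intro!: has_derivative_mult)
      then show ?thesis
        by (rule has_derivative_transform_within_open[OF _ U(1) True]) (simp add: \<omega>_def ext_def)
    next
      case False
      then have "D x = (\<lambda>_. 0)" "x \<notin> S" using U(2) by (auto simp: D_def)
      moreover have "\<omega> y = 0" if "y \<notin> S" for y using \<phi>0[OF that] by (simp add: \<omega>_def ext_def)
      ultimately show ?thesis using has_derivative_zero_outside[OF S(3), of \<omega> x] by simp
    qed
    have "D x e = P x + Q x" for x by (auto simp: D_def P_def Q_def ext_def)
    then show "continuous_on UNIV (\<lambda>x. D x e)" using continuous_on_add[OF P(1) Q(1)] by presburger
    show "\<omega> x = 0" if "x \<notin> S" for x using \<phi>0[OF that] by (simp add: \<omega>_def ext_def)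
  qed
  have L: "(LINT x:W|lebesgue. (\<psi> x * h (u x)) * ?d x e) = (LINT x|lborel. h (u1 x) * P x)"
  proof (rule transfer)
    show "(\<lambda>x. h (u1 x) * P x) \<in> borel_measurable borel" by measurable
    show "AE x in lebesgue. x \<in> K \<longrightarrow> \<psi> x * h (u x) * ?d x e = h (u1 x) * P x"
      using u1(2) by eventually_elim (use \<phi>U in \<open>auto simp: P_def ext_def\<close>)
  qed (use \<phi>U in \<open>auto simp: P_def ext_def\<close>)
  have R: "(LINT x:W|lebesgue. (\<psi> x * (h' (u x) * f x) + h (u x) * D\<psi> x e) * \<phi> x)
     = (LINT x|lborel. f1 x * h' (u1 x) * \<omega> x + h (u1 x) * Q x)"
  proof (rule transfer)
    show "(\<lambda>x. f1 x * h' (u1 x) * \<omega> x + h (u1 x) * Q x) \<in> borel_measurable borel" by measurable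
    show "AE x in lebesgue. x \<in> K \<longrightarrow> (\<psi> x * (h' (u x) * f x) + h (u x) * D\<psi> x e) * \<phi> x
       = f1 x * h' (u1 x) * \<omega> x + h (u1 x) * Q x"
      using u1(2) f1(2) by eventually_elim (use \<phi>U in \<open>auto simp: Q_def \<omega>_def ext_def algebra_simps\<close>)
  qed (use \<phi>U in \<open>auto simp: Q_def \<omega>_def ext_def\<close>)
  have "(LINT x|lborel. h (u1 x) * D x e) = (LINT x|lborel. h (u1 x) * P x + h (u1 x) * Q x)"
    by (rule Bochner_Integration.integral_cong) (auto simp: D_def P_def Q_def ext_def algebra_simps)
  also have "\<dots> = (LINT x|lborel. h (u1 x) * P x) + (LINT x|lborel. h (u1 x) * Q x)" using i1 i2 by simp
  finally have E: "(LINT x|lborel. h (u1 x) * D x e) = (LINT x|lborel. h (u1 x) * P x) + (LINT x|lborel. h (u1 x) * Q x)" .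
  have "(LINT x|lborel. h' (u1 x) * f1 x * \<omega> x) = (LINT x|lborel. f1 x * h' (u1 x) * \<omega> x)"
    by (simp add: mult.commute)
  with chain E L R i2 i3 show ?thesis by simp
qed

text \<open>\<open>W\<close> is a countable union of closed boxes. On each open box the fundamental
  lemma applies to Borel representatives of the truncated functions, and the boundaries of the boxes
  are null.\<close>

lemma weak_derivative_unique:
  fixes f1 f2 :: "real^'n::finite \<Rightarrow> real"
  assumes W: "open W"
    and f1: "\<And>K. compact K \<Longrightarrow> K \<subseteq> W \<Longrightarrow> set_integrable lebesgue K f1"
    and f2: "\<And>K. compact K \<Longrightarrow> K \<subseteq> W \<Longrightarrow> set_integrable lebesgue K f2"
    and eq: "\<And>\<phi>. test_function W \<phi> \<Longrightarrow> (LINT x:W|lebesgue. f1 x * \<phi> x) = (LINT x:W|lebesgue. f2 x * \<phi> x)"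
  shows "AE x in lebesgue. x \<in> W \<longrightarrow> f1 x = f2 x"
proof -
  obtain D where D: "countable D" "D \<subseteq> Pow W" "\<And>X. X \<in> D \<Longrightarrow> \<exists>a b. X = cbox a b" "\<Union>D = W"
    using open_countable_Union_open_cbox[OF W] by metis
  have "AE x in lebesgue. x \<in> X \<longrightarrow> f1 x = f2 x" if "X \<in> D" for X
  proof -
    obtain a b where X: "X = cbox a b" using D(3)[OF \<open>X \<in> D\<close>] by metis
    have K: "compact X" "X \<subseteq> W" using X that D(2) by auto
    obtain v1 where v1: "integrable lborel v1" "AE x in lebesgue. v1 x = indicator X x * f1 x"
      using borel_representative[OF f1[OF K]] by blast
    obtain v2 where v2: "integrable lborel v2" "AE x in lebesgue. v2 x = indicator X x * f2 x"
      using borel_representative[OF f2[OF K]] by blast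
    have tr: "(LINT x|lborel. v x * \<theta> x) = (LINT x:W|lebesgue. f x * \<theta> x)"
      if v: "integrable lborel v" "AE x in lebesgue. v x = indicator X x * f x"
        and \<theta>: "test_function (box a b) \<theta>" for v f \<theta>
    proof -
      have sub: "closure {y. \<theta> y \<noteq> 0} \<subseteq> box a b" using \<theta> by (simp add: test_function_def)
      have "continuous_on UNIV \<theta>"
        using has_derivative_continuous[OF test_function_has_derivative(1)[OF \<theta>]]
        by (simp add: continuous_at_imp_continuous_on)
      then have "\<theta> \<in> borel_measurable borel" by (rule borel_measurable_continuous_onI)
      then have m: "(\<lambda>x. v x * \<theta> x) \<in> borel_measurable lborel" using borel_measurable_integrable[OF v(1)] by simp
      have z: "\<theta> x = 0" if "x \<notin> box a b" for x using test_function_eq_0(1)[OF \<theta>] sub that by blast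
      have ml: "(\<lambda>x. v x * \<theta> x) \<in> borel_measurable lebesgue" using m by (rule measurable_completion)
      have ae: "AE x in lebesgue. v x * \<theta> x = indicator W x * (f x * \<theta> x)"
        using v(2) by eventually_elim (use z K X box_subset_cbox[of a b] in \<open>auto simp: indicator_def\<close>)
      have "(LINT x|lborel. v x * \<theta> x) = (LINT x|lebesgue. v x * \<theta> x)"
        using m by (intro integral_completion[symmetric])
      also have "\<dots> = (LINT x:W|lebesgue. f x * \<theta> x)"
        unfolding set_lebesgue_integral_def real_scaleR_def
        by (rule integral_cong_AE[OF ml borel_measurable_AE[OF ml ae] ae])
      finally show ?thesis .
    qed
    have "AE x in lborel. x \<in> box a b \<longrightarrow> v1 x - v2 x = 0"
    proof (rule fundamental_lemma[OF _ open_box])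
      show "integrable lborel (\<lambda>x. v1 x - v2 x)" using v1 v2 by auto
      fix k :: real and c d :: "real^'n" assume k: "k > 0" "cbox c d \<subseteq> box a b"
      have t: "test_function (box a b) (box_bump k c d)" by (rule box_bump_test_function[OF k])
      have bm: "box_bump k c d \<in> borel_measurable lborel"
        using borel_measurable_continuous_onI[OF continuous_box_bump] by simp
      have bb: "\<bar>box_bump k c d x\<bar> \<le> 1" for x using box_bump_bounds[of k c d x] by simp
      have "(LINT x|lborel. v1 x * box_bump k c d x) = (LINT x|lborel. v2 x * box_bump k c d x)"
        using tr[OF v1 t] tr[OF v2 t] eq[OF test_function_mono[OF t]] K X box_subset_cbox[of a b] by auto
      then show "(LINT x|lborel. (v1 x - v2 x) * box_bump k c d x) = 0"
        using integrable_mult_bounded[OF v1(1) bm bb] integrable_mult_bounded[OF v2(1) bm bb]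
        by (simp add: left_diff_distrib)
    qed
    then have 1: "AE x in lebesgue. x \<in> box a b \<longrightarrow> v1 x = v2 x"
      by (intro AE_completion) (auto elim: eventually_mono)
    have "negligible (cbox a b - box a b)" by (rule negligible_frontier_interval)
    then have "AE x in lebesgue. x \<notin> cbox a b - box a b"
      unfolding negligible_iff_null_sets by (rule AE_not_in)
    then show ?thesis using 1 v1(2) v2(2) by eventually_elim (auto simp: X)
  qed
  then have "AE x in lebesgue. \<forall>X\<in>D. x \<in> X \<longrightarrow> f1 x = f2 x"
    unfolding AE_ball_countable[OF D(1)] by blast
  then show ?thesis by eventually_elim (use D(4) in blast)
qed

section \<open>Linear algebra of positive definite bilinear forms\<close>

lemma bilinear_Cauchy_Schwarz:
  fixes B :: "'v::euclidean_space \<Rightarrow> 'v \<Rightarrow> real"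
  assumes B: "bilinear B" and sym: "\<And>v w. B v w = B w v" and pos: "\<And>v. v \<noteq> 0 \<Longrightarrow> B v v > 0"
  shows "\<bar>B v w\<bar> \<le> sqrt (B v v) * sqrt (B w w)"
proof -
  note b = bilinear_ladd[OF B] bilinear_radd[OF B] bilinear_lmul[OF B] bilinear_rmul[OF B] bilinear_lsub[OF B] bilinear_rsub[OF B]
  have nn: "B v v \<ge> 0" for v using pos[of v] bilinear_lzero[OF B] by (cases "v = 0") (auto simp: less_imp_le)
  have "(B v w)\<^sup>2 \<le> B v v * B w w"
  proof (cases "w = 0")
    case True then show ?thesis using bilinear_rzero[OF B] by simp
  next
    case False
    then have ww: "B w w > 0" by (rule pos)
    define t where "t = B v w / B w w"
    have "0 \<le> B (v - t *\<^sub>R w) (v - t *\<^sub>R w)" by (rule nn)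
    also have "\<dots> = B v v - 2 * t * B v w + t\<^sup>2 * B w w"
      by (simp add: b sym[of w v] algebra_simps power2_eq_square)
    also have "\<dots> = B v v - (B v w)\<^sup>2 / B w w" using ww by (simp add: t_def power2_eq_square field_simps)
    finally show ?thesis using ww by (simp add: field_simps)
  qed
  then have "sqrt ((B v w)\<^sup>2) \<le> sqrt (B v v * B w w)" by (rule real_sqrt_le_mono)
  then show ?thesis by (simp add: real_sqrt_mult)
qed

lemma bilinear_triangle:
  fixes B :: "'v::euclidean_space \<Rightarrow> 'v \<Rightarrow> real"
  assumes B: "bilinear B" and sym: "\<And>v w. B v w = B w v" and pos: "\<And>v. v \<noteq> 0 \<Longrightarrow> B v v > 0"
  shows "sqrt (B (v + w) (v + w)) \<le> sqrt (B v v) + sqrt (B w w)"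
proof -
  note b = bilinear_ladd[OF B] bilinear_radd[OF B]
  have nn: "B v v \<ge> 0" for v using pos[of v] bilinear_lzero[OF B] by (cases "v = 0") (auto simp: less_imp_le)
  have "B (v + w) (v + w) = B v v + 2 * B v w + B w w" by (simp add: b sym[of w v])
  also have "\<dots> \<le> B v v + 2 * (sqrt (B v v) * sqrt (B w w)) + B w w"
    using bilinear_Cauchy_Schwarz[OF assms, of v w] by auto
  also have "\<dots> = (sqrt (B v v) + sqrt (B w w))\<^sup>2" using nn by (simp add: power2_sum)
  finally show ?thesis using real_sqrt_le_mono nn by (fastforce intro!: real_le_lsqrt add_nonneg_nonneg)
qed

lemma linear_axis_expansion:
  fixes T :: "real^'n::finite \<Rightarrow> 'b::real_vector"
  assumes T: "linear T"
  shows "T v = (\<Sum>i\<in>UNIV. v $ i *\<^sub>R T (axis i 1))"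
proof -
  have "v = (\<Sum>i\<in>UNIV. v $ i *\<^sub>R axis i 1)"
    using basis_expansion[of v] by (simp add: scalar_mult_eq_scaleR)
  then have "T v = T (\<Sum>i\<in>UNIV. v $ i *\<^sub>R axis i 1)" by (rule arg_cong)
  then show ?thesis by (simp only: linear_sum[OF T] linear_cmul[OF T])
qed

lemma bilinear_expand:
  fixes B :: "real^'n::finite \<Rightarrow> real^'n \<Rightarrow> real"
  assumes B: "bilinear B"
  shows "B v w = (\<Sum>i\<in>UNIV. \<Sum>j\<in>UNIV. v $ i * w $ j * B (axis i 1) (axis j 1))"
proof -
  have l: "linear (\<lambda>v. B v w)" "linear (B v)" for v w using B by (auto simp: bilinear_def)
  have "B v w = (\<Sum>i\<in>UNIV. v $ i *\<^sub>R B (axis i 1) w)" by (rule linear_axis_expansion[OF l(1)])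
  also have "\<dots> = (\<Sum>i\<in>UNIV. v $ i *\<^sub>R (\<Sum>j\<in>UNIV. w $ j *\<^sub>R B (axis i 1) (axis j 1)))"
    by (intro sum.cong refl arg_cong[where f="scaleR _"] linear_axis_expansion[OF l(2)])
  finally show ?thesis by (simp add: sum_distrib_left mult.assoc)
qed

lemma continuous_on_det:
  fixes M :: "'b::topological_space \<Rightarrow> real^'n::finite^'n"
  assumes "\<And>i j. continuous_on S (\<lambda>y. M y $ i $ j)"
  shows "continuous_on S (\<lambda>y. det (M y))"
  unfolding det_def
  by (intro continuous_on_sum continuous_on_mult continuous_on_const continuous_on_prod assms)

text \<open>Along the segment from the identity to M all matrices are positive definite, hence
  injective, so the determinant has no zero there; it starts at 1 and the intermediate value theorem
  keeps it positive.\<close>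

lemma det_pos_of_positive_definite:
  fixes M :: "real^'n::finite^'n"
  assumes "\<And>v. v \<noteq> 0 \<Longrightarrow> v \<bullet> (M *v v) > 0"
  shows "det M > 0"
proof -
  define N where "N t = (\<chi> i j. t * M $ i $ j + (1 - t) * (mat 1 :: real^'n^'n) $ i $ j)" for t :: real
  have N: "N t *v v = t *\<^sub>R (M *v v) + (1 - t) *\<^sub>R v" for t v
  proof -
    have "N t = t *\<^sub>R M + (1 - t) *\<^sub>R mat 1" by (simp add: N_def vec_eq_iff)
    then show ?thesis by (simp add: matrix_vector_mult_add_rdistrib scaleR_matrix_vector_assoc[symmetric])
  qed
  have nz: "det (N t) \<noteq> 0" if "0 \<le> t" "t \<le> 1" for t
  proof
    assume "det (N t) = 0"
    then have "\<not> invertible (N t)" by (simp add: invertible_det_nz)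
    then obtain v where v: "v \<noteq> 0" "N t *v v = 0"
      using invertible_left_inverse matrix_left_invertible_ker by blast
    have "0 = v \<bullet> (N t *v v)" using v by simp
    also have "\<dots> = t * (v \<bullet> (M *v v)) + (1 - t) * (v \<bullet> v)" by (simp add: N inner_add_right)
    also have "\<dots> > 0"
      using assms[OF v(1)] v(1) that
      by (cases "t = 0") (auto intro!: add_pos_nonneg mult_nonneg_nonneg)
    finally show False by simp
  qed
  have c: "continuous_on {0..1} (\<lambda>t. det (N t))"
    by (rule continuous_on_det) (auto simp: N_def intro!: continuous_intros)
  have e: "det (N 1) = det M" "det (N 0) = 1"
    by (simp_all add: N_def)
  show ?thesis
  proof (rule ccontr)
    assume "\<not> det M > 0"
    then have "\<exists>t\<ge>0. t \<le> 1 \<and> det (N t) = 0"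
      by (intro IVT2'[of "\<lambda>t. det (N t)"] c) (use e in auto)
    then show False using nz by blast
  qed
qed

section \<open>Charts and tangent vectors\<close>

locale riem_manifold =
  fixes \<A> :: "('a::{t2_space, second_countable_topology}, 'n::finite) chart set"
    and g :: "('a, 'n) metric"
  assumes riemannian: "riemannian_manifold \<A> g"
begin

lemma atlas: "maximal_atlas \<A>" and metric: "riemannian_metric \<A> g"
  using riemannian by (auto simp: riemannian_manifold_def)

lemma metric_sym: "X \<in> tangent_space \<A> x \<Longrightarrow> Y \<in> tangent_space \<A> x \<Longrightarrow> g x X Y = g x Y X"
  and metric_pos: "X \<in> tangent_space \<A> x \<Longrightarrow> X \<noteq> zero_tvec \<Longrightarrow> g x X X > 0"
  and metric_bilinear: "c \<in> \<A> \<Longrightarrow> x \<in> dom_of c \<Longrightarrow>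
     bilinear (\<lambda>v w. g x (tvec_of \<A> c x v) (tvec_of \<A> c x w))"
  and metric_smooth: "c \<in> \<A> \<Longrightarrow> smooth_on (chart_map c ` dom_of c)
     (\<lambda>y. g (chart_inv c y) (coord_field \<A> c i (chart_inv c y)) (coord_field \<A> c j (chart_inv c y)))"
proof -
  note m = metric[unfolded riemannian_metric_def]
  show "X \<in> tangent_space \<A> x \<Longrightarrow> Y \<in> tangent_space \<A> x \<Longrightarrow> g x X Y = g x Y X"
    using m[THEN conjunct1, THEN spec, of x] by (meson bspec)
  show "X \<in> tangent_space \<A> x \<Longrightarrow> X \<noteq> zero_tvec \<Longrightarrow> g x X X > 0"
    using m[THEN conjunct2, THEN conjunct1] by blast
  show "c \<in> \<A> \<Longrightarrow> x \<in> dom_of c \<Longrightarrow> bilinear (\<lambda>v w. g x (tvec_of \<A> c x v) (tvec_of \<A> c x w))"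
    using m[THEN conjunct2, THEN conjunct2, THEN conjunct1] by blast
  show "c \<in> \<A> \<Longrightarrow> smooth_on (chart_map c ` dom_of c)
     (\<lambda>y. g (chart_inv c y) (coord_field \<A> c i (chart_inv c y)) (coord_field \<A> c j (chart_inv c y)))"
    using m[THEN conjunct2, THEN conjunct2, THEN conjunct2] by blast
qed

lemma chart_cover: obtains c where "c \<in> \<A>" "x \<in> dom_of c"
  using atlas unfolding maximal_atlas_def by blast

context
  fixes c assumes c: "c \<in> \<A>"
begin

lemma is_chart: "is_chart c" using atlas c by (auto simp: maximal_atlas_def)

lemma open_dom: "open (dom_of c)" and open_range: "open (chart_map c ` dom_of c)"
  using is_chart by (auto simp: is_chart_def)

text \<open>\<open>is_chart\<close> provides some inverse homeomorphism; on the image it agrees with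
  \<open>inv_into\<close>, the inverse that enters all definitions.\<close>

lemma chart_homeo: "homeomorphism (dom_of c) (chart_map c ` dom_of c) (chart_map c) (chart_inv c)"
proof -
  obtain h where h: "homeomorphism (dom_of c) (chart_map c ` dom_of c) (chart_map c) h"
    using is_chart by (auto simp: is_chart_def)
  have inj: "inj_on (chart_map c) (dom_of c)" using homeomorphism_apply1[OF h] by (rule inj_on_inverseI)
  have "chart_inv c y = h y" if y: "y \<in> chart_map c ` dom_of c" for y
    using y homeomorphism_apply1[OF h] inv_into_f_f[OF inj] by fastforce
  then show ?thesis by (intro homeomorphism_cong[OF h refl refl]) simp_all
qed

lemma chart_inv_map [simp]: "x \<in> dom_of c \<Longrightarrow> chart_inv c (chart_map c x) = x"
  using chart_homeo by (simp add: homeomorphism_def)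

lemma chart_map_inv [simp]: "y \<in> chart_map c ` dom_of c \<Longrightarrow> chart_map c (chart_inv c y) = y"
  by (rule f_inv_into_f)

lemma chart_inv_dom: "y \<in> chart_map c ` dom_of c \<Longrightarrow> chart_inv c y \<in> dom_of c"
  by auto

lemma continuous_chart: "continuous_on (dom_of c) (chart_map c)"
  "continuous_on (chart_map c ` dom_of c) (chart_inv c)"
  using chart_homeo by (auto simp: homeomorphism_def)

lemma chart_image_eq: "chart_map c ` (U \<inter> dom_of c) = {y \<in> chart_map c ` dom_of c. chart_inv c y \<in> U}"
  by force

lemma open_chart_image: "open U \<Longrightarrow> open (chart_map c ` (U \<inter> dom_of c))"
proof -
  assume "open U"
  have "chart_map c ` (U \<inter> dom_of c) = chart_map c ` dom_of c \<inter> chart_inv c -` U"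
    unfolding chart_image_eq by auto
  then show ?thesis
    using continuous_open_preimage[OF continuous_chart(2) open_range \<open>open U\<close>] by simp
qed

lemma open_chart_preimage: "open V \<Longrightarrow> open {x \<in> dom_of c. chart_map c x \<in> V}"
  using continuous_open_preimage[OF continuous_chart(1) open_dom, of V]
  unfolding vimage_def Int_def by simp

end

definition transition_deriv :: "('a, 'n) chart \<Rightarrow> ('a, 'n) chart \<Rightarrow> 'a \<Rightarrow> real^'n \<Rightarrow> real^'n" where
  "transition_deriv c d x = frechet_derivative (chart_map d \<circ> chart_inv c) (at (chart_map c x))"

lemma transition:
  assumes "c \<in> \<A>" "d \<in> \<A>"
  shows "x \<in> dom_of c \<Longrightarrow> x \<in> dom_of d \<Longrightarrow>
      (chart_map d \<circ> chart_inv c has_derivative transition_deriv c d x) (at (chart_map c x))"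
    and "continuous_on (chart_map c ` (dom_of d \<inter> dom_of c)) (\<lambda>y. transition_deriv c d (chart_inv c y) v)"
proof -
  have "smooth_on (chart_map c ` (dom_of c \<inter> dom_of d)) (chart_map d \<circ> chart_inv c)"
    using atlas assms unfolding maximal_atlas_def compatible_def by blast
  then have "Ck_on (Suc 0) (chart_map c ` (dom_of c \<inter> dom_of d)) (chart_map d \<circ> chart_inv c)"
    unfolding smooth_on_def by blast
  then have D: "\<And>y. y \<in> chart_map c ` (dom_of c \<inter> dom_of d) \<Longrightarrow> (chart_map d \<circ> chart_inv c) differentiable (at y)"
    and C: "continuous_on (chart_map c ` (dom_of c \<inter> dom_of d)) (\<lambda>y. frechet_derivative (chart_map d \<circ> chart_inv c) (at y) v)"
    by auto
  show "(chart_map d \<circ> chart_inv c has_derivative transition_deriv c d x) (at (chart_map c x))"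
    if "x \<in> dom_of c" "x \<in> dom_of d"
    using D[of "chart_map c x"] that unfolding transition_deriv_def by (simp add: frechet_derivative_works)
  show "continuous_on (chart_map c ` (dom_of d \<inter> dom_of c)) (\<lambda>y. transition_deriv c d (chart_inv c y) v)"
  proof -
    have "continuous_on (chart_map c ` (dom_of c \<inter> dom_of d)) (\<lambda>y. transition_deriv c d (chart_inv c y) v)"
      using C by (rule continuous_on_eq) (auto simp: transition_deriv_def assms)
    then show ?thesis by (simp add: Int_commute)
  qed
qed

lemma transition_linear: "c \<in> \<A> \<Longrightarrow> d \<in> \<A> \<Longrightarrow> x \<in> dom_of c \<Longrightarrow> x \<in> dom_of d \<Longrightarrow> linear (transition_deriv c d x)"
  using transition(1) has_derivative_linear by blast

lemma transition_cocycle: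
  assumes A: "c \<in> \<A>" "d \<in> \<A>" "e \<in> \<A>" and x: "x \<in> dom_of c" "x \<in> dom_of d" "x \<in> dom_of e"
  shows "transition_deriv c e x v = transition_deriv d e x (transition_deriv c d x v)"
proof -
  have "(chart_map d \<circ> chart_inv c) (chart_map c x) = chart_map d x" using A x by simp
  then have "((chart_map e \<circ> chart_inv d) \<circ> (chart_map d \<circ> chart_inv c) has_derivative
      transition_deriv d e x \<circ> transition_deriv c d x) (at (chart_map c x))"
    using transition(1)[OF A(1,2) x(1,2)] transition(1)[OF A(2,3) x(2,3)] by (intro diff_chain_at) auto
  then have "(chart_map e \<circ> chart_inv c has_derivative
      transition_deriv d e x \<circ> transition_deriv c d x) (at (chart_map c x))"
    by (rule has_derivative_transform_within_open[OF _ open_chart_image[OF A(1) open_dom[OF A(2)]]])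
      (use A x in auto)
  then show ?thesis
    using transition(1)[OF A(1,3) x(1,3)] has_derivative_unique by (metis comp_apply)
qed

lemma transition_refl:
  assumes "c \<in> \<A>" "x \<in> dom_of c" shows "transition_deriv c c x v = v"
proof -
  have "(chart_map c \<circ> chart_inv c has_derivative (\<lambda>v. v)) (at (chart_map c x))"
    by (rule has_derivative_transform_within_open[OF has_derivative_ident open_range[OF assms(1)]]) (use assms in auto)
  then show ?thesis using transition(1)[OF assms(1,1,2,2)] has_derivative_unique by metis
qed

lemma tvec_of_apply: "d \<in> \<A> \<Longrightarrow> x \<in> dom_of d \<Longrightarrow> tvec_of \<A> c x v d = transition_deriv c d x v"
  by (simp add: tvec_of_def transition_deriv_def)

lemma tvec_of_self [simp]: "c \<in> \<A> \<Longrightarrow> x \<in> dom_of c \<Longrightarrow> tvec_of \<A> c x v c = v"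
  by (simp add: tvec_of_apply transition_refl)

lemma tangent_space_iff:
  "X \<in> tangent_space \<A> x \<longleftrightarrow> (\<forall>c. \<not> (c \<in> \<A> \<and> x \<in> dom_of c) \<longrightarrow> X c = 0) \<and>
    (\<forall>c\<in>\<A>. \<forall>d\<in>\<A>. x \<in> dom_of c \<and> x \<in> dom_of d \<longrightarrow> X d = transition_deriv c d x (X c))"
  unfolding tangent_space_def transition_deriv_def by (rule mem_Collect_eq)

lemma tangent_spaceI:
  assumes 1: "\<And>c. \<not> (c \<in> \<A> \<and> x \<in> dom_of c) \<Longrightarrow> X c = 0"
    and 2: "\<And>c d. c \<in> \<A> \<Longrightarrow> d \<in> \<A> \<Longrightarrow> x \<in> dom_of c \<Longrightarrow> x \<in> dom_of d \<Longrightarrow> X d = transition_deriv c d x (X c)"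
  shows "X \<in> tangent_space \<A> x"
proof (rule tangent_space_iff[THEN iffD2], rule conjI)
  show "\<forall>c. \<not> (c \<in> \<A> \<and> x \<in> dom_of c) \<longrightarrow> X c = 0"
    by (intro allI impI) (rule 1)
  show "\<forall>c\<in>\<A>. \<forall>d\<in>\<A>. x \<in> dom_of c \<and> x \<in> dom_of d \<longrightarrow> X d = transition_deriv c d x (X c)"
    by (intro ballI impI, erule conjE) (rule 2)
qed

lemma tangent_coord_eq_0: "X \<in> tangent_space \<A> x \<Longrightarrow> \<not> (c \<in> \<A> \<and> x \<in> dom_of c) \<Longrightarrow> X c = 0"
  by (drule tangent_space_iff[THEN iffD1, THEN conjunct1, THEN spec]) (erule mp)

lemma tangent_coord_transition:
  assumes "X \<in> tangent_space \<A> x" "c \<in> \<A>" "d \<in> \<A>" "x \<in> dom_of c" "x \<in> dom_of d"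
  shows "X d = transition_deriv c d x (X c)"
  by (rule tangent_space_iff[THEN iffD1, THEN conjunct2, OF assms(1), THEN bspec, OF assms(2),
        THEN bspec, OF assms(3), THEN mp, OF conjI[OF assms(4,5)]])

text \<open>The compatibility required of tangent vectors is exactly the cocycle identity for
  transition derivatives.\<close>

lemma tvec_of_tangent:
  assumes "c \<in> \<A>" "x \<in> dom_of c" shows "tvec_of \<A> c x v \<in> tangent_space \<A> x"
  unfolding tangent_space_iff
proof (intro conjI allI impI ballI)
  show "tvec_of \<A> c x v d = 0" if "\<not> (d \<in> \<A> \<and> x \<in> dom_of d)" for d
    using that by (auto simp: tvec_of_def)
  fix d e assume "d \<in> \<A>" "e \<in> \<A>" "x \<in> dom_of d \<and> x \<in> dom_of e"
  then show "tvec_of \<A> c x v e = transition_deriv d e x (tvec_of \<A> c x v d)"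
    using transition_cocycle[OF assms(1), of d e x v] assms(2) by (simp add: tvec_of_apply)
qed

lemma tangent_eq_tvec_of:
  assumes "c \<in> \<A>" "x \<in> dom_of c" "X \<in> tangent_space \<A> x"
  shows "tvec_of \<A> c x (X c) = X"
proof
  fix d show "tvec_of \<A> c x (X c) d = X d"
  proof (cases "d \<in> \<A> \<and> x \<in> dom_of d")
    case True
    then have "X d = transition_deriv c d x (X c)" using assms by (intro tangent_coord_transition) auto
    then show ?thesis using True by (simp add: tvec_of_apply)
  next
    case False
    then have "X d = 0" by (rule tangent_coord_eq_0[OF assms(3)])
    then show ?thesis using False by (auto simp: tvec_of_def)
  qed
qed

lemma tangent_eqI:
  assumes "c \<in> \<A>" "x \<in> dom_of c" "X \<in> tangent_space \<A> x" "Y \<in> tangent_space \<A> x" "X c = Y c"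
  shows "X = Y"
proof -
  have "tvec_of \<A> c x (X c) = tvec_of \<A> c x (Y c)" by (simp only: assms(5))
  then show ?thesis by (rule box_equals[OF _ tangent_eq_tvec_of[OF assms(1-3)] tangent_eq_tvec_of[OF assms(1,2,4)]])
qed

lemma tangent_lincomb:
  assumes "X \<in> tangent_space \<A> x" "Y \<in> tangent_space \<A> x"
  shows "(\<lambda>c. a *\<^sub>R X c + b *\<^sub>R Y c) \<in> tangent_space \<A> x"
proof (rule tangent_spaceI)
  fix d assume d: "\<not> (d \<in> \<A> \<and> x \<in> dom_of d)"
  show "a *\<^sub>R X d + b *\<^sub>R Y d = 0"
    by (simp only: assms[THEN tangent_coord_eq_0, OF d] scaleR_zero_right add_0)
next
  fix d e assume d: "d \<in> \<A>" "e \<in> \<A>" "x \<in> dom_of d" "x \<in> dom_of e"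
  note l = transition_linear[OF d]
  have X: "X e = transition_deriv d e x (X d)" by (rule tangent_coord_transition[OF assms(1) d])
  have Y: "Y e = transition_deriv d e x (Y d)" by (rule tangent_coord_transition[OF assms(2) d])
  show "a *\<^sub>R X e + b *\<^sub>R Y e = transition_deriv d e x (a *\<^sub>R X d + b *\<^sub>R Y d)"
    unfolding X Y by (simp only: linear_add[OF l] linear_cmul[OF l])
qed

section \<open>The metric and its norm in chart coordinates\<close>

definition cmetric :: "('a, 'n) chart \<Rightarrow> 'a \<Rightarrow> real^'n \<Rightarrow> real^'n \<Rightarrow> real" where
  "cmetric c x v w = g x (tvec_of \<A> c x v) (tvec_of \<A> c x w)"

definition cnorm :: "('a, 'n) chart \<Rightarrow> 'a \<Rightarrow> real^'n \<Rightarrow> real" where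
  "cnorm c x v = sqrt (cmetric c x v v)"

context
  fixes c x assumes c: "c \<in> \<A>" and x: "x \<in> dom_of c"
begin

lemma cmetric_bilinear: "bilinear (cmetric c x)"
  unfolding cmetric_def[abs_def] by (rule metric_bilinear[OF c x])

lemma cmetric_sym: "cmetric c x v w = cmetric c x w v"
  unfolding cmetric_def by (rule metric_sym; rule tvec_of_tangent[OF c x])

lemma cmetric_pos:
  assumes "v \<noteq> 0" shows "cmetric c x v v > 0"
proof -
  have "tvec_of \<A> c x v \<noteq> zero_tvec"
  proof
    assume "tvec_of \<A> c x v = zero_tvec"
    then have "tvec_of \<A> c x v c = 0" by (simp add: zero_tvec_def)
    with assms show False unfolding tvec_of_self[OF c x] by simp
  qed
  then show ?thesis unfolding cmetric_def by (rule metric_pos[OF tvec_of_tangent[OF c x]])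
qed

lemmas cmetric_Cauchy_Schwarz = bilinear_Cauchy_Schwarz[OF cmetric_bilinear cmetric_sym cmetric_pos, folded cnorm_def]
lemmas cnorm_triangle = bilinear_triangle[OF cmetric_bilinear cmetric_sym cmetric_pos, folded cnorm_def]
lemmas cmetric_expand = bilinear_expand[OF cmetric_bilinear]

lemma cmetric_nonneg: "cmetric c x v v \<ge> 0"
  using cmetric_pos[of v] bilinear_lzero[OF cmetric_bilinear] by (cases "v = 0") (auto simp: less_imp_le)

lemma cnorm_nonneg [simp]: "cnorm c x v \<ge> 0" by (simp add: cnorm_def cmetric_nonneg)

lemma cnorm_sq: "(cnorm c x v)\<^sup>2 = cmetric c x v v" by (simp add: cnorm_def cmetric_nonneg)

lemma cnorm_scaleR: "cnorm c x (r *\<^sub>R v) = \<bar>r\<bar> * cnorm c x v"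
  by (simp add: cnorm_def bilinear_lmul[OF cmetric_bilinear] bilinear_rmul[OF cmetric_bilinear]
      real_sqrt_mult mult.assoc[symmetric])

lemma cnorm_zero [simp]: "cnorm c x 0 = 0"
  by (simp add: cnorm_def bilinear_lzero[OF cmetric_bilinear])

lemma cnorm_pos: "v \<noteq> 0 \<Longrightarrow> cnorm c x v > 0"
  by (simp add: cnorm_def cmetric_pos)

lemma g_eq_cmetric:
  assumes "X \<in> tangent_space \<A> x" "Y \<in> tangent_space \<A> x"
  shows "g x X Y = cmetric c x (X c) (Y c)"
  using assms by (simp add: cmetric_def tangent_eq_tvec_of[OF c x])

lemma tnorm_eq_cnorm: "X \<in> tangent_space \<A> x \<Longrightarrow> tnorm g x X = cnorm c x (X c)"
  by (simp add: tnorm_def cnorm_def g_eq_cmetric)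

lemma gram_det_pos: "gram_det \<A> g c x > 0"
  unfolding gram_det_def
proof (rule det_pos_of_positive_definite)
  fix v :: "real^'n" assume "v \<noteq> 0"
  then have "0 < cmetric c x v v" by (rule cmetric_pos)
  also have "\<dots> = v \<bullet> ((\<chi> i j. g x (coord_field \<A> c i x) (coord_field \<A> c j x)) *v v)"
    by (subst cmetric_expand)
      (simp add: inner_vec_def matrix_vector_mult_def cmetric_def sum_distrib_left algebra_simps)
  finally show "0 < v \<bullet> ((\<chi> i j. g x (coord_field \<A> c i x) (coord_field \<A> c j x)) *v v)" .
qed

end

text \<open>Both sides are the norm of the same tangent vector
  \<open>tvec_of \<A> c x v\<close>.\<close>

lemma cnorm_change_chart:
  assumes "c \<in> \<A>" "d \<in> \<A>" "x \<in> dom_of c" "x \<in> dom_of d"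
  shows "cnorm d x (transition_deriv c d x v) = cnorm c x v"
  using tnorm_eq_cnorm[OF assms(1,3) tvec_of_tangent[OF assms(1,3)], of v]
    tnorm_eq_cnorm[OF assms(2,4) tvec_of_tangent[OF assms(1,3)], of v] assms
  by (simp add: tvec_of_apply transition_refl)

lemma tangent_triangle:
  assumes "X \<in> tangent_space \<A> x" "Y \<in> tangent_space \<A> x"
  shows "tnorm g x (\<lambda>c. a *\<^sub>R X c + b *\<^sub>R Y c) \<le> \<bar>a\<bar> * tnorm g x X + \<bar>b\<bar> * tnorm g x Y"
proof -
  obtain c where c: "c \<in> \<A>" "x \<in> dom_of c" using chart_cover[of x] by blast
  show ?thesis
    using cnorm_triangle[OF c, of "a *\<^sub>R X c" "b *\<^sub>R Y c"]
    by (simp add: tnorm_eq_cnorm[OF c] assms tangent_lincomb cnorm_scaleR[OF c])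
qed

lemma tangent_Cauchy_Schwarz:
  assumes "X \<in> tangent_space \<A> x" "Y \<in> tangent_space \<A> x"
  shows "\<bar>g x X Y\<bar> \<le> tnorm g x X * tnorm g x Y"
proof -
  obtain c where c: "c \<in> \<A>" "x \<in> dom_of c" using chart_cover[of x] by blast
  show ?thesis
    using cmetric_Cauchy_Schwarz[OF c, of "X c" "Y c"]
    by (simp add: tnorm_eq_cnorm[OF c] g_eq_cmetric[OF c] assms)
qed

lemma g_lincomb_right:
  assumes "X \<in> tangent_space \<A> x" "Y \<in> tangent_space \<A> x" "Z \<in> tangent_space \<A> x"
  shows "g x Z (\<lambda>c. a *\<^sub>R X c + b *\<^sub>R Y c) = a * g x Z X + b * g x Z Y"
proof -
  obtain c where c: "c \<in> \<A>" "x \<in> dom_of c" using chart_cover[of x] by blast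
  note B = cmetric_bilinear[OF c]
  show ?thesis
    by (simp add: g_eq_cmetric[OF c] assms tangent_lincomb bilinear_radd[OF B] bilinear_rmul[OF B])
qed

lemma tnorm_nonneg: "X \<in> tangent_space \<A> x \<Longrightarrow> tnorm g x X \<ge> 0"
  by (metis chart_cover tnorm_eq_cnorm cnorm_nonneg)

lemma tnorm_sq: "X \<in> tangent_space \<A> x \<Longrightarrow> (tnorm g x X)\<^sup>2 = g x X X"
  by (metis chart_cover tnorm_eq_cnorm cnorm_sq g_eq_cmetric)

lemma tnorm_eq_0: "X \<in> tangent_space \<A> x \<Longrightarrow> tnorm g x X = 0 \<Longrightarrow> X = zero_tvec"
  using metric_pos[of X x] by (auto simp: tnorm_def)

lemma continuous_cmetric_coeff:
  assumes c: "c \<in> \<A>"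
  shows "continuous_on (chart_map c ` dom_of c) (\<lambda>y. cmetric c (chart_inv c y) (axis i 1) (axis j 1))"
  using metric_smooth[OF c, of i j, unfolded smooth_on_def, THEN spec, of 0] by (simp add: cmetric_def)

lemma continuous_cmetric:
  assumes c: "c \<in> \<A>" and "continuous_on S a" "continuous_on S v" "continuous_on S w"
    and a: "\<And>z. z \<in> S \<Longrightarrow> a z \<in> chart_map c ` dom_of c"
  shows "continuous_on S (\<lambda>z. cmetric c (chart_inv c (a z)) (v z) (w z))"
proof -
  have "continuous_on S (\<lambda>z. \<Sum>i\<in>UNIV. \<Sum>j\<in>UNIV. v z $ i * w z $ j * cmetric c (chart_inv c (a z)) (axis i 1) (axis j 1))"
    using a by (intro continuous_intros assms continuous_on_compose2[OF continuous_cmetric_coeff[OF c] assms(2)]) auto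
  then show ?thesis
    by (rule continuous_on_eq) (rule cmetric_expand[OF c chart_inv_dom[OF c a], symmetric])
qed

lemma continuous_cnorm:
  assumes c: "c \<in> \<A>" and "continuous_on S a" "continuous_on S v"
    and a: "\<And>z. z \<in> S \<Longrightarrow> a z \<in> chart_map c ` dom_of c"
  shows "continuous_on S (\<lambda>z. cnorm c (chart_inv c (a z)) (v z))"
  unfolding cnorm_def using assms by (intro continuous_intros continuous_cmetric) auto

lemma continuous_gram_det:
  assumes c: "c \<in> \<A>"
  shows "continuous_on (chart_map c ` dom_of c) (\<lambda>y. gram_det \<A> g c (chart_inv c y))"
  unfolding gram_det_def
  by (intro continuous_on_det) (use continuous_cmetric_coeff[OF c] in \<open>simp add: cmetric_def\<close>)

text \<open>The norm is positive and uniformly continuous on a closed ball times the unit sphere. If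
  m is its minimum there, a change below m (e - 1) is a change by a factor of at most e, and
  homogeneity extends this to all vectors.\<close>

lemma cnorm_local_comparison:
  assumes c: "c \<in> \<A>" and x: "x \<in> dom_of c" and e: "(e::real) > 1"
  obtains r where "r > 0" "cball (chart_map c x) r \<subseteq> chart_map c ` dom_of c"
    "\<And>y z v. y \<in> cball (chart_map c x) r \<Longrightarrow> z \<in> cball (chart_map c x) r \<Longrightarrow>
       cnorm c (chart_inv c y) v \<le> e * cnorm c (chart_inv c z) v"
proof -
  let ?W = "chart_map c ` dom_of c" and ?S = "sphere 0 1 :: (real^'n) set"
  let ?y0 = "chart_map c x"
  obtain r0 where r0: "r0 > 0" "cball ?y0 r0 \<subseteq> ?W" using open_range[OF c] x open_contains_cball by blast
  let ?N = "\<lambda>p. cnorm c (chart_inv c (fst p)) (snd p)"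
  have cN: "continuous_on (cball ?y0 r0 \<times> ?S) ?N"
    using r0 by (intro continuous_cnorm[OF c] continuous_intros) auto
  have K: "compact (cball ?y0 r0 \<times> ?S)" by (intro compact_Times) auto
  have pos: "?N p > 0" if "p \<in> cball ?y0 r0 \<times> ?S" for p
    using that r0 chart_inv_dom[OF c] by (intro cnorm_pos[OF c]) (auto simp: subset_iff)
  have "?S \<noteq> {}" by (simp add: sphere_eq_empty)
  then have ne: "cball ?y0 r0 \<times> ?S \<noteq> {}" using r0(1) by (simp add: Times_empty)
    obtain p0 where p0: "p0 \<in> cball ?y0 r0 \<times> ?S" "\<And>p. p \<in> cball ?y0 r0 \<times> ?S \<Longrightarrow> ?N p0 \<le> ?N p"
      using continuous_attains_inf[OF K ne cN] by blast
    define m where "m = ?N p0"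
    have m: "m > 0" using pos[OF p0(1)] by (simp add: m_def)
    have "uniformly_continuous_on (cball ?y0 r0 \<times> ?S) ?N" by (rule compact_uniformly_continuous[OF cN K])
    moreover have "m * (e - 1) > 0" using m e by simp
    ultimately obtain d where d: "d > 0" "\<And>p q. p \<in> cball ?y0 r0 \<times> ?S \<Longrightarrow> q \<in> cball ?y0 r0 \<times> ?S \<Longrightarrow>
      dist p q < d \<Longrightarrow> dist (?N p) (?N q) < m * (e - 1)"
      unfolding uniformly_continuous_on_def by metis
    \<comment> \<open>Two points of the ball of radius r are at most 2 r < d apart.\<close>
    define r where "r = min r0 (d / 3)"
    have r: "r > 0" "r \<le> r0" "2 * r < d" using r0 d by (auto simp: r_def)
    show ?thesis
    proof (rule that[of r])
      show "r > 0" by (rule r(1))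
      show "cball ?y0 r \<subseteq> ?W" using r r0(2) by (meson order_trans subset_cball)
      fix y z and v :: "real^'n" assume y: "y \<in> cball ?y0 r" and z: "z \<in> cball ?y0 r"
      have yd: "chart_inv c y \<in> dom_of c" "chart_inv c z \<in> dom_of c"
        using y z r r0 chart_inv_dom[OF c] by (auto simp: subset_iff)
      show "cnorm c (chart_inv c y) v \<le> e * cnorm c (chart_inv c z) v"
      proof (cases "v = 0")
        case True then show ?thesis by (simp add: cnorm_zero[OF c] yd)
      next
        case False
        define w where "w = v /\<^sub>R norm v"
        have w: "w \<in> ?S" "v = norm v *\<^sub>R w" using False by (auto simp: w_def)
        have mem: "(y, w) \<in> cball ?y0 r0 \<times> ?S" "(z, w) \<in> cball ?y0 r0 \<times> ?S" using y z r w by auto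
        have "dist y z \<le> 2 * r" using y z dist_triangle[of y z ?y0] by (auto simp: dist_commute)
        then have "dist (y, w) (z, w) < d" using r by (simp add: dist_Pair_Pair)
        from d(2)[OF mem this] have "cnorm c (chart_inv c y) w \<le> cnorm c (chart_inv c z) w + m * (e - 1)"
          by (simp add: dist_real_def)
        also have "m * (e - 1) \<le> cnorm c (chart_inv c z) w * (e - 1)"
          using p0(2)[OF mem(2)] e by (intro mult_right_mono) (auto simp: m_def)
        finally have "cnorm c (chart_inv c y) w \<le> e * cnorm c (chart_inv c z) w" by (simp add: algebra_simps)
        then have "norm v * cnorm c (chart_inv c y) w \<le> norm v * (e * cnorm c (chart_inv c z) w)"
          by (intro mult_left_mono) auto
        then show ?thesis
          using cnorm_scaleR[OF c yd(1), of "norm v" w] cnorm_scaleR[OF c yd(2), of "norm v" w] w(2)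
          by (simp add: algebra_simps)
      qed
    qed
qed

lemma cnorm_euclid_comparison:
  assumes c: "c \<in> \<A>" and x: "x \<in> dom_of c"
  obtains m M where "m > 0" "M > 0" "\<And>v. m * norm v \<le> cnorm c x v" "\<And>v. cnorm c x v \<le> M * norm v"
proof -
  let ?S = "sphere 0 1 :: (real^'n) set"
  have cN: "continuous_on ?S (\<lambda>v. cnorm c (chart_inv c (chart_map c x)) v)"
    using x by (intro continuous_cnorm[OF c] continuous_intros) auto
  then have cN: "continuous_on ?S (cnorm c x)" using c x by simp
  have ne: "?S \<noteq> {}" by (simp add: sphere_eq_empty)
  obtain v0 where v0: "v0 \<in> ?S" "\<And>v. v \<in> ?S \<Longrightarrow> cnorm c x v0 \<le> cnorm c x v"
    using continuous_attains_inf[OF compact_sphere ne cN] by blast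
  obtain v1 where v1: "v1 \<in> ?S" "\<And>v. v \<in> ?S \<Longrightarrow> cnorm c x v \<le> cnorm c x v1"
    using continuous_attains_sup[OF compact_sphere ne cN] by blast
  have sc: "cnorm c x v = norm v * cnorm c x (v /\<^sub>R norm v)" if "v \<noteq> 0" for v
    using that by (simp add: cnorm_scaleR[OF c x])
  have "v0 \<noteq> 0" "v1 \<noteq> 0" using v0 v1 by auto
  then show ?thesis
  proof (intro that[of "cnorm c x v0" "cnorm c x v1"] cnorm_pos[OF c x])
    fix v :: "real^'n"
    show "cnorm c x v0 * norm v \<le> cnorm c x v"
    proof (cases "v = 0")
      case False
      have "cnorm c x v0 \<le> cnorm c x (v /\<^sub>R norm v)" using False by (intro v0) simp
      then show ?thesis using sc[OF False] by (simp add: mult.commute mult_left_mono)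
    qed (simp add: cnorm_zero[OF c x])
    show "cnorm c x v \<le> cnorm c x v1 * norm v"
    proof (cases "v = 0")
      case False
      have "cnorm c x (v /\<^sub>R norm v) \<le> cnorm c x v1" using False by (intro v1) simp
      then show ?thesis using sc[OF False] by (simp add: mult.commute mult_left_mono)
    qed (simp add: cnorm_zero[OF c x])
  qed
qed

end

section \<open>The Riemannian distance\<close>

context riem_manifold
begin

definition speed :: "(real \<Rightarrow> 'a) \<Rightarrow> real \<Rightarrow> real" where
  "speed \<gamma> t = tnorm g (\<gamma> t) (velocity \<A> \<gamma> t)"

text \<open>The finite exceptional set of a piecewise C^1 curve is traded for the open set of
  remaining parameters, a notion stable under restriction, affine substitution and union.\<close>

definition regular_on :: "real set \<Rightarrow> (real \<Rightarrow> 'a) \<Rightarrow> bool" where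
  "regular_on T \<gamma> \<longleftrightarrow> open T \<and> continuous_on T \<gamma> \<and>
     (\<forall>c\<in>\<A>. (chart_map c \<circ> \<gamma>) C1_differentiable_on {t \<in> T. \<gamma> t \<in> dom_of c})"

definition length_on :: "real set \<Rightarrow> (real \<Rightarrow> 'a) \<Rightarrow> ennreal" where
  "length_on T \<gamma> = (\<integral>\<^sup>+t\<in>T. ennreal (speed \<gamma> t) \<partial>lborel)"

lemma regular_on_open: "regular_on T \<gamma> \<Longrightarrow> open T"
  and regular_on_continuous: "regular_on T \<gamma> \<Longrightarrow> continuous_on T \<gamma>"
  and regular_on_C1: "regular_on T \<gamma> \<Longrightarrow> c \<in> \<A> \<Longrightarrow>
     (chart_map c \<circ> \<gamma>) C1_differentiable_on {t \<in> T. \<gamma> t \<in> dom_of c}"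
  by (auto simp: regular_on_def)

lemma regular_on_chart_open:
  assumes "regular_on T \<gamma>" "c \<in> \<A>" shows "open {t \<in> T. \<gamma> t \<in> dom_of c}"
proof -
  have "{t \<in> T. \<gamma> t \<in> dom_of c} = T \<inter> \<gamma> -` dom_of c" by auto
  then show ?thesis
    using continuous_open_preimage[OF regular_on_continuous regular_on_open open_dom] assms by simp
qed

lemma regular_on_derivative:
  assumes "regular_on T \<gamma>" "c \<in> \<A>" "t \<in> T" "\<gamma> t \<in> dom_of c"
  shows "(chart_map c \<circ> \<gamma> has_vector_derivative vector_derivative (chart_map c \<circ> \<gamma>) (at t)) (at t)"
proof -
  obtain D where "\<forall>x\<in>{t \<in> T. \<gamma> t \<in> dom_of c}. (chart_map c \<circ> \<gamma> has_vector_derivative D x) (at x)"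
    using regular_on_C1[OF assms(1,2)] unfolding C1_differentiable_on_def by blast
  then have "(chart_map c \<circ> \<gamma> has_vector_derivative D t) (at t)" using assms(3,4) by blast
  then show ?thesis by (simp add: vector_derivative_at)
qed

text \<open>The chain rule for transition maps carries the derivative in one chart to every other
  chart around the point.\<close>

lemma velocity_eq:
  assumes "open T" "continuous_on T \<gamma>" "t \<in> T" and c: "c \<in> \<A>" "\<gamma> t \<in> dom_of c"
    and v: "(chart_map c \<circ> \<gamma> has_vector_derivative v) (at t)"
  shows "velocity \<A> \<gamma> t = tvec_of \<A> c (\<gamma> t) v"
proof
  fix d show "velocity \<A> \<gamma> t d = tvec_of \<A> c (\<gamma> t) v d"
  proof (cases "d \<in> \<A> \<and> \<gamma> t \<in> dom_of d")
    case True
    have D: "(chart_map d \<circ> chart_inv c has_derivative transition_deriv c d (\<gamma> t)) (at ((chart_map c \<circ> \<gamma>) t))"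
      using transition(1)[OF c(1) _ c(2)] True by simp
    have lin: "linear (transition_deriv c d (\<gamma> t))" using transition_linear c True by blast
    have "((chart_map d \<circ> chart_inv c) \<circ> (chart_map c \<circ> \<gamma>) has_derivative
        transition_deriv c d (\<gamma> t) \<circ> (\<lambda>h. h *\<^sub>R v)) (at t)"
      using v D unfolding has_vector_derivative_def by (rule diff_chain_at)
    then have "((chart_map d \<circ> chart_inv c) \<circ> (chart_map c \<circ> \<gamma>) has_vector_derivative transition_deriv c d (\<gamma> t) v) (at t)"
      unfolding has_vector_derivative_def o_def by (simp only: linear_cmul[OF lin])
    moreover have "open (T \<inter> \<gamma> -` dom_of c)"
      using continuous_open_preimage[OF assms(2,1) open_dom[OF c(1)]] .
    ultimately have "(chart_map d \<circ> \<gamma> has_vector_derivative transition_deriv c d (\<gamma> t) v) (at t)"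
      by (rule has_vector_derivative_transform_within_open) (use assms in auto)
    then show ?thesis using True by (simp add: velocity_def tvec_of_apply vector_derivative_at)
  next
    case False
    then show ?thesis by (auto simp: velocity_def tvec_of_def)
  qed
qed

lemma speed_eq:
  assumes "open T" "continuous_on T \<gamma>" "t \<in> T" and c: "c \<in> \<A>" "\<gamma> t \<in> dom_of c"
    and v: "(chart_map c \<circ> \<gamma> has_vector_derivative v) (at t)"
  shows "speed \<gamma> t = cnorm c (\<gamma> t) v"
  unfolding speed_def velocity_eq[OF assms] by (simp add: tnorm_eq_cnorm[OF c tvec_of_tangent[OF c]] c)

text \<open>Continuity is local, so one chart at a time suffices; it is what makes the integrand of
  the length measurable.\<close>

lemma continuous_speed:
  assumes r: "regular_on T \<gamma>" shows "continuous_on T (speed \<gamma>)"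
proof -
  have "\<exists>U. open U \<and> t \<in> U \<and> continuous_on U (speed \<gamma>)" if t: "t \<in> T" for t
  proof -
    obtain c where c: "c \<in> \<A>" "\<gamma> t \<in> dom_of c" using chart_cover[of "\<gamma> t"] by blast
    define U where "U = {t \<in> T. \<gamma> t \<in> dom_of c}"
    have U: "open U" "U \<subseteq> T" unfolding U_def using regular_on_chart_open[OF r c(1)] by auto
    obtain D where D: "\<And>s. s \<in> U \<Longrightarrow> (chart_map c \<circ> \<gamma> has_vector_derivative D s) (at s)" "continuous_on U D"
      using regular_on_C1[OF r c(1)] unfolding C1_differentiable_on_def U_def by blast
    have cg: "continuous_on U (chart_map c \<circ> \<gamma>)"
      using continuous_on_compose[OF continuous_on_subset[OF regular_on_continuous[OF r] U(2)], of "chart_map c"]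
        continuous_on_subset[OF continuous_chart(1)[OF c(1)], of "\<gamma> ` U"] by (auto simp: U_def)
    have "continuous_on U (\<lambda>s. cnorm c (chart_inv c ((chart_map c \<circ> \<gamma>) s)) (D s))"
      by (rule continuous_cnorm[OF c(1) cg D(2)]) (auto simp: U_def)
    then have "continuous_on U (speed \<gamma>)"
    proof (rule continuous_on_eq)
      fix s assume s: "s \<in> U"
      have "speed \<gamma> s = cnorm c (\<gamma> s) (D s)"
        using speed_eq[OF regular_on_open[OF r] regular_on_continuous[OF r] _ c(1) _ D(1)] s by (auto simp: U_def)
      then show "cnorm c (chart_inv c ((chart_map c \<circ> \<gamma>) s)) (D s) = speed \<gamma> s"
        using s c by (simp add: U_def)
    qed
    then show ?thesis using U t c by (intro exI[of _ U]) (auto simp: U_def)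
  qed
  then show ?thesis
    unfolding continuous_on_eq_continuous_at[OF regular_on_open[OF r]] by (meson continuous_on_eq_continuous_at)
qed

lemma measurable_speed:
  assumes r: "regular_on T \<gamma>"
  shows "(\<lambda>t. ennreal (speed \<gamma> t) * indicator T t) \<in> borel_measurable borel"
proof -
  have "(\<lambda>t. indicator T t *\<^sub>R speed \<gamma> t) \<in> borel_measurable borel"
    using regular_on_open[OF r] by (intro borel_measurable_continuous_on_indicator continuous_speed[OF r]) auto
  then have "(\<lambda>t. ennreal (indicator T t *\<^sub>R speed \<gamma> t)) \<in> borel_measurable borel" by simp
  also have "(\<lambda>t. ennreal (indicator T t *\<^sub>R speed \<gamma> t)) = (\<lambda>t. ennreal (speed \<gamma> t) * indicator T t)"
    by (auto simp: indicator_def)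
  finally show ?thesis .
qed

lemma regular_on_subset:
  assumes "regular_on T \<gamma>" "open U" "U \<subseteq> T" shows "regular_on U \<gamma>"
  using assms unfolding regular_on_def
  by (auto intro: continuous_on_subset C1_differentiable_on_subset)

lemma regular_on_cong:
  assumes r: "regular_on T \<gamma>" and eq: "\<And>t. t \<in> T \<Longrightarrow> \<gamma>' t = \<gamma> t"
  shows "regular_on T \<gamma>'" "\<And>t. t \<in> T \<Longrightarrow> speed \<gamma>' t = speed \<gamma> t"
proof -
  note T = regular_on_open[OF r]
  have ct: "continuous_on T \<gamma>'" using regular_on_continuous[OF r] eq by (simp cong: continuous_on_cong)
  have der: "(chart_map c \<circ> \<gamma>' has_vector_derivative v) (at t)"
    if "t \<in> T" "(chart_map c \<circ> \<gamma> has_vector_derivative v) (at t)" for c v t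
    using has_vector_derivative_transform_within_open[OF that(2) T that(1), of "chart_map c \<circ> \<gamma>'"] eq by simp
  show "regular_on T \<gamma>'" unfolding regular_on_def
  proof (intro conjI ballI T ct)
    fix c assume c: "c \<in> \<A>"
    have e: "{t \<in> T. \<gamma>' t \<in> dom_of c} = {t \<in> T. \<gamma> t \<in> dom_of c}" using eq by auto
    obtain D where D: "\<And>s. s \<in> {t \<in> T. \<gamma> t \<in> dom_of c} \<Longrightarrow> (chart_map c \<circ> \<gamma> has_vector_derivative D s) (at s)"
      "continuous_on {t \<in> T. \<gamma> t \<in> dom_of c} D"
      using regular_on_C1[OF r c] unfolding C1_differentiable_on_def by blast
    show "(chart_map c \<circ> \<gamma>') C1_differentiable_on {t \<in> T. \<gamma>' t \<in> dom_of c}"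
      unfolding C1_differentiable_on_def e
    proof (intro exI[of _ D] conjI ballI)
      fix x assume x: "x \<in> {t \<in> T. \<gamma> t \<in> dom_of c}"
      then show "(chart_map c \<circ> \<gamma>' has_vector_derivative D x) (at x)"
        by (intro der[OF _ D(1)]) simp_all
    qed (rule D(2))
  qed
  fix t assume t: "t \<in> T"
  obtain c where c: "c \<in> \<A>" "\<gamma> t \<in> dom_of c" using chart_cover[of "\<gamma> t"] by blast
  note d = regular_on_derivative[OF r c(1) t c(2)]
  show "speed \<gamma>' t = speed \<gamma> t"
    using speed_eq[OF T ct t c(1) _ der[OF t d]] speed_eq[OF T regular_on_continuous[OF r] t c d] c eq[OF t] by simp
qed

lemma regular_on_affine:
  assumes r: "regular_on T \<gamma>" and m: "m \<noteq> 0"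
  shows "regular_on ((\<lambda>t. k + m * t) -` T) (\<lambda>t. \<gamma> (k + m * t))" (is ?R)
    and "\<And>t. k + m * t \<in> T \<Longrightarrow> speed (\<lambda>t. \<gamma> (k + m * t)) t = \<bar>m\<bar> * speed \<gamma> (k + m * t)"
    and "length_on ((\<lambda>t. k + m * t) -` T) (\<lambda>t. \<gamma> (k + m * t)) = length_on T \<gamma>"
proof -
  let ?s = "\<lambda>t. k + m * t" and ?\<gamma> = "\<lambda>t. \<gamma> (k + m * t)"
  note T = regular_on_open[OF r]
  have cs: "continuous_on UNIV ?s" by (intro continuous_intros)
  have oT: "open (?s -` T)" using open_vimage[OF T cs] .
  have ct: "continuous_on (?s -` T) ?\<gamma>"
    by (rule continuous_on_compose2[OF regular_on_continuous[OF r] continuous_on_subset[OF cs]]) auto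
  have der: "(chart_map c \<circ> ?\<gamma> has_vector_derivative m *\<^sub>R v) (at t)"
    if "(chart_map c \<circ> \<gamma> has_vector_derivative v) (at (?s t))" for c v t
  proof -
    have "(?s has_vector_derivative m) (at t)"
      unfolding has_real_derivative_iff_has_vector_derivative[symmetric] by (auto intro!: derivative_eq_intros)
    from vector_diff_chain_at[OF this that] show ?thesis by (simp add: o_def)
  qed
  show ?R unfolding regular_on_def
  proof (intro conjI ballI oT ct)
    fix c assume c: "c \<in> \<A>"
    obtain D where D: "\<And>s. s \<in> {t \<in> T. \<gamma> t \<in> dom_of c} \<Longrightarrow> (chart_map c \<circ> \<gamma> has_vector_derivative D s) (at s)"
      "continuous_on {t \<in> T. \<gamma> t \<in> dom_of c} D"
      using regular_on_C1[OF r c] unfolding C1_differentiable_on_def by blast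
    have "continuous_on {t \<in> ?s -` T. ?\<gamma> t \<in> dom_of c} (\<lambda>t. m *\<^sub>R D (?s t))"
      by (intro continuous_intros continuous_on_compose2[OF D(2)]) auto
    then show "(chart_map c \<circ> ?\<gamma>) C1_differentiable_on {t \<in> ?s -` T. ?\<gamma> t \<in> dom_of c}"
      unfolding C1_differentiable_on_def
    proof (intro exI[of _ "\<lambda>t. m *\<^sub>R D (?s t)"] conjI ballI)
      fix x assume "x \<in> {t \<in> ?s -` T. ?\<gamma> t \<in> dom_of c}"
      then show "(chart_map c \<circ> ?\<gamma> has_vector_derivative m *\<^sub>R D (?s x)) (at x)"
        by (intro der[OF D(1)]) simp_all
    qed
  qed
  show sp: "speed ?\<gamma> t = \<bar>m\<bar> * speed \<gamma> (?s t)" if t: "?s t \<in> T" for t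
  proof -
    obtain c where c: "c \<in> \<A>" "\<gamma> (?s t) \<in> dom_of c" using chart_cover[of "\<gamma> (?s t)"] by blast
    note d = regular_on_derivative[OF r c(1) t c(2)]
    show ?thesis
      using speed_eq[OF oT ct _ c(1) _ der[OF d]] speed_eq[OF T regular_on_continuous[OF r] t c d] c t
      by (simp add: cnorm_scaleR[OF c])
  qed
  have "length_on T \<gamma> = \<bar>m\<bar> * (\<integral>\<^sup>+t. ennreal (speed \<gamma> (k + m * t)) * indicator T (k + m * t) \<partial>lborel)"
    unfolding length_on_def by (rule nn_integral_real_affine[OF measurable_speed[OF r] m])
  also have "\<dots> = (\<integral>\<^sup>+t. \<bar>m\<bar> * (ennreal (speed \<gamma> (k + m * t)) * indicator T (k + m * t)) \<partial>lborel)"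
  proof (rule nn_integral_cmult[symmetric])
    show "(\<lambda>t. ennreal (speed \<gamma> (k + m * t)) * indicator T (k + m * t)) \<in> borel_measurable lborel"
      using measurable_compose[OF _ measurable_speed[OF r], of ?s borel] by simp
  qed
  also have "\<dots> = length_on (?s -` T) ?\<gamma>"
    unfolding length_on_def
    by (intro nn_integral_cong) (auto simp: indicator_def sp ennreal_mult' split: if_splits)
  finally show "length_on (?s -` T) ?\<gamma> = length_on T \<gamma>" by simp
qed

lemma regular_on_Un:
  assumes r: "regular_on S \<gamma>" "regular_on T \<gamma>"
  shows "regular_on (S \<union> T) \<gamma>"
  unfolding regular_on_def
proof (intro conjI ballI)
  show "open (S \<union> T)" using r by (auto simp: regular_on_def)
  show "continuous_on (S \<union> T) \<gamma>"
    using r by (auto simp: regular_on_def intro!: continuous_on_open_Un)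
  fix c assume c: "c \<in> \<A>"
  have e: "{t \<in> S \<union> T. \<gamma> t \<in> dom_of c} = {t \<in> S. \<gamma> t \<in> dom_of c} \<union> {t \<in> T. \<gamma> t \<in> dom_of c}" by auto
  show "(chart_map c \<circ> \<gamma>) C1_differentiable_on {t \<in> S \<union> T. \<gamma> t \<in> dom_of c}"
    using regular_on_C1[OF r(1) c] regular_on_C1[OF r(2) c] regular_on_chart_open[OF r(1) c] regular_on_chart_open[OF r(2) c]
    unfolding e C1_differentiable_on_eq by (auto intro!: continuous_on_open_Un)
qed

lemma length_on_Un:
  assumes r: "regular_on S \<gamma>" "regular_on T \<gamma>" and d: "S \<inter> T = {}"
  shows "length_on (S \<union> T) \<gamma> = length_on S \<gamma> + length_on T \<gamma>"
proof -
  have "length_on (S \<union> T) \<gamma> = (\<integral>\<^sup>+t. (ennreal (speed \<gamma> t) * indicator S t) + (ennreal (speed \<gamma> t) * indicator T t) \<partial>lborel)"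
    unfolding length_on_def using d by (intro nn_integral_cong) (auto simp: indicator_def)
  also have "\<dots> = length_on S \<gamma> + length_on T \<gamma>"
    unfolding length_on_def
    using measurable_speed[OF r(1)] measurable_speed[OF r(2)] by (intro nn_integral_add) auto
  finally show ?thesis .
qed

lemma length_on_mono: "S \<subseteq> T \<Longrightarrow> length_on S \<gamma> \<le> length_on T \<gamma>"
  unfolding length_on_def by (intro nn_integral_mono) (auto simp: indicator_def)

definition almost_all :: "real set \<Rightarrow> bool" where
  "almost_all T \<longleftrightarrow> T \<subseteq> {0<..<1} \<and> finite ({0<..<1} - T)"

text \<open>The exceptional parameters and the two endpoints form a finite, hence null, set.\<close>

lemma curve_length_eq:
  assumes "almost_all T" shows "curve_length \<A> g \<gamma> = length_on T \<gamma>"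
proof -
  have "AE t in lborel. t \<notin> ({0<..<1} - T) \<union> {0, 1}"
    using assms by (intro AE_not_in finite_imp_null_set_lborel) (auto simp: almost_all_def)
  then have "AE t in lborel. t \<in> {0..1} \<longleftrightarrow> t \<in> T"
    by eventually_elim (use assms in \<open>auto simp: almost_all_def\<close>)
  then show ?thesis unfolding curve_length_def length_on_def speed_def
    by (intro nn_integral_cong_AE) (auto simp: indicator_def elim!: eventually_mono)
qed

lemma piecewise_C1_curveE:
  assumes "piecewise_C1_curve \<A> \<gamma>"
  obtains T where "almost_all T" "regular_on T \<gamma>" "path \<gamma>" "curve_length \<A> g \<gamma> = length_on T \<gamma>"
proof -
  obtain S where S: "path \<gamma>" "finite S"
    "\<forall>c\<in>\<A>. (chart_map c \<circ> \<gamma>) C1_differentiable_on {t \<in> {0<..<1} - S. \<gamma> t \<in> dom_of c}"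
    using assms unfolding piecewise_C1_curve_def by blast
  have "almost_all ({0<..<1} - S)" using S(2) by (auto simp: almost_all_def intro: finite_subset)
  moreover have "regular_on ({0<..<1} - S) \<gamma>"
    unfolding regular_on_def using S finite_imp_closed[OF S(2)] unfolding path_def
    by (auto intro: continuous_on_subset)
  ultimately show ?thesis using that S(1) curve_length_eq by blast
qed

lemma piecewise_C1_curveI:
  assumes "path \<gamma>" "almost_all T" "regular_on T \<gamma>"
  shows "piecewise_C1_curve \<A> \<gamma>" "curve_length \<A> g \<gamma> = length_on T \<gamma>"
proof -
  have "{0<..<1} - ({0<..<1} - T) = T" using assms(2) by (auto simp: almost_all_def)
  then show "piecewise_C1_curve \<A> \<gamma>"
    unfolding piecewise_C1_curve_def using assms regular_on_C1[OF assms(3)]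
    by (intro conjI exI[of _ "{0<..<1} - T"]) (auto simp: almost_all_def)
  show "curve_length \<A> g \<gamma> = length_on T \<gamma>" by (rule curve_length_eq[OF assms(2)])
qed

text \<open>The distance before the conversion to a real number, which would turn an empty infimum into 0.\<close>

definition edist :: "'a \<Rightarrow> 'a \<Rightarrow> ennreal" where
  "edist x y = (INF \<gamma> \<in> {\<gamma>. piecewise_C1_curve \<A> \<gamma> \<and> pathstart \<gamma> = x \<and> pathfinish \<gamma> = y}. curve_length \<A> g \<gamma>)"

lemma riemannian_dist_eq: "riemannian_dist \<A> g x y = enn2real (edist x y)"
  by (simp add: riemannian_dist_def edist_def)

lemma edist_le:
  assumes "piecewise_C1_curve \<A> \<gamma>" shows "edist (\<gamma> 0) (\<gamma> 1) \<le> curve_length \<A> g \<gamma>"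
  unfolding edist_def by (rule INF_lower) (use assms in \<open>auto simp: pathstart_def pathfinish_def\<close>)

lemma edist_lessE:
  assumes "edist x y < e"
  obtains \<gamma> where "piecewise_C1_curve \<A> \<gamma>" "\<gamma> 0 = x" "\<gamma> 1 = y" "curve_length \<A> g \<gamma> < e"
  using assms unfolding edist_def INF_less_iff by (auto simp: pathstart_def pathfinish_def)

text \<open>The straight chart segment from y to z is an admissible curve with constant coordinate
  velocity z - y, so its speed is the norm of this one vector at the running point.\<close>

lemma edist_le_segment:
  assumes c: "c \<in> \<A>" and B: "convex B" "B \<subseteq> chart_map c ` dom_of c" and yz: "y \<in> B" "z \<in> B"
    and M: "\<And>w. w \<in> B \<Longrightarrow> cnorm c (chart_inv c w) (z - y) \<le> M"
  shows "edist (chart_inv c y) (chart_inv c z) \<le> ennreal M"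
proof -
  let ?l = "\<lambda>t::real. y + t *\<^sub>R (z - y)"
  define \<gamma> where "\<gamma> = (\<lambda>t. chart_inv c (?l t))"
  have lB: "?l t \<in> B" if "t \<in> {0..1}" for t
  proof -
    have "(1 - t) *\<^sub>R y + t *\<^sub>R z \<in> B" using that yz B(1) by (intro convexD_alt) auto
    then show ?thesis by (simp add: algebra_simps)
  qed
  have cont: "continuous_on {0..1} \<gamma>" unfolding \<gamma>_def
    by (rule continuous_on_compose2[OF continuous_chart(2)[OF c]]) (use lB B in \<open>auto intro!: continuous_intros\<close>)
  have dom: "\<gamma> t \<in> dom_of c" "chart_map c (\<gamma> t) = ?l t" if "t \<in> {0..1}" for t
    using lB[OF that] B(2) c chart_inv_dom[OF c] unfolding \<gamma>_def by (auto simp: subset_iff)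
  have der: "(chart_map d \<circ> \<gamma> has_vector_derivative transition_deriv c d (\<gamma> t) (z - y)) (at t)"
    if d: "d \<in> \<A>" and t: "t \<in> {0<..<1}" "\<gamma> t \<in> dom_of d" for d t
  proof -
    have tt: "t \<in> {0..1}" using t by auto
    have l: "(?l has_derivative (\<lambda>h. h *\<^sub>R (z - y))) (at t)" by (auto intro!: derivative_eq_intros)
    have D: "(chart_map d \<circ> chart_inv c has_derivative transition_deriv c d (\<gamma> t)) (at (?l t))"
      using transition(1)[OF c d dom(1)[OF tt] t(2)] dom(2)[OF tt] by simp
    have lin: "linear (transition_deriv c d (\<gamma> t))" using transition_linear c d dom(1)[OF tt] t by blast
    have "((chart_map d \<circ> chart_inv c) \<circ> ?l has_derivative
        transition_deriv c d (\<gamma> t) \<circ> (\<lambda>h. h *\<^sub>R (z - y))) (at t)"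
      using l D by (rule diff_chain_at)
    then show ?thesis
      unfolding has_vector_derivative_def o_def \<gamma>_def by (simp only: linear_cmul[OF lin, unfolded \<gamma>_def])
  qed
  have reg: "regular_on {0<..<1} \<gamma>" unfolding regular_on_def
  proof (intro conjI ballI)
    show "continuous_on {0<..<1} \<gamma>" by (rule continuous_on_subset[OF cont]) auto
    fix d assume d: "d \<in> \<A>"
    have "continuous_on {t \<in> {0<..<1}. \<gamma> t \<in> dom_of d} (\<lambda>t. transition_deriv c d (chart_inv c (?l t)) (z - y))"
    proof (rule continuous_on_compose2[OF transition(2)[OF c d]])
      show "?l ` {t \<in> {0<..<1}. \<gamma> t \<in> dom_of d} \<subseteq> chart_map c ` (dom_of d \<inter> dom_of c)"
      proof
        fix w assume "w \<in> ?l ` {t \<in> {0<..<1}. \<gamma> t \<in> dom_of d}"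
        then obtain t where t0: "w = ?l t" "t \<in> {0<..<1}" "\<gamma> t \<in> dom_of d" by blast
        then have t: "w = ?l t" "t \<in> {0..1}" "\<gamma> t \<in> dom_of d" by auto
        then show "w \<in> chart_map c ` (dom_of d \<inter> dom_of c)"
          using dom[OF t(2)] by (metis IntI image_eqI)
      qed
    qed (intro continuous_intros)
    then show "(chart_map d \<circ> \<gamma>) C1_differentiable_on {t \<in> {0<..<1}. \<gamma> t \<in> dom_of d}"
      unfolding C1_differentiable_on_def using der[OF d]
      by (intro exI[of _ "\<lambda>t. transition_deriv c d (chart_inv c (?l t)) (z - y)"]) (auto simp: \<gamma>_def)
  qed simp
  have aa: "almost_all {0<..<1}" by (simp add: almost_all_def)
  note pc = piecewise_C1_curveI[OF _ aa reg, unfolded path_def, OF cont]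
  have sp: "speed \<gamma> t \<le> M" if "t \<in> {0<..<1}" for t
  proof -
    have tt: "t \<in> {0..1}" using that by auto
    have "speed \<gamma> t = cnorm c (\<gamma> t) (transition_deriv c c (\<gamma> t) (z - y))"
      by (rule speed_eq[OF regular_on_open[OF reg] regular_on_continuous[OF reg] that c dom(1)[OF tt] der[OF c that dom(1)[OF tt]]])
    also have "\<dots> = cnorm c (chart_inv c (?l t)) (z - y)"
      using transition_refl[OF c dom(1)[OF tt]] by (simp add: \<gamma>_def)
    also have "\<dots> \<le> M" by (rule M[OF lB[OF tt]])
    finally show ?thesis .
  qed
  have "edist (\<gamma> 0) (\<gamma> 1) \<le> length_on {0<..<1} \<gamma>" using edist_le[OF pc(1)] pc(2) by simp
  also have "\<dots> \<le> (\<integral>\<^sup>+t. ennreal M * indicator {0<..<1::real} t \<partial>lborel)"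
    unfolding length_on_def using sp by (intro nn_integral_mono) (auto simp: indicator_def intro: ennreal_leI)
  also have "\<dots> = ennreal M" by (simp add: nn_integral_cmult_indicator)
  finally show ?thesis by (simp add: \<gamma>_def)
qed

lemma edist_refl: "edist x x = 0"
proof -
  obtain c where c: "c \<in> \<A>" "x \<in> dom_of c" using chart_cover[of x] by blast
  have "edist (chart_inv c (chart_map c x)) (chart_inv c (chart_map c x)) \<le> ennreal 0"
    by (rule edist_le_segment[OF c(1), of "{chart_map c x}"]) (use c in auto)
  then show ?thesis using c by simp
qed

lemma finite_affine_vimage: "finite S \<Longrightarrow> m \<noteq> 0 \<Longrightarrow> finite ((\<lambda>t::real. k + m * t) -` S)"
  by (intro finite_vimageI) (auto intro: injI)

text \<open>Nearly optimal curves are reversed, which preserves length.\<close>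

lemma edist_sym_le: "edist y x \<le> edist x y"
proof (rule ccontr)
  assume "\<not> edist y x \<le> edist x y"
  then have "edist x y < edist y x" by simp
  then obtain \<gamma> where \<gamma>: "piecewise_C1_curve \<A> \<gamma>" "\<gamma> 0 = x" "\<gamma> 1 = y" "curve_length \<A> g \<gamma> < edist y x"
    by (rule edist_lessE)
  obtain T where T: "almost_all T" "regular_on T \<gamma>" "path \<gamma>" "curve_length \<A> g \<gamma> = length_on T \<gamma>"
    by (rule piecewise_C1_curveE[OF \<gamma>(1)])
  let ?\<gamma> = "\<lambda>t. \<gamma> (1 + (-1) * t)" and ?T = "(\<lambda>t. 1 + (-1) * t) -` T"
  have "{0<..<1} - ?T = (\<lambda>t. 1 + (-1) * t) -` ({0<..<1} - T)" by auto
  then have aa: "almost_all ?T"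
    using T(1) finite_affine_vimage[of "{0<..<1} - T" "-1" 1] unfolding almost_all_def by auto
  have "path ?\<gamma>" using T(3) unfolding path_def
    by (rule continuous_on_compose2) (auto intro!: continuous_intros)
  note pc = piecewise_C1_curveI[OF this aa regular_on_affine(1)[OF T(2)]]
  have "edist y x \<le> curve_length \<A> g \<gamma>"
    using edist_le[OF pc(1)] pc(2) regular_on_affine(3)[OF T(2), of "-1" 1] T(4) \<gamma>(2,3) by simp
  then show False using \<gamma>(4) by simp
qed

lemma edist_sym: "edist x y = edist y x"
  using edist_sym_le by (simp add: antisym)

lemma ennreal_less_add: "a < top \<Longrightarrow> 0 < e \<Longrightarrow> a < a + ennreal e"
  by (cases a) (auto simp: ennreal_plus[symmetric] ennreal_less_iff simp del: ennreal_plus)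

text \<open>Two curves with surplus e/2 each are joined; the joint at parameter 1/2 is one more
  exceptional parameter.\<close>

lemma edist_triangle: "edist x z \<le> edist x y + edist y z"
proof (rule ennreal_le_epsilon)
  fix e :: real assume fin: "edist x y + edist y z < top" and e: "0 < e"
  then have "edist x y < top" "edist y z < top" by (auto simp: less_top)
  then have lt: "edist x y < edist x y + ennreal (e/2)" "edist y z < edist y z + ennreal (e/2)"
    using e by (auto simp: ennreal_less_add)
  obtain \<gamma>1 where \<gamma>1: "piecewise_C1_curve \<A> \<gamma>1" "\<gamma>1 0 = x" "\<gamma>1 1 = y" "curve_length \<A> g \<gamma>1 < edist x y + ennreal (e/2)"
    using edist_lessE[OF lt(1)] by blast
  obtain \<gamma>2 where \<gamma>2: "piecewise_C1_curve \<A> \<gamma>2" "\<gamma>2 0 = y" "\<gamma>2 1 = z" "curve_length \<A> g \<gamma>2 < edist y z + ennreal (e/2)"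
    using edist_lessE[OF lt(2)] by blast
  obtain T1 where T1: "almost_all T1" "regular_on T1 \<gamma>1" "path \<gamma>1" "curve_length \<A> g \<gamma>1 = length_on T1 \<gamma>1"
    by (rule piecewise_C1_curveE[OF \<gamma>1(1)])
  obtain T2 where T2: "almost_all T2" "regular_on T2 \<gamma>2" "path \<gamma>2" "curve_length \<A> g \<gamma>2 = length_on T2 \<gamma>2"
    by (rule piecewise_C1_curveE[OF \<gamma>2(1)])
  let ?S1 = "(\<lambda>t. 0 + 2 * t) -` T1" and ?S2 = "(\<lambda>t. -1 + 2 * t) -` T2"
  let ?\<gamma> = "\<gamma>1 +++ \<gamma>2"
  have S1: "?S1 \<subseteq> {0<..<1/2}" and S2: "?S2 \<subseteq> {1/2<..<1}" using T1(1) T2(1) by (auto simp: almost_all_def)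
  have e1: "?\<gamma> t = \<gamma>1 (0 + 2 * t)" if "t \<in> ?S1" for t using S1 that by (auto simp: joinpaths_def)
  have e2: "?\<gamma> t = \<gamma>2 (-1 + 2 * t)" if "t \<in> ?S2" for t using S2 that by (auto simp: joinpaths_def)
  note a1 = regular_on_affine[OF T1(2), of 2 0, OF zero_neq_numeral[symmetric]] and a2 = regular_on_affine[OF T2(2), of 2 "-1", OF zero_neq_numeral[symmetric]]
  note r1 = regular_on_cong[OF a1(1) e1] and r2 = regular_on_cong[OF a2(1) e2]
  have "length_on ?S1 ?\<gamma> = length_on ?S1 (\<lambda>t. \<gamma>1 (0 + 2 * t))"
    unfolding length_on_def
  proof (rule nn_integral_cong)
    fix t :: real
    show "ennreal (speed ?\<gamma> t) * indicator ?S1 t = ennreal (speed (\<lambda>t. \<gamma>1 (0 + 2 * t)) t) * indicator ?S1 t"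
      by (cases "t \<in> ?S1") (simp_all only: r1(2) indicator_simps mult_zero_right not_False_eq_True)
  qed
  also have "\<dots> = length_on T1 \<gamma>1" by (rule a1(3))
  finally have l1: "length_on ?S1 ?\<gamma> = length_on T1 \<gamma>1" .
  have "length_on ?S2 ?\<gamma> = length_on ?S2 (\<lambda>t. \<gamma>2 (-1 + 2 * t))"
    unfolding length_on_def
  proof (rule nn_integral_cong)
    fix t :: real
    show "ennreal (speed ?\<gamma> t) * indicator ?S2 t = ennreal (speed (\<lambda>t. \<gamma>2 (-1 + 2 * t)) t) * indicator ?S2 t"
      by (cases "t \<in> ?S2") (simp_all only: r2(2) indicator_simps mult_zero_right not_False_eq_True)
  qed
  also have "\<dots> = length_on T2 \<gamma>2" by (rule a2(3))
  finally have l2: "length_on ?S2 ?\<gamma> = length_on T2 \<gamma>2" .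
  have rU: "regular_on (?S1 \<union> ?S2) ?\<gamma>" using r1(1) r2(1) by (intro regular_on_Un) auto
  have aa: "almost_all (?S1 \<union> ?S2)"
  proof -
    have "{0<..<1} - (?S1 \<union> ?S2) \<subseteq> (\<lambda>t. 0 + 2 * t) -` ({0<..<1} - T1) \<union> (\<lambda>t. -1 + 2 * t) -` ({0<..<1} - T2) \<union> {1/2}"
      by (auto simp: not_less)
    moreover have "finite \<dots>"
      using T1(1) T2(1) finite_affine_vimage[of "{0<..<1} - T1" 2 0] finite_affine_vimage[of "{0<..<1} - T2" 2 "-1"]
      by (auto simp: almost_all_def)
    ultimately show ?thesis using S1 S2 unfolding almost_all_def by (auto intro: finite_subset)
  qed
  have "path ?\<gamma>" using T1(3) T2(3) \<gamma>1(3) \<gamma>2(2) by (auto simp: pathstart_def pathfinish_def)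
  note pc = piecewise_C1_curveI[OF this aa rU]
  have "edist x z \<le> curve_length \<A> g ?\<gamma>"
    using edist_le[OF pc(1)] \<gamma>1(2) \<gamma>2(3) by (simp add: joinpaths_def)
  also have "\<dots> = length_on ?S1 ?\<gamma> + length_on ?S2 ?\<gamma>"
  proof -
    have "{0<..<1/2::real} \<inter> {1/2<..<1} = {}" by auto
    then have "?S1 \<inter> ?S2 = {}" using S1 S2 by blast
    moreover have "regular_on ?S1 ?\<gamma>" "regular_on ?S2 ?\<gamma>" using r1(1) r2(1) by simp_all
    ultimately show ?thesis unfolding pc(2) by (intro length_on_Un)
  qed
  also have "\<dots> \<le> (edist x y + ennreal (e/2)) + (edist y z + ennreal (e/2))"
    using \<gamma>1(4) \<gamma>2(4) T1(4) T2(4) l1 l2 by (intro add_mono) auto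
  also have "\<dots> = edist x y + edist y z + ennreal e"
    using e by (simp add: ennreal_plus[symmetric] ac_simps del: ennreal_plus)
  finally show "edist x z \<le> edist x y + edist y z + ennreal e" .
qed

text \<open>Both pieces are rescaled to the unit interval, which preserves length. Intermediate
  points can thus be read off from nearly optimal curves, in place of minimising ones.\<close>

lemma edist_split:
  assumes pc: "piecewise_C1_curve \<A> \<gamma>" and s: "0 < s" "s < 1"
  shows "edist (\<gamma> 0) (\<gamma> s) + edist (\<gamma> s) (\<gamma> 1) \<le> curve_length \<A> g \<gamma>"
proof -
  obtain T where T: "almost_all T" "regular_on T \<gamma>" "path \<gamma>" "curve_length \<A> g \<gamma> = length_on T \<gamma>"
    by (rule piecewise_C1_curveE[OF pc])
  have sub: "edist (\<gamma> a) (\<gamma> b) \<le> length_on (T \<inter> {a<..<b}) \<gamma>" if "0 \<le> a" "a < b" "b \<le> 1" for a b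
  proof -
    let ?s = "\<lambda>t. a + (b - a) * t"
    have in1: "?s t \<in> {a<..<b} \<longleftrightarrow> t \<in> {0<..<1}" for t
    proof -
      have "a < ?s t \<longleftrightarrow> 0 < t" using that by (simp add: zero_less_mult_iff)
      moreover have "?s t < b \<longleftrightarrow> t < 1"
        using that mult_less_cancel_left_pos[of "b - a" t 1] by (auto simp: algebra_simps)
      ultimately show ?thesis by simp
    qed
    have in2: "?s t \<in> {0..1}" if "t \<in> {0..1}" for t
    proof -
      have "0 \<le> (b - a) * t" "(b - a) * t \<le> (b - a) * 1"
        using that \<open>a < b\<close> by (auto intro!: mult_left_mono)
      then show ?thesis using \<open>0 \<le> a\<close> \<open>b \<le> 1\<close> by auto
    qed
    have r: "regular_on (T \<inter> {a<..<b}) \<gamma>"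
      using regular_on_open[OF T(2)] by (intro regular_on_subset[OF T(2)]) auto
    have m: "b - a \<noteq> 0" using that by simp
    note af = regular_on_affine[OF r m, of a]
    have "{0<..<1} - ?s -` (T \<inter> {a<..<b}) \<subseteq> ?s -` ({0<..<1} - T)"
    proof
      fix t assume t: "t \<in> {0<..<1} - ?s -` (T \<inter> {a<..<b})"
      then have st: "?s t \<in> {a<..<b}" using in1 by blast
      then have "?s t \<in> {0<..<1}" using that by auto
      then show "t \<in> ?s -` ({0<..<1} - T)" using t st by blast
    qed
    moreover have "finite (?s -` ({0<..<1} - T))"
      using T(1) m by (intro finite_affine_vimage) (auto simp: almost_all_def)
    ultimately have aa: "almost_all (?s -` (T \<inter> {a<..<b}))"
      using in1 unfolding almost_all_def by (auto intro: finite_subset)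
    have "path (\<lambda>t. \<gamma> (?s t))" using T(3) unfolding path_def
      by (rule continuous_on_compose2) (use in2 in \<open>auto intro!: continuous_intros\<close>)
    note p = piecewise_C1_curveI[OF this aa af(1)]
    show ?thesis using edist_le[OF p(1)] p(2) af(3) by simp
  qed
  have "edist (\<gamma> 0) (\<gamma> s) + edist (\<gamma> s) (\<gamma> 1) \<le> length_on (T \<inter> {0<..<s}) \<gamma> + length_on (T \<inter> {s<..<1}) \<gamma>"
    using sub[of 0 s] sub[of s 1] s by (intro add_mono) auto
  also have "\<dots> = length_on (T \<inter> {0<..<s} \<union> T \<inter> {s<..<1}) \<gamma>"
    using regular_on_open[OF T(2)]
    by (intro length_on_Un[symmetric] regular_on_subset[OF T(2)]) auto
  also have "\<dots> \<le> length_on T \<gamma>" by (rule length_on_mono) auto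
  finally show ?thesis using T(4) by simp
qed

end

section \<open>Comparison of the distance with chart coordinates\<close>

context riem_manifold
begin

text \<open>The chart displacement is the integral of the coordinate velocity, whose norm is at most
  the speed divided by m as long as the curve stays in \<open>U\<close>. The fundamental theorem is
  used in the form that admits finitely many exceptional points, since the velocity is controlled on
  \<open>T\<close> only.\<close>

lemma chart_displacement_le_length:
  assumes c: "c \<in> \<A>" and m: "m > 0"
    and lower: "\<And>z v. z \<in> U \<Longrightarrow> m * norm v \<le> cnorm c z v" and U: "U \<subseteq> dom_of c"
    and T: "almost_all T" "regular_on T \<gamma>" "path \<gamma>"
    and t: "0 \<le> t" "t \<le> 1" "\<gamma> ` {0..t} \<subseteq> U"
  shows "ennreal (norm (chart_map c (\<gamma> t) - chart_map c (\<gamma> 0))) \<le> ennreal (1 / m) * length_on T \<gamma>"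
proof -
  define h where "h = chart_map c \<circ> \<gamma>"
  define f' where "f' u = (if u \<in> T then vector_derivative h (at u) else 0)" for u
  define T' where "T' = T \<inter> {0<..<t}"
  define F where "F u = indicator T' u *\<^sub>R f' u" for u
  have T': "open T'" "T' \<subseteq> T" using regular_on_open[OF T(2)] by (auto simp: T'_def)
  have in_dom: "\<gamma> u \<in> dom_of c" "\<gamma> u \<in> U" if "u \<in> {0..t}" for u
  proof -
    show "\<gamma> u \<in> U" using t(3) that by (rule subsetD[OF _ imageI])
    then show "\<gamma> u \<in> dom_of c" using U by (rule subsetD[rotated])
  qed
  have sub: "T' \<subseteq> {u \<in> T. \<gamma> u \<in> dom_of c}" using in_dom by (auto simp: T'_def)
  have der: "(h has_vector_derivative f' u) (at u)" if "u \<in> T'" for u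
  proof -
    have "u \<in> T" "\<gamma> u \<in> dom_of c" using that sub by auto
    from regular_on_derivative[where \<gamma>=\<gamma> and t=u, OF T(2) c this]
    show ?thesis using \<open>u \<in> T\<close> by (simp add: f'_def h_def)
  qed
  have "continuous_on T' (\<lambda>u. vector_derivative h (at u))"
    using regular_on_C1[OF T(2) c] sub unfolding C1_differentiable_on_eq h_def
    by (auto intro: continuous_on_subset)
  then have cf: "continuous_on T' f'"
    by (rule continuous_on_eq) (use T'(2) in \<open>auto simp: f'_def\<close>)
  have Fm: "F \<in> borel_measurable borel"
    unfolding F_def using T'(1) by (intro borel_measurable_continuous_on_indicator cf) auto
  have Fle: "ennreal (norm (F u)) \<le> ennreal (1/m) * (ennreal (speed \<gamma> u) * indicator T u)" for u
  proof (cases "u \<in> T'")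
    case True
    then have u: "u \<in> T" "\<gamma> u \<in> dom_of c" "\<gamma> u \<in> U" using sub in_dom by (auto simp: T'_def)
    have "speed \<gamma> u = cnorm c (\<gamma> u) (f' u)"
      by (rule speed_eq[OF regular_on_open[OF T(2)] regular_on_continuous[OF T(2)] u(1) c u(2) der[OF True, unfolded h_def]])
    then have "norm (f' u) \<le> (1/m) * speed \<gamma> u"
      using lower[OF u(3), of "f' u"] m by (simp add: field_simps)
    then have "ennreal (norm (f' u)) \<le> ennreal ((1/m) * speed \<gamma> u)" by (rule ennreal_leI)
    also have "\<dots> = ennreal (1/m) * ennreal (speed \<gamma> u)" using m by (intro ennreal_mult') simp
    finally show ?thesis using True u by (simp add: F_def)
  qed (simp add: F_def)
  have le: "(\<integral>\<^sup>+u. ennreal (norm (F u)) \<partial>lborel) \<le> ennreal (1 / m) * length_on T \<gamma>"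
  proof -
    have "(\<integral>\<^sup>+u. ennreal (norm (F u)) \<partial>lborel) \<le> (\<integral>\<^sup>+u. ennreal (1/m) * (ennreal (speed \<gamma> u) * indicator T u) \<partial>lborel)"
      by (rule nn_integral_mono) (rule Fle)
    also have "\<dots> = ennreal (1 / m) * length_on T \<gamma>"
      unfolding length_on_def using measurable_speed[OF T(2)] by (intro nn_integral_cmult) simp
    finally show ?thesis .
  qed
  \<comment> \<open>Speeds may be unbounded near exceptional parameters. Infinite length makes the
    bound trivial; finite length makes the velocity integrable.\<close>
  show ?thesis
  proof (cases "ennreal (1 / m) * length_on T \<gamma> = \<infinity>")
    case False
    have iF: "integrable lborel F"
      using Fm le False by (intro integrableI_bounded) (auto simp: less_top[symmetric] top_unique)
    have "continuous_on {0..t} \<gamma>" using T(3) t unfolding path_def by (auto intro: continuous_on_subset)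
    then have ch: "continuous_on {0..t} h"
      unfolding h_def using in_dom by (intro continuous_on_compose continuous_on_subset[OF continuous_chart(1)[OF c]]) auto
    have "(f' has_integral (h t - h 0)) {0..t}"
    proof (rule fundamental_theorem_of_calculus_interior_strong[OF _ t(1) _ ch])
      show "finite ({0<..<1} - T)" using T(1) by (simp add: almost_all_def)
      show "(h has_vector_derivative f' x) (at x)" if "x \<in> {0<..<t} - ({0<..<1} - T)" for x
        using that t by (intro der) (auto simp: T'_def)
    qed
    then have "((\<lambda>u. if u \<in> {0..t} then f' u else 0) has_integral (h t - h 0)) UNIV"
      by (simp only: has_integral_restrict_UNIV)
    then have "(F has_integral (h t - h 0)) UNIV"
      by (rule has_integral_spike[of "{0, t}", rotated -1])
        (auto simp: F_def T'_def f'_def indicator_def intro: negligible_finite)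
    then have "h t - h 0 = (LINT u|lborel. F u)"
      using has_integral_integral_lborel[OF iF] has_integral_unique by blast
    then have "ennreal (norm (h t - h 0)) \<le> (\<integral>\<^sup>+u. ennreal (norm (F u)) \<partial>lborel)"
      using integral_norm_bound_ennreal[OF iF] by simp
    then show ?thesis using le by (simp add: h_def)
  qed simp
qed

text \<open>A curve shorter than m s cannot leave the chart ball of radius s. Before the first exit
  time its displacement is at most some \<rho> < s, so it runs in the compact image of the closed
  ball of radius \<rho>; this set contains the exit point too, which is then no exit point at
  all.\<close>

lemma edist_chart_lower:
  assumes c: "c \<in> \<A>" and x: "x \<in> dom_of c"
  obtains r m where "r > 0" "m > 0" "cball (chart_map c x) r \<subseteq> chart_map c ` dom_of c"
    "\<And>s y. 0 < s \<Longrightarrow> s \<le> r \<Longrightarrow> edist x y < ennreal (m * s) \<Longrightarrow>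
       y \<in> dom_of c \<and> dist (chart_map c x) (chart_map c y) < s"
proof -
  obtain r where r: "r > 0" "cball (chart_map c x) r \<subseteq> chart_map c ` dom_of c"
    "\<And>y z v. y \<in> cball (chart_map c x) r \<Longrightarrow> z \<in> cball (chart_map c x) r \<Longrightarrow>
       cnorm c (chart_inv c y) v \<le> 2 * cnorm c (chart_inv c z) v"
    using cnorm_local_comparison[OF c x, of 2] by auto
  obtain m M where mM: "m > 0" "\<And>v. m * norm v \<le> cnorm c x v"
    using cnorm_euclid_comparison[OF c x] by metis
  \<comment> \<open>Norms at points of the ball are within a factor 2 of the norm at x, which turns
    m into m/2.\<close>
  have lower: "(m/2) * norm v \<le> cnorm c z v" if "z \<in> dom_of c" "chart_map c z \<in> cball (chart_map c x) r" for z v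
    using mM(2)[of v] r(3)[OF _ that(2), of "chart_map c x" v] r(1) x c that(1) by auto
  show ?thesis
  proof (rule that[of r "m/2"])
    fix s y assume s: "0 < s" "s \<le> r" and lt: "edist x y < ennreal (m/2 * s)"
    obtain \<gamma> where \<gamma>: "piecewise_C1_curve \<A> \<gamma>" "\<gamma> 0 = x" "\<gamma> 1 = y" "curve_length \<A> g \<gamma> < ennreal (m/2 * s)"
      by (rule edist_lessE[OF lt])
    obtain T where T: "almost_all T" "regular_on T \<gamma>" "path \<gamma>" "curve_length \<A> g \<gamma> = length_on T \<gamma>"
      by (rule piecewise_C1_curveE[OF \<gamma>(1)])
    define U where "U = {z \<in> dom_of c. chart_map c z \<in> ball (chart_map c x) s}"
    have U: "open U" "U \<subseteq> dom_of c" "x \<in> U" using open_chart_preimage[OF c open_ball, of "chart_map c x" s] s x by (auto simp: U_def)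
    \<comment> \<open>The largest chart displacement that the length of the curve permits; it is
      strictly below s.\<close>
    define \<rho> where "\<rho> = enn2real (length_on T \<gamma>) / (m/2)"
    have fin: "length_on T \<gamma> < top" using \<gamma>(4) T(4) by (auto intro: order_less_le_trans)
    have "enn2real (length_on T \<gamma>) < m/2 * s"
      using \<gamma>(4) T(4) fin s mM(1) by (metis enn2real_ennreal enn2real_less_iff mult_pos_pos half_gt_zero less_imp_le mult_nonneg_nonneg)
    then have \<rho>: "\<rho> < s" using mM(1) by (simp add: \<rho>_def field_simps)
    have bound: "dist (chart_map c x) (chart_map c (\<gamma> t)) \<le> \<rho>"
      if t: "0 \<le> t" "t \<le> 1" "\<gamma> ` {0..t} \<subseteq> U" for t
    proof -
      have low: "(m/2) * norm v \<le> cnorm c z v" if "z \<in> U" for z v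
        using that s by (intro lower) (auto simp: U_def)
      have "ennreal (norm (chart_map c (\<gamma> t) - chart_map c (\<gamma> 0))) \<le> ennreal (1 / (m/2)) * length_on T \<gamma>"
        using mM(1) by (intro chart_displacement_le_length[OF c _ low U(2) T(1-3) t]) auto
      also have "\<dots> = ennreal \<rho>"
        using fin mM(1) by (cases "length_on T \<gamma>") (auto simp: \<rho>_def ennreal_mult'[symmetric])
      finally have "norm (chart_map c (\<gamma> t) - chart_map c (\<gamma> 0)) \<le> \<rho>"
        using mM(1) by (subst (asm) ennreal_le_iff) (auto simp: \<rho>_def)
      then show ?thesis using \<gamma>(2) by (simp add: dist_norm norm_minus_commute)
    qed
    have in_U: "\<gamma> t \<in> U" if "t \<in> {0..1}" for t
    proof (rule ccontr)
      assume nU: "\<gamma> t \<notin> U"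
      \<comment> \<open>The parameters outside \<open>U\<close> form a compact set, whose least
        element \<open>t0\<close> is the first exit time.\<close>
      define A where "A = {0..1} \<inter> \<gamma> -` (- U)"
      have "closed A" unfolding A_def
        using T(3) U(1) by (intro continuous_closed_preimage) (auto simp: path_def)
      then have "compact ({0..1} \<inter> A)" by (intro compact_Int_closed compact_Icc)
      moreover have "{0..1} \<inter> A = A" by (auto simp: A_def)
      ultimately have "compact A" by simp
      moreover have "A \<noteq> {}" using nU that unfolding A_def by blast
      ultimately have "\<exists>t0\<in>A. \<forall>u\<in>A. t0 \<le> u" by (rule compact_attains_inf)
      then obtain t0 where t0: "t0 \<in> A" "\<And>u. u \<in> A \<Longrightarrow> t0 \<le> u" by auto
      have t01: "t0 \<in> {0..1}" "\<gamma> t0 \<notin> U" using t0(1) by (auto simp: A_def)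
      then have pos: "t0 > 0" using \<gamma>(2) U(3) by (cases "t0 = 0") auto
      define K where "K = chart_inv c ` cball (chart_map c x) \<rho>"
      have cb: "cball (chart_map c x) \<rho> \<subseteq> cball (chart_map c x) r" using \<rho> s by (intro subset_cball) auto
      have "compact K" unfolding K_def
        using cb r(2) by (intro compact_continuous_image continuous_on_subset[OF continuous_chart(2)[OF c]]) auto
      then have "closed K" by (rule compact_imp_closed)
      have "\<gamma> ` {0..<t0} \<subseteq> K"
      proof
        fix z assume "z \<in> \<gamma> ` {0..<t0}"
        then obtain u where u: "z = \<gamma> u" "0 \<le> u" "u < t0" by auto
        have "\<gamma> ` {0..u} \<subseteq> U"
        proof
          fix w assume "w \<in> \<gamma> ` {0..u}"
          then obtain v where v: "w = \<gamma> v" "0 \<le> v" "v \<le> u" by auto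
          then have "v \<notin> A" using t0(2)[of v] u by auto
          then show "w \<in> U" using v u t01(1) by (auto simp: A_def)
        qed
        then have "z \<in> U" "dist (chart_map c x) (chart_map c z) \<le> \<rho>"
          using bound[of u] u t01(1) by (auto simp: image_subset_iff)
        then have "dist (chart_map c x) (chart_map c z) \<le> \<rho>" "z \<in> dom_of c" using U(2) by auto
        then show "z \<in> K" unfolding K_def using c by (intro image_eqI[of _ _ "chart_map c z"]) auto
      qed
      then have "\<gamma> ` closure {0..<t0} \<subseteq> K"
        using T(3) t01 \<open>closed K\<close> pos by (intro image_closure_subset) (auto simp: path_def elim: continuous_on_subset)
      then have "\<gamma> t0 \<in> K" using pos by (auto simp: image_subset_iff)
      then obtain w where w: "\<gamma> t0 = chart_inv c w" "w \<in> cball (chart_map c x) \<rho>" by (auto simp: K_def)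
      then have "w \<in> chart_map c ` dom_of c" using cb r(2) by blast
      then have "\<gamma> t0 \<in> U" using w \<rho> chart_inv_dom[OF c] chart_map_inv[OF c] by (auto simp: U_def)
      then show False using t01 by simp
    qed
    have "\<gamma> 1 \<in> U" "dist (chart_map c x) (chart_map c (\<gamma> 1)) \<le> \<rho>"
      using in_U by (auto intro!: bound)
    then show "y \<in> dom_of c \<and> dist (chart_map c x) (chart_map c y) < s"
      using \<gamma>(3) \<rho> U(2) by auto
  qed (use r mM in auto)
qed

text \<open>The norm may be taken at any third point w of the ball. This freedom gives slope bounds
  in terms of the norm at one fixed point while both ends of the segment vary.\<close>

lemma edist_chart_upper:
  assumes c: "c \<in> \<A>" and x: "x \<in> dom_of c" and e: "(e::real) > 1"
  obtains r where "r > 0" "cball (chart_map c x) r \<subseteq> chart_map c ` dom_of c"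
    "\<And>y z w. y \<in> cball (chart_map c x) r \<Longrightarrow> z \<in> cball (chart_map c x) r \<Longrightarrow> w \<in> cball (chart_map c x) r \<Longrightarrow>
       edist (chart_inv c y) (chart_inv c z) \<le> ennreal (e * cnorm c (chart_inv c w) (z - y))"
proof -
  obtain r where r: "r > 0" "cball (chart_map c x) r \<subseteq> chart_map c ` dom_of c"
    "\<And>y z v. y \<in> cball (chart_map c x) r \<Longrightarrow> z \<in> cball (chart_map c x) r \<Longrightarrow>
       cnorm c (chart_inv c y) v \<le> e * cnorm c (chart_inv c z) v"
    using cnorm_local_comparison[OF c x e] by blast
  show ?thesis
    by (rule that[OF r(1,2)]) (rule edist_le_segment[OF c convex_cball r(2)], auto intro: r(3))
qed

end

section \<open>The distance as a metric that induces the given topology\<close>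

locale riem_connected = riem_manifold \<A> g
  for \<A> :: "('a::{t2_space, second_countable_topology}, 'n::finite) chart set" and g +
  assumes conn: "connected (UNIV :: 'a set)"
begin

abbreviation rdist :: "'a \<Rightarrow> 'a \<Rightarrow> real" where "rdist \<equiv> riemannian_dist \<A> g"

lemma edist_finite_nhd: "\<exists>V. open V \<and> x \<in> V \<and> (\<forall>y\<in>V. edist x y < top)"
proof -
  obtain c where c: "c \<in> \<A>" "x \<in> dom_of c" using chart_cover[of x] by blast
  have two: "1 < (2::real)" by simp
  obtain r where r: "r > 0" "cball (chart_map c x) r \<subseteq> chart_map c ` dom_of c"
    "\<And>y z w. y \<in> cball (chart_map c x) r \<Longrightarrow> z \<in> cball (chart_map c x) r \<Longrightarrow> w \<in> cball (chart_map c x) r \<Longrightarrow>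
       edist (chart_inv c y) (chart_inv c z) \<le> ennreal (2 * cnorm c (chart_inv c w) (z - y))"
    by (rule edist_chart_upper[OF c two]) (rule that)
  have "edist x y < top" if "y \<in> dom_of c" "chart_map c y \<in> ball (chart_map c x) r" for y
    using r(3)[of "chart_map c x" "chart_map c y" "chart_map c x"] that r(1) c
    by (auto intro: order_le_less_trans)
  then show ?thesis
    using open_chart_preimage[OF c(1) open_ball, of "chart_map c x" r] c r(1)
    by (intro exI[of _ "{y \<in> dom_of c. chart_map c y \<in> ball (chart_map c x) r}"]) auto
qed

text \<open>By finiteness near each point and the triangle inequality, the points at finite distance
  from x form an open set with open complement; connectedness concludes.\<close>

lemma edist_finite: "edist x y < top"
proof -
  define F where "F = {y. edist x y < top}"
  have tr: "edist x z < top" if "edist x y < top" "edist y z < top" for y z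
    using edist_triangle[of x z y] that by (auto simp: less_top[symmetric] top_unique)
  have "open F"
  proof (subst open_subopen, intro ballI)
    fix y assume y: "y \<in> F"
    obtain V where "open V" "y \<in> V" "\<forall>z\<in>V. edist y z < top" using edist_finite_nhd by blast
    then show "\<exists>T. open T \<and> y \<in> T \<and> T \<subseteq> F" using y tr by (intro exI[of _ V]) (auto simp: F_def)
  qed
  moreover have "open (- F)"
  proof (subst open_subopen, intro ballI)
    fix y assume y: "y \<in> - F"
    obtain V where V: "open V" "y \<in> V" "\<forall>z\<in>V. edist y z < top" using edist_finite_nhd by blast
    have "z \<in> - F" if "z \<in> V" for z
      using tr[of z y] y V(3) that edist_sym[of y z] by (auto simp: F_def)
    then show "\<exists>T. open T \<and> y \<in> T \<and> T \<subseteq> - F" using V by (intro exI[of _ V]) auto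
  qed
  moreover have "x \<in> F" by (simp add: F_def edist_refl)
  ultimately have "F = UNIV" using connectedD[OF conn, of F "- F"] by blast
  then show ?thesis by (auto simp: F_def)
qed

lemma ennreal_rdist: "ennreal (rdist x y) = edist x y"
  using edist_finite[of x y] by (simp add: riemannian_dist_eq)

lemma rdist_nonneg [simp]: "rdist x y \<ge> 0" by (simp add: riemannian_dist_eq)

lemma rdist_less_iff: "edist x y < ennreal e \<longleftrightarrow> rdist x y < e"
  by (simp add: ennreal_rdist[symmetric] ennreal_less_iff)

lemma rdist_le_iff: "0 \<le> e \<Longrightarrow> edist x y \<le> ennreal e \<longleftrightarrow> rdist x y \<le> e"
  by (simp add: ennreal_rdist[symmetric])

text \<open>By the lower chart bound, a point at distance 0 lies in a chart around x and within
  every s > 0 of x in coordinates.\<close>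

lemma rdist_eq_0: "rdist x y = 0 \<Longrightarrow> x = y"
proof -
  assume 0: "rdist x y = 0"
  obtain c where c: "c \<in> \<A>" "x \<in> dom_of c" using chart_cover[of x] by blast
  obtain r m where r: "r > 0" "m > 0" "\<And>s y. 0 < s \<Longrightarrow> s \<le> r \<Longrightarrow> edist x y < ennreal (m * s) \<Longrightarrow>
       y \<in> dom_of c \<and> dist (chart_map c x) (chart_map c y) < s"
    by (rule edist_chart_lower[OF c]) metis
  have y: "y \<in> dom_of c \<and> dist (chart_map c x) (chart_map c y) < s" if "0 < s" "s \<le> r" for s
    using that r(2) 0 by (intro r(3)) (auto simp: rdist_less_iff)
  have "dist (chart_map c x) (chart_map c y) \<le> 0"
  proof (rule ccontr)
    assume "\<not> ?thesis"
    then show False using y[of "min r (dist (chart_map c x) (chart_map c y))"] r(1) by auto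
  qed
  then have "chart_inv c (chart_map c x) = chart_inv c (chart_map c y)" by simp
  moreover have "y \<in> dom_of c" using y[of r] r(1) by simp
  ultimately show "x = y" using c by simp
qed

lemma rdist_metric: "Metric_space UNIV rdist"
proof
  fix x y z
  show "rdist x y = 0 \<longleftrightarrow> x = y"
    using rdist_eq_0 by (auto simp: riemannian_dist_eq edist_refl)
  show "rdist x y = rdist y x" by (simp only: riemannian_dist_eq edist_sym[of x y])
  have "ennreal (rdist x z) \<le> ennreal (rdist x y + rdist y z)"
    using edist_triangle[of x z y] unfolding ennreal_rdist[symmetric] by (simp only: ennreal_plus rdist_nonneg)
  then show "rdist x z \<le> rdist x y + rdist y z"
    using ennreal_le_iff[of "rdist x y + rdist y z" "rdist x z"] rdist_nonneg[of x y] rdist_nonneg[of y z] by linarith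
qed simp

sublocale RM: Metric_space UNIV rdist by (rule rdist_metric)

lemma rdist_nhd:
  assumes "e > 0" shows "\<exists>V. open V \<and> x \<in> V \<and> (\<forall>y\<in>V. rdist x y < e)"
proof -
  obtain c where c: "c \<in> \<A>" "x \<in> dom_of c" using chart_cover[of x] by blast
  have two: "1 < (2::real)" by simp
  obtain r where r: "r > 0" "cball (chart_map c x) r \<subseteq> chart_map c ` dom_of c"
    "\<And>y z w. y \<in> cball (chart_map c x) r \<Longrightarrow> z \<in> cball (chart_map c x) r \<Longrightarrow> w \<in> cball (chart_map c x) r \<Longrightarrow>
       edist (chart_inv c y) (chart_inv c z) \<le> ennreal (2 * cnorm c (chart_inv c w) (z - y))"
    by (rule edist_chart_upper[OF c two]) (rule that)
  obtain M where M: "M > 0" "\<And>v. cnorm c x v \<le> M * norm v"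
    using cnorm_euclid_comparison[OF c] by metis
  define d where "d = min r (e / (2 * M))"
  have d: "d > 0" "d \<le> r" "2 * M * d \<le> e" using r(1) M(1) assms by (auto simp: d_def field_simps min_def)
  have "rdist x y < e" if "y \<in> dom_of c" "chart_map c y \<in> ball (chart_map c x) d" for y
  proof -
    have lt: "norm (chart_map c y - chart_map c x) < d" using that by (simp add: dist_norm norm_minus_commute)
    have "edist x y \<le> ennreal (2 * cnorm c x (chart_map c y - chart_map c x))"
      using r(3)[of "chart_map c x" "chart_map c y" "chart_map c x"] that d r(1) c by auto
    then have "rdist x y \<le> 2 * cnorm c x (chart_map c y - chart_map c x)"
      using cnorm_nonneg[OF c] by (subst (asm) rdist_le_iff) auto
    also have "\<dots> \<le> 2 * M * norm (chart_map c y - chart_map c x)" using M(2)[of "chart_map c y - chart_map c x"] by simp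
    also have "\<dots> < 2 * M * d" using lt M(1) by simp
    finally show ?thesis using d by simp
  qed
  then show ?thesis
    using open_chart_preimage[OF c(1) open_ball, of "chart_map c x" d] c d(1)
    by (intro exI[of _ "{y \<in> dom_of c. chart_map c y \<in> ball (chart_map c x) d}"]) auto
qed

text \<open>Upper chart bounds make metric balls neighbourhoods in the given topology; lower chart
  bounds fit metric balls into given open sets.\<close>

lemma mtopology_eq: "RM.mtopology = euclidean"
proof -
  have "openin RM.mtopology U \<longleftrightarrow> open U" for U
  proof
    assume U: "openin RM.mtopology U"
    show "open U"
    proof (subst open_subopen, intro ballI)
      fix x assume "x \<in> U"
      then obtain r where "r > 0" "RM.mball x r \<subseteq> U" using U RM.openin_mtopology by blast
      moreover obtain V where "open V" "x \<in> V" "\<forall>y\<in>V. rdist x y < r" using rdist_nhd[OF \<open>r > 0\<close>] by blast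
      ultimately show "\<exists>T. open T \<and> x \<in> T \<and> T \<subseteq> U" by (intro exI[of _ V]) auto
    qed
  next
    assume U: "open U"
    show "openin RM.mtopology U" unfolding RM.openin_mtopology
    proof (intro conjI allI impI)
      fix x assume x: "x \<in> U"
      obtain c where c: "c \<in> \<A>" "x \<in> dom_of c" using chart_cover[of x] by blast
      obtain r m where r: "r > 0" "m > 0" "\<And>s y. 0 < s \<Longrightarrow> s \<le> r \<Longrightarrow> edist x y < ennreal (m * s) \<Longrightarrow>
           y \<in> dom_of c \<and> dist (chart_map c x) (chart_map c y) < s"
        by (rule edist_chart_lower[OF c]) metis
      have "chart_map c x \<in> chart_map c ` (U \<inter> dom_of c)" using x c(2) by blast
      with open_chart_image[OF c(1) U] obtain s where s: "s > 0" "ball (chart_map c x) s \<subseteq> chart_map c ` (U \<inter> dom_of c)"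
        by (rule openE)
      have "y \<in> U" if "rdist x y < m * min s r" for y
      proof -
        have y: "y \<in> dom_of c" "dist (chart_map c x) (chart_map c y) < min s r"
          using r(3)[of "min s r" y] that s(1) r(1) by (auto simp: rdist_less_iff)
        then have "chart_map c y \<in> chart_map c ` (U \<inter> dom_of c)" using s(2) by auto
        then obtain z where z: "z \<in> U" "z \<in> dom_of c" "chart_map c y = chart_map c z" by blast
        then have "chart_inv c (chart_map c y) = chart_inv c (chart_map c z)" by simp
        then have "y = z" unfolding chart_inv_map[OF c(1) y(1)] chart_inv_map[OF c(1) z(2)] .
        then show ?thesis using z(1) by simp
      qed
      then show "\<exists>r>0. RM.mball x r \<subseteq> U" using s(1) r by (intro exI[of _ "m * min s r"]) auto
    qed simp
  qed
  then show ?thesis by (simp add: topology_eq)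
qed

lemma open_mball: "open (RM.mball x r)"
  using RM.openin_mball[of x r] by (simp add: mtopology_eq)

lemma closed_mcball: "closed (RM.mcball x r)"
  using RM.closedin_mcball[of x r] by (simp add: mtopology_eq closed_closedin[symmetric])

lemma continuous_rdist: "continuous_on S (rdist x)"
proof (rule continuous_at_imp_continuous_on, rule ballI)
  fix y show "isCont (rdist x) y" unfolding continuous_at
  proof (rule tendstoI)
    fix e :: real assume "e > 0"
    then obtain V where V: "open V" "y \<in> V" "\<forall>z\<in>V. rdist y z < e" using rdist_nhd by blast
    have "dist (rdist x z) (rdist x y) < e" if "z \<in> V" for z
      using V(3) that RM.triangle[of x y z] RM.triangle[of x z y] RM.commute[of z y] by (force simp: dist_real_def)
    then show "\<forall>\<^sub>F z in at y. dist (rdist x z) (rdist x y) < e"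
      using V by (auto simp: eventually_at_topological)
  qed
qed

text \<open>On a curve from x to y of length below their distance plus e, the distance from x takes
  the value s by the intermediate value theorem; the part of the curve behind that point bounds the
  remaining distance.\<close>

lemma rdist_split:
  assumes s: "0 \<le> s" "s \<le> rdist x y" and e: "e > 0"
  shows "\<exists>z. rdist x z = s \<and> rdist z y \<le> rdist x y - s + e"
proof -
  have "edist x y < ennreal (rdist x y + e)" unfolding rdist_less_iff using e by simp
  then obtain \<gamma> where \<gamma>: "piecewise_C1_curve \<A> \<gamma>" "\<gamma> 0 = x" "\<gamma> 1 = y" "curve_length \<A> g \<gamma> < ennreal (rdist x y + e)"
    by (rule edist_lessE)
  have "path \<gamma>" using \<gamma>(1) by (simp add: piecewise_C1_curve_def)
  then have "continuous_on {0..1} (\<lambda>t. rdist x (\<gamma> t))"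
    unfolding path_def by (rule continuous_on_compose2[OF continuous_rdist]) auto
  then obtain t where t: "0 \<le> t" "t \<le> 1" "rdist x (\<gamma> t) = s"
    using IVT'[of "\<lambda>t. rdist x (\<gamma> t)" 0 s 1] s \<gamma>(2,3) by auto
  show ?thesis
  proof (cases "t = 0 \<or> t = 1")
    case True
    then show ?thesis using t \<gamma>(2,3) e by (intro exI[of _ "\<gamma> t"]) auto
  next
    case False
    then have "edist x (\<gamma> t) + edist (\<gamma> t) y \<le> curve_length \<A> g \<gamma>"
      using edist_split[OF \<gamma>(1), of t] t \<gamma>(2,3) by simp
    also have "\<dots> \<le> ennreal (rdist x y + e)" using \<gamma>(4) by simp
    finally have "ennreal (s + rdist (\<gamma> t) y) \<le> ennreal (rdist x y + e)"
      using t(3) s by (simp add: ennreal_rdist[symmetric] ennreal_plus)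
    moreover have "0 \<le> rdist x y + e" using e by (simp add: add_nonneg_nonneg)
    ultimately have "s + rdist (\<gamma> t) y \<le> rdist x y + e" by (simp only: ennreal_le_iff)
    then show ?thesis using t(3) by (intro exI[of _ "\<gamma> t"]) simp
  qed
qed

lemma compact_nhd:
  obtains V N where "open V" "x \<in> V" "V \<subseteq> N" "compact (N :: 'a set)"
proof -
  obtain c where c: "c \<in> \<A>" "x \<in> dom_of c" using chart_cover[of x] by blast
  obtain r where r: "r > 0" "cball (chart_map c x) r \<subseteq> chart_map c ` dom_of c"
    using open_range[OF c(1)] c(2) open_contains_cball by blast
  show ?thesis
  proof (rule that)
    show "open {y \<in> dom_of c. chart_map c y \<in> ball (chart_map c x) r}"
      by (rule open_chart_preimage[OF c(1) open_ball])
    show "compact (chart_inv c ` cball (chart_map c x) r)"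
      using r(2) by (intro compact_continuous_image continuous_on_subset[OF continuous_chart(2)[OF c(1)]]) auto
    show "{y \<in> dom_of c. chart_map c y \<in> ball (chart_map c x) r} \<subseteq> chart_inv c ` cball (chart_map c x) r"
    proof
      fix y assume "y \<in> {y \<in> dom_of c. chart_map c y \<in> ball (chart_map c x) r}"
      then show "y \<in> chart_inv c ` cball (chart_map c x) r"
        using c by (intro image_eqI[of _ _ "chart_map c y"]) auto
    qed
    show "x \<in> {y \<in> dom_of c. chart_map c y \<in> ball (chart_map c x) r}" using c(2) r(1) by simp
  qed
qed

end

section \<open>Compactness of closed balls in a complete manifold\<close>

locale riem_complete = riem_connected \<A> g
  for \<A> :: "('a::{t2_space, second_countable_topology}, 'n::finite) chart set" and g +
  assumes complete: "complete_manifold \<A> g"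
begin

lemma mcomplete: "RM.mcomplete" using complete by (simp add: complete_manifold_def)

text \<open>A finite net of a slightly smaller closed ball is a coarser net of the larger one, since
  the further points are close to the sphere of the smaller radius. So the ball is totally bounded,
  and completeness makes it compact.\<close>

lemma compact_mcball_limit:
  assumes \<rho>: "\<rho> > 0" and P: "\<And>r. 0 \<le> r \<Longrightarrow> r < \<rho> \<Longrightarrow> compact (RM.mcball x r)"
  shows "compact (RM.mcball x \<rho>)"
proof -
  have "RM.mtotally_bounded (RM.mcball x \<rho>)"
    unfolding RM.mtotally_bounded_def
  proof (intro allI impI)
    fix e :: real assume e: "e > 0"
    \<comment> \<open>Budget: e/4 for the net, e/4 for \<rho> - r and e/4 for the inexact splitting
      of distances. The maximum with 0 keeps r a nonnegative radius.\<close>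
    define r where "r = max 0 (\<rho> - e/4)"
    have r: "0 \<le> r" "r < \<rho>" "\<rho> - r \<le> e/4" using e \<rho> by (auto simp: r_def max_def)
    have "compactin RM.mtopology (RM.mcball x r)" using P[OF r(1,2)] by (simp add: mtopology_eq)
    then have "RM.mtotally_bounded (RM.mcball x r)" by (rule RM.compactin_imp_mtotally_bounded)
    then obtain K where K: "finite K" "K \<subseteq> RM.mcball x r" "RM.mcball x r \<subseteq> (\<Union>k\<in>K. RM.mball k (e/4))"
      unfolding RM.mtotally_bounded_def using e by (metis zero_less_divide_iff zero_less_numeral)
    have "y \<in> (\<Union>k\<in>K. RM.mball k e)" if y: "rdist x y \<le> \<rho>" for y
    proof (cases "rdist x y \<le> r")
      case True
      then obtain k where "k \<in> K" "rdist k y < e/4" using K(3) by force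
      then show ?thesis using e by force
    next
      case False
      then obtain z where z: "rdist x z = r" "rdist z y \<le> rdist x y - r + e/4"
        using rdist_split[of r x y "e/4"] r e by auto
      then obtain k where k: "k \<in> K" "rdist k z < e/4" using K(3) by force
      have "rdist k y < e" using RM.triangle[of k z y] k z y r e by simp
      then show ?thesis using k by auto
    qed
    then have "RM.mcball x \<rho> \<subseteq> (\<Union>k\<in>K. RM.mball k e)" by auto
    moreover have "K \<subseteq> RM.mcball x \<rho>" using K(2) r by force
    ultimately show "\<exists>K. finite K \<and> K \<subseteq> RM.mcball x \<rho> \<and> RM.mcball x \<rho> \<subseteq> (\<Union>k\<in>K. RM.mball k e)" using K(1) by blast
  qed
  then have "compactin RM.mtopology (RM.mtopology closure_of RM.mcball x \<rho>)"
    using RM.mtotally_bounded_eq_compact_closure_of[OF mcomplete] by blast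
  moreover have "RM.mtopology closure_of RM.mcball x \<rho> = RM.mcball x \<rho>"
    unfolding closure_of_eq by (rule RM.closedin_mcball)
  ultimately show ?thesis by (simp add: mtopology_eq)
qed

text \<open>Finitely many balls of radius \<open>d y\<close> cover the compact ball, and their
  doubles lie in compact sets. With \<delta> the least of these radii, points within \<delta> of the
  ball still lie in the doubles.\<close>

lemma compact_mcball_extend:
  assumes \<rho>: "\<rho> \<ge> 0" and P: "compact (RM.mcball x \<rho>)"
  shows "\<exists>d>0. compact (RM.mcball x (\<rho> + d))"
proof -
  obtain V N where VN: "\<And>y. open (V y) \<and> y \<in> V y \<and> V y \<subseteq> N y \<and> compact (N y :: 'a set)"
  proof -
    have "\<forall>y::'a. \<exists>V N. open V \<and> y \<in> V \<and> V \<subseteq> N \<and> compact (N :: 'a set)"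
    proof
      fix y :: 'a
      obtain V N where "open V" "y \<in> V" "V \<subseteq> N" "compact (N :: 'a set)" by (rule compact_nhd)
      then show "\<exists>V N. open V \<and> y \<in> V \<and> V \<subseteq> N \<and> compact (N :: 'a set)" by blast
    qed
    then show thesis using that by metis
  qed
  have "\<exists>d>0. RM.mball y (2 * d) \<subseteq> V y" for y
  proof -
    have "openin RM.mtopology (V y)" using VN by (simp add: mtopology_eq)
    then obtain d where "d > 0" "RM.mball y d \<subseteq> V y" using VN unfolding RM.openin_mtopology by blast
    then show ?thesis by (intro exI[of _ "d/2"]) auto
  qed
  then obtain d where d: "\<And>y. d y > 0" "\<And>y. RM.mball y (2 * d y) \<subseteq> V y" by metis
  have "RM.mcball x \<rho> \<subseteq> (\<Union>y\<in>UNIV. RM.mball y (d y))" using d(1) by (auto intro!: exI)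
  then obtain F where F: "finite F" "RM.mcball x \<rho> \<subseteq> (\<Union>y\<in>F. RM.mball y (d y))"
    using compactE_image[OF P, of UNIV "\<lambda>y. RM.mball y (d y)"] open_mball by (metis subset_UNIV)
  have "x \<in> RM.mcball x \<rho>" using \<rho> by simp
  then have Fne: "F \<noteq> {}" using F(2) by auto
  define \<delta> where "\<delta> = Min (d ` F)"
  have \<delta>: "\<delta> > 0" "\<And>y. y \<in> F \<Longrightarrow> \<delta> \<le> d y" using F(1) Fne d(1) by (auto simp: \<delta>_def)
  have comp: "compact (\<Union>y\<in>F. N y)" using F(1) VN by (intro compact_UN) auto
  have "y \<in> (\<Union>y\<in>F. N y)" if y: "rdist x y \<le> \<rho> + \<delta>/2" for y
  proof -
    obtain z where z: "rdist x z \<le> \<rho>" "rdist z y < \<delta>"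
    proof (cases "rdist x y \<le> \<rho>")
      case True
      then show ?thesis using that[of y] \<delta>(1) by simp
    next
      case False
      then obtain z where "rdist x z = \<rho>" "rdist z y \<le> rdist x y - \<rho> + \<delta>/4"
        using rdist_split[of \<rho> x y "\<delta>/4"] \<rho> \<delta>(1) by auto
      then show ?thesis using that[of z] y \<delta>(1) by simp
    qed
    then obtain k where k: "k \<in> F" "rdist k z < d k" using F(2) by force
    have "rdist k y < 2 * d k" using RM.triangle[of k z y] k z \<delta>(2)[OF k(1)] by simp
    then have "y \<in> V k" using d(2)[of k] by auto
    then show ?thesis using k VN by blast
  qed
  then have "RM.mcball x (\<rho> + \<delta>/2) \<subseteq> (\<Union>y\<in>F. N y)" by auto
  then have "compact (RM.mcball x (\<rho> + \<delta>/2))"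
    using compact_Int_closed[OF comp closed_mcball, of x "\<rho> + \<delta>/2"] by (simp add: Int_absorb1)
  then show ?thesis using \<delta>(1) by (intro exI[of _ "\<delta>/2"]) auto
qed

text \<open>The radii with compact balls form a downward closed set. If it were bounded, its
  supremum would belong to it by the limit lemma and could be exceeded by the extension
  lemma.\<close>

theorem Hopf_Rinow: "compact (RM.mcball x R)"
proof (rule ccontr)
  assume nc: "\<not> compact (RM.mcball x R)"
  define P where "P r \<longleftrightarrow> compact (RM.mcball x r)" for r
  have mono: "P r" if "P s" "r \<le> s" for r s
  proof -
    have "RM.mcball x r \<subseteq> RM.mcball x s" using that by auto
    then show ?thesis
      using that(1) compact_Int_closed[of "RM.mcball x s", OF _ closed_mcball, of x r] by (simp add: P_def Int_absorb1)
  qed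
  define S where "S = {r. 0 \<le> r \<and> P r}"
  have "y = x" if "rdist x y \<le> 0" for y
    using rdist_eq_0[of x y] antisym[OF that rdist_nonneg] by simp
  then have "RM.mcball x 0 = {x}" by auto
  then have 0: "0 \<in> S" by (simp add: S_def P_def)
  have bdd: "r \<le> R" if "r \<in> S" for r
  proof (rule ccontr)
    assume "\<not> r \<le> R"
    then have "P R" using that mono[of r R] by (simp add: S_def)
    then show False using nc by (simp add: P_def)
  qed
  define \<rho> where "\<rho> = Sup S"
  have bS: "bdd_above S" using bdd by (auto simp: bdd_above_def)
  have \<rho>0: "\<rho> \<ge> 0" unfolding \<rho>_def using 0 bS by (rule cSup_upper)
  have below: "P r" if "r < \<rho>" for r
  proof -
    have "S \<noteq> {}" using 0 by blast
    then have "\<exists>s\<in>S. r < s" using that unfolding \<rho>_def by (simp add: less_cSup_iff bS)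
    then obtain s where "s \<in> S" "r < s" by blast
    then show ?thesis using mono[of s r] by (auto simp: S_def)
  qed
  have "P \<rho>"
  proof (cases "\<rho> = 0")
    case True then show ?thesis using 0 by (simp add: S_def)
  next
    case False
    then show ?thesis using \<rho>0 below compact_mcball_limit[of \<rho> x] by (simp add: P_def)
  qed
  then obtain d where "d > 0" "P (\<rho> + d)" using compact_mcball_extend[OF \<rho>0] by (auto simp: P_def)
  then have "\<rho> + d \<in> S" using \<rho>0 by (simp add: S_def)
  then have "\<rho> + d \<le> \<rho>" unfolding \<rho>_def using bS by (rule cSup_upper)
  then show False using \<open>d > 0\<close> by simp
qed

lemma compact_closure_mball: "compact (closure (RM.mball x R))"
proof -
  have "closure (RM.mball x R) \<subseteq> RM.mcball x R"
    by (rule closure_minimal[OF _ closed_mcball]) auto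
  then show ?thesis
    using compact_Int_closed[OF Hopf_Rinow[of x R] closed_closure, of "RM.mball x R"] by (simp add: Int_absorb1)
qed

end

section \<open>Volume and weak gradients\<close>

locale riem_volume = riem_complete \<A> g
  for \<A> :: "('a::{t2_space, second_countable_topology}, 'n::finite) chart set" and g +
  fixes vol :: "'a measure"
  assumes volume: "riemannian_volume \<A> g vol"
begin

lemma space_vol [simp]: "space vol = UNIV"
  and sets_vol: "B \<in> sets vol \<longleftrightarrow> (\<forall>c\<in>\<A>. chart_map c ` (B \<inter> dom_of c) \<in> sets lebesgue)"
  and emeasure_vol: "c \<in> \<A> \<Longrightarrow> B \<in> sets vol \<Longrightarrow> B \<subseteq> dom_of c \<Longrightarrow> emeasure vol B =
     (\<integral>\<^sup>+y\<in>chart_map c ` B. ennreal (sqrt (gram_det \<A> g c (chart_inv c y))) \<partial>lebesgue)"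
  using volume unfolding riemannian_volume_def by blast+

lemma open_lebesgue: "open (S :: (real^'m::finite) set) \<Longrightarrow> S \<in> sets lebesgue"
  by (rule sets_completionI_sets) simp

lemma open_sets_vol: "open U \<Longrightarrow> U \<in> sets vol"
  unfolding sets_vol using open_lebesgue[OF open_chart_image] by simp

lemma borel_sets_vol: "B \<in> sets borel \<Longrightarrow> B \<in> sets vol"
proof -
  have "sigma_sets UNIV {S :: 'a set. open S} \<subseteq> sets vol"
    using sets.sigma_sets_subset[of "{S. open S}" vol] open_sets_vol by auto
  then show "B \<in> sets borel \<Longrightarrow> B \<in> sets vol" by (auto simp: borel_def)
qed

lemma closed_sets_vol: "closed S \<Longrightarrow> S \<in> sets vol"
  by (intro borel_sets_vol borel_closed)

lemma compact_sets_vol: "compact S \<Longrightarrow> S \<in> sets vol"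
  by (intro closed_sets_vol compact_imp_closed)

lemma measurable_vol_borel: "f \<in> borel_measurable borel \<Longrightarrow> f \<in> borel_measurable vol"
  by (rule measurableI) (auto intro!: borel_sets_vol dest: measurable_sets simp: vimage_def)

lemma measurable_continuous_vol:
  fixes f :: "'a \<Rightarrow> 'b::topological_space"
  assumes "continuous_on U f" "open U" shows "f \<in> borel_measurable (restrict_space vol U)"
proof (rule borel_measurableI)
  fix S :: "'b set" assume "open S"
  then have "open (U \<inter> f -` S)" using continuous_open_preimage[OF assms] by blast
  then have "U \<inter> f -` S \<in> sets vol" by (rule open_sets_vol)
  then have "f -` S \<inter> U \<in> sets (restrict_space vol U)"
    by (auto simp: sets_restrict_space_iff open_sets_vol[OF assms(2)] Int_commute)
  then show "f -` S \<inter> space (restrict_space vol U) \<in> sets (restrict_space vol U)"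
    by (simp add: space_restrict_space)
qed

lemma dom_sets_vol: "c \<in> \<A> \<Longrightarrow> dom_of c \<in> sets vol"
  by (intro open_sets_vol open_dom)

lemma chart_image_sets: "c \<in> \<A> \<Longrightarrow> B \<in> sets vol \<Longrightarrow> chart_map c ` (B \<inter> dom_of c) \<in> sets lebesgue"
  by (simp add: sets_vol)

text \<open>Lindelof's theorem for the chart domains. Countability lets measurability and almost
  everywhere statements be checked one chart at a time.\<close>

lemma countable_charts: obtains C where "countable C" "C \<subseteq> \<A>" "(\<Union>c\<in>C. dom_of c) = UNIV"
proof -
  have "open S" if "S \<in> fst ` \<A>" for S using that open_dom by auto
  then obtain F where F: "F \<subseteq> fst ` \<A>" "countable F" "\<Union>F = \<Union>(fst ` \<A>)" by (rule Lindelof)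
  obtain C where C: "C \<subseteq> \<A>" "F = fst ` C" "inj_on fst C"
    using F(1) by (metis subset_image_inj)
  have "countable C" using F(2) C countable_image_inj_on by blast
  moreover have "(\<Union>c\<in>C. dom_of c) = UNIV"
  proof (rule UNIV_eq_I[symmetric])
    fix x
    obtain c where "c \<in> \<A>" "x \<in> dom_of c" by (rule chart_cover)
    then have "x \<in> \<Union>F" unfolding F(3) by blast
    then show "x \<in> (\<Union>c\<in>C. dom_of c)" unfolding C(2) .
  qed
  ultimately show ?thesis using C(1) that by blast
qed

lemma measurable_chart_inv:
  assumes c: "c \<in> \<A>"
  shows "chart_inv c \<in> measurable (lebesgue_on (chart_map c ` dom_of c)) (restrict_space vol (dom_of c))"
proof (rule measurableI)
  show "chart_inv c x \<in> space (restrict_space vol (dom_of c))" if "x \<in> space (lebesgue_on (chart_map c ` dom_of c))" for x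
    using that chart_inv_dom[OF c] by (simp add: space_restrict_space)
  fix B assume "B \<in> sets (restrict_space vol (dom_of c))"
  then have B: "B \<in> sets vol" "B \<subseteq> dom_of c" using dom_sets_vol[OF c] by (auto simp: sets_restrict_space_iff)
  have "chart_inv c -` B \<inter> chart_map c ` dom_of c = chart_map c ` (B \<inter> dom_of c)"
    unfolding chart_image_eq[OF c] by auto
  then show "chart_inv c -` B \<inter> space (lebesgue_on (chart_map c ` dom_of c)) \<in> sets (lebesgue_on (chart_map c ` dom_of c))"
    using chart_image_sets[OF c B(1)] open_lebesgue[OF open_range[OF c]]
    by (auto simp: sets_restrict_space_iff space_restrict_space)
qed

definition density_of :: "('a, 'n) chart \<Rightarrow> real^'n \<Rightarrow> real" where
  "density_of c y = sqrt (gram_det \<A> g c (chart_inv c y))"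

lemma density_of_pos: "c \<in> \<A> \<Longrightarrow> y \<in> chart_map c ` dom_of c \<Longrightarrow> density_of c y > 0"
  unfolding density_of_def using gram_det_pos chart_inv_dom by simp

lemma continuous_density_of: "c \<in> \<A> \<Longrightarrow> continuous_on (chart_map c ` dom_of c) (density_of c)"
  unfolding density_of_def by (intro continuous_intros continuous_gram_det)

lemma range_lebesgue: "c \<in> \<A> \<Longrightarrow> chart_map c ` dom_of c \<in> sets lebesgue"
  using open_lebesgue[OF open_range] .

lemma measurable_density_of: "c \<in> \<A> \<Longrightarrow> density_of c \<in> borel_measurable (lebesgue_on (chart_map c ` dom_of c))"
  by (intro continuous_imp_measurable_on_sets_lebesgue continuous_density_of range_lebesgue)

text \<open>On the chart domain the volume is the image, under the inverse chart, of Lebesgue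
  measure with density \<open>density_of c\<close>: both agree on measurable sets by the defining
  formula.\<close>

lemma nn_integral_chart:
  assumes c: "c \<in> \<A>" and f: "f \<in> borel_measurable (restrict_space vol (dom_of c))"
  shows "(\<integral>\<^sup>+x\<in>dom_of c. f x \<partial>vol)
    = (\<integral>\<^sup>+y\<in>chart_map c ` dom_of c. f (chart_inv c y) * ennreal (density_of c y) \<partial>lebesgue)"
proof -
  let ?W = "chart_map c ` dom_of c"
  let ?L = "lebesgue_on ?W" and ?V = "restrict_space vol (dom_of c)"
  have w: "(\<lambda>y. ennreal (density_of c y)) \<in> borel_measurable ?L" using measurable_density_of[OF c] by simp
  note ci = measurable_chart_inv[OF c]
  have eq: "?V = distr (density ?L (\<lambda>y. ennreal (density_of c y))) ?V (chart_inv c)"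
  proof (rule measure_eqI)
    fix B assume B': "B \<in> sets ?V"
    then have B: "B \<in> sets vol" "B \<subseteq> dom_of c" using dom_sets_vol[OF c] by (auto simp: sets_restrict_space_iff)
    have im: "chart_inv c -` B \<inter> ?W = chart_map c ` B"
      using chart_image_eq[OF c, of B] B(2) by (auto simp: Int_absorb2)
    have "emeasure ?V B = emeasure vol B"
      using B dom_sets_vol[OF c] by (intro emeasure_restrict_space) auto
    also have "\<dots> = (\<integral>\<^sup>+y. ennreal (density_of c y) * indicator (chart_map c ` B) y \<partial>lebesgue)"
      unfolding density_of_def by (rule emeasure_vol[OF c B])
    also have "\<dots> = (\<integral>\<^sup>+y. ennreal (density_of c y) * indicator (chart_map c ` B) y \<partial>?L)"
    proof (subst nn_integral_restrict_space)
      have "chart_map c ` B \<subseteq> ?W" using B(2) by blast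
      then show "(\<integral>\<^sup>+y. ennreal (density_of c y) * indicator (chart_map c ` B) y \<partial>lebesgue)
        = (\<integral>\<^sup>+y. ennreal (density_of c y) * indicator (chart_map c ` B) y * indicator ?W y \<partial>lebesgue)"
        by (intro nn_integral_cong) (auto simp: indicator_def)
    qed (simp add: range_lebesgue[OF c])
    also have "\<dots> = emeasure (density ?L (\<lambda>y. ennreal (density_of c y))) (chart_map c ` B)"
      using w measurable_sets[OF ci B'] im by (subst emeasure_density) (auto simp: space_restrict_space)
    also have "\<dots> = emeasure (distr (density ?L (\<lambda>y. ennreal (density_of c y))) ?V (chart_inv c)) B"
      using ci B' im by (subst emeasure_distr) (auto simp: space_restrict_space)
    finally show "emeasure ?V B = emeasure (distr (density ?L (\<lambda>y. ennreal (density_of c y))) ?V (chart_inv c)) B" .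
  qed simp
  have fc: "(\<lambda>y. f (chart_inv c y)) \<in> borel_measurable ?L" using measurable_compose[OF ci f] .
  have "(\<integral>\<^sup>+x\<in>dom_of c. f x \<partial>vol) = (\<integral>\<^sup>+x. f x \<partial>?V)"
    using dom_sets_vol[OF c] by (subst nn_integral_restrict_space) auto
  also have "\<dots> = (\<integral>\<^sup>+y. f (chart_inv c y) \<partial>density ?L (\<lambda>y. ennreal (density_of c y)))"
    by (subst eq) (use ci f in \<open>auto intro!: nn_integral_distr\<close>)
  also have "\<dots> = (\<integral>\<^sup>+y. ennreal (density_of c y) * f (chart_inv c y) \<partial>?L)"
    using fc w by (intro nn_integral_density) auto
  also have "\<dots> = (\<integral>\<^sup>+y\<in>?W. f (chart_inv c y) * ennreal (density_of c y) \<partial>lebesgue)"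
    using range_lebesgue[OF c] by (subst nn_integral_restrict_space) (auto simp: mult.commute)
  finally show ?thesis .
qed

text \<open>A null set of the volume has zero weighted Lebesgue integral in the chart, and the
  weight is positive.\<close>

lemma AE_chart_of_vol:
  assumes c: "c \<in> \<A>" and ae: "AE x in vol. P x"
  shows "AE y in lebesgue. y \<in> chart_map c ` dom_of c \<longrightarrow> P (chart_inv c y)"
proof -
  let ?W = "chart_map c ` dom_of c"
  obtain N where N: "N \<in> null_sets vol" "{x. \<not> P x} \<subseteq> N" using ae unfolding eventually_ae_filter by auto
  have Ns: "N \<in> sets vol" using N by auto
  have iN: "(indicator N :: 'a \<Rightarrow> ennreal) \<in> borel_measurable (restrict_space vol (dom_of c))"
    using Ns by (intro measurable_restrict_space1) simp
  have "(\<integral>\<^sup>+y\<in>?W. indicator N (chart_inv c y) * ennreal (density_of c y) \<partial>lebesgue) = (\<integral>\<^sup>+x\<in>dom_of c. indicator N x \<partial>vol)"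
    by (rule nn_integral_chart[OF c iN, symmetric])
  also have "\<dots> \<le> (\<integral>\<^sup>+x. indicator N x \<partial>vol)" by (intro nn_integral_mono) (auto simp: indicator_def)
  also have "\<dots> = 0" using N(1) Ns by (simp add: null_setsD1)
  finally have 0: "(\<integral>\<^sup>+y\<in>?W. indicator N (chart_inv c y) * ennreal (density_of c y) \<partial>lebesgue) = 0" by simp
  have m: "(\<lambda>y. indicator N (chart_inv c y) * ennreal (density_of c y)) \<in> borel_measurable (lebesgue_on ?W)"
    using measurable_compose[OF measurable_chart_inv[OF c] iN] measurable_density_of[OF c] by simp
  then have "(\<lambda>y. indicator N (chart_inv c y) * ennreal (density_of c y) * indicator ?W y) \<in> borel_measurable lebesgue"
    using range_lebesgue[OF c] by (subst (asm) borel_measurable_restrict_space_iff_ennreal) auto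
  then have "AE y in lebesgue. indicator N (chart_inv c y) * ennreal (density_of c y) * indicator ?W y = 0"
    using 0 by (subst (asm) nn_integral_0_iff_AE) auto
  then show ?thesis
  proof eventually_elim
    case (elim y)
    show ?case
    proof
      assume y: "y \<in> ?W"
      then have "chart_inv c y \<notin> N" using elim density_of_pos[OF c y] by (auto simp: indicator_def split: if_splits)
      then show "P (chart_inv c y)" using N(2) by blast
    qed
  qed
qed

text \<open>The defining formula for the volume speaks of measurable sets, so the exceptional set is
  assumed measurable; it is null because its chart image is.\<close>

lemma AE_vol_of_chart:
  assumes c: "c \<in> \<A>" and m: "{x \<in> dom_of c. \<not> P x} \<in> sets vol"
    and ae: "AE y in lebesgue. y \<in> chart_map c ` dom_of c \<longrightarrow> P (chart_inv c y)"
  shows "AE x in vol. x \<in> dom_of c \<longrightarrow> P x"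
proof -
  let ?N = "{x \<in> dom_of c. \<not> P x}"
  have "emeasure vol ?N = (\<integral>\<^sup>+y. ennreal (sqrt (gram_det \<A> g c (chart_inv c y))) * indicator (chart_map c ` ?N) y \<partial>lebesgue)"
    by (rule emeasure_vol[OF c m]) auto
  also have "\<dots> = (\<integral>\<^sup>+(y::real^'n). 0 \<partial>lebesgue)"
  proof (rule nn_integral_cong_AE)
    show "AE y in lebesgue. ennreal (sqrt (gram_det \<A> g c (chart_inv c y))) * indicator (chart_map c ` ?N) y = 0"
      using ae
    proof eventually_elim
      case (elim y)
      have "y \<notin> chart_map c ` ?N" using elim c by auto
      then show ?case by simp
    qed
  qed
  finally have "?N \<in> null_sets vol" using m by auto
  then show ?thesis by (rule AE_I'[of ?N]) auto
qed

text \<open>The density is continuous and positive, hence at least some w > 0 on the compact image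
  of \<open>K\<close>; Lebesgue integrals of absolute values there are at most 1/w times the
  integrals against the volume.\<close>

lemma set_integrable_chart:
  assumes c: "c \<in> \<A>" and K: "compact K" "K \<subseteq> dom_of c"
    and f: "set_integrable vol K (f :: 'a \<Rightarrow> real)"
  shows "set_integrable lebesgue (chart_map c ` K) (\<lambda>y. f (chart_inv c y))"
proof -
  let ?W = "chart_map c ` dom_of c"
  let ?F = "\<lambda>x. indicator K x * f x"
  have cK: "compact (chart_map c ` K)"
    by (intro compact_continuous_image continuous_on_subset[OF continuous_chart(1)[OF c] K(2)] K(1))
  have KW: "chart_map c ` K \<subseteq> ?W" using K(2) by blast
  have iF: "integrable vol ?F" using f by (simp add: set_integrable_def)
  then have Fm: "?F \<in> borel_measurable (restrict_space vol (dom_of c))"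
    by (intro measurable_restrict_space1 borel_measurable_integrable)
  have ind: "indicator K (chart_inv c y) = (indicator (chart_map c ` K) y :: real)" if "y \<in> ?W" for y
    using that K(2) c by (auto simp: indicator_def)
  have "(\<lambda>y. ?F (chart_inv c y)) \<in> borel_measurable (lebesgue_on ?W)"
    using measurable_compose[OF measurable_chart_inv[OF c] Fm] .
  then have "(\<lambda>y. indicator ?W y *\<^sub>R ?F (chart_inv c y)) \<in> borel_measurable lebesgue"
    using range_lebesgue[OF c] by (subst (asm) borel_measurable_restrict_space_iff) auto
  also have "(\<lambda>y. indicator ?W y *\<^sub>R ?F (chart_inv c y)) = (\<lambda>y. indicator (chart_map c ` K) y *\<^sub>R f (chart_inv c y))"
  proof
    fix y
    show "indicator ?W y *\<^sub>R ?F (chart_inv c y) = indicator (chart_map c ` K) y *\<^sub>R f (chart_inv c y)"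
    proof (cases "y \<in> ?W")
      case True then show ?thesis by (simp only: ind indicator_simps scaleR_one real_scaleR_def mult_1_left)
    next
      case False
      then have "y \<notin> chart_map c ` K" using KW by blast
      with False show ?thesis by (simp only: indicator_simps scaleR_zero_left not_False_eq_True)
    qed
  qed
  finally have m: "(\<lambda>y. indicator (chart_map c ` K) y *\<^sub>R f (chart_inv c y)) \<in> borel_measurable lebesgue" .
  show ?thesis
  proof (cases "K = {}")
    case True then show ?thesis by (simp add: set_integrable_def)
  next
    case False
    obtain y0 where y0: "y0 \<in> chart_map c ` K" "\<And>y. y \<in> chart_map c ` K \<Longrightarrow> density_of c y0 \<le> density_of c y"
      using continuous_attains_inf[OF cK _ continuous_on_subset[OF continuous_density_of[OF c] KW]] False by auto
    define w where "w = density_of c y0"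
    have w: "w > 0" using density_of_pos[OF c] y0(1) KW by (auto simp: w_def)
    have "(\<integral>\<^sup>+y. ennreal (norm (indicator (chart_map c ` K) y *\<^sub>R f (chart_inv c y))) \<partial>lebesgue)
      \<le> (\<integral>\<^sup>+y. ennreal (1/w) * (ennreal (norm (?F (chart_inv c y))) * ennreal (density_of c y) * indicator ?W y) \<partial>lebesgue)"
    proof (rule nn_integral_mono)
      fix y
      show "ennreal (norm (indicator (chart_map c ` K) y *\<^sub>R f (chart_inv c y)))
        \<le> ennreal (1/w) * (ennreal (norm (?F (chart_inv c y))) * ennreal (density_of c y) * indicator ?W y)"
      proof (cases "y \<in> chart_map c ` K")
        case True
        then have yW: "y \<in> ?W" using KW by blast
        have "\<bar>f (chart_inv c y)\<bar> = (1/w) * (\<bar>f (chart_inv c y)\<bar> * w)" using w by simp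
        also have "\<dots> \<le> (1/w) * (\<bar>f (chart_inv c y)\<bar> * density_of c y)"
          using y0(2)[OF True] w by (intro mult_left_mono) (auto simp: w_def)
        finally have "ennreal \<bar>f (chart_inv c y)\<bar> \<le> ennreal ((1/w) * (\<bar>f (chart_inv c y)\<bar> * density_of c y))"
          by (rule ennreal_leI)
        also have "\<dots> = ennreal (1/w) * (ennreal \<bar>f (chart_inv c y)\<bar> * ennreal (density_of c y))"
          using w by (simp only: ennreal_mult' abs_ge_zero zero_le_divide_1_iff less_imp_le)
        finally show ?thesis using True yW ind[OF yW] by simp
      qed simp
    qed
    also have "\<dots> = ennreal (1/w) * (\<integral>\<^sup>+y. ennreal (norm (?F (chart_inv c y))) * ennreal (density_of c y) * indicator ?W y \<partial>lebesgue)"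
    proof (rule nn_integral_cmult)
      have "(\<lambda>y. ennreal (norm (?F (chart_inv c y))) * ennreal (density_of c y)) \<in> borel_measurable (lebesgue_on ?W)"
        using measurable_compose[OF measurable_chart_inv[OF c] Fm] measurable_density_of[OF c] by simp
      then show "(\<lambda>y. ennreal (norm (?F (chart_inv c y))) * ennreal (density_of c y) * indicator ?W y) \<in> borel_measurable lebesgue"
        using range_lebesgue[OF c] by (subst (asm) borel_measurable_restrict_space_iff_ennreal) auto
    qed
    also have "(\<integral>\<^sup>+y. ennreal (norm (?F (chart_inv c y))) * ennreal (density_of c y) * indicator ?W y \<partial>lebesgue)
       = (\<integral>\<^sup>+x\<in>dom_of c. ennreal (norm (?F x)) \<partial>vol)"
      using Fm by (intro nn_integral_chart[OF c, symmetric]) simp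
    also have "\<dots> \<le> (\<integral>\<^sup>+x. ennreal (norm (?F x)) \<partial>vol)" by (intro nn_integral_mono) (auto simp: indicator_def)
    finally have le: "(\<integral>\<^sup>+y. ennreal (norm (indicator (chart_map c ` K) y *\<^sub>R f (chart_inv c y))) \<partial>lebesgue)
      \<le> ennreal (1/w) * (\<integral>\<^sup>+x. ennreal (norm (?F x)) \<partial>vol)" by (simp add: mult_left_mono)
    have "ennreal (1/w) * (\<integral>\<^sup>+x. ennreal (norm (?F x)) \<partial>vol) < \<infinity>"
      using iF unfolding integrable_iff_bounded by (simp add: ennreal_mult_less_top)
    then show ?thesis unfolding set_integrable_def using m le by (intro integrableI_bounded) (auto intro: order_le_less_trans)
  qed
qed

section \<open>Measurable vector fields and weak gradients\<close>

definition chart_measurable :: "'a set \<Rightarrow> ('a \<Rightarrow> ('a, 'n) tvec) \<Rightarrow> bool" where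
  "chart_measurable \<Omega> X \<longleftrightarrow> (\<forall>x\<in>\<Omega>. X x \<in> tangent_space \<A> x) \<and>
     (\<forall>c\<in>\<A>. (\<lambda>x. X x c) \<in> borel_measurable (restrict_space vol (\<Omega> \<inter> dom_of c)))"

lemma measurable_by_charts:
  assumes \<Omega>: "open \<Omega>"
    and f: "\<And>c. c \<in> \<A> \<Longrightarrow> f \<in> measurable (restrict_space vol (\<Omega> \<inter> dom_of c)) N"
  shows "f \<in> measurable (restrict_space vol \<Omega>) N"
proof -
  obtain C where C: "countable C" "C \<subseteq> \<A>" "(\<Union>c\<in>C. dom_of c) = UNIV" by (rule countable_charts)
  show ?thesis
  proof (rule measurable_piecewise_restrict)
    show "countable (fst ` C)" using C(1) by simp
    show "space (restrict_space vol \<Omega>) \<subseteq> \<Union> (fst ` C)" using C(3) by auto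
    fix D assume "D \<in> fst ` C"
    then obtain c where c: "c \<in> \<A>" "D = dom_of c" using C(2) by auto
    show "D \<inter> space (restrict_space vol \<Omega>) \<in> sets (restrict_space vol \<Omega>)"
      using open_sets_vol[OF \<Omega>] dom_sets_vol[OF c(1)] c(2)
      by (auto simp: sets_restrict_space_iff space_restrict_space)
    show "f \<in> measurable (restrict_space (restrict_space vol \<Omega>) D) N"
      using f[OF c(1)] open_sets_vol[OF \<Omega>] dom_sets_vol[OF c(1)] c(2) by (simp add: restrict_restrict_space)
  qed
qed

text \<open>In a chart the inner product is a finite sum of products of measurable components with
  continuous metric coefficients.\<close>

lemma measurable_g:
  assumes \<Omega>: "open \<Omega>" and X: "chart_measurable \<Omega> X" and Y: "chart_measurable \<Omega> Y"
  shows "(\<lambda>x. g x (X x) (Y x)) \<in> borel_measurable (restrict_space vol \<Omega>)"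
proof (rule measurable_by_charts[OF \<Omega>])
  fix c assume c: "c \<in> \<A>"
  let ?M = "restrict_space vol (\<Omega> \<inter> dom_of c)"
  have Xc: "(\<lambda>x. X x c $ i) \<in> borel_measurable ?M" and Yc: "(\<lambda>x. Y x c $ i) \<in> borel_measurable ?M" for i
  proof -
    have n: "(\<lambda>v :: real^'n. v $ i) \<in> borel_measurable borel" by (intro borel_measurable_continuous_onI continuous_intros)
    have "(\<lambda>x. X x c) \<in> borel_measurable ?M" "(\<lambda>x. Y x c) \<in> borel_measurable ?M"
      using X Y c by (simp_all add: chart_measurable_def)
    then show "(\<lambda>x. X x c $ i) \<in> borel_measurable ?M" "(\<lambda>x. Y x c $ i) \<in> borel_measurable ?M"
      using measurable_compose[OF _ n] by auto
  qed
  have Gc: "(\<lambda>x. cmetric c x (axis i 1) (axis j 1)) \<in> borel_measurable ?M" for i j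
  proof -
    have "continuous_on (dom_of c) (\<lambda>x. cmetric c (chart_inv c (chart_map c x)) (axis i 1) (axis j 1))"
      by (rule continuous_on_compose2[OF continuous_cmetric_coeff[OF c] continuous_chart(1)[OF c]]) auto
    then have "continuous_on (dom_of c) (\<lambda>x. cmetric c x (axis i 1) (axis j 1))"
      by (rule continuous_on_eq) (simp add: c)
    then show ?thesis
      using open_dom[OF c] \<Omega> by (intro measurable_continuous_vol) (auto elim: continuous_on_subset)
  qed
  have "(\<lambda>x. \<Sum>i\<in>UNIV. \<Sum>j\<in>UNIV. X x c $ i * Y x c $ j * cmetric c x (axis i 1) (axis j 1)) \<in> borel_measurable ?M"
    by (intro borel_measurable_sum borel_measurable_times Xc Yc Gc)
  moreover have "g x (X x) (Y x) = (\<Sum>i\<in>UNIV. \<Sum>j\<in>UNIV. X x c $ i * Y x c $ j * cmetric c x (axis i 1) (axis j 1))"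
    if "x \<in> space ?M" for x
  proof -
    have x: "x \<in> \<Omega>" "x \<in> dom_of c" using that by (auto simp: space_restrict_space)
    then have "X x \<in> tangent_space \<A> x" "Y x \<in> tangent_space \<A> x" using X Y by (auto simp: chart_measurable_def)
    then have "g x (X x) (Y x) = cmetric c x (X x c) (Y x c)" by (rule g_eq_cmetric[OF c x(2)])
    also note cmetric_expand[OF c x(2)]
    finally show ?thesis .
  qed
  ultimately show "(\<lambda>x. g x (X x) (Y x)) \<in> borel_measurable ?M"
    by (subst measurable_cong) auto
qed

lemma measurable_tnorm:
  assumes \<Omega>: "open \<Omega>" and X: "chart_measurable \<Omega> X"
  shows "(\<lambda>x. tnorm g x (X x)) \<in> borel_measurable (restrict_space vol \<Omega>)"
  unfolding tnorm_def using measurable_g[OF \<Omega> X X] by simp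

lemma chart_measurable_coord_field:
  assumes c: "c \<in> \<A>" shows "chart_measurable (dom_of c) (coord_field \<A> c i)"
  unfolding chart_measurable_def
proof (intro conjI ballI)
  fix d assume d: "d \<in> \<A>"
  have "continuous_on (dom_of c \<inter> dom_of d) (\<lambda>x. transition_deriv c d (chart_inv c (chart_map c x)) (axis i 1))"
    by (rule continuous_on_compose2[OF transition(2)[OF c d]])
      (auto intro: continuous_on_subset[OF continuous_chart(1)[OF c]])
  then have "continuous_on (dom_of c \<inter> dom_of d) (\<lambda>x. coord_field \<A> c i x d)"
    by (rule continuous_on_eq) (simp add: tvec_of_apply d c)
  then show "(\<lambda>x. coord_field \<A> c i x d) \<in> borel_measurable (restrict_space vol (dom_of c \<inter> dom_of d))"
    using open_dom[OF c] open_dom[OF d] by (intro measurable_continuous_vol) auto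
qed (simp add: tvec_of_tangent[OF c])

lemma chart_measurable_subset:
  assumes "chart_measurable \<Omega> X" "\<Omega>' \<subseteq> \<Omega>" "open \<Omega>'" shows "chart_measurable \<Omega>' X"
  unfolding chart_measurable_def
proof (intro conjI ballI)
  show "X x \<in> tangent_space \<A> x" if "x \<in> \<Omega>'" for x using assms that by (auto simp: chart_measurable_def)
  fix c assume c: "c \<in> \<A>"
  then have "(\<lambda>x. X x c) \<in> borel_measurable (restrict_space vol (\<Omega> \<inter> dom_of c))"
    using assms(1) by (simp add: chart_measurable_def)
  then have "(\<lambda>x. X x c) \<in> borel_measurable (restrict_space (restrict_space vol (\<Omega> \<inter> dom_of c)) \<Omega>')"
    by (rule measurable_restrict_space1)
  moreover have "sets (restrict_space (restrict_space vol (\<Omega> \<inter> dom_of c)) \<Omega>') = sets (restrict_space vol (\<Omega>' \<inter> dom_of c))"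
  proof -
    have "(\<Omega> \<inter> dom_of c) \<inter> \<Omega>' = \<Omega>' \<inter> dom_of c" using assms(2) by blast
    then show ?thesis unfolding sets_restrict_restrict_space by simp
  qed
  ultimately show "(\<lambda>x. X x c) \<in> borel_measurable (restrict_space vol (\<Omega>' \<inter> dom_of c))"
    using measurable_cong_sets by blast
qed

lemma chart_measurableD:
  assumes "chart_measurable \<Omega> X"
  shows "x \<in> \<Omega> \<Longrightarrow> X x \<in> tangent_space \<A> x"
    and "c \<in> \<A> \<Longrightarrow> (\<lambda>x. X x c) \<in> borel_measurable (restrict_space vol (\<Omega> \<inter> dom_of c))"
  using assms unfolding chart_measurable_def by (auto dest: bspec)

lemma measurable_restrict_UNIV:
  assumes "f \<in> measurable (restrict_space vol UNIV) N" shows "f \<in> measurable vol N"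
proof -
  have "sets (restrict_space vol UNIV) = sets vol" by (simp add: sets_restrict_space)
  then show ?thesis using assms measurable_cong_sets by blast
qed

lemma weak_gradientD:
  assumes "weak_gradient \<A> g vol \<Omega> u X"
  shows "chart_measurable \<Omega> X"
    and "\<And>K. compact K \<Longrightarrow> K \<subseteq> \<Omega> \<Longrightarrow> set_integrable vol K u"
    and "\<And>K. compact K \<Longrightarrow> K \<subseteq> \<Omega> \<Longrightarrow> set_integrable vol K (\<lambda>x. tnorm g x (X x))"
    and "\<And>c \<phi> i. c \<in> \<A> \<Longrightarrow> test_function (chart_map c ` (\<Omega> \<inter> dom_of c)) \<phi> \<Longrightarrow>
        (LINT y : chart_map c ` (\<Omega> \<inter> dom_of c) | lebesgue.
           u (chart_inv c y) * frechet_derivative \<phi> (at y) (axis i 1)) =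
        - (LINT y : chart_map c ` (\<Omega> \<inter> dom_of c) | lebesgue.
           g (chart_inv c y) (X (chart_inv c y)) (coord_field \<A> c i (chart_inv c y)) * \<phi> y)"
proof -
  note w = assms[unfolded weak_gradient_def]
  note w2 = w[THEN conjunct2, THEN conjunct2]
  show "chart_measurable \<Omega> X"
    unfolding chart_measurable_def by (rule conjI[OF w[THEN conjunct1] w[THEN conjunct2, THEN conjunct1]])
  fix K :: "'a set" assume K: "compact K" "K \<subseteq> \<Omega>"
  note k = w2[THEN conjunct1, THEN spec, THEN mp, OF conjI[OF K]]
  show "set_integrable vol K u" by (rule k[THEN conjunct1])
  show "set_integrable vol K (\<lambda>x. tnorm g x (X x))" by (rule k[THEN conjunct2])
next
  fix c \<phi> i assume c: "c \<in> \<A>" and t: "test_function (chart_map c ` (\<Omega> \<inter> dom_of c)) \<phi>"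
  note w = assms[unfolded weak_gradient_def, THEN conjunct2, THEN conjunct2, THEN conjunct2]
  show "(LINT y : chart_map c ` (\<Omega> \<inter> dom_of c) | lebesgue.
           u (chart_inv c y) * frechet_derivative \<phi> (at y) (axis i 1)) =
        - (LINT y : chart_map c ` (\<Omega> \<inter> dom_of c) | lebesgue.
           g (chart_inv c y) (X (chart_inv c y)) (coord_field \<A> c i (chart_inv c y)) * \<phi> y)"
    by (rule w[THEN bspec, OF c, THEN spec, THEN spec, THEN mp, OF t])
qed

lemma weak_gradientI:
  assumes "chart_measurable \<Omega> X"
    and "\<And>K. compact K \<Longrightarrow> K \<subseteq> \<Omega> \<Longrightarrow> set_integrable vol K u"
    and "\<And>K. compact K \<Longrightarrow> K \<subseteq> \<Omega> \<Longrightarrow> set_integrable vol K (\<lambda>x. tnorm g x (X x))"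
    and "\<And>c \<phi> i. c \<in> \<A> \<Longrightarrow> test_function (chart_map c ` (\<Omega> \<inter> dom_of c)) \<phi> \<Longrightarrow>
        (LINT y : chart_map c ` (\<Omega> \<inter> dom_of c) | lebesgue.
           u (chart_inv c y) * frechet_derivative \<phi> (at y) (axis i 1)) =
        - (LINT y : chart_map c ` (\<Omega> \<inter> dom_of c) | lebesgue.
           g (chart_inv c y) (X (chart_inv c y)) (coord_field \<A> c i (chart_inv c y)) * \<phi> y)"
  shows "weak_gradient \<A> g vol \<Omega> u X"
proof -
  note m = assms(1)[unfolded chart_measurable_def]
  show ?thesis unfolding weak_gradient_def
  proof (intro conjI)
    show "\<forall>x\<in>\<Omega>. X x \<in> tangent_space \<A> x" by (rule m[THEN conjunct1])
    show "\<forall>c\<in>\<A>. (\<lambda>x. X x c) \<in> borel_measurable (restrict_space vol (\<Omega> \<inter> dom_of c))"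
      by (rule m[THEN conjunct2])
    show "\<forall>K. compact K \<and> K \<subseteq> \<Omega> \<longrightarrow> set_integrable vol K u \<and> set_integrable vol K (\<lambda>x. tnorm g x (X x))"
      by (intro allI impI conjI assms(2,3)) (erule conjunct1 conjunct2)+
  qed (intro ballI allI impI, rule assms(4))
qed

lemma test_integral_subset:
  assumes "test_function S \<phi>" "S \<subseteq> T"
  shows "(LINT y:T|lebesgue. f y * \<phi> y) = (LINT y:S|lebesgue. f y * \<phi> y)"
    and "(LINT y:T|lebesgue. f y * frechet_derivative \<phi> (at y) e) = (LINT y:S|lebesgue. f y * frechet_derivative \<phi> (at y) e)"
proof -
  have z: "\<phi> y = 0" "frechet_derivative \<phi> (at y) e = 0" if "y \<notin> S" for y
  proof -
    have "y \<notin> closure {y. \<phi> y \<noteq> 0}" using assms(1) that by (auto simp: test_function_def)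
    note * = test_function_eq_0[OF assms(1) this]
    show "\<phi> y = 0" by (rule *(1))
    show "frechet_derivative \<phi> (at y) e = 0" by (simp only: *(2))
  qed
  have e: "indicator T y *\<^sub>R (f y * \<phi> y) = indicator S y *\<^sub>R (f y * \<phi> y)"
    "indicator T y *\<^sub>R (f y * frechet_derivative \<phi> (at y) e) = indicator S y *\<^sub>R (f y * frechet_derivative \<phi> (at y) e)" for y
    using assms(2) z[of y] by (cases "y \<in> S"; auto simp: indicator_def)+
  then show "(LINT y:T|lebesgue. f y * \<phi> y) = (LINT y:S|lebesgue. f y * \<phi> y)"
    "(LINT y:T|lebesgue. f y * frechet_derivative \<phi> (at y) e) = (LINT y:S|lebesgue. f y * frechet_derivative \<phi> (at y) e)"
    unfolding set_lebesgue_integral_def by (simp_all only: e)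
qed

lemma weak_gradient_subset:
  assumes w: "weak_gradient \<A> g vol \<Omega> u X" and \<Omega>': "open \<Omega>'" "\<Omega>' \<subseteq> \<Omega>"
  shows "weak_gradient \<A> g vol \<Omega>' u X"
proof (rule weak_gradientI)
  show "chart_measurable \<Omega>' X" by (rule chart_measurable_subset[OF weak_gradientD(1)[OF w] \<Omega>'(2,1)])
  fix K :: "'a set" assume K: "compact K" "K \<subseteq> \<Omega>'"
  then have "K \<subseteq> \<Omega>" using \<Omega>' by blast
  then show "set_integrable vol K u" "set_integrable vol K (\<lambda>x. tnorm g x (X x))"
    using weak_gradientD(2,3)[OF w] K by auto
next
  fix c \<phi> i assume c: "c \<in> \<A>" and \<phi>: "test_function (chart_map c ` (\<Omega>' \<inter> dom_of c)) \<phi>"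
  have sub: "chart_map c ` (\<Omega>' \<inter> dom_of c) \<subseteq> chart_map c ` (\<Omega> \<inter> dom_of c)" using \<Omega>' by blast
  show "(LINT y : chart_map c ` (\<Omega>' \<inter> dom_of c) | lebesgue.
           u (chart_inv c y) * frechet_derivative \<phi> (at y) (axis i 1)) =
        - (LINT y : chart_map c ` (\<Omega>' \<inter> dom_of c) | lebesgue.
           g (chart_inv c y) (X (chart_inv c y)) (coord_field \<A> c i (chart_inv c y)) * \<phi> y)"
    using weak_gradientD(4)[OF w c test_function_mono[OF \<phi> sub], of i]
    unfolding test_integral_subset[OF \<phi> sub] .
qed

lemma set_borel_measurable_restrict:
  fixes f :: "'a \<Rightarrow> real"
  assumes "f \<in> borel_measurable (restrict_space vol U)" "A \<in> sets vol" "A \<subseteq> U" "U \<in> sets vol"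
  shows "set_borel_measurable vol A f"
proof -
  have "f \<in> borel_measurable (restrict_space (restrict_space vol U) A)"
    using assms(1) by (rule measurable_restrict_space1)
  then have "f \<in> borel_measurable (restrict_space vol A)"
    using assms by (simp add: restrict_restrict_space Int_absorb1)
  then show ?thesis
    unfolding set_borel_measurable_def using assms(2) by (subst (asm) borel_measurable_restrict_space_iff) auto
qed

lemma measurable_component:
  assumes "open \<Omega>" "chart_measurable \<Omega> X" "c \<in> \<A>"
  shows "(\<lambda>x. g x (X x) (coord_field \<A> c i x)) \<in> borel_measurable (restrict_space vol (\<Omega> \<inter> dom_of c))"
proof -
  have o: "open (\<Omega> \<inter> dom_of c)" by (rule open_Int[OF assms(1) open_dom[OF assms(3)]])
  have "chart_measurable (\<Omega> \<inter> dom_of c) X"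
    by (rule chart_measurable_subset[OF assms(2) Int_lower1 o])
  moreover have "chart_measurable (\<Omega> \<inter> dom_of c) (coord_field \<A> c i)"
    by (rule chart_measurable_subset[OF chart_measurable_coord_field[OF assms(3)] Int_lower2 o])
  ultimately show ?thesis by (rule measurable_g[OF o])
qed

lemma compact_chart_preimage:
  assumes c: "c \<in> \<A>" and K: "compact K" "K \<subseteq> chart_map c ` (\<Omega> \<inter> dom_of c)"
  shows "compact (chart_inv c ` K)" "chart_inv c ` K \<subseteq> \<Omega> \<inter> dom_of c" "chart_map c ` chart_inv c ` K = K"
proof -
  have KW: "K \<subseteq> chart_map c ` dom_of c" using K(2) by blast
  show "compact (chart_inv c ` K)"
    by (rule compact_continuous_image[OF continuous_on_subset[OF continuous_chart(2)[OF c] KW] K(1)])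
  show "chart_inv c ` K \<subseteq> \<Omega> \<inter> dom_of c"
    using K(2) unfolding chart_image_eq[OF c] using chart_inv_dom[OF c] by auto
  show "chart_map c ` chart_inv c ` K = K"
    unfolding image_image using KW chart_map_inv[OF c] by (force simp: subset_iff)
qed

text \<open>Cauchy-Schwarz against the coordinate field, whose norm is continuous and hence bounded
  on the compact set.\<close>

lemma set_integrable_component:
  assumes c: "c \<in> \<A>" and \<Omega>: "open \<Omega>" and X: "chart_measurable \<Omega> X"
    and iX: "\<And>K. compact K \<Longrightarrow> K \<subseteq> \<Omega> \<Longrightarrow> set_integrable vol K (\<lambda>x. tnorm g x (X x))"
    and K: "compact K" "K \<subseteq> chart_map c ` (\<Omega> \<inter> dom_of c)"
  shows "set_integrable lebesgue K (\<lambda>y. g (chart_inv c y) (X (chart_inv c y)) (coord_field \<A> c i (chart_inv c y)))"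
proof -
  let ?K = "chart_inv c ` K"
  note K' = compact_chart_preimage[OF c K]
  have "continuous_on K (\<lambda>y. cnorm c (chart_inv c y) (axis i 1))"
    using K(2) by (intro continuous_cnorm[OF c] continuous_intros) auto
  then have "bounded ((\<lambda>y. cnorm c (chart_inv c y) (axis i 1)) ` K)"
    by (intro compact_imp_bounded compact_continuous_image K)
  then obtain M where M: "\<And>y. y \<in> K \<Longrightarrow> \<bar>cnorm c (chart_inv c y) (axis i 1)\<bar> \<le> M"
    unfolding bounded_iff by auto
  have "set_integrable vol ?K (\<lambda>x. g x (X x) (coord_field \<A> c i x))"
  proof (rule set_integrable_bound)
    show "set_integrable vol ?K (\<lambda>x. \<bar>M\<bar> * tnorm g x (X x))"
      using iX[OF K'(1)] K'(2) by (intro set_integrable_mult_right) auto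
    show "set_borel_measurable vol ?K (\<lambda>x. g x (X x) (coord_field \<A> c i x))"
      using K' open_sets_vol[OF \<Omega>] dom_sets_vol[OF c] compact_sets_vol
      by (intro set_borel_measurable_restrict[OF measurable_component[OF \<Omega> X c]]) auto
    show "AE x in vol. x \<in> ?K \<longrightarrow> norm (g x (X x) (coord_field \<A> c i x)) \<le> norm (\<bar>M\<bar> * tnorm g x (X x))"
    proof (intro AE_I2 impI)
      fix x assume x: "x \<in> ?K"
      then have xd: "x \<in> \<Omega>" "x \<in> dom_of c" using K'(2) by auto
      have tx: "X x \<in> tangent_space \<A> x" using X xd by (simp add: chart_measurable_def)
      have te: "coord_field \<A> c i x \<in> tangent_space \<A> x" by (rule tvec_of_tangent[OF c xd(2)])
      have "\<bar>g x (X x) (coord_field \<A> c i x)\<bar> \<le> tnorm g x (X x) * tnorm g x (coord_field \<A> c i x)"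
        by (rule tangent_Cauchy_Schwarz[OF tx te])
      also have "tnorm g x (coord_field \<A> c i x) = cnorm c x (axis i 1)"
        using tnorm_eq_cnorm[OF c xd(2) te] by (simp add: c xd)
      also have "tnorm g x (X x) * cnorm c x (axis i 1) \<le> tnorm g x (X x) * \<bar>M\<bar>"
        using M x tnorm_nonneg[OF tx] by (intro mult_left_mono) force+
      finally show "norm (g x (X x) (coord_field \<A> c i x)) \<le> norm (\<bar>M\<bar> * tnorm g x (X x))"
        using tnorm_nonneg[OF tx] by (simp add: abs_mult mult.commute)
    qed
  qed
  then have "set_integrable lebesgue (chart_map c ` ?K) (\<lambda>y. g (chart_inv c y) (X (chart_inv c y)) (coord_field \<A> c i (chart_inv c y)))"
    using K'(2) by (intro set_integrable_chart[OF c K'(1)]) auto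
  then show ?thesis unfolding K'(3) .
qed

lemma set_integrable_function:
  assumes c: "c \<in> \<A>" and iu: "\<And>K. compact K \<Longrightarrow> K \<subseteq> \<Omega> \<Longrightarrow> set_integrable vol K (u :: 'a \<Rightarrow> real)"
    and K: "compact K" "K \<subseteq> chart_map c ` (\<Omega> \<inter> dom_of c)"
  shows "set_integrable lebesgue K (\<lambda>y. u (chart_inv c y))"
proof -
  note K' = compact_chart_preimage[OF c K]
  have "set_integrable lebesgue (chart_map c ` chart_inv c ` K) (\<lambda>y. u (chart_inv c y))"
    using K'(2) by (intro set_integrable_chart[OF c K'(1)] iu K'(1)) auto
  then show ?thesis unfolding K'(3) .
qed

text \<open>The difference of the two vectors is orthogonal to a basis, hence to itself.\<close>

lemma cmetric_components_eq:
  assumes c: "c \<in> \<A>" "x \<in> dom_of c" and eq: "\<And>i. cmetric c x v (axis i 1) = cmetric c x w (axis i 1)"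
  shows "v = w"
proof (rule ccontr)
  assume "v \<noteq> w"
  note B = cmetric_bilinear[OF c]
  have l: "linear (cmetric c x (v - w))" using B by (simp add: bilinear_def)
  have z: "cmetric c x (v - w) (axis i 1) = 0" for i using eq[of i] by (simp add: bilinear_lsub[OF B])
  have "cmetric c x (v - w) (v - w) = 0"
    by (subst linear_axis_expansion[OF l]) (simp only: z scaleR_zero_right sum.neutral_const)
  then show False using cmetric_pos[OF c, of "v - w"] \<open>v \<noteq> w\<close> by simp
qed

text \<open>In each chart the covariant components agree almost everywhere by uniqueness of weak
  derivatives; nondegeneracy of the metric recovers the vectors, and countably many charts
  cover.\<close>

lemma weak_gradient_unique:
  assumes \<Omega>: "open \<Omega>" and X: "weak_gradient \<A> g vol \<Omega> u X" and Y: "weak_gradient \<A> g vol \<Omega> u Y"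
  shows "AE x in vol. x \<in> \<Omega> \<longrightarrow> X x = Y x"
proof -
  have *: "AE x in vol. x \<in> dom_of c \<longrightarrow> (x \<in> \<Omega> \<longrightarrow> X x = Y x)" if c: "c \<in> \<A>" for c
  proof (rule AE_vol_of_chart[OF c])
    let ?M = "restrict_space vol (\<Omega> \<inter> dom_of c)"
    have "(\<lambda>x. X x c - Y x c) \<in> borel_measurable ?M"
      by (intro borel_measurable_diff chart_measurableD(2)[OF weak_gradientD(1)[OF X] c]
          chart_measurableD(2)[OF weak_gradientD(1)[OF Y] c])
    then have "(\<lambda>x. X x c - Y x c) -` (- {0}) \<inter> space ?M \<in> sets ?M" by (rule measurable_sets) simp
    moreover have "(\<lambda>x. X x c - Y x c) -` (- {0}) \<inter> space ?M = {x \<in> dom_of c. \<not> (x \<in> \<Omega> \<longrightarrow> X x = Y x)}"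
    proof -
      have "X x c = Y x c \<longleftrightarrow> X x = Y x" if "x \<in> \<Omega>" "x \<in> dom_of c" for x
      proof
        assume "X x c = Y x c"
        then show "X x = Y x"
          by (rule tangent_eqI[OF c that(2) chart_measurableD(1)[OF weak_gradientD(1)[OF X] that(1)]
                chart_measurableD(1)[OF weak_gradientD(1)[OF Y] that(1)]])
      qed simp
      then show ?thesis by (auto simp: space_restrict_space)
    qed
    ultimately show "{x \<in> dom_of c. \<not> (x \<in> \<Omega> \<longrightarrow> X x = Y x)} \<in> sets vol"
      using open_sets_vol[OF \<Omega>] dom_sets_vol[OF c] by (auto simp: sets_restrict_space_iff)
    let ?W = "chart_map c ` (\<Omega> \<inter> dom_of c)"
    let ?f = "\<lambda>X i y. g (chart_inv c y) (X (chart_inv c y)) (coord_field \<A> c i (chart_inv c y))"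
    have "AE y in lebesgue. y \<in> ?W \<longrightarrow> ?f X i y = ?f Y i y" for i
    proof (rule weak_derivative_unique[OF open_chart_image[OF c \<Omega>]])
      show "set_integrable lebesgue K (?f X i)" "set_integrable lebesgue K (?f Y i)" if "compact K" "K \<subseteq> ?W" for K
        using set_integrable_component[OF c \<Omega> weak_gradientD(1,3)[OF X] that]
          set_integrable_component[OF c \<Omega> weak_gradientD(1,3)[OF Y] that] by auto
      show "(LINT x:?W|lebesgue. ?f X i x * \<phi> x) = (LINT x:?W|lebesgue. ?f Y i x * \<phi> x)" if "test_function ?W \<phi>" for \<phi>
        using weak_gradientD(4)[OF X c that, of i] weak_gradientD(4)[OF Y c that, of i] by simp
    qed
    then have "AE y in lebesgue. \<forall>i. y \<in> ?W \<longrightarrow> ?f X i y = ?f Y i y" by (intro eventually_all_finite)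
    then show "AE y in lebesgue. y \<in> chart_map c ` dom_of c \<longrightarrow> (chart_inv c y \<in> \<Omega> \<longrightarrow> X (chart_inv c y) = Y (chart_inv c y))"
    proof eventually_elim
      case (elim y)
      show ?case
      proof (intro impI)
        assume y: "y \<in> chart_map c ` dom_of c" "chart_inv c y \<in> \<Omega>"
        let ?x = "chart_inv c y"
        have x: "?x \<in> dom_of c" "y \<in> ?W" using y chart_inv_dom[OF c] by (auto simp: chart_image_eq[OF c])
        have t: "X ?x \<in> tangent_space \<A> ?x" "Y ?x \<in> tangent_space \<A> ?x"
          by (rule chart_measurableD(1)[OF weak_gradientD(1)[OF X] y(2)] chart_measurableD(1)[OF weak_gradientD(1)[OF Y] y(2)])+
        have "cmetric c ?x (X ?x c) (axis i 1) = cmetric c ?x (Y ?x c) (axis i 1)" for i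
        proof -
          have "?f X i y = ?f Y i y" using elim x by blast
          then show ?thesis
            using g_eq_cmetric[OF c x(1) t(1) tvec_of_tangent[OF c x(1)]] g_eq_cmetric[OF c x(1) t(2) tvec_of_tangent[OF c x(1)]]
            by (simp add: c x)
        qed
        then have "X ?x c = Y ?x c" by (rule cmetric_components_eq[OF c x(1)])
        then show "X ?x = Y ?x" by (rule tangent_eqI[OF c x(1) t])
      qed
    qed
  qed
  obtain C where C: "countable C" "C \<subseteq> \<A>" "(\<Union>c\<in>C. dom_of c) = UNIV" by (rule countable_charts)
  have "AE x in vol. \<forall>c\<in>C. x \<in> dom_of c \<longrightarrow> (x \<in> \<Omega> \<longrightarrow> X x = Y x)"
    unfolding AE_ball_countable[OF C(1)] using * C(2) by blast
  then show ?thesis by eventually_elim (use C(3) in blast)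
qed

lemma measurable_chart_inv_restrict:
  assumes c: "c \<in> \<A>" and \<Omega>: "open \<Omega>" and f: "f \<in> borel_measurable (restrict_space vol (\<Omega> \<inter> dom_of c))"
  shows "(\<lambda>y. indicator (chart_map c ` (\<Omega> \<inter> dom_of c)) y * (f (chart_inv c y) :: real)) \<in> borel_measurable lebesgue"
proof -
  let ?W = "chart_map c ` dom_of c"
  have "(\<lambda>x. indicator (\<Omega> \<inter> dom_of c) x *\<^sub>R f x) \<in> borel_measurable vol"
    using f open_sets_vol[OF \<Omega>] dom_sets_vol[OF c] by (subst (asm) borel_measurable_restrict_space_iff) auto
  then have "(\<lambda>x. indicator (\<Omega> \<inter> dom_of c) x *\<^sub>R f x) \<in> borel_measurable (restrict_space vol (dom_of c))"
    by (rule measurable_restrict_space1)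
  from measurable_compose[OF measurable_chart_inv[OF c] this]
  have "(\<lambda>y. indicator ?W y *\<^sub>R (indicator (\<Omega> \<inter> dom_of c) (chart_inv c y) *\<^sub>R f (chart_inv c y))) \<in> borel_measurable lebesgue"
    using range_lebesgue[OF c] by (subst (asm) borel_measurable_restrict_space_iff) auto
  also have "(\<lambda>y. indicator ?W y *\<^sub>R (indicator (\<Omega> \<inter> dom_of c) (chart_inv c y) *\<^sub>R f (chart_inv c y)))
    = (\<lambda>y. indicator (chart_map c ` (\<Omega> \<inter> dom_of c)) y * f (chart_inv c y))"
    unfolding chart_image_eq[OF c] using chart_inv_dom[OF c] by (auto simp: indicator_def fun_eq_iff)
  finally show ?thesis .
qed

text \<open>Gradients from different regions are glued up to null sets only; the lemma transfers the
  defining identities to the glued field.\<close>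

lemma weak_gradient_cong_AE:
  assumes \<Omega>: "open \<Omega>" and X: "weak_gradient \<A> g vol \<Omega> u X" and Y: "chart_measurable \<Omega> Y"
    and ae: "AE x in vol. x \<in> \<Omega> \<longrightarrow> X x = Y x"
  shows "weak_gradient \<A> g vol \<Omega> u Y"
proof (rule weak_gradientI[OF Y weak_gradientD(2)[OF X]])
  fix K :: "'a set" assume K: "compact K" "K \<subseteq> \<Omega>"
  show "set_integrable vol K (\<lambda>x. tnorm g x (Y x))"
  proof (rule set_integrable_bound[OF weak_gradientD(3)[OF X K]])
    show "set_borel_measurable vol K (\<lambda>x. tnorm g x (Y x))"
      using set_borel_measurable_restrict[OF measurable_tnorm[OF \<Omega> Y] compact_sets_vol[OF K(1)] K(2) open_sets_vol[OF \<Omega>]] .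
    show "AE x in vol. x \<in> K \<longrightarrow> norm (tnorm g x (Y x)) \<le> norm (tnorm g x (X x))"
      using ae by eventually_elim (use K(2) in auto)
  qed
next
  fix c \<phi> i assume c: "c \<in> \<A>" and \<phi>: "test_function (chart_map c ` (\<Omega> \<inter> dom_of c)) \<phi>"
  let ?W = "chart_map c ` (\<Omega> \<inter> dom_of c)"
  let ?f = "\<lambda>X y. g (chart_inv c y) (X (chart_inv c y)) (coord_field \<A> c i (chart_inv c y))"
  have \<phi>m: "\<phi> \<in> borel_measurable lebesgue"
    using has_derivative_continuous[OF test_function_has_derivative(1)[OF \<phi>]]
    by (intro measurable_completion) (simp add: borel_measurable_continuous_onI continuous_at_imp_continuous_on)
  have m: "(\<lambda>y. indicator ?W y *\<^sub>R (?f Z y * \<phi> y)) \<in> borel_measurable lebesgue" if "chart_measurable \<Omega> Z" for Z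
    using borel_measurable_times[OF measurable_chart_inv_restrict[OF c \<Omega> measurable_component[OF \<Omega> that c]] \<phi>m]
    by (simp add: mult.assoc)
  have "(LINT y:?W|lebesgue. ?f X y * \<phi> y) = (LINT y:?W|lebesgue. ?f Y y * \<phi> y)"
    unfolding set_lebesgue_integral_def
  proof (rule integral_cong_AE[OF m[OF weak_gradientD(1)[OF X]] m[OF Y]])
    show "AE y in lebesgue. indicator ?W y *\<^sub>R (?f X y * \<phi> y) = indicator ?W y *\<^sub>R (?f Y y * \<phi> y)"
      using AE_chart_of_vol[OF c ae]
      by eventually_elim (auto simp: chart_image_eq[OF c] indicator_def)
  qed
  then show "(LINT y:?W|lebesgue. u (chart_inv c y) * frechet_derivative \<phi> (at y) (axis i 1)) = - (LINT y:?W|lebesgue. ?f Y y * \<phi> y)"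
    using weak_gradientD(4)[OF X c \<phi>, of i] by simp
qed

lemma compact_in_mball:
  assumes "compact K" obtains n :: nat where "K \<subseteq> RM.mball x0 (real n)"
proof -
  have "bounded (rdist x0 ` K)"
    by (intro compact_imp_bounded compact_continuous_image continuous_rdist assms)
  then obtain M where M: "\<And>x. x \<in> K \<Longrightarrow> \<bar>rdist x0 x\<bar> \<le> M" unfolding bounded_iff by auto
  obtain n :: nat where "M < real n" using reals_Archimedean2 by blast
  then show ?thesis using M by (intro that[of n]) force
qed

lemma UN_mball: "(\<Union>n::nat. RM.mball x0 (real n)) = UNIV"
  using reals_Archimedean2 by (auto simp: set_eq_iff)

lemma measurable_by_mballs:
  assumes "\<And>n::nat. f \<in> measurable (restrict_space vol (RM.mball x0 (real n) \<inter> U)) N" and "open U"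
  shows "f \<in> measurable (restrict_space vol U) N"
proof (rule measurable_piecewise_restrict[of "range (\<lambda>n::nat. RM.mball x0 (real n))"])
  show "space (restrict_space vol U) \<subseteq> \<Union> (range (\<lambda>n::nat. RM.mball x0 (real n)))" using UN_mball[of x0] by blast
  fix D assume "D \<in> range (\<lambda>n::nat. RM.mball x0 (real n))"
  then obtain n :: nat where D: "D = RM.mball x0 (real n)" by blast
  have s: "D \<in> sets vol" "U \<in> sets vol" unfolding D using open_mball assms(2) by (auto intro: open_sets_vol)
  then show "D \<inter> space (restrict_space vol U) \<in> sets (restrict_space vol U)"
    by (auto simp: sets_restrict_space_iff space_restrict_space)
  show "f \<in> measurable (restrict_space (restrict_space vol U) D) N"
    using assms(1)[of n] s unfolding D by (simp add: restrict_restrict_space Int_commute)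
qed simp

text \<open>Every compact set, in particular the preimage of the support of a test function, lies in
  one of the balls.\<close>

lemma weak_gradient_UNIV:
  assumes w: "\<And>n::nat. weak_gradient \<A> g vol (RM.mball x0 (real n)) u X"
  shows "weak_gradient \<A> g vol UNIV u X"
proof (rule weak_gradientI)
  show "chart_measurable UNIV X" unfolding chart_measurable_def
  proof (intro conjI ballI)
    fix x :: 'a
    obtain n :: nat where "x \<in> RM.mball x0 (real n)" using UN_mball[of x0] by blast
    then show "X x \<in> tangent_space \<A> x" using weak_gradientD(1)[OF w[of n]] by (simp add: chart_measurable_def)
  next
    fix c assume c: "c \<in> \<A>"
    show "(\<lambda>x. X x c) \<in> borel_measurable (restrict_space vol (UNIV \<inter> dom_of c))"
      unfolding Int_UNIV_left
      by (rule measurable_by_mballs[OF _ open_dom[OF c]]) (rule chart_measurableD(2)[OF weak_gradientD(1)[OF w] c])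
  qed
  fix K :: "'a set" assume K: "compact K"
  obtain n :: nat where "K \<subseteq> RM.mball x0 (real n)" by (rule compact_in_mball[OF K])
  then show "set_integrable vol K u" "set_integrable vol K (\<lambda>x. tnorm g x (X x))"
    using weak_gradientD(2,3)[OF w[of n] K] by auto
next
  fix c \<phi> i assume c: "c \<in> \<A>" and \<phi>: "test_function (chart_map c ` (UNIV \<inter> dom_of c)) \<phi>"
  let ?S = "closure {y. \<phi> y \<noteq> 0}"
  have S: "compact ?S" "?S \<subseteq> chart_map c ` (UNIV \<inter> dom_of c)" using \<phi> unfolding test_function_def by simp_all
  note S' = compact_chart_preimage[OF c S]
  obtain n :: nat where n: "chart_inv c ` ?S \<subseteq> RM.mball x0 (real n)" by (rule compact_in_mball[OF S'(1)])
  let ?B = "RM.mball x0 (real n)"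
  have "?S \<subseteq> chart_map c ` (?B \<inter> dom_of c)" using n S(2) by (subst chart_image_eq[OF c]) auto
  then have \<phi>': "test_function (chart_map c ` (?B \<inter> dom_of c)) \<phi>" using \<phi> by (simp add: test_function_def)
  have sub: "chart_map c ` (?B \<inter> dom_of c) \<subseteq> chart_map c ` (UNIV \<inter> dom_of c)" by blast
  show "(LINT y : chart_map c ` (UNIV \<inter> dom_of c) | lebesgue.
           u (chart_inv c y) * frechet_derivative \<phi> (at y) (axis i 1)) =
        - (LINT y : chart_map c ` (UNIV \<inter> dom_of c) | lebesgue.
           g (chart_inv c y) (X (chart_inv c y)) (coord_field \<A> c i (chart_inv c y)) * \<phi> y)"
    using weak_gradientD(4)[OF w[of n] c \<phi>', of i] unfolding test_integral_subset[OF \<phi>' sub] .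
qed

text \<open>The local space provides one gradient for each relatively compact open set, whereas
  \<open>grad\<close> chooses among gradients on the whole manifold. A global gradient has to be
  glued before that choice has any property; balls serve as the regions because their closures are
  compact.\<close>

lemma W1p_loc_weak_gradient:
  assumes u: "u \<in> W1p_loc \<A> g vol p"
  shows "weak_gradient \<A> g vol UNIV u (grad \<A> g vol u)"
    and "(\<lambda>x. tnorm g x (grad \<A> g vol u x)) \<in> Lp_on vol p (RM.mball x0 R)"
    and "u \<in> Lp_on vol p (RM.mball x0 R)"
proof -
  let ?B = "\<lambda>R. RM.mball x0 R"
  have W: "u \<in> W1p \<A> g vol p (?B R)" for R
    using u open_mball compact_closure_mball unfolding W1p_loc_def by blast
  then show "u \<in> Lp_on vol p (?B R)" by (simp add: W1p_def)
  have "\<exists>X. weak_gradient \<A> g vol (?B R) u X \<and> (\<lambda>x. tnorm g x (X x)) \<in> Lp_on vol p (?B R)" for R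
    using W[of R] by (simp add: W1p_def)
  then obtain X where X: "\<And>R. weak_gradient \<A> g vol (?B R) u (X R)"
    "\<And>R. (\<lambda>x. tnorm g x (X R x)) \<in> Lp_on vol p (?B R)" by metis
  \<comment> \<open>Adding 1 puts x into the open ball of radius N x. The glued field takes at x the
    gradient belonging to this ball, so it is a countable patchwork of measurable fields.\<close>
  define N where "N x = nat \<lfloor>rdist x0 x\<rfloor> + 1" for x
  have xN: "x \<in> ?B (real (N x))" for x by (simp add: N_def) linarith
  have Nm: "{x. N x = j} \<in> sets vol" for j
  proof -
    have "(\<lambda>x. rdist x0 x) \<in> borel_measurable borel" by (intro borel_measurable_continuous_onI continuous_rdist)
    then have "(\<lambda>x. rdist x0 x) \<in> borel_measurable vol" by (rule measurable_vol_borel)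
    then have "N \<in> measurable vol (count_space UNIV)" unfolding N_def by measurable
    then have "N -` {j} \<inter> space vol \<in> sets vol" by (rule measurable_sets) simp
    then show ?thesis by (simp add: vimage_def)
  qed
  define Z where "Z x = X (real (N x)) x" for x
  have t: "Z x \<in> tangent_space \<A> x" for x
    using weak_gradientD(1)[OF X(1)[of "real (N x)"]] xN by (simp add: chart_measurable_def Z_def)
  have Zm: "chart_measurable UNIV Z" unfolding chart_measurable_def
  proof (intro conjI ballI t)
    fix c assume c: "c \<in> \<A>"
    show "(\<lambda>x. Z x c) \<in> borel_measurable (restrict_space vol (UNIV \<inter> dom_of c))" unfolding Int_UNIV_left
    proof (rule measurable_piecewise_restrict[of "range (\<lambda>j. {x. N x = j})"])
      show "space (restrict_space vol (dom_of c)) \<subseteq> \<Union> (range (\<lambda>j. {x. N x = j}))" by auto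
      fix D assume "D \<in> range (\<lambda>j. {x. N x = j})"
      then obtain j where D: "D = {x. N x = j}" by blast
      show "D \<inter> space (restrict_space vol (dom_of c)) \<in> sets (restrict_space vol (dom_of c))"
        using Nm[of j] dom_sets_vol[OF c] by (auto simp: D sets_restrict_space_iff space_restrict_space)
      have "(\<lambda>x. X (real j) x c) \<in> borel_measurable (restrict_space vol (?B (real j) \<inter> dom_of c))"
        using weak_gradientD(1)[OF X(1)] c by (simp add: chart_measurable_def)
      then have "(\<lambda>x. X (real j) x c) \<in> borel_measurable (restrict_space (restrict_space vol (?B (real j) \<inter> dom_of c)) D)"
        by (rule measurable_restrict_space1)
      moreover have "sets (restrict_space (restrict_space vol (?B (real j) \<inter> dom_of c)) D) = sets (restrict_space (restrict_space vol (dom_of c)) D)"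
      proof -
        have "?B (real j) \<inter> dom_of c \<inter> D = dom_of c \<inter> D" using xN by (auto simp: D)
        then show ?thesis unfolding sets_restrict_restrict_space by simp
      qed
      ultimately have "(\<lambda>x. X (real j) x c) \<in> borel_measurable (restrict_space (restrict_space vol (dom_of c)) D)"
        using measurable_cong_sets by blast
      then show "(\<lambda>x. Z x c) \<in> borel_measurable (restrict_space (restrict_space vol (dom_of c)) D)"
        by (rule measurable_cong[THEN iffD1, rotated]) (auto simp: Z_def D space_restrict_space)
    qed simp
  qed
  have aeZ: "AE x in vol. x \<in> ?B R \<longrightarrow> X R x = Z x" for R
  proof -
    \<comment> \<open>Gradients on overlapping balls agree almost everywhere by uniqueness, and only
      countably many integer radii are involved.\<close>
    have "AE x in vol. x \<in> ?B R \<inter> ?B (real j) \<longrightarrow> X R x = X (real j) x" for j :: nat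
      by (rule weak_gradient_unique[where u=u]; (intro weak_gradient_subset[OF X(1)])?) (auto intro!: open_Int open_mball)
    then have "AE x in vol. \<forall>j::nat. x \<in> ?B R \<inter> ?B (real j) \<longrightarrow> X R x = X (real j) x"
      unfolding AE_all_countable by (rule allI)
    then show ?thesis
    proof eventually_elim
      case (elim x)
      then show ?case using xN[of x] unfolding Z_def by blast
    qed
  qed
  have wZ: "weak_gradient \<A> g vol (?B R) u Z" for R
    using chart_measurable_subset[OF Zm _ open_mball] aeZ by (intro weak_gradient_cong_AE[OF open_mball X(1)]) auto
  have "weak_gradient \<A> g vol UNIV u Z" by (rule weak_gradient_UNIV[OF wZ])
  then show gr: "weak_gradient \<A> g vol UNIV u (grad \<A> g vol u)" unfolding grad_def
    by (rule someI[of "weak_gradient \<A> g vol UNIV u" Z])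
  show "(\<lambda>x. tnorm g x (grad \<A> g vol u x)) \<in> Lp_on vol p (?B R)"
  proof -
    let ?M = "restrict_space vol (?B R)"
    note gB = weak_gradient_subset[OF gr open_mball subset_UNIV, of x0 R]
    have m: "(\<lambda>x. tnorm g x (grad \<A> g vol u x)) \<in> borel_measurable ?M"
      by (rule measurable_tnorm[OF open_mball weak_gradientD(1)[OF gB]])
    have "AE x in vol. x \<in> ?B R \<longrightarrow> X R x = grad \<A> g vol u x"
      by (rule weak_gradient_unique[OF open_mball X(1) gB])
    then have ae: "AE x in ?M. X R x = grad \<A> g vol u x"
      using open_sets_vol[OF open_mball] by (subst AE_restrict_space_iff) auto
    have "integrable ?M (\<lambda>x. \<bar>tnorm g x (X R x)\<bar> powr p)" using X(2) by (simp add: Lp_on_def)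
    then have "integrable ?M (\<lambda>x. \<bar>tnorm g x (grad \<A> g vol u x)\<bar> powr p)"
      by (rule integrable_cong_AE_imp) (use m ae in \<open>auto elim: eventually_mono\<close>)
    then show ?thesis using m by (simp add: Lp_on_def)
  qed
qed

text \<open>The classical gradient of a continuously differentiable function, in the covariant form
  in which weak gradients are tested.\<close>

definition has_gradient :: "('a \<Rightarrow> real) \<Rightarrow> ('a \<Rightarrow> ('a, 'n) tvec) \<Rightarrow> bool" where
  "has_gradient \<psi> Y \<longleftrightarrow> chart_measurable UNIV Y \<and> continuous_on UNIV \<psi> \<and>
     (\<forall>c\<in>\<A>. \<forall>i. \<exists>D. (\<forall>y\<in>chart_map c ` dom_of c. (\<psi> \<circ> chart_inv c has_derivative D y) (at y)) \<and>
        (\<forall>y\<in>chart_map c ` dom_of c. D y (axis i 1) = g (chart_inv c y) (Y (chart_inv c y)) (coord_field \<A> c i (chart_inv c y))) \<and>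
        continuous_on (chart_map c ` dom_of c) (\<lambda>y. D y (axis i 1)))"

lemma measurable_locally_integrable:
  assumes "\<And>K. compact K \<Longrightarrow> set_integrable vol K (u :: 'a \<Rightarrow> real)"
  shows "u \<in> borel_measurable vol"
proof -
  fix x0 :: 'a
  have "u \<in> borel_measurable (restrict_space vol (UNIV::'a set))"
  proof (rule measurable_by_mballs[of _ x0])
    fix n :: nat
    have "set_integrable vol (RM.mcball x0 (real n)) u" by (intro assms Hopf_Rinow)
    then have "(\<lambda>x. indicator (RM.mcball x0 (real n)) x *\<^sub>R u x) \<in> borel_measurable vol"
      unfolding set_integrable_def by (rule borel_measurable_integrable)
    then have "u \<in> borel_measurable (restrict_space vol (RM.mcball x0 (real n)))"
      using closed_sets_vol[OF closed_mcball] by (subst borel_measurable_restrict_space_iff) auto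
    then have "u \<in> borel_measurable (restrict_space (restrict_space vol (RM.mcball x0 (real n))) (RM.mball x0 (real n)))"
      by (rule measurable_restrict_space1)
    moreover have "RM.mcball x0 (real n) \<inter> RM.mball x0 (real n) = RM.mball x0 (real n)" by auto
    ultimately show "u \<in> borel_measurable (restrict_space vol (RM.mball x0 (real n) \<inter> UNIV))"
      using closed_sets_vol[OF closed_mcball] open_sets_vol[OF open_mball] by (simp add: restrict_restrict_space)
  qed simp
  then show ?thesis by (rule measurable_restrict_UNIV)
qed

text \<open>In each chart this is the product rule for weak derivatives, with the components
  recombined by bilinearity of the metric. The pointwise bounds in terms of u and its gradient are
  what puts the product into the local Sobolev space.\<close>

lemma weak_gradient_product_chain:
  assumes u: "weak_gradient \<A> g vol UNIV u X" and \<psi>: "has_gradient \<psi> Y"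
    and bd: "\<And>x. \<bar>\<psi> x\<bar> \<le> B" "\<And>x. tnorm g x (Y x) \<le> L"
    and h: "\<And>t. (h has_real_derivative h' t) (at t)" "continuous_on UNIV h'" "\<And>t. \<bar>h' t\<bar> \<le> C" "h 0 = 0"
  shows "weak_gradient \<A> g vol UNIV (\<lambda>x. \<psi> x * h (u x)) (\<lambda>x c. (\<psi> x * h' (u x)) *\<^sub>R X x c + h (u x) *\<^sub>R Y x c)"
    (is "weak_gradient \<A> g vol UNIV ?\<phi> ?Z")
    and "\<And>x. \<bar>\<psi> x * h (u x)\<bar> \<le> B * C * \<bar>u x\<bar>"
    and "\<And>x. tnorm g x (\<lambda>c. (\<psi> x * h' (u x)) *\<^sub>R X x c + h (u x) *\<^sub>R Y x c) \<le> B * C * tnorm g x (X x) + C * L * \<bar>u x\<bar>"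
    and "(\<lambda>x. \<psi> x * h (u x)) \<in> borel_measurable vol"
proof -
  note uD = weak_gradientD[OF u]
  have um: "u \<in> borel_measurable vol" using uD(2) by (intro measurable_locally_integrable) auto
  have hc: "continuous_on UNIV h"
    using h(1) by (auto simp: continuous_on_eq_continuous_at intro: DERIV_isCont)
  have hm: "h \<in> borel_measurable borel" "h' \<in> borel_measurable borel"
    using hc h(2) by (auto intro: borel_measurable_continuous_onI)
  have hum[measurable]: "(\<lambda>x. h (u x)) \<in> borel_measurable vol" "(\<lambda>x. h' (u x)) \<in> borel_measurable vol"
    using measurable_compose[OF um hm(1)] measurable_compose[OF um hm(2)] by auto
  have \<psi>m[measurable]: "\<psi> \<in> borel_measurable vol"
    using \<psi> by (intro measurable_vol_borel borel_measurable_continuous_onI) (simp add: has_gradient_def)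
  show \<phi>m: "?\<phi> \<in> borel_measurable vol" by measurable
  have Ym: "chart_measurable UNIV Y" using \<psi> by (simp add: has_gradient_def)
  have tX: "X x \<in> tangent_space \<A> x" and tY: "Y x \<in> tangent_space \<A> x" for x
    using uD(1) Ym by (auto simp: chart_measurable_def)
  have B0: "B \<ge> 0" and L0: "L \<ge> 0" and C0: "C \<ge> 0"
    using bd(1)[of undefined] bd(2)[of undefined] tnorm_nonneg[OF tY, of undefined] h(3)[of 0] by linarith+
  have hC: "\<bar>h t\<bar> \<le> C * \<bar>t\<bar>" for t using Lipschitz_of_bounded_derivative[OF h(1,3), of t 0] h(4) by simp
  show b\<phi>: "\<bar>?\<phi> x\<bar> \<le> B * C * \<bar>u x\<bar>" for x
  proof -
    have "\<bar>?\<phi> x\<bar> \<le> B * (C * \<bar>u x\<bar>)" unfolding abs_mult by (intro mult_mono bd hC B0 abs_ge_zero)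
    then show ?thesis by (simp add: mult.assoc)
  qed
  show bZ: "tnorm g x (?Z x) \<le> B * C * tnorm g x (X x) + C * L * \<bar>u x\<bar>" for x
  proof -
    have "tnorm g x (?Z x) \<le> \<bar>\<psi> x * h' (u x)\<bar> * tnorm g x (X x) + \<bar>h (u x)\<bar> * tnorm g x (Y x)"
      by (rule tangent_triangle[OF tX tY])
    also have "\<dots> \<le> (B * C) * tnorm g x (X x) + (C * \<bar>u x\<bar>) * L"
      using tnorm_nonneg[OF tX, of x] tnorm_nonneg[OF tY, of x] bd[of x] h(3)[of "u x"] hC[of "u x"] B0 C0 L0
      by (intro add_mono mult_mono) (auto simp: abs_mult intro!: mult_mono)
    finally show ?thesis by (simp add: mult.commute mult.left_commute mult.assoc)
  qed
  have Zm: "chart_measurable UNIV ?Z" unfolding chart_measurable_def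
  proof (intro conjI ballI tangent_lincomb tX tY)
    fix c assume c: "c \<in> \<A>"
    let ?M = "restrict_space vol (UNIV \<inter> dom_of c)"
    have 1: "(\<lambda>x. X x c) \<in> borel_measurable ?M" "(\<lambda>x. Y x c) \<in> borel_measurable ?M"
      using uD(1) Ym c by (auto simp: chart_measurable_def)
    have 2: "(\<lambda>x. \<psi> x * h' (u x)) \<in> borel_measurable ?M" "(\<lambda>x. h (u x)) \<in> borel_measurable ?M"
      by (intro measurable_restrict_space1; measurable)+
    show "(\<lambda>x. ?Z x c) \<in> borel_measurable ?M"
      by (intro borel_measurable_add borel_measurable_scaleR 1 2)
  qed
  show "weak_gradient \<A> g vol UNIV ?\<phi> ?Z"
  proof (rule weak_gradientI[OF Zm])
    fix K :: "'a set" assume K: "compact K"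
    have ms: "set_borel_measurable vol K f" if "f \<in> borel_measurable vol" for f :: "'a \<Rightarrow> real"
      unfolding set_borel_measurable_def using that compact_sets_vol[OF K] by simp
    show "set_integrable vol K ?\<phi>"
    proof (rule set_integrable_bound)
      show "set_integrable vol K (\<lambda>x. B * C * u x)" using uD(2)[OF K] by (intro set_integrable_mult_right) auto
      show "AE x in vol. x \<in> K \<longrightarrow> norm (?\<phi> x) \<le> norm (B * C * u x)"
        using b\<phi> B0 C0 by (auto simp: abs_mult intro!: AE_I2)
    qed (rule ms[OF \<phi>m])
    show "set_integrable vol K (\<lambda>x. tnorm g x (?Z x))"
    proof (rule set_integrable_bound)
      show "set_integrable vol K (\<lambda>x. B * C * tnorm g x (X x) + C * L * \<bar>u x\<bar>)"
        using uD(2,3)[OF K] by (intro set_integral_add(1) set_integrable_mult_right set_integrable_abs) auto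
      show "set_borel_measurable vol K (\<lambda>x. tnorm g x (?Z x))"
        using measurable_tnorm[OF open_UNIV Zm] by (intro ms measurable_restrict_UNIV)
      show "AE x in vol. x \<in> K \<longrightarrow> norm (tnorm g x (?Z x)) \<le> norm (B * C * tnorm g x (X x) + C * L * \<bar>u x\<bar>)"
        using bZ tnorm_nonneg[OF tangent_lincomb[OF tX tY]] by (auto intro!: AE_I2 order_trans[OF _ abs_ge_self])
    qed
  next
    fix c \<phi> i assume c: "c \<in> \<A>" and \<phi>: "test_function (chart_map c ` (UNIV \<inter> dom_of c)) \<phi>"
    let ?W = "chart_map c ` (UNIV \<inter> dom_of c)"
    have Weq: "?W = chart_map c ` dom_of c" by simp
    obtain D where D0: "\<forall>y\<in>chart_map c ` dom_of c. (\<psi> \<circ> chart_inv c has_derivative D y) (at y)"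
      "\<forall>y\<in>chart_map c ` dom_of c. D y (axis i 1) = g (chart_inv c y) (Y (chart_inv c y)) (coord_field \<A> c i (chart_inv c y))"
      "continuous_on (chart_map c ` dom_of c) (\<lambda>y. D y (axis i 1))"
      using \<psi>[unfolded has_gradient_def, THEN conjunct2, THEN conjunct2, THEN bspec, OF c, THEN spec, of i]
      by (elim exE conjE) (rule that; assumption)
    note D' = D0[folded Weq]
    note D = bspec[OF D'(1)] bspec[OF D'(2)] D'(3)
    have "(LINT y:?W|lebesgue. ((\<psi> \<circ> chart_inv c) y * h (u (chart_inv c y))) * frechet_derivative \<phi> (at y) (axis i 1))
      = - (LINT y:?W|lebesgue. ((\<psi> \<circ> chart_inv c) y * (h' (u (chart_inv c y)) *
           g (chart_inv c y) (X (chart_inv c y)) (coord_field \<A> c i (chart_inv c y))) + h (u (chart_inv c y)) * D y (axis i 1)) * \<phi> y)"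
    proof (rule weak_product_chain_rule[OF open_chart_image[OF c open_UNIV] _ _ _ h D(1,3) \<phi>])
      show "set_integrable lebesgue K (\<lambda>y. u (chart_inv c y))" if "compact K" "K \<subseteq> ?W" for K
        by (rule set_integrable_function[OF c uD(2) that])
      show "set_integrable lebesgue K (\<lambda>y. g (chart_inv c y) (X (chart_inv c y)) (coord_field \<A> c i (chart_inv c y)))"
        if "compact K" "K \<subseteq> ?W" for K
        by (rule set_integrable_component[OF c open_UNIV uD(1,3) that])
      show "(LINT y:?W|lebesgue. u (chart_inv c y) * frechet_derivative \<theta> (at y) (axis i 1))
        = - (LINT y:?W|lebesgue. g (chart_inv c y) (X (chart_inv c y)) (coord_field \<A> c i (chart_inv c y)) * \<theta> y)"
        if "test_function ?W \<theta>" for \<theta> by (rule uD(4)[OF c that])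
    qed
    also have "(LINT y:?W|lebesgue. ((\<psi> \<circ> chart_inv c) y * (h' (u (chart_inv c y)) *
           g (chart_inv c y) (X (chart_inv c y)) (coord_field \<A> c i (chart_inv c y))) + h (u (chart_inv c y)) * D y (axis i 1)) * \<phi> y)
      = (LINT y:?W|lebesgue. g (chart_inv c y) (?Z (chart_inv c y)) (coord_field \<A> c i (chart_inv c y)) * \<phi> y)"
      unfolding set_lebesgue_integral_def
    proof (rule Bochner_Integration.integral_cong[OF refl])
      fix y
      show "indicator ?W y *\<^sub>R (((\<psi> \<circ> chart_inv c) y * (h' (u (chart_inv c y)) *
           g (chart_inv c y) (X (chart_inv c y)) (coord_field \<A> c i (chart_inv c y))) + h (u (chart_inv c y)) * D y (axis i 1)) * \<phi> y)
       = indicator ?W y *\<^sub>R (g (chart_inv c y) (?Z (chart_inv c y)) (coord_field \<A> c i (chart_inv c y)) * \<phi> y)"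
      proof (cases "y \<in> ?W")
        case True
        let ?x = "chart_inv c y"
        have x: "?x \<in> dom_of c" using True chart_inv_dom[OF c] by simp
        note te = tvec_of_tangent[OF c x, of "axis i 1"]
        have "g ?x (?Z ?x) (coord_field \<A> c i ?x) = g ?x (coord_field \<A> c i ?x) (?Z ?x)"
          by (rule metric_sym[OF tangent_lincomb[OF tX tY] te])
        also have "\<dots> = (\<psi> ?x * h' (u ?x)) * g ?x (coord_field \<A> c i ?x) (X ?x) + h (u ?x) * g ?x (coord_field \<A> c i ?x) (Y ?x)"
          by (rule g_lincomb_right[OF tX tY te])
        also have "g ?x (coord_field \<A> c i ?x) (X ?x) = g ?x (X ?x) (coord_field \<A> c i ?x)" by (rule metric_sym[OF te tX])
        also have "g ?x (coord_field \<A> c i ?x) (Y ?x) = D y (axis i 1)"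
          using metric_sym[OF te tY] D(2)[OF True] by simp
        finally show ?thesis by simp
      qed simp
    qed
    finally show "(LINT y:?W|lebesgue. ?\<phi> (chart_inv c y) * frechet_derivative \<phi> (at y) (axis i 1)) =
        - (LINT y:?W|lebesgue. g (chart_inv c y) (?Z (chart_inv c y)) (coord_field \<A> c i (chart_inv c y)) * \<phi> y)"
      by simp
  qed
qed

end

section \<open>Smoothing the distance function\<close>

text \<open>The square of the positive part is C^1, unlike the positive part itself; the mollifier
  and the cutoff profile are built from it.\<close>

definition pos_sq :: "real \<Rightarrow> real" where "pos_sq t = (max 0 t)\<^sup>2"

lemma pos_sq_derivative: "(pos_sq has_real_derivative 2 * max 0 t) (at t)"
proof -
  consider "t < 0" | "t = 0" | "t > 0" by linarith
  then show ?thesis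
  proof cases
    case 1
    have "((\<lambda>_. 0) has_real_derivative 2 * max 0 t) (at t)" using 1 by simp
    then show ?thesis
      by (rule has_field_derivative_transform_within_open[where S="{..<0}"]) (use 1 in \<open>auto simp: pos_sq_def\<close>)
  next
    case 2
    have "((\<lambda>h. max 0 h) \<longlongrightarrow> max 0 (0::real)) (at 0)" by (intro tendsto_intros)
    then have l: "((\<lambda>h. max 0 h) \<longlongrightarrow> (0::real)) (at 0)" by simp
    have "((\<lambda>h. (pos_sq (0 + h) - pos_sq 0) / h) \<longlongrightarrow> 0) (at 0)"
      by (rule Lim_transform_eventually[OF l]) (auto simp: eventually_at_filter pos_sq_def power2_eq_square max_def)
    then show ?thesis using 2 by (simp add: DERIV_def)
  next
    case 3
    have "((\<lambda>t. t\<^sup>2) has_real_derivative 2 * max 0 t) (at t)" using 3 by (auto intro!: derivative_eq_intros)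
    then show ?thesis
      by (rule has_field_derivative_transform_within_open[where S="{0<..}"]) (use 3 in \<open>auto simp: pos_sq_def\<close>)
  qed
qed

lemma continuous_pos_sq: "continuous_on S pos_sq"
  unfolding pos_sq_def[abs_def] by (intro continuous_intros)

text \<open>The kernel ((e^2 - |z|^2)_+)^2 vanishes off the ball of radius e and is C^1, the
  regularity wanted for the smoothed distance.\<close>

lemma mollifier_exists:
  assumes e: "(e::real) > 0"
  obtains k where "k > 0" "integrable lborel (\<lambda>z :: 'a::euclidean_space. k * pos_sq (e\<^sup>2 - z \<bullet> z))"
    "(LINT z :: 'a|lborel. k * pos_sq (e\<^sup>2 - z \<bullet> z)) = 1"
proof -
  let ?h = "\<lambda>z :: 'a. pos_sq (e\<^sup>2 - z \<bullet> z)"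
  have hc: "continuous_on UNIV ?h"
    by (rule continuous_on_compose2[OF continuous_pos_sq]) (auto intro!: continuous_intros)
  have z: "?h z = 0" if "z \<notin> cball 0 e" for z
  proof -
    have "e\<^sup>2 < (norm z)\<^sup>2" using that e by (intro power_strict_mono) auto
    then show ?thesis by (simp add: pos_sq_def dot_square_norm)
  qed
  have "set_integrable lborel (cball 0 e) ?h"
    unfolding set_integrable_def
    by (rule borel_integrable_compact[OF compact_cball continuous_on_subset[OF hc]]) auto
  moreover have "(\<lambda>z. indicator (cball 0 e) z *\<^sub>R ?h z) = ?h" using z by (auto simp: indicator_def fun_eq_iff)
  ultimately have i: "integrable lborel ?h" by (simp add: set_integrable_def)
  \<comment> \<open>On the ball of radius e/2 one has |z|^2 \<le> e^2/4, so the kernel is at least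
    (3/4 e^2)^2 there and its integral is positive.\<close>
  have "(LINT z::'a|lborel. indicator (ball 0 (e/2)) z * ((3/4) * e\<^sup>2)\<^sup>2) \<le> (LINT z|lborel. ?h z)"
  proof (rule integral_mono[OF _ i])
    show "integrable lborel (\<lambda>z::'a. indicator (ball 0 (e/2)) z * ((3/4) * e\<^sup>2)\<^sup>2)"
      by (intro integrable_mult_left integrable_real_indicator) (use emeasure_bounded_finite[OF bounded_ball, of "0::'a" "e/2"] in auto)
    fix z :: 'a
    show "indicator (ball 0 (e/2)) z * ((3/4) * e\<^sup>2)\<^sup>2 \<le> ?h z"
    proof (cases "z \<in> ball 0 (e/2)")
      case True
      then have "(norm z)\<^sup>2 \<le> (e/2)\<^sup>2" by (intro power_mono) auto
      then have "z \<bullet> z \<le> e\<^sup>2 / 4" by (simp add: dot_square_norm power_divide)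
      then have *: "(3/4) * e\<^sup>2 \<le> max 0 (e\<^sup>2 - z \<bullet> z)" by linarith
      have "((3/4) * e\<^sup>2)\<^sup>2 \<le> (max 0 (e\<^sup>2 - z \<bullet> z))\<^sup>2" using * by (intro power_mono) auto
      then show ?thesis using True by (simp add: pos_sq_def)
    qed (simp add: pos_sq_def)
  qed
  moreover have "(LINT z|lborel. indicator (ball 0 (e/2)) (z::'a) * ((3/4) * e\<^sup>2)\<^sup>2) = measure lborel (ball (0::'a) (e/2)) * ((3/4) * e\<^sup>2)\<^sup>2"
    by simp
  moreover have "measure lborel (ball (0::'a) (e/2)) > 0" using content_ball_pos[of "e/2" "0::'a"] e by simp
  ultimately have I: "(LINT z|lborel. ?h z) > 0"
    using e by (smt (verit) mult_pos_pos zero_less_power zero_less_divide_iff)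
  show ?thesis
  proof (rule that)
    show "1 / (LINT z|lborel. ?h z) > 0" using I by simp
    show "integrable lborel (\<lambda>z. 1 / (LINT z|lborel. ?h z) * ?h z)" using i by (intro integrable_mult_right) auto
    have "(LINT z|lborel. 1 / (LINT z|lborel. ?h z) * ?h z) = 1 / (LINT z|lborel. ?h z) * (LINT z|lborel. ?h z)"
      by (rule integral_mult_right_zero)
    then show "(LINT z|lborel. 1 / (LINT z|lborel. ?h z) * ?h z) = 1" using I by simp
  qed
qed

text \<open>Convolution with a small kernel. Increments of the result in direction v are averages of
  increments of f in the same direction, so a Lipschitz constant of f along v passes to the
  derivative, whatever norm it comes from. The box between the two balls is the domain over which
  the integral is differentiated.\<close>

lemma C1_approximation:
  fixes f :: "'a::euclidean_space \<Rightarrow> real"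
  assumes f: "continuous_on (cball a R) f" and \<rho>: "0 < \<rho>" "\<rho> < R" and \<delta>: "\<delta> > 0"
    and Q: "cball a \<rho> \<subseteq> interior (cbox l u)" "cbox l u \<subseteq> cball a R"
  obtains F D where "\<And>y. (F has_derivative D y) (at y)" "\<And>v. continuous_on UNIV (\<lambda>y. D y v)"
    "\<And>y. y \<in> cball a \<rho> \<Longrightarrow> \<bar>F y - f y\<bar> \<le> \<delta>"
    "\<And>y v L. y \<in> cball a \<rho> \<Longrightarrow> (\<And>z t. z \<in> cball a R \<Longrightarrow> z + t *\<^sub>R v \<in> cball a R \<Longrightarrow> \<bar>f (z + t *\<^sub>R v) - f z\<bar> \<le> L * \<bar>t\<bar>)
       \<Longrightarrow> \<bar>D y v\<bar> \<le> L"
proof -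
  have fQ: "continuous_on (cbox l u) f" by (rule continuous_on_subset[OF f Q(2)])
  obtain d0 where d0: "d0 > 0" "(\<Union>x\<in>cball a \<rho>. cball x d0) \<subseteq> interior (cbox l u)"
    using compact_subset_open_imp_cball_epsilon_subset[OF compact_cball open_interior Q(1)] by blast
  have "uniformly_continuous_on (cbox l u) f" by (rule compact_uniformly_continuous[OF fQ compact_cbox])
  then obtain d1 where d1: "d1 > 0" "\<And>x y. x \<in> cbox l u \<Longrightarrow> y \<in> cbox l u \<Longrightarrow> dist y x < d1 \<Longrightarrow> dist (f y) (f x) < \<delta>"
    using \<delta> unfolding uniformly_continuous_on_def by metis
  \<comment> \<open>The kernel radius is strictly below d0; the difference d0 - e is the room for
    the increments t v in the difference quotients.\<close>
  define e where "e = min (d0 / 2) (d1 / 2)"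
  have e: "e > 0" "e < d0" "e < d1" using d0(1) d1(1) by (auto simp: e_def)
  obtain k where k: "k > 0" "integrable lborel (\<lambda>z::'a. k * pos_sq (e\<^sup>2 - z \<bullet> z))"
    "(LINT z::'a|lborel. k * pos_sq (e\<^sup>2 - z \<bullet> z)) = 1" by (rule mollifier_exists[OF e(1)])
  define \<eta> where "\<eta> z = k * pos_sq (e\<^sup>2 - z \<bullet> z)" for z :: 'a
  have \<eta>0: "\<eta> z \<ge> 0" for z using k(1) by (simp add: \<eta>_def pos_sq_def)
  have \<eta>z: "\<eta> z = 0" if "norm z \<ge> e" for z
  proof -
    have "e\<^sup>2 \<le> (norm z)\<^sup>2" using that e by (intro power_mono) auto
    then show ?thesis by (simp add: \<eta>_def pos_sq_def dot_square_norm)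
  qed
  have \<eta>c: "continuous_on UNIV \<eta>" unfolding \<eta>_def
    by (intro continuous_intros continuous_on_compose2[OF continuous_pos_sq]) auto
  define F where "F y = integral (cbox l u) (\<lambda>w. f w * \<eta> (y - w))" for y
  define fx where "fx y w = (f w * (k * (- 4 * max 0 (e\<^sup>2 - (y - w) \<bullet> (y - w))))) *\<^sub>R blinfun_inner_right (y - w)" for y w
  have der: "((\<lambda>y. f w * \<eta> (y - w)) has_derivative blinfun_apply (fx y w)) (at y)" for y w
  proof -
    have 1: "((\<lambda>y. e\<^sup>2 - (y - w) \<bullet> (y - w)) has_derivative (\<lambda>v. - (2 * ((y - w) \<bullet> v)))) (at y)"
      by (auto intro!: derivative_eq_intros simp: inner_commute)
    have "((\<lambda>y. f w * (k * pos_sq (e\<^sup>2 - (y - w) \<bullet> (y - w)))) has_derivative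
        (\<lambda>v. f w * (k * ((2 * max 0 (e\<^sup>2 - (y - w) \<bullet> (y - w))) * (- (2 * ((y - w) \<bullet> v))))))) (at y)"
      by (intro has_derivative_mult_right has_derivative_compose[OF 1 pos_sq_derivative[unfolded has_field_derivative_def]])
    also have "(\<lambda>v. f w * (k * ((2 * max 0 (e\<^sup>2 - (y - w) \<bullet> (y - w))) * (- (2 * ((y - w) \<bullet> v)))))) = blinfun_apply (fx y w)"
      by (auto simp: fx_def fun_eq_iff blinfun.scaleR_left blinfun.minus_left)
    finally show ?thesis by (simp add: \<eta>_def)
  qed
  have cfx: "continuous_on (UNIV \<times> cbox l u) (\<lambda>(y, w). fx y w)"
  proof -
    have 1: "continuous_on (UNIV \<times> cbox l u) (\<lambda>p. f (snd p))"
      by (rule continuous_on_compose2[OF fQ]) (auto intro!: continuous_intros)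
    have 2: "continuous_on (UNIV \<times> cbox l u) (\<lambda>p :: 'a \<times> 'a. blinfun_inner_right (fst p - snd p))"
      by (rule bounded_linear.continuous_on[OF bounded_linear_blinfun_inner_right]) (intro continuous_intros)
    show ?thesis unfolding fx_def case_prod_unfold
      by (intro continuous_intros 1 2)
  qed
  have int: "(\<lambda>w. f w * \<eta> (y - w)) integrable_on cbox l u" for y
    by (intro integrable_continuous continuous_intros fQ continuous_on_compose2[OF \<eta>c]) auto
  define D where "D y = blinfun_apply (integral (cbox l u) (fx y))" for y
  have FD: "(F has_derivative D y) (at y)" for y
    using leibniz_rule[of UNIV l u "\<lambda>y w. f w * \<eta> (y - w)" fx y, OF _ int cfx] der
    unfolding F_def D_def by auto
  have "continuous_on UNIV (\<lambda>y. integral (cbox l u) (fx y))"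
    by (rule integral_continuous_on_param[OF cfx])
  then have cD: "continuous_on UNIV (\<lambda>y. D y v)" for v
    unfolding D_def by (intro continuous_intros)
  have inQ: "y + z \<in> cbox l u" if "y \<in> cball a \<rho>" "norm z \<le> d0" for y z
  proof -
    have "y + z \<in> cball y d0" using that(2) by (simp add: dist_norm)
    then have "y + z \<in> interior (cbox l u)" using d0(2) that(1) by blast
    then show ?thesis using interior_subset by blast
  qed
  let ?f = "\<lambda>w. indicator (cbox l u) w * f w"
  have fi: "integrable lborel ?f"
    using borel_integrable_compact[OF compact_cbox fQ] by (simp add: set_integrable_def)
  have \<eta>b: "\<bar>\<eta> z\<bar> \<le> k * (e\<^sup>2)\<^sup>2" for z
  proof -
    have "(max 0 (e\<^sup>2 - z \<bullet> z))\<^sup>2 \<le> (e\<^sup>2)\<^sup>2" by (intro power_mono) auto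
    then show ?thesis using k(1) by (simp add: \<eta>_def pos_sq_def abs_mult)
  qed
  have \<eta>m: "\<eta> \<in> borel_measurable borel" by (rule borel_measurable_continuous_onI[OF \<eta>c])
  have \<eta>i: "integrable lborel \<eta>" "(LINT z|lborel. \<eta> z) = 1" using k(2,3) by (simp_all add: \<eta>_def[abs_def])
  \<comment> \<open>After a translation y occurs only in the argument of f, so increments of F are
    averages of increments of f.\<close>
  have Fconv: "F y = (LINT z|lborel. ?f (y + z) * \<eta> z)" for y
  proof -
    have i: "integrable lborel (\<lambda>w. ?f w * \<eta> (y - w))"
    proof (rule integrable_mult_bounded[OF fi _ \<eta>b])
      show "(\<lambda>w. \<eta> (y - w)) \<in> borel_measurable lborel"
        using measurable_compose[OF _ \<eta>m, of "\<lambda>w. y - w" lborel] by simp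
    qed
    have "F y = (LINT w:cbox l u|lborel. f w * \<eta> (y - w))"
      unfolding F_def using i by (intro set_borel_integral_eq_integral(2)[symmetric]) (simp add: set_integrable_def mult.assoc)
    also have "\<dots> = (LINT w|lborel. ?f w * \<eta> (y - w))" by (simp add: set_lebesgue_integral_def mult.assoc)
    also have "\<dots> = (LINT w|lborel. ?f (w + y) * \<eta> (y - (w + y)))"
      using borel_measurable_integrable[OF i] by (intro lborel_integral_translate[symmetric]) simp
    also have "\<dots> = (LINT z|lborel. ?f (y + z) * \<eta> z)"
      by (simp add: \<eta>_def add.commute)
    finally show ?thesis .
  qed
  have ifz: "integrable lborel (\<lambda>z. ?f (y + z) * \<eta> z)" for y
    using lborel_integrable_translate[OF fi, of y] \<eta>m by (intro integrable_mult_bounded[OF _ _ \<eta>b]) (auto simp: add.commute)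
  show ?thesis
  proof (rule that[OF FD cD])
    fix y assume y: "y \<in> cball a \<rho>"
    have yQ: "y \<in> cbox l u" using inQ[OF y, of 0] d0 by simp
    have "\<bar>F y - f y\<bar> = \<bar>(LINT z|lborel. ?f (y + z) * \<eta> z) - (LINT z|lborel. f y * \<eta> z)\<bar>"
      by (simp add: Fconv \<eta>i(2))
    also have "\<dots> = \<bar>LINT z|lborel. ?f (y + z) * \<eta> z - f y * \<eta> z\<bar>" using ifz \<eta>i(1) by simp
    also have "\<dots> \<le> (LINT z|lborel. \<bar>?f (y + z) * \<eta> z - f y * \<eta> z\<bar>)"
      using integral_norm_bound[of lborel "\<lambda>z. ?f (y + z) * \<eta> z - f y * \<eta> z"] by simp
    also have "\<dots> \<le> (LINT z|lborel. \<delta> * \<eta> z)"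
    proof (rule integral_mono)
      show "integrable lborel (\<lambda>z. \<bar>?f (y + z) * \<eta> z - f y * \<eta> z\<bar>)" using ifz \<eta>i(1) by auto
      show "integrable lborel (\<lambda>z. \<delta> * \<eta> z)" using \<eta>i(1) by simp
      fix z
      show "\<bar>?f (y + z) * \<eta> z - f y * \<eta> z\<bar> \<le> \<delta> * \<eta> z"
      proof (cases "norm z < e")
        case True
        then have zQ: "y + z \<in> cbox l u" using inQ[OF y] e by simp
        have "dist (f (y + z)) (f y) < \<delta>" using True e by (intro d1(2)[OF yQ zQ]) (simp add: dist_norm)
        then have "\<bar>f (y + z) - f y\<bar> * \<eta> z \<le> \<delta> * \<eta> z" using \<eta>0 by (intro mult_right_mono) (auto simp: dist_real_def)
        then show ?thesis using zQ \<eta>0[of z] by (simp add: left_diff_distrib[symmetric] abs_mult)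
      qed (simp add: \<eta>z)
    qed
    also have "\<dots> = \<delta>" by (simp add: \<eta>i(2))
    finally show "\<bar>F y - f y\<bar> \<le> \<delta>" .
  next
    fix y v L assume y: "y \<in> cball a \<rho>"
      and lip: "\<And>z t. z \<in> cball a R \<Longrightarrow> z + t *\<^sub>R v \<in> cball a R \<Longrightarrow> \<bar>f (z + t *\<^sub>R v) - f z\<bar> \<le> L * \<bar>t\<bar>"
    have lin: "linear (D y)" using FD has_derivative_linear by blast
    have "((\<lambda>t. F (y + t *\<^sub>R v)) has_derivative (\<lambda>t. D y (t *\<^sub>R v))) (at 0)"
    proof -
      have "((\<lambda>t::real. y + t *\<^sub>R v) has_derivative (\<lambda>t. t *\<^sub>R v)) (at 0)" by (auto intro!: derivative_eq_intros)
      from has_derivative_compose[OF this, of F "D (y + 0 *\<^sub>R v)"] FD show ?thesis by simp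
    qed
    also have "(\<lambda>t. D y (t *\<^sub>R v)) = (*) (D y v)" by (simp add: linear_cmul[OF lin] fun_eq_iff mult.commute)
    finally have "((\<lambda>t. F (y + t *\<^sub>R v)) has_real_derivative D y v) (at 0)" unfolding has_field_derivative_def .
    then have lim: "((\<lambda>t. (F (y + t *\<^sub>R v) - F y) / t) \<longlongrightarrow> D y v) (at 0)"
      by (simp add: has_field_derivative_iff)
    have "(L :: real) \<ge> 0"
    proof -
      have "y \<in> cball a R" "y + 0 *\<^sub>R v \<in> cball a R" using y \<rho> by auto
      have "0 < (d0 - e) / (norm v + 1)" using e by (simp add: add_nonneg_pos)
      define t0 where "t0 = (d0 - e) / (norm v + 1)"
      have t0: "t0 > 0" using \<open>0 < (d0 - e) / (norm v + 1)\<close> by (simp add: t0_def)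
      have "norm (t0 *\<^sub>R v) \<le> d0"
      proof -
        have "norm (t0 *\<^sub>R v) = (d0 - e) * (norm v / (norm v + 1))" using t0 e by (simp add: t0_def abs_mult)
        also have "\<dots> \<le> (d0 - e) * 1" using e by (intro mult_left_mono) (auto simp: divide_le_eq_1 add_nonneg_pos)
        finally show ?thesis using e by simp
      qed
      then have "y + t0 *\<^sub>R v \<in> cball a R" using inQ[OF y] Q(2) by blast
      from lip[OF \<open>y \<in> cball a R\<close> this] have "0 \<le> L * \<bar>t0\<bar>" by linarith
      then show ?thesis using t0 by (simp add: zero_le_mult_iff)
    qed
    have "\<forall>\<^sub>F t in at 0. \<bar>(F (y + t *\<^sub>R v) - F y) / t\<bar> \<le> L"
    proof -
      have "((\<lambda>t. norm (t *\<^sub>R v)) \<longlongrightarrow> norm (0 *\<^sub>R v)) (at 0)" by (intro tendsto_intros)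
      then have "\<forall>\<^sub>F t in at 0. norm (t *\<^sub>R v) < d0 - e" using e by (intro order_tendstoD(2)) auto
      then show ?thesis
      proof (rule eventually_mono[OF eventually_conj[OF _ eventually_neq_at_within[of 0]]])
        fix t :: real assume t: "norm (t *\<^sub>R v) < d0 - e \<and> t \<noteq> 0"
        have "\<bar>F (y + t *\<^sub>R v) - F y\<bar> = \<bar>LINT z|lborel. ?f (y + t *\<^sub>R v + z) * \<eta> z - ?f (y + z) * \<eta> z\<bar>"
          using ifz by (simp add: Fconv)
        also have "\<dots> \<le> (LINT z|lborel. \<bar>?f (y + t *\<^sub>R v + z) * \<eta> z - ?f (y + z) * \<eta> z\<bar>)"
          using integral_norm_bound[of lborel "\<lambda>z. ?f (y + t *\<^sub>R v + z) * \<eta> z - ?f (y + z) * \<eta> z"] by simp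
        also have "\<dots> \<le> (LINT z|lborel. (L * \<bar>t\<bar>) * \<eta> z)"
        proof (rule integral_mono)
          show "integrable lborel (\<lambda>z. \<bar>?f (y + t *\<^sub>R v + z) * \<eta> z - ?f (y + z) * \<eta> z\<bar>)" using ifz by auto
          show "integrable lborel (\<lambda>z. (L * \<bar>t\<bar>) * \<eta> z)" using \<eta>i(1) by simp
          fix z
          show "\<bar>?f (y + t *\<^sub>R v + z) * \<eta> z - ?f (y + z) * \<eta> z\<bar> \<le> (L * \<bar>t\<bar>) * \<eta> z"
          proof (cases "norm z < e")
            case True
            have 1: "y + z \<in> cbox l u" using inQ[OF y] True e by simp
            have "norm (z + t *\<^sub>R v) \<le> d0" using norm_triangle_ineq[of z "t *\<^sub>R v"] True t by linarith
            then have 2: "y + t *\<^sub>R v + z \<in> cbox l u" using inQ[OF y, of "z + t *\<^sub>R v"] by (simp add: algebra_simps)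
            have "\<bar>f (y + z + t *\<^sub>R v) - f (y + z)\<bar> \<le> L * \<bar>t\<bar>"
              using 1 2 Q(2) by (intro lip) (auto simp: algebra_simps subset_iff)
            then have "\<bar>f (y + t *\<^sub>R v + z) - f (y + z)\<bar> * \<eta> z \<le> (L * \<bar>t\<bar>) * \<eta> z"
              using \<eta>0 by (intro mult_right_mono) (auto simp: algebra_simps)
            then show ?thesis using 1 2 \<eta>0[of z] by (simp add: left_diff_distrib[symmetric] abs_mult)
          qed (simp add: \<eta>z)
        qed
        also have "\<dots> = L * \<bar>t\<bar>" by (simp add: \<eta>i(2))
        finally show "\<bar>(F (y + t *\<^sub>R v) - F y) / t\<bar> \<le> L" using t by (simp add: field_simps)
      qed
    qed
    then show "\<bar>D y v\<bar> \<le> L"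
      by (rule tendsto_upperbound[OF tendsto_rabs[OF lim]]) simp
  qed
qed

section \<open>C^1 functions on the manifold and bounds for their slope\<close>

context riem_volume
begin

definition dfun :: "('a, 'n) chart \<Rightarrow> ('a \<Rightarrow> real) \<Rightarrow> 'a \<Rightarrow> real^'n \<Rightarrow> real" where
  "dfun c f x = frechet_derivative (f \<circ> chart_inv c) (at (chart_map c x))"

definition C1_on :: "'a set \<Rightarrow> ('a \<Rightarrow> real) \<Rightarrow> bool" where
  "C1_on U f \<longleftrightarrow> open U \<and> (\<forall>c\<in>\<A>. (\<forall>x\<in>U \<inter> dom_of c. (f \<circ> chart_inv c has_derivative dfun c f x) (at (chart_map c x))) \<and>
     (\<forall>v. continuous_on (U \<inter> dom_of c) (\<lambda>x. dfun c f x v)))"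

text \<open>A bound on the dual norm of the differential, that is, on the norm of the gradient.
  Gluing is carried out with differentials; a gradient vector is constructed only for the finished
  function.\<close>

definition slope_le :: "('a \<Rightarrow> real) \<Rightarrow> 'a \<Rightarrow> real \<Rightarrow> bool" where
  "slope_le f x L \<longleftrightarrow> (\<forall>c\<in>\<A>. x \<in> dom_of c \<longrightarrow> (\<forall>v. \<bar>dfun c f x v\<bar> \<le> L * cnorm c x v))"

lemma C1_onD:
  assumes "C1_on U f"
  shows "open U"
    and "c \<in> \<A> \<Longrightarrow> x \<in> U \<Longrightarrow> x \<in> dom_of c \<Longrightarrow> (f \<circ> chart_inv c has_derivative dfun c f x) (at (chart_map c x))"
    and "c \<in> \<A> \<Longrightarrow> continuous_on (U \<inter> dom_of c) (\<lambda>x. dfun c f x v)"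
proof -
  note C = assms[unfolded C1_on_def]
  show "open U" by (rule C[THEN conjunct1])
  note C2 = C[THEN conjunct2, THEN bspec]
  show "(f \<circ> chart_inv c has_derivative dfun c f x) (at (chart_map c x))" if "c \<in> \<A>" "x \<in> U" "x \<in> dom_of c"
    by (rule C2[OF that(1), THEN conjunct1, THEN bspec, OF IntI[OF that(2,3)]])
  show "continuous_on (U \<inter> dom_of c) (\<lambda>x. dfun c f x v)" if "c \<in> \<A>"
    by (rule C2[OF that, THEN conjunct2, THEN spec])
qed

lemma dfun_eqI: "(f \<circ> chart_inv c has_derivative D) (at (chart_map c x)) \<Longrightarrow> dfun c f x = D"
  unfolding dfun_def by (rule frechet_derivative_at[symmetric])

lemma C1_onI:
  assumes U: "open U"
    and der: "\<And>c x. c \<in> \<A> \<Longrightarrow> x \<in> U \<Longrightarrow> x \<in> dom_of c \<Longrightarrow> (f \<circ> chart_inv c has_derivative D c x) (at (chart_map c x))"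
    and cont: "\<And>c v. c \<in> \<A> \<Longrightarrow> continuous_on (U \<inter> dom_of c) (\<lambda>x. D c x v)"
  shows "C1_on U f"
proof -
  have eq: "dfun c f x = D c x" if "c \<in> \<A>" "x \<in> U" "x \<in> dom_of c" for c x
    by (rule dfun_eqI[OF der[OF that]])
  show ?thesis unfolding C1_on_def
  proof (intro conjI ballI allI U)
    fix c x assume "c \<in> \<A>" "x \<in> U \<inter> dom_of c"
    then show "(f \<circ> chart_inv c has_derivative dfun c f x) (at (chart_map c x))"
      using der[of c x] eq[of c x] by simp
  next
    fix c v assume c: "c \<in> \<A>"
    show "continuous_on (U \<inter> dom_of c) (\<lambda>x. dfun c f x v)"
      by (rule continuous_on_eq[OF cont[OF c, of v]]) (simp add: eq c)
  qed
qed

lemma slope_leD: "slope_le f x L \<Longrightarrow> c \<in> \<A> \<Longrightarrow> x \<in> dom_of c \<Longrightarrow> \<bar>dfun c f x v\<bar> \<le> L * cnorm c x v"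
  by (simp add: slope_le_def)

lemma slope_leI: "(\<And>c v. c \<in> \<A> \<Longrightarrow> x \<in> dom_of c \<Longrightarrow> \<bar>dfun c f x v\<bar> \<le> L * cnorm c x v) \<Longrightarrow> slope_le f x L"
  by (simp add: slope_le_def)

lemma slope_le_mono: "slope_le f x L \<Longrightarrow> L \<le> M \<Longrightarrow> slope_le f x M"
  unfolding slope_le_def using mult_right_mono cnorm_nonneg by (meson order_trans)

lemma C1_on_subset: "C1_on U f \<Longrightarrow> open V \<Longrightarrow> V \<subseteq> U \<Longrightarrow> C1_on V f"
proof (rule C1_onI[of V f "\<lambda>c. dfun c f"])
  assume f: "C1_on U f" and V: "V \<subseteq> U"
  show "(f \<circ> chart_inv c has_derivative dfun c f x) (at (chart_map c x))" if "c \<in> \<A>" "x \<in> V" "x \<in> dom_of c" for c x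
    using C1_onD(2)[OF f] that V by blast
  show "continuous_on (V \<inter> dom_of c) (\<lambda>x. dfun c f x v)" if "c \<in> \<A>" for c v
    by (rule continuous_on_subset[OF C1_onD(3)[OF f that]]) (use V in blast)
qed

lemma dfun_cong:
  assumes "open U" "\<And>y. y \<in> U \<Longrightarrow> f y = h y" "x \<in> U" "c \<in> \<A>" "x \<in> dom_of c"
    and d: "(f \<circ> chart_inv c has_derivative D) (at (chart_map c x))"
  shows "(h \<circ> chart_inv c has_derivative D) (at (chart_map c x))"
proof (rule has_derivative_transform_within_open[OF d open_chart_image[OF assms(4,1)]])
  show "chart_map c x \<in> chart_map c ` (U \<inter> dom_of c)" using assms by blast
  fix y assume "y \<in> chart_map c ` (U \<inter> dom_of c)"
  then have "chart_inv c y \<in> U" by (simp add: chart_image_eq[OF assms(4)])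
  then show "(f \<circ> chart_inv c) y = (h \<circ> chart_inv c) y" using assms(2) by simp
qed

lemma C1_on_cong:
  assumes f: "C1_on U f" and eq: "\<And>y. y \<in> U \<Longrightarrow> f y = h y"
  shows "C1_on U h" "\<And>x L. x \<in> U \<Longrightarrow> slope_le f x L \<Longrightarrow> slope_le h x L"
proof -
  note fD = C1_onD[OF f]
  have der: "(h \<circ> chart_inv c has_derivative dfun c f x) (at (chart_map c x))" if "c \<in> \<A>" "x \<in> U" "x \<in> dom_of c" for c x
    by (rule dfun_cong[OF fD(1) eq that(2,1,3) fD(2)[OF that]])
  show "C1_on U h" by (rule C1_onI[OF fD(1) der fD(3)])
  show "slope_le h x L" if "x \<in> U" "slope_le f x L" for x L
    using dfun_eqI[OF der[OF _ that(1)]] slope_leD[OF that(2)] by (intro slope_leI) simp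
qed

lemma C1_on_Un:
  assumes f: "C1_on U f" "C1_on V f" shows "C1_on (U \<union> V) f"
proof (rule C1_onI[of _ f "\<lambda>c. dfun c f"])
  show "open (U \<union> V)" using C1_onD(1)[OF f(1)] C1_onD(1)[OF f(2)] by (rule open_Un)
  show "(f \<circ> chart_inv c has_derivative dfun c f x) (at (chart_map c x))" if "c \<in> \<A>" "x \<in> U \<union> V" "x \<in> dom_of c" for c x
    using that C1_onD(2)[OF f(1)] C1_onD(2)[OF f(2)] by blast
  fix c v assume c: "c \<in> \<A>"
  have "(U \<union> V) \<inter> dom_of c = (U \<inter> dom_of c) \<union> (V \<inter> dom_of c)" by blast
  then show "continuous_on ((U \<union> V) \<inter> dom_of c) (\<lambda>x. dfun c f x v)"
    using C1_onD(3)[OF f(1) c] C1_onD(3)[OF f(2) c] C1_onD(1)[OF f(1)] C1_onD(1)[OF f(2)] open_dom[OF c]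
    by (simp only:) (intro continuous_on_open_Un open_Int)
qed

lemma C1_on_continuous:
  assumes f: "C1_on U f" shows "continuous_on U f"
  unfolding continuous_on_eq_continuous_at[OF C1_onD(1)[OF f]]
proof
  fix x assume x: "x \<in> U"
  obtain c where c: "c \<in> \<A>" "x \<in> dom_of c" using chart_cover[of x] by blast
  have 1: "isCont (f \<circ> chart_inv c) (chart_map c x)"
    by (rule has_derivative_continuous[OF C1_onD(2)[OF f c(1) x c(2)]])
  have 2: "isCont (chart_map c) x"
    using continuous_chart(1)[OF c(1)] c(2) by (simp add: continuous_on_eq_continuous_at[OF open_dom[OF c(1)]])
  have 3: "isCont ((f \<circ> chart_inv c) \<circ> chart_map c) x" by (rule continuous_at_compose[OF 2 1])
  have ev: "\<forall>\<^sub>F y in nhds x. ((f \<circ> chart_inv c) \<circ> chart_map c) y = f y"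
    using eventually_nhds_in_open[OF open_dom[OF c(1)] c(2)] by eventually_elim (simp add: c(1))
  show "isCont f x" using 3 isCont_cong[OF ev] by simp
qed

lemma C1_on_const: "open U \<Longrightarrow> C1_on U (\<lambda>_. k)" "slope_le (\<lambda>_. k) x 0"
proof -
  have d: "((\<lambda>_. k) \<circ> chart_inv c has_derivative (\<lambda>_. 0)) (at y)" for c :: "('a,'n) chart" and y
    by (simp add: o_def)
  show "open U \<Longrightarrow> C1_on U (\<lambda>_. k)"
    by (rule C1_onI[of U _ "\<lambda>_ _ _. 0"]) (auto intro: d)
  show "slope_le (\<lambda>_. k) x 0"
    unfolding slope_le_def dfun_def frechet_derivative_at[OF d, symmetric] by simp
qed

text \<open>The differential is (1 - b) df + b dh + (h - f) db. The last term is small when h is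
  close to f, however steep b is, so gluing costs almost no slope.\<close>

lemma C1_on_combine:
  assumes f: "C1_on U f" and h: "C1_on U h" and b: "C1_on U b"
  shows "C1_on U (\<lambda>x. f x + b x * (h x - f x))"
    and "\<And>x L1 L2 B d. x \<in> U \<Longrightarrow> slope_le f x L1 \<Longrightarrow> slope_le h x L2 \<Longrightarrow> slope_le b x B \<Longrightarrow> 0 \<le> b x \<Longrightarrow> b x \<le> 1 \<Longrightarrow>
      \<bar>h x - f x\<bar> \<le> d \<Longrightarrow> 0 \<le> B \<Longrightarrow> slope_le (\<lambda>x. f x + b x * (h x - f x)) x ((1 - b x) * L1 + b x * L2 + B * d)"
proof -
  let ?D = "\<lambda>c x v. dfun c f x v + (b x * (dfun c h x v - dfun c f x v) + dfun c b x v * (h x - f x))"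
  have der: "((\<lambda>x. f x + b x * (h x - f x)) \<circ> chart_inv c has_derivative ?D c x) (at (chart_map c x))"
    if c: "c \<in> \<A>" "x \<in> U" "x \<in> dom_of c" for c x
  proof -
    note d = C1_onD(2)[OF f c] C1_onD(2)[OF h c] C1_onD(2)[OF b c]
    have "((\<lambda>y. (f \<circ> chart_inv c) y + (b \<circ> chart_inv c) y * ((h \<circ> chart_inv c) y - (f \<circ> chart_inv c) y)) has_derivative
      (\<lambda>v. dfun c f x v + ((b \<circ> chart_inv c) (chart_map c x) * (dfun c h x v - dfun c f x v) +
         dfun c b x v * ((h \<circ> chart_inv c) (chart_map c x) - (f \<circ> chart_inv c) (chart_map c x))))) (at (chart_map c x))"
      by (intro has_derivative_add has_derivative_mult has_derivative_diff d)
    then show ?thesis using c by (simp add: o_def)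
  qed
  have cont: "continuous_on (U \<inter> dom_of c) (\<lambda>x. ?D c x v)" if c: "c \<in> \<A>" for c v
    using C1_on_continuous[OF f] C1_on_continuous[OF h] C1_on_continuous[OF b]
    by (intro continuous_intros C1_onD(3)[OF f c] C1_onD(3)[OF h c] C1_onD(3)[OF b c]) (auto elim: continuous_on_subset)
  show "C1_on U (\<lambda>x. f x + b x * (h x - f x))" by (rule C1_onI[OF C1_onD(1)[OF f] der cont])
  fix x L1 L2 B d assume x: "x \<in> U" and L: "slope_le f x L1" "slope_le h x L2" "slope_le b x B"
    and b: "0 \<le> b x" "b x \<le> 1" and d: "\<bar>h x - f x\<bar> \<le> d" "0 \<le> B"
  show "slope_le (\<lambda>x. f x + b x * (h x - f x)) x ((1 - b x) * L1 + b x * L2 + B * d)"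
  proof (rule slope_leI)
    fix c v assume c: "c \<in> \<A>" "x \<in> dom_of c"
    let ?N = "cnorm c x v"
    have "\<bar>?D c x v\<bar> = \<bar>(1 - b x) * dfun c f x v + b x * dfun c h x v + dfun c b x v * (h x - f x)\<bar>"
      by (simp add: algebra_simps)
    also have "\<dots> \<le> \<bar>(1 - b x) * dfun c f x v\<bar> + \<bar>b x * dfun c h x v\<bar> + \<bar>dfun c b x v * (h x - f x)\<bar>" by linarith
    also have "\<dots> \<le> (1 - b x) * (L1 * ?N) + b x * (L2 * ?N) + (B * ?N) * d"
      unfolding abs_mult using b d slope_leD[OF L(1) c, of v] slope_leD[OF L(2) c, of v] slope_leD[OF L(3) c, of v] cnorm_nonneg[OF c, of v]
      by (intro add_mono mult_mono) auto
    also have "\<dots> = ((1 - b x) * L1 + b x * L2 + B * d) * ?N" by (simp add: algebra_simps)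
    finally show "\<bar>dfun c (\<lambda>x. f x + b x * (h x - f x)) x v\<bar> \<le> ((1 - b x) * L1 + b x * L2 + B * d) * ?N"
      unfolding dfun_eqI[OF der[OF c(1) x c(2)]] .
  qed
qed

lemma C1_on_compose:
  assumes f: "C1_on U f" and \<theta>: "\<And>t. (\<theta> has_real_derivative \<theta>' t) (at t)" "continuous_on UNIV \<theta>'"
  shows "C1_on U (\<lambda>x. \<theta> (f x))"
    and "\<And>x L. x \<in> U \<Longrightarrow> slope_le f x L \<Longrightarrow> slope_le (\<lambda>x. \<theta> (f x)) x (\<bar>\<theta>' (f x)\<bar> * L)"
proof -
  let ?D = "\<lambda>c x v. \<theta>' (f x) * dfun c f x v"
  have der: "((\<lambda>x. \<theta> (f x)) \<circ> chart_inv c has_derivative ?D c x) (at (chart_map c x))"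
    if c: "c \<in> \<A>" "x \<in> U" "x \<in> dom_of c" for c x
  proof -
    have "((\<lambda>y. \<theta> ((f \<circ> chart_inv c) y)) has_derivative (\<lambda>v. \<theta>' ((f \<circ> chart_inv c) (chart_map c x)) * dfun c f x v)) (at (chart_map c x))"
      by (rule has_derivative_compose[OF C1_onD(2)[OF f c] \<theta>(1)[unfolded has_field_derivative_def]])
    then show ?thesis using c by (simp add: o_def)
  qed
  have cont: "continuous_on (U \<inter> dom_of c) (\<lambda>x. ?D c x v)" if c: "c \<in> \<A>" for c v
    by (intro continuous_intros C1_onD(3)[OF f c] continuous_on_compose2[OF \<theta>(2) continuous_on_subset[OF C1_on_continuous[OF f]]]) auto
  show "C1_on U (\<lambda>x. \<theta> (f x))" by (rule C1_onI[OF C1_onD(1)[OF f] der cont])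
  fix x L assume x: "x \<in> U" and L: "slope_le f x L"
  show "slope_le (\<lambda>x. \<theta> (f x)) x (\<bar>\<theta>' (f x)\<bar> * L)"
  proof (rule slope_leI)
    fix c v assume c: "c \<in> \<A>" "x \<in> dom_of c"
    have "\<bar>?D c x v\<bar> \<le> \<bar>\<theta>' (f x)\<bar> * (L * cnorm c x v)"
      unfolding abs_mult by (intro mult_left_mono slope_leD[OF L c]) auto
    then show "\<bar>dfun c (\<lambda>x. \<theta> (f x)) x v\<bar> \<le> (\<bar>\<theta>' (f x)\<bar> * L) * cnorm c x v"
      unfolding dfun_eqI[OF der[OF c(1) x c(2)]] by (simp add: mult.assoc)
  qed
qed

text \<open>The chain rule passes from one chart to the others. There the differential is applied to
  a moving direction, and linearity reduces its continuity to the finitely many coordinate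
  directions.\<close>

lemma C1_on_chart:
  assumes c: "c \<in> \<A>" and U: "open U" "U \<subseteq> dom_of c"
    and F: "\<And>x. x \<in> U \<Longrightarrow> (F has_derivative D (chart_map c x)) (at (chart_map c x))"
    and cD: "\<And>v. continuous_on (chart_map c ` U) (\<lambda>y. D y v)"
  shows "C1_on U (\<lambda>x. F (chart_map c x))"
    and "\<And>x L. x \<in> U \<Longrightarrow> (\<And>v. \<bar>D (chart_map c x) v\<bar> \<le> L * cnorm c x v) \<Longrightarrow> slope_le (\<lambda>x. F (chart_map c x)) x L"
proof -
  let ?f = "\<lambda>x. F (chart_map c x)"
  let ?D = "\<lambda>d x v. D (chart_map c x) (transition_deriv d c x v)"
  have lin: "linear (D (chart_map c x))" if "x \<in> U" for x using F[OF that] has_derivative_linear by blast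
  have der: "(?f \<circ> chart_inv d has_derivative ?D d x) (at (chart_map d x))"
    if d: "d \<in> \<A>" "x \<in> U" "x \<in> dom_of d" for d x
  proof -
    have xc: "x \<in> dom_of c" using d(2) U(2) by blast
    have "(F \<circ> (chart_map c \<circ> chart_inv d) has_derivative D (chart_map c x) \<circ> transition_deriv d c x) (at (chart_map d x))"
      using transition(1)[OF d(1) c d(3) xc] F[OF d(2)] d by (intro diff_chain_at) auto
    then show ?thesis by (simp add: o_def)
  qed
  have cont: "continuous_on (U \<inter> dom_of d) (\<lambda>x. ?D d x v)" if d: "d \<in> \<A>" for d v
  proof -
    have ct: "continuous_on (U \<inter> dom_of d) (\<lambda>x. transition_deriv d c x v)"
    proof -
      have "continuous_on (U \<inter> dom_of d) (\<lambda>x. transition_deriv d c (chart_inv d (chart_map d x)) v)"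
      proof (rule continuous_on_compose2[OF transition(2)[OF d c]])
        show "continuous_on (U \<inter> dom_of d) (chart_map d)" by (rule continuous_on_subset[OF continuous_chart(1)[OF d]]) auto
        show "chart_map d ` (U \<inter> dom_of d) \<subseteq> chart_map d ` (dom_of c \<inter> dom_of d)" using U(2) by blast
      qed
      then show ?thesis by (rule continuous_on_eq) (simp add: d)
    qed
    have cc: "continuous_on (U \<inter> dom_of d) (\<lambda>x. D (chart_map c x) (axis i 1))" for i
      by (rule continuous_on_compose2[OF cD continuous_on_subset[OF continuous_chart(1)[OF c]]]) (use U(2) in auto)
    have "continuous_on (U \<inter> dom_of d) (\<lambda>x. \<Sum>i\<in>UNIV. transition_deriv d c x v $ i * D (chart_map c x) (axis i 1))"
      by (intro continuous_intros ct cc)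
    then show ?thesis
    proof (rule continuous_on_eq)
      fix x assume "x \<in> U \<inter> dom_of d"
      then have l: "linear (D (chart_map c x))" using lin by blast
      let ?w = "transition_deriv d c x v"
      show "(\<Sum>i\<in>UNIV. ?w $ i * D (chart_map c x) (axis i 1)) = D (chart_map c x) ?w"
        unfolding linear_axis_expansion[OF l, of ?w] by simp
    qed
  qed
  show "C1_on U ?f" by (rule C1_onI[OF U(1) der cont])
  fix x L assume x: "x \<in> U" and L: "\<And>v. \<bar>D (chart_map c x) v\<bar> \<le> L * cnorm c x v"
  have xc: "x \<in> dom_of c" using x U(2) by blast
  show "slope_le ?f x L"
  proof (rule slope_leI)
    fix d v assume d: "d \<in> \<A>" "x \<in> dom_of d"
    show "\<bar>dfun d ?f x v\<bar> \<le> L * cnorm d x v"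
      unfolding dfun_eqI[OF der[OF d(1) x d(2)]]
      using L[of "transition_deriv d c x v"] cnorm_change_chart[OF d(1) c d(2) xc, of v] by simp
  qed
qed

lemma dfun_change_chart:
  assumes f: "C1_on U f" and x: "x \<in> U" and c: "c \<in> \<A>" "x \<in> dom_of c" and d: "d \<in> \<A>" "x \<in> dom_of d"
  shows "dfun d f x v = dfun c f x (transition_deriv d c x v)"
proof -
  have "(f \<circ> chart_inv c \<circ> (chart_map c \<circ> chart_inv d) has_derivative dfun c f x \<circ> transition_deriv d c x) (at (chart_map d x))"
    using transition(1)[OF d(1) c(1) d(2) c(2)] C1_onD(2)[OF f c(1) x c(2)] c d by (intro diff_chain_at) auto
  then have "(f \<circ> chart_inv d has_derivative dfun c f x \<circ> transition_deriv d c x) (at (chart_map d x))"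
    by (rule has_derivative_transform_within_open[OF _ open_chart_image[OF d(1) open_dom[OF c(1)]]])
      (use c d in auto)
  then have "dfun d f x = dfun c f x \<circ> transition_deriv d c x" by (rule dfun_eqI)
  then show ?thesis by simp
qed

text \<open>The gradient solves the Gram system in each chart. Cramer's rule makes the solution
  continuous in the point, which gives measurability, and |Y|^2 = df(Y) \<le> L |Y| gives the norm
  bound.\<close>

lemma has_gradient_exists:
  assumes f: "C1_on UNIV f" and L: "\<And>x. slope_le f x (L x)"
  obtains Y where "has_gradient f Y" "\<And>x. tnorm g x (Y x) \<le> L x"
proof -
  define G :: "('a, 'n) chart \<Rightarrow> 'a \<Rightarrow> real^'n^'n" where "G c x = (\<chi> i j. cmetric c x (axis i 1) (axis j 1))" for c x
  define sol :: "('a, 'n) chart \<Rightarrow> 'a \<Rightarrow> real^'n" where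
    "sol c x = (\<chi> k. det (\<chi> i j. if j = k then (\<chi> i. dfun c f x (axis i 1)) $ i else G c x $ i $ j) / det (G c x))" for c x
  have detG: "det (G c x) > 0" if "c \<in> \<A>" "x \<in> dom_of c" for c x
    using gram_det_pos[OF that] by (simp add: G_def gram_det_def cmetric_def)
  have solE: "cmetric c x (sol c x) (axis i 1) = dfun c f x (axis i 1)" if c: "c \<in> \<A>" "x \<in> dom_of c" for c x i
  proof -
    have "det (G c x) \<noteq> 0" using detG[OF c] by simp
    then have "G c x *v sol c x = (\<chi> i. dfun c f x (axis i 1))"
      unfolding sol_def by (subst cramer) auto
    then have "(G c x *v sol c x) $ i = dfun c f x (axis i 1)" by simp
    moreover have "(G c x *v sol c x) $ i = cmetric c x (axis i 1) (sol c x)"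
    proof -
      have l: "linear (cmetric c x (axis i 1))" using cmetric_bilinear[OF c] by (simp add: bilinear_def)
      show ?thesis
        unfolding linear_axis_expansion[OF l, of "sol c x"] by (simp add: matrix_vector_mult_def G_def mult.commute)
    qed
    ultimately show ?thesis using cmetric_sym[OF c, of "sol c x" "axis i 1"] by simp
  qed
  \<comment> \<open>One chart is chosen at each point to define the vector; \<open>Ysol\<close>
    shows that its coordinates in every other chart solve the system of that chart.\<close>
  define ch where "ch x = (SOME c. c \<in> \<A> \<and> x \<in> dom_of c)" for x
  have ch: "ch x \<in> \<A>" "x \<in> dom_of (ch x)" for x
  proof -
    obtain c where "c \<in> \<A>" "x \<in> dom_of c" using chart_cover[of x] by blast
    then have "\<exists>c. c \<in> \<A> \<and> x \<in> dom_of c" by blast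
    from someI_ex[OF this] show "ch x \<in> \<A>" "x \<in> dom_of (ch x)" by (simp_all add: ch_def)
  qed
  define Y where "Y x = tvec_of \<A> (ch x) x (sol (ch x) x)" for x
  have tY: "Y x \<in> tangent_space \<A> x" for x unfolding Y_def by (rule tvec_of_tangent[OF ch])
  have all: "cmetric c x (sol c x) v = dfun c f x v" if c: "c \<in> \<A>" "x \<in> dom_of c" for c x v
  proof -
    have l1: "linear (cmetric c x (sol c x))" using cmetric_bilinear[OF c] by (simp add: bilinear_def)
    have l2: "linear (dfun c f x)" using C1_onD(2)[OF f c(1) UNIV_I c(2)] has_derivative_linear by blast
    show ?thesis
      unfolding linear_axis_expansion[OF l1, of v] linear_axis_expansion[OF l2, of v] by (simp only: solE[OF c])
  qed
  have Yd: "g x (Y x) (tvec_of \<A> d x v) = dfun d f x v" if d: "d \<in> \<A>" "x \<in> dom_of d" for d x v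
  proof -
    have "g x (Y x) (tvec_of \<A> d x v) = cmetric (ch x) x (Y x (ch x)) (tvec_of \<A> d x v (ch x))"
      by (rule g_eq_cmetric[OF ch tY tvec_of_tangent[OF d]])
    also have "Y x (ch x) = sol (ch x) x" unfolding Y_def by (rule tvec_of_self[OF ch])
    also have "tvec_of \<A> d x v (ch x) = transition_deriv d (ch x) x v" by (rule tvec_of_apply[OF ch])
    also have "cmetric (ch x) x (sol (ch x) x) (transition_deriv d (ch x) x v) = dfun (ch x) f x (transition_deriv d (ch x) x v)"
      by (rule all[OF ch])
    also have "\<dots> = dfun d f x v" by (rule dfun_change_chart[OF f UNIV_I ch d, symmetric])
    finally show ?thesis .
  qed
  have Ysol: "Y x d = sol d x" if d: "d \<in> \<A>" "x \<in> dom_of d" for d x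
  proof (rule cmetric_components_eq[OF d])
    fix i
    have "cmetric d x (Y x d) (axis i 1) = g x (Y x) (tvec_of \<A> d x (axis i 1))"
      unfolding g_eq_cmetric[OF d tY tvec_of_tangent[OF d]] tvec_of_self[OF d] ..
    also have "\<dots> = dfun d f x (axis i 1)" by (rule Yd[OF d])
    also have "\<dots> = cmetric d x (sol d x) (axis i 1)" by (rule solE[OF d, symmetric])
    finally show "cmetric d x (Y x d) (axis i 1) = cmetric d x (sol d x) (axis i 1)" .
  qed
  have Ym: "chart_measurable UNIV Y" unfolding chart_measurable_def
  proof (intro conjI ballI tY)
    fix c assume c: "c \<in> \<A>"
    have Gc: "continuous_on (dom_of c) (\<lambda>x. G c x $ i $ j)" for i j
    proof -
      have "continuous_on (dom_of c) (\<lambda>x. cmetric c (chart_inv c (chart_map c x)) (axis i 1) (axis j 1))"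
        by (rule continuous_on_compose2[OF continuous_cmetric_coeff[OF c] continuous_chart(1)[OF c]]) auto
      then show ?thesis by (rule continuous_on_eq) (simp add: c G_def)
    qed
    have fc: "continuous_on (dom_of c) (\<lambda>x. dfun c f x (axis i 1))" for i
      using C1_onD(3)[OF f c] by simp
    have nk: "continuous_on (dom_of c) (\<lambda>x. det (\<chi> i j. if j = k then (\<chi> i. dfun c f x (axis i 1)) $ i else G c x $ i $ j))" for k
    proof (rule continuous_on_det)
      fix i j
      show "continuous_on (dom_of c) (\<lambda>x. (\<chi> i j. if j = k then (\<chi> i. dfun c f x (axis i 1)) $ i else G c x $ i $ j) $ i $ j)"
        using Gc[of i j] fc[of i] by (cases "j = k") simp_all
    qed
    have dG: "continuous_on (dom_of c) (\<lambda>x. det (G c x))" by (rule continuous_on_det[OF Gc])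
    have "continuous_on (dom_of c) (\<lambda>x. sol c x)"
      unfolding sol_def
      by (intro continuous_on_vec_lambda continuous_on_divide nk dG ballI) (use detG[OF c] in force)
    then have "continuous_on (dom_of c) (\<lambda>x. Y x c)" by (rule continuous_on_eq) (simp add: Ysol c)
    then show "(\<lambda>x. Y x c) \<in> borel_measurable (restrict_space vol (UNIV \<inter> dom_of c))"
      using open_dom[OF c] by (simp add: measurable_continuous_vol)
  qed
  have "has_gradient f Y" unfolding has_gradient_def
  proof (intro conjI ballI allI Ym)
    show "continuous_on UNIV f" by (rule C1_on_continuous[OF f])
    fix c i assume c: "c \<in> \<A>"
    let ?W = "chart_map c ` dom_of c"
    show "\<exists>D. (\<forall>y\<in>?W. (f \<circ> chart_inv c has_derivative D y) (at y)) \<and>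
        (\<forall>y\<in>?W. D y (axis i 1) = g (chart_inv c y) (Y (chart_inv c y)) (coord_field \<A> c i (chart_inv c y))) \<and>
        continuous_on ?W (\<lambda>y. D y (axis i 1))"
    proof (intro exI[of _ "\<lambda>y. dfun c f (chart_inv c y)"] conjI ballI)
      fix y assume y: "y \<in> ?W"
      show "(f \<circ> chart_inv c has_derivative dfun c f (chart_inv c y)) (at y)"
        using C1_onD(2)[OF f c UNIV_I chart_inv_dom[OF c y]] chart_map_inv[OF c y] by simp
      show "dfun c f (chart_inv c y) (axis i 1) = g (chart_inv c y) (Y (chart_inv c y)) (coord_field \<A> c i (chart_inv c y))"
        by (rule Yd[OF c chart_inv_dom[OF c y], symmetric])
    next
      show "continuous_on ?W (\<lambda>y. dfun c f (chart_inv c y) (axis i 1))"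
        by (rule continuous_on_compose2[OF C1_onD(3)[OF f c] continuous_chart(2)[OF c]]) (use chart_inv_dom[OF c] in auto)
    qed
  qed
  moreover have "tnorm g x (Y x) \<le> L x" for x
  proof -
    let ?c = "ch x"
    have "(tnorm g x (Y x))\<^sup>2 = g x (Y x) (Y x)" by (rule tnorm_sq[OF tY])
    also have "\<dots> = g x (Y x) (tvec_of \<A> ?c x (Y x ?c))" by (simp only: tangent_eq_tvec_of[OF ch tY])
    also have "\<dots> = dfun ?c f x (Y x ?c)" by (rule Yd[OF ch])
    also have "\<dots> \<le> L x * cnorm ?c x (Y x ?c)" using slope_leD[OF L ch, of x "Y x ?c"] by linarith
    also have "cnorm ?c x (Y x ?c) = tnorm g x (Y x)" by (rule tnorm_eq_cnorm[OF ch tY, symmetric])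
    finally have *: "tnorm g x (Y x) * tnorm g x (Y x) \<le> L x * tnorm g x (Y x)" by (simp add: power2_eq_square)
    \<comment> \<open>If the gradient vanishes, the claim is that L x is nonnegative, which the
      slope bound gives on any nonzero coordinate vector.\<close>
    show ?thesis
    proof (cases "tnorm g x (Y x) = 0")
      case True
      have "axis undefined 1 \<noteq> (0 :: real^'n)" by (simp add: axis_eq_0_iff)
      then obtain v :: "real^'n" where "v \<noteq> 0" by blast
      then have "cnorm ?c x v > 0" by (rule cnorm_pos[OF ch])
      moreover have "0 \<le> L x * cnorm ?c x v" using slope_leD[OF L ch, of x v] by linarith
      ultimately show ?thesis using True by (simp add: zero_le_mult_iff)
    next
      case False
      then have "tnorm g x (Y x) > 0" using tnorm_nonneg[OF tY, of x] by simp
      then show ?thesis using * by simp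
    qed
  qed
  ultimately show ?thesis by (rule that)
qed

end

section \<open>The profile of the cutoff\<close>

definition step :: "nat \<Rightarrow> real \<Rightarrow> real" where "step j t = pos_sq (1 - pos_sq (t - 1)) ^ j"

definition step_deriv :: "nat \<Rightarrow> real \<Rightarrow> real" where
  "step_deriv j t = - (real j * pos_sq (1 - pos_sq (t - 1)) ^ (j - 1) *
     (2 * max 0 (1 - pos_sq (t - 1))) * (2 * max 0 (t - 1)))"

lemma step_derivative: "(step j has_real_derivative step_deriv j t) (at t)"
proof -
  have 1: "((\<lambda>t. 1 - pos_sq (t - 1)) has_real_derivative - (2 * max 0 (t - 1))) (at t)"
  proof -
    have "((\<lambda>t. pos_sq (t - 1)) has_real_derivative (2 * max 0 (t - 1)) * 1) (at t)"
      by (rule DERIV_chain'[OF _ pos_sq_derivative]) (auto intro!: derivative_eq_intros)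
    then show ?thesis using DERIV_diff[OF DERIV_const[of 1]] by fastforce
  qed
  have 2: "((\<lambda>t. pos_sq (1 - pos_sq (t - 1))) has_real_derivative
      2 * max 0 (1 - pos_sq (t - 1)) * (- (2 * max 0 (t - 1)))) (at t)"
    by (rule DERIV_chain'[OF 1 pos_sq_derivative])
  have "((\<lambda>t. pos_sq (1 - pos_sq (t - 1)) ^ j) has_real_derivative
      real j * (2 * max 0 (1 - pos_sq (t - 1)) * (- (2 * max 0 (t - 1))) * pos_sq (1 - pos_sq (t - 1)) ^ (j - Suc 0))) (at t)"
    by (rule DERIV_power[OF 2])
  then show ?thesis
    unfolding step_def[abs_def] step_deriv_def by (rule DERIV_cong) simp
qed

lemma continuous_step_deriv: "continuous_on UNIV (step_deriv j)"
  unfolding step_deriv_def[abs_def]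
  by (intro continuous_intros continuous_on_compose2[OF continuous_pos_sq]) auto

lemma pos_sq_le_1: "s \<le> 1 \<Longrightarrow> pos_sq s \<le> 1" "pos_sq s \<ge> 0"
  by (auto simp: pos_sq_def max_def power_le_one)

lemma step_bounds: "0 \<le> step j t" "step j t \<le> 1"
  using pos_sq_le_1(1)[of "1 - pos_sq (t - 1)"] pos_sq_le_1(2)
  by (auto simp: step_def intro!: power_le_one)

lemma step_eq_1: "t \<le> 1 \<Longrightarrow> step j t = 1" "t \<le> 1 \<Longrightarrow> step_deriv j t = 0"
  by (auto simp: step_def step_deriv_def pos_sq_def)

lemma pos_sq_ge_1: "t \<ge> 2 \<Longrightarrow> pos_sq (t - 1) \<ge> 1"
  by (auto simp: pos_sq_def max_def)

lemma step_eq_0: "t \<ge> 2 \<Longrightarrow> j \<ge> 1 \<Longrightarrow> step j t = 0" "t \<ge> 2 \<Longrightarrow> step_deriv j t = 0"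
  using pos_sq_ge_1[of t] by (auto simp: step_def step_deriv_def pos_sq_def[of "1 - _"])

text \<open>With \<sigma> = (1 - ((t-1)_+)^2)_+ the profile is \<sigma>^(2j), and its derivative is
  at most 4 j \<sigma>^(2j-1), because t - 1 \<le> 1 where \<sigma> > 0. As \<sigma> \<le> 1, the
  exponent 2j - 1 may be lowered to 2j (p-1)/p, and p \<le> 2j is exactly the condition for
  that.\<close>

lemma step_deriv_bound:
  assumes p: "p > 1" and j: "p \<le> 2 * real j"
  shows "\<bar>step_deriv j t\<bar> \<le> 4 * real j * step j t powr ((p - 1) / p)"
proof (cases "t \<ge> 2")
  case True
  then show ?thesis by (simp add: step_eq_0)
next
  case False
  define \<sigma> where "\<sigma> = max 0 (1 - pos_sq (t - 1))"
  have \<sigma>: "0 \<le> \<sigma>" "\<sigma> \<le> 1" using pos_sq_le_1(2)[of "t - 1"] by (auto simp: \<sigma>_def)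
  have j1: "j \<ge> 1" using p j by (cases j) auto
  show ?thesis
  proof (cases "\<sigma> = 0")
    case True
    then show ?thesis by (simp add: step_deriv_def \<sigma>_def[symmetric] powr_def)
  next
    case False
    then have s0: "\<sigma> > 0" using \<sigma> by simp
    have sq: "pos_sq (1 - pos_sq (t - 1)) = \<sigma>\<^sup>2" by (simp add: pos_sq_def \<sigma>_def)
    have st: "step j t = \<sigma> powr (2 * real j)"
      using powr_realpow[OF s0, of "2 * j"] by (simp add: step_def sq power_mult[symmetric])
    have "\<bar>step_deriv j t\<bar> = real j * (\<sigma>\<^sup>2) ^ (j - 1) * (2 * \<sigma>) * (2 * max 0 (t - 1))"
      unfolding step_deriv_def sq \<sigma>_def[symmetric] using \<sigma> by (simp add: abs_mult)
    also have "\<dots> \<le> real j * (\<sigma>\<^sup>2) ^ (j - 1) * (2 * \<sigma>) * (2 * 1)"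
      using \<open>\<not> 2 \<le> t\<close> \<sigma> by (intro mult_left_mono) auto
    also have "\<dots> = 4 * real j * (\<sigma> ^ (2 * (j - 1) + 1))" by (simp add: power_mult)
    also have "\<sigma> ^ (2 * (j - 1) + 1) = \<sigma> powr (2 * real j - 1)"
    proof -
      have "real (2 * (j - 1) + 1) = 2 * real j - 1" using j1 by (simp add: of_nat_diff)
      then show ?thesis using powr_realpow[OF s0, of "2 * (j - 1) + 1"] by simp
    qed
    also have "\<dots> \<le> \<sigma> powr (2 * real j * ((p - 1) / p))"
    proof (rule powr_mono')
      show "2 * real j * ((p - 1) / p) \<le> 2 * real j - 1" using p j by (simp add: field_simps)
    qed (use \<sigma> in auto)
    also have "\<dots> = step j t powr ((p - 1) / p)" by (simp add: st powr_powr)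
    finally show ?thesis by (simp add: mult_left_mono)
  qed
qed

section \<open>Gluing local smoothings of the distance, and the cutoff\<close>

context riem_volume
begin

text \<open>The profile \<open>step 1\<close> of the squared chart distance from a, divided by
  (\<rho>/2)^2. It is 1 up to radius \<rho>/2 and vanishes from radius 3/4 \<rho> on, as 9/16 \<ge>
  2/4; its support is compact inside the chart, so the extension by 0 is C^1.\<close>

lemma chart_radial:
  assumes c: "c \<in> \<A>" and \<rho>: "\<rho> > 0" "cball a \<rho> \<subseteq> chart_map c ` dom_of c"
    and m: "m > 0" "\<And>z v. z \<in> cball a \<rho> \<Longrightarrow> m * norm v \<le> cnorm c (chart_inv c z) v"
  obtains b B where "C1_on UNIV b" "\<And>y. 0 \<le> b y" "\<And>y. b y \<le> 1" "B \<ge> 0" "\<And>y. slope_le b y B"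
    "\<And>y. y \<in> dom_of c \<Longrightarrow> chart_map c y \<in> ball a (\<rho> / 2) \<Longrightarrow> b y = 1"
    "\<And>y. y \<notin> chart_inv c ` cball a (3/4 * \<rho>) \<Longrightarrow> b y = 0"
proof -
  define t where "t = \<rho>\<^sup>2 / 4"
  have t: "t > 0" using \<rho> by (simp add: t_def)
  let ?F = "\<lambda>z. step 1 (((z - a) \<bullet> (z - a)) / t)"
  let ?D = "\<lambda>z v. step_deriv 1 (((z - a) \<bullet> (z - a)) / t) * ((2 * ((z - a) \<bullet> v)) / t)"
  have der: "(?F has_derivative ?D z) (at z)" for z
  proof -
    have 1: "((\<lambda>z. ((z - a) \<bullet> (z - a)) / t) has_derivative (\<lambda>v. (2 * ((z - a) \<bullet> v)) / t)) (at z)"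
      using t by (auto intro!: derivative_eq_intros simp: inner_commute)
    show ?thesis by (rule has_derivative_compose[OF 1 step_derivative[unfolded has_field_derivative_def]])
  qed
  have cD: "continuous_on S (\<lambda>z. ?D z v)" for v S
    using t by (intro continuous_intros continuous_on_compose2[OF continuous_step_deriv]) auto
  let ?S = "chart_inv c ` cball a (3/4 * \<rho>)"
  have sub: "cball a (3/4 * \<rho>) \<subseteq> cball a \<rho>" using \<rho> by auto
  then have SW: "cball a (3/4 * \<rho>) \<subseteq> chart_map c ` dom_of c" using \<rho> by blast
  have "compact ?S"
    by (rule compact_continuous_image[OF continuous_on_subset[OF continuous_chart(2)[OF c] SW] compact_cball])
  then have oS: "open (- ?S)" by (simp add: compact_imp_closed open_Compl)
  have Sdom: "?S \<subseteq> dom_of c" using SW chart_inv_dom[OF c] by blast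
  define b where "b y = (if y \<in> dom_of c then ?F (chart_map c y) else 0)" for y
  have z: "?F z = 0" if "z \<notin> cball a (3/4 * \<rho>)" for z
  proof -
    have "(3/4 * \<rho>)\<^sup>2 \<le> (norm (z - a))\<^sup>2" using that \<rho> by (intro power_mono) (auto simp: dist_norm norm_minus_commute)
    then have "2 * t \<le> (z - a) \<bullet> (z - a)"
    proof -
      have "(3/4 * \<rho>)\<^sup>2 = 9/16 * \<rho>\<^sup>2" by (simp add: power2_eq_square)
      then show ?thesis
        using zero_le_power2[of \<rho>] \<open>(3/4 * \<rho>)\<^sup>2 \<le> (norm (z - a))\<^sup>2\<close> unfolding t_def dot_square_norm by linarith
    qed
    then show ?thesis using t by (intro step_eq_0) (auto simp: field_simps)
  qed
  have b0: "b y = 0" if "y \<notin> ?S" for y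
  proof (cases "y \<in> dom_of c")
    case True
    then have "chart_map c y \<notin> cball a (3/4 * \<rho>)" using that chart_inv_map[OF c True] by (metis imageI)
    then show ?thesis using z True by (simp only: b_def if_True)
  qed (simp add: b_def)
  note C = C1_on_chart[OF c open_dom[OF c] subset_refl der cD]
  have bd: "C1_on (dom_of c) b" by (rule C1_on_cong(1)[OF C(1)]) (simp add: b_def)
  have bs: "C1_on (- ?S) b" by (rule C1_on_cong(1)[OF C1_on_const(1)[OF oS, of 0]]) (rule b0[symmetric], simp)
  have C1: "C1_on UNIV b"
  proof -
    have "dom_of c \<union> - ?S = UNIV" using Sdom by blast
    then show ?thesis using C1_on_Un[OF bd bs] by simp
  qed
  \<comment> \<open>Here 4 bounds the derivative of \<open>step 1\<close>, 2 \<rho> / t the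
    Euclidean slope of the scaled squared distance, and 1/m converts Euclidean norms to metric
    ones.\<close>
  define B where "B = 4 * (2 * \<rho> / t) / m"
  have B: "B \<ge> 0" using \<rho> t m by (simp add: B_def)
  show ?thesis
  proof (rule that[OF C1 _ _ B])
    show "0 \<le> b y" "b y \<le> 1" for y using step_bounds by (auto simp: b_def)
    show "b y = 1" if "y \<in> dom_of c" "chart_map c y \<in> ball a (\<rho> / 2)" for y
    proof -
      have "(norm (chart_map c y - a))\<^sup>2 \<le> (\<rho> / 2)\<^sup>2" using that(2) by (intro power_mono) (auto simp: dist_norm norm_minus_commute)
      then have "(chart_map c y - a) \<bullet> (chart_map c y - a) \<le> t" by (simp add: t_def dot_square_norm power_divide)
      then have "((chart_map c y - a) \<bullet> (chart_map c y - a)) / t \<le> 1" using t by simp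
      then show ?thesis using that(1) by (simp only: b_def if_True step_eq_1)
    qed
    show "b y = 0" if "y \<notin> ?S" for y by (rule b0[OF that])
    fix y
    show "slope_le b y B"
    proof (cases "y \<in> ?S")
      case False
      have "slope_le (\<lambda>_. 0) y B" by (rule slope_le_mono[OF C1_on_const(2) B])
      then show ?thesis
        by (rule C1_on_cong(2)[OF C1_on_const(1)[OF oS], rotated 2]) (use False b0 in auto)
    next
      case True
      then obtain z where z: "z \<in> cball a (3/4 * \<rho>)" "y = chart_inv c z" by blast
      have zr: "z \<in> cball a \<rho>" using z(1) sub by blast
      have cy: "chart_map c y = z" using z chart_map_inv[OF c] SW by blast
      have "slope_le (\<lambda>x. ?F (chart_map c x)) y B"
      proof (rule C(2))
        show yd: "y \<in> dom_of c" using True Sdom by blast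
        fix v
        \<comment> \<open>The bound for the profile with p = 2 and j = 1, whose power on the right
          is at most 1.\<close>
        have "\<bar>step_deriv 1 (((z - a) \<bullet> (z - a)) / t)\<bar> \<le> 4"
          using step_deriv_bound[of 2 1 "((z - a) \<bullet> (z - a)) / t"] powr_mono2[OF _ step_bounds(1) step_bounds(2), of "1/2" 1 "((z - a) \<bullet> (z - a)) / t"] by simp
        moreover have "\<bar>2 * ((z - a) \<bullet> v) / t\<bar> \<le> 2 * \<rho> / t * norm v"
        proof -
          have "\<bar>(z - a) \<bullet> v\<bar> \<le> norm (z - a) * norm v" by (rule Cauchy_Schwarz_ineq2)
          also have "\<dots> \<le> \<rho> * norm v" using zr by (intro mult_right_mono) (auto simp: dist_norm norm_minus_commute)
          finally show ?thesis using t by (simp add: abs_mult divide_simps)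
        qed
        ultimately have "\<bar>?D z v\<bar> \<le> 4 * (2 * \<rho> / t * norm v)" unfolding abs_mult by (intro mult_mono) auto
        also have "\<dots> = B * (m * norm v)" using m by (simp add: B_def)
        also have "\<dots> \<le> B * cnorm c y v" unfolding z(2) by (rule mult_left_mono[OF m(2)[OF zr] B])
        finally show "\<bar>?D (chart_map c y) v\<bar> \<le> B * cnorm c y v" unfolding cy .
      qed
      then show ?thesis
        by (rule C1_on_cong(2)[OF C(1), rotated 2]) (use True Sdom in \<open>auto simp: b_def\<close>)
    qed
  qed
qed

text \<open>\<open>V\<close> is a neighbourhood on which \<open>r\<close> may be replaced by a \<open>C\<^sup>1\<close> function; \<open>b\<close> interpolates between the
  old and the new function on \<open>N\<close>, with a slope bound fixed before the accuracy \<open>\<delta>\<close> is chosen.\<close>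

definition patch :: "('a \<Rightarrow> real) \<Rightarrow> 'a set \<Rightarrow> bool" where
  "patch r V \<longleftrightarrow> open V \<and> (\<exists>b S N B. C1_on UNIV b \<and> (\<forall>y. 0 \<le> b y \<and> b y \<le> 1 \<and> slope_le b y B) \<and> 0 \<le> B \<and>
     (\<forall>y\<in>V. b y = 1) \<and> (\<forall>y. y \<notin> S \<longrightarrow> b y = 0) \<and> closed S \<and> S \<subseteq> N \<and> open N \<and>
     (\<forall>\<delta>>0. \<exists>F. C1_on N F \<and> (\<forall>y\<in>N. \<bar>F y - r y\<bar> \<le> \<delta> \<and> slope_le F y 2)))"

text \<open>The distance from \<open>x0\<close> is mollified in a chart. It is 1-Lipschitz, and the
  distance of two points of the chart ball is at most twice the norm of their coordinate difference
  at any third point y of the ball; so the slope at y is at most 2. The bump b is built from the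
  chart radii before the accuracy is known.\<close>

lemma patch_exists: "\<exists>V. x \<in> V \<and> patch (rdist x0) V"
proof -
  obtain c where c: "c \<in> \<A>" "x \<in> dom_of c" using chart_cover[of x] by blast
  let ?a = "chart_map c x"
  have two: "1 < (2::real)" by simp
  obtain r1 where r1: "r1 > 0" "cball ?a r1 \<subseteq> chart_map c ` dom_of c"
    "\<And>y z w. y \<in> cball ?a r1 \<Longrightarrow> z \<in> cball ?a r1 \<Longrightarrow> w \<in> cball ?a r1 \<Longrightarrow>
       edist (chart_inv c y) (chart_inv c z) \<le> ennreal (2 * cnorm c (chart_inv c w) (z - y))"
    using edist_chart_upper[OF c two] by blast
  obtain r2 where r2: "r2 > 0" "cball ?a r2 \<subseteq> chart_map c ` dom_of c"
    "\<And>y z v. y \<in> cball ?a r2 \<Longrightarrow> z \<in> cball ?a r2 \<Longrightarrow> cnorm c (chart_inv c y) v \<le> 2 * cnorm c (chart_inv c z) v"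
    using cnorm_local_comparison[OF c two] by blast
  obtain m M where m: "m > 0" "M > 0" "\<And>v. m * norm v \<le> cnorm c x v" "\<And>v. cnorm c x v \<le> M * norm v"
    using cnorm_euclid_comparison[OF c] by blast
  let ?f = "\<lambda>y. rdist x0 (chart_inv c y)"
  have f: "continuous_on (cball ?a r1) ?f"
    by (rule continuous_on_compose2[OF continuous_rdist[of UNIV] continuous_on_subset[OF continuous_chart(2)[OF c(1)] r1(2)]]) simp
  have "?a \<in> ball ?a r1" using r1(1) by simp
  then obtain l u where lu: "cbox l u \<subseteq> ball ?a r1" "?a \<in> box l u" by (rule open_contains_cbox[OF open_ball])
  then have lu1: "cbox l u \<subseteq> cball ?a r1" by auto
  obtain r3 where r3: "r3 > 0" "cball ?a r3 \<subseteq> box l u" using open_box lu(2) open_contains_cball by blast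
  \<comment> \<open>Small enough for the upper bound on distances (r1, halved for strictness), for
    the comparison of norms (r2) and for the box (r3).\<close>
  define \<rho> where "\<rho> = Min {r1 / 2, r2, r3}"
  have \<rho>: "\<rho> > 0" "\<rho> < r1" "\<rho> \<le> r2" "\<rho> \<le> r3" using r1 r2 r3 by (auto simp: \<rho>_def)
  have sub: "cball ?a \<rho> \<subseteq> cball ?a r1" "cball ?a \<rho> \<subseteq> cball ?a r2" using \<rho> by auto
  have sW: "cball ?a \<rho> \<subseteq> chart_map c ` dom_of c" using sub r1(2) by blast
  have Q: "cball ?a \<rho> \<subseteq> interior (cbox l u)" using r3(2) \<rho>(4) by (auto simp: interior_cbox)
  have m2: "m / 2 * norm v \<le> cnorm c (chart_inv c z) v" if "z \<in> cball ?a \<rho>" for z v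
  proof -
    have "cnorm c (chart_inv c ?a) v \<le> 2 * cnorm c (chart_inv c z) v"
      using that sub r2(1) by (intro r2(3)) auto
    then show ?thesis using m(3)[of v] c by simp
  qed
  have m0: "m / 2 > 0" using m(1) by simp
  obtain b B where b: "C1_on UNIV b" "\<And>y. 0 \<le> b y" "\<And>y. b y \<le> 1" "B \<ge> 0" "\<And>y. slope_le b y B"
    "\<And>y. y \<in> dom_of c \<Longrightarrow> chart_map c y \<in> ball ?a (\<rho> / 2) \<Longrightarrow> b y = 1"
    "\<And>y. y \<notin> chart_inv c ` cball ?a (3/4 * \<rho>) \<Longrightarrow> b y = 0"
    by (rule chart_radial[OF c(1) \<rho>(1) sW m0]) (erule m2, rule that)
  define N where "N = {y \<in> dom_of c. chart_map c y \<in> ball ?a \<rho>}"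
  define V where "V = {y \<in> dom_of c. chart_map c y \<in> ball ?a (\<rho> / 2)}"
  let ?S = "chart_inv c ` cball ?a (3/4 * \<rho>)"
  have oN: "open N" "open V" unfolding N_def V_def by (intro open_chart_preimage[OF c(1)] open_ball)+
  have Ssub: "cball ?a (3/4 * \<rho>) \<subseteq> ball ?a \<rho>" using \<rho> by auto
  then have SW: "cball ?a (3/4 * \<rho>) \<subseteq> chart_map c ` dom_of c" using sW ball_subset_cball by blast
  have "compact ?S"
    by (rule compact_continuous_image[OF continuous_on_subset[OF continuous_chart(2)[OF c(1)] SW] compact_cball])
  then have cS: "closed ?S" by (rule compact_imp_closed)
  have SN: "?S \<subseteq> N"
  proof
    fix y assume "y \<in> ?S"
    then obtain z where z: "z \<in> cball ?a (3/4 * \<rho>)" "y = chart_inv c z" by blast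
    then have "chart_map c y = z" "y \<in> dom_of c" using chart_map_inv[OF c(1)] chart_inv_dom[OF c(1)] SW by blast+
    then show "y \<in> N" using z(1) Ssub unfolding N_def by blast
  qed
  have ND: "N \<subseteq> dom_of c" by (auto simp: N_def)
  have F: "\<exists>F. C1_on N F \<and> (\<forall>y\<in>N. \<bar>F y - rdist x0 y\<bar> \<le> \<delta> \<and> slope_le F y 2)" if \<delta>: "\<delta> > 0" for \<delta>
  proof -
    obtain F D where F: "\<And>y. (F has_derivative D y) (at y)" "\<And>v. continuous_on UNIV (\<lambda>y. D y v)"
      "\<And>y. y \<in> cball ?a \<rho> \<Longrightarrow> \<bar>F y - ?f y\<bar> \<le> \<delta>"
      "\<And>y v L. y \<in> cball ?a \<rho> \<Longrightarrow> (\<And>z t. z \<in> cball ?a r1 \<Longrightarrow> z + t *\<^sub>R v \<in> cball ?a r1 \<Longrightarrow> \<bar>?f (z + t *\<^sub>R v) - ?f z\<bar> \<le> L * \<bar>t\<bar>)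
       \<Longrightarrow> \<bar>D y v\<bar> \<le> L"
      by (rule C1_approximation[OF f \<rho>(1,2) \<delta> Q lu1]) (rule that, assumption, assumption, assumption, metis)
    note C = C1_on_chart[OF c(1) oN(1) ND F(1) continuous_on_subset[OF F(2) subset_UNIV]]
    show ?thesis
    proof (intro exI[of _ "\<lambda>y. F (chart_map c y)"] conjI ballI C(1))
      fix y assume y: "y \<in> N"
      then have yd: "y \<in> dom_of c" and yb: "chart_map c y \<in> cball ?a \<rho>" by (auto simp: N_def)
      show "\<bar>F (chart_map c y) - rdist x0 y\<bar> \<le> \<delta>" using F(3)[OF yb] c(1) yd by simp
      show "slope_le (\<lambda>y. F (chart_map c y)) y 2"
      proof (rule C(2)[OF y])
        fix v
        show "\<bar>D (chart_map c y) v\<bar> \<le> 2 * cnorm c y v"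
        proof (rule F(4)[OF yb])
          fix z t assume z: "z \<in> cball ?a r1" "z + t *\<^sub>R v \<in> cball ?a r1"
          let ?p = "chart_inv c z" and ?q = "chart_inv c (z + t *\<^sub>R v)"
          have yr: "chart_map c y \<in> cball ?a r1" using yb sub by blast
          have "edist ?p ?q \<le> ennreal (2 * cnorm c y (t *\<^sub>R v))"
            using r1(3)[OF z yr] c(1) yd by simp
          then have "rdist ?p ?q \<le> 2 * cnorm c y (t *\<^sub>R v)"
            using cnorm_nonneg[OF c(1) yd] by (subst (asm) rdist_le_iff) auto
          then have "rdist ?p ?q \<le> 2 * cnorm c y v * \<bar>t\<bar>" unfolding cnorm_scaleR[OF c(1) yd] by (simp add: mult_ac)
          moreover have "\<bar>rdist x0 ?q - rdist x0 ?p\<bar> \<le> rdist ?p ?q"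
            using RM.triangle[of x0 ?p ?q] RM.triangle[of x0 ?q ?p] RM.commute[of ?p ?q] by simp
          ultimately show "\<bar>?f (z + t *\<^sub>R v) - ?f z\<bar> \<le> 2 * cnorm c y v * \<bar>t\<bar>" by linarith
        qed
      qed
    qed
  qed
  have V1: "\<forall>y\<in>V. b y = 1" using b(6) by (simp add: V_def)
  have b1: "\<forall>y. 0 \<le> b y \<and> b y \<le> 1 \<and> slope_le b y B" "\<forall>y. y \<notin> ?S \<longrightarrow> b y = 0" using b(2,3,5,7) by blast+
  have "\<forall>\<delta>>0. \<exists>F. C1_on N F \<and> (\<forall>y\<in>N. \<bar>F y - rdist x0 y\<bar> \<le> \<delta> \<and> slope_le F y 2)" using F by blast
  with oN(1) SN cS b1(2) V1 b(4) b1(1) b(1) oN(2) have "patch (rdist x0) V" unfolding patch_def by blast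
  moreover have "x \<in> V" using c \<rho>(1) by (simp add: V_def)
  ultimately show ?thesis by blast
qed

text \<open>Induction over the patches with the target slope L variable: the function built so far
  gets the slope L0 halfway between 2 and L, and the other half of L - 2 pays for the term in which
  the bump is differentiated.\<close>

lemma patches_smoothing:
  assumes "finite \<V>" "\<And>V. V \<in> \<V> \<Longrightarrow> patch r V" "\<delta> > 0" "L > 2"
  shows "\<exists>\<rho> U. \<Union>\<V> \<subseteq> U \<and> C1_on U \<rho> \<and> (\<forall>y\<in>U. \<bar>\<rho> y - r y\<bar> \<le> \<delta> \<and> slope_le \<rho> y L)"
  using assms
proof (induction \<V> arbitrary: \<delta> L rule: finite_induct)
  case empty
  show ?case by (intro exI[of _ "\<lambda>_. 0"] exI[of _ "{}"]) (simp add: C1_on_const)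
next
  case (insert V \<V>)
  have "patch r V" using insert.prems by simp
  then obtain b S N B where oV: "open V" and b: "C1_on UNIV b" "\<forall>y. 0 \<le> b y \<and> b y \<le> 1 \<and> slope_le b y B" "0 \<le> B"
    "\<forall>y\<in>V. b y = 1" "\<forall>y. y \<notin> S \<longrightarrow> b y = 0" "closed S" "S \<subseteq> N" "open N"
    and F: "\<forall>\<delta>>0. \<exists>F. C1_on N F \<and> (\<forall>y\<in>N. \<bar>F y - r y\<bar> \<le> \<delta> \<and> slope_le F y 2)"
    unfolding patch_def by blast
  \<comment> \<open>Both functions are within d of r, so they differ by at most 2 d, and this choice
    gives B (2 d) \<le> (L - 2)/2 = L - L0.\<close>
  define d where "d = min \<delta> ((L - 2) / 4 / (B + 1))"
  have d: "d > 0" "d \<le> \<delta>" using insert.prems b(3) by (auto simp: d_def)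
  have Bd: "B * (2 * d) \<le> (L - 2) / 2"
  proof -
    have "B * (2 * d) \<le> (B + 1) * (2 * ((L - 2) / 4 / (B + 1)))"
      using b(3) d by (intro mult_mono) (auto simp: d_def)
    also have "\<dots> = (L - 2) / 2"
    proof -
      have *: "e * (2 * (K / 4 / e)) = K / 2" if "e \<noteq> 0" for e K :: real using that by simp
      show ?thesis by (rule *) (use b(3) in simp)
    qed
    finally show ?thesis .
  qed
  define L0 where "L0 = (2 + L) / 2"
  have L0: "L0 > 2" "L0 \<le> L" "2 \<le> L" using insert.prems by (auto simp: L0_def)
  obtain \<rho>0 U0 where U0: "\<Union>\<V> \<subseteq> U0" and C0: "C1_on U0 \<rho>0" and \<rho>0: "\<forall>y\<in>U0. \<bar>\<rho>0 y - r y\<bar> \<le> d \<and> slope_le \<rho>0 y L0"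
    using insert.IH[OF _ d(1) L0(1)] insert.prems by (metis insertCI)
  obtain F where CF: "C1_on N F" and F: "\<forall>y\<in>N. \<bar>F y - r y\<bar> \<le> d \<and> slope_le F y 2" using F d(1) by blast
  have VS: "V \<subseteq> S" using b(4,5) by fastforce
  \<comment> \<open>Outside \<open>U0\<close> nothing is known about the old function, so on
    \<open>V\<close> the new one is used alone; this agrees with the interpolation because b = 1
    there. Off \<open>S\<close> the interpolation is the old function.\<close>
  define \<rho> where "\<rho> y = (if y \<in> V then F y else if y \<in> N then \<rho>0 y + b y * (F y - \<rho>0 y) else \<rho>0 y)" for y
  have o: "open (U0 \<inter> N)" "open (U0 - S)" using C1_onD(1)[OF C0] b(6,8) by auto
  have C1: "C1_on V F" by (rule C1_on_subset[OF CF oV]) (use VS b(7) in blast)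
  have C2: "C1_on (U0 - S) \<rho>0" by (rule C1_on_subset[OF C0 o(2)]) blast
  have C3a: "C1_on (U0 \<inter> N) \<rho>0" by (rule C1_on_subset[OF C0 o(1)]) blast
  have C3b: "C1_on (U0 \<inter> N) F" by (rule C1_on_subset[OF CF o(1)]) blast
  have C3c: "C1_on (U0 \<inter> N) b" by (rule C1_on_subset[OF b(1) o(1)]) blast
  note C3 = C1_on_combine[OF C3a C3b C3c]
  have e1: "F y = \<rho> y" if "y \<in> V" for y using that by (simp add: \<rho>_def)
  have e2: "\<rho>0 y = \<rho> y" if "y \<in> U0 - S" for y using that VS b(5) by (auto simp: \<rho>_def)
  have e3: "\<rho>0 y + b y * (F y - \<rho>0 y) = \<rho> y" if "y \<in> U0 \<inter> N" for y using that b(4) by (auto simp: \<rho>_def)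
  have eq: "U0 \<union> V = V \<union> ((U0 \<inter> N) \<union> (U0 - S))" using b(7) by blast
  have "C1_on (V \<union> ((U0 \<inter> N) \<union> (U0 - S))) \<rho>"
    by (intro C1_on_Un C1_on_cong(1)[OF C1 e1] C1_on_cong(1)[OF C2 e2] C1_on_cong(1)[OF C3(1) e3])
  then have C: "C1_on (U0 \<union> V) \<rho>" unfolding eq .
  moreover have "\<bar>\<rho> y - r y\<bar> \<le> \<delta> \<and> slope_le \<rho> y L" if y: "y \<in> U0 \<union> V" for y
  proof -
    consider "y \<in> V" | "y \<in> U0 \<inter> N" | "y \<in> U0 - S" using y eq by blast
    then show ?thesis
    proof cases
      case 1
      then have yN: "y \<in> N" using VS b(7) by blast
      then have s: "slope_le F y L" using F slope_le_mono[OF _ L0(3)] by blast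
      have "slope_le \<rho> y L" by (rule C1_on_cong(2)[OF C1 e1 1 s])
      then show ?thesis using F yN e1[OF 1] d(2) by fastforce
    next
      case 2
      have y0: "\<bar>\<rho>0 y - r y\<bar> \<le> d" "slope_le \<rho>0 y L0" "\<bar>F y - r y\<bar> \<le> d" "slope_le F y 2" using 2 \<rho>0 F by auto
      have bb: "0 \<le> b y" "b y \<le> 1" "slope_le b y B" using b(2) by auto
      have df: "\<bar>F y - \<rho>0 y\<bar> \<le> 2 * d" using y0 by linarith
      have s: "slope_le (\<lambda>x. \<rho>0 x + b x * (F x - \<rho>0 x)) y ((1 - b y) * L0 + b y * 2 + B * (2 * d))"
        by (rule C3(2)[OF 2 y0(2,4) bb(3,1,2) df b(3)])
      have "(1 - b y) * L0 + b y * 2 \<le> (1 - b y) * L0 + b y * L0" using bb L0 by (intro add_left_mono mult_left_mono) auto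
      also have "\<dots> = L0" by (simp add: algebra_simps)
      finally have "(1 - b y) * L0 + b y * 2 + B * (2 * d) \<le> L" using Bd by (simp add: L0_def field_simps)
      then have "slope_le \<rho> y L" by (intro C1_on_cong(2)[OF C3(1) e3 2] slope_le_mono[OF s])
      moreover have "\<bar>\<rho> y - r y\<bar> \<le> d"
      proof -
        have dec: "\<rho> y - r y = (1 - b y) * (\<rho>0 y - r y) + b y * (F y - r y)"
          unfolding e3[OF 2, symmetric] by (simp add: algebra_simps)
        have "\<bar>\<rho> y - r y\<bar> \<le> (1 - b y) * \<bar>\<rho>0 y - r y\<bar> + b y * \<bar>F y - r y\<bar>"
          unfolding dec using bb by (intro order_trans[OF abs_triangle_ineq]) (simp add: abs_mult)
        also have "\<dots> \<le> (1 - b y) * d + b y * d" using bb y0 by (intro add_mono mult_left_mono) auto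
        finally show ?thesis by (simp add: algebra_simps)
      qed
      ultimately show ?thesis using d(2) by linarith
    next
      case 3
      then have s: "slope_le \<rho>0 y L" using \<rho>0 slope_le_mono[OF _ L0(2)] by blast
      have "slope_le \<rho> y L" by (rule C1_on_cong(2)[OF C2 e2 3 s])
      moreover have "\<bar>\<rho> y - r y\<bar> \<le> d" unfolding e2[OF 3, symmetric] using \<rho>0 3 by blast
      ultimately show ?thesis using d(2) by linarith
    qed
  qed
  ultimately show ?case using U0 by (intro exI[of _ \<rho>] exI[of _ "U0 \<union> V"]) blast
qed

text \<open>Any slope above the 2 of the patches could be prescribed; 3 is a convenient value. The
  accuracy 1 reappears as the shifts by 1 in the radii of the cutoff.\<close>

lemma distance_smoothing:
  obtains W \<rho> where "RM.mcball x0 R \<subseteq> W" "C1_on W \<rho>" "\<And>y. y \<in> W \<Longrightarrow> \<bar>\<rho> y - rdist x0 y\<bar> \<le> 1" "\<And>y. y \<in> W \<Longrightarrow> slope_le \<rho> y 3"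
proof -
  have "RM.mcball x0 R \<subseteq> \<Union>{V. patch (rdist x0) V}" using patch_exists[of _ x0] by blast
  moreover have "\<And>V. V \<in> {V. patch (rdist x0) V} \<Longrightarrow> open V" by (simp add: patch_def)
  ultimately obtain \<V> where V: "\<V> \<subseteq> {V. patch (rdist x0) V}" "finite \<V>" "RM.mcball x0 R \<subseteq> \<Union>\<V>"
    using compactE[OF Hopf_Rinow] by metis
  have P: "\<And>V. V \<in> \<V> \<Longrightarrow> patch (rdist x0) V" using V(1) by blast
  obtain \<rho> U where U: "\<Union>\<V> \<subseteq> U" "C1_on U \<rho>" "\<forall>y\<in>U. \<bar>\<rho> y - rdist x0 y\<bar> \<le> 1 \<and> slope_le \<rho> y 3"
    using patches_smoothing[OF V(2) P zero_less_one, of 3] by auto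
  show ?thesis by (rule that[of U \<rho>]) (use U V(3) in auto)
qed

text \<open>The profile is applied to the smoothed distance divided by R. The error 1 of the
  smoothing turns the radii R and 2R into R - 1 and 2R + 1, and the constant 12 j / R is the slope 3
  times the bound 4 j of the profile, divided by R.\<close>

lemma cutoff_exists:
  assumes p: "p > 1" and j: "p \<le> 2 * real j" and R: "R > 0"
  obtains \<Psi> Y where "has_gradient \<Psi> Y" "\<And>x. 0 \<le> \<Psi> x" "\<And>x. \<Psi> x \<le> 1"
    "\<And>x. rdist x0 x < R - 1 \<Longrightarrow> \<Psi> x = 1" "\<And>x. rdist x0 x < R - 1 \<Longrightarrow> tnorm g x (Y x) \<le> 0"
    "\<And>x. rdist x0 x > 2 * R + 1 \<Longrightarrow> \<Psi> x = 0"
    "\<And>x. tnorm g x (Y x) \<le> 12 * real j / R * \<Psi> x powr ((p - 1) / p)"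
proof -
  \<comment> \<open>The smoothing reaches beyond radius 2R + 1, so that its domain and the region
    where the cutoff is 0 cover the manifold.\<close>
  obtain W \<rho> where W: "RM.mcball x0 (2 * R + 2) \<subseteq> W" "C1_on W \<rho>" "\<And>y. y \<in> W \<Longrightarrow> \<bar>\<rho> y - rdist x0 y\<bar> \<le> 1" "\<And>y. y \<in> W \<Longrightarrow> slope_le \<rho> y 3"
    by (rule distance_smoothing[of x0 "2 * R + 2"]) (rule that)
  have j1: "j \<ge> 1" using p j by (cases j) auto
  let ?\<theta> = "\<lambda>t. step j (t / R)" and ?\<theta>' = "\<lambda>t. step_deriv j (t / R) * (1 / R)"
  have d: "(?\<theta> has_real_derivative ?\<theta>' t) (at t)" for t
    by (rule DERIV_chain'[OF _ step_derivative]) (use R in \<open>auto intro!: derivative_eq_intros\<close>)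
  have cd: "continuous_on UNIV ?\<theta>'"
    using R by (intro continuous_intros continuous_on_compose2[OF continuous_step_deriv]) auto
  note C = C1_on_compose[OF W(2) d cd]
  define \<Psi> where "\<Psi> x = (if x \<in> W then ?\<theta> (\<rho> x) else 0)" for x
  have z: "\<Psi> x = 0" if "rdist x0 x > 2 * R + 1" for x
  proof (cases "x \<in> W")
    case True
    then have "\<rho> x \<ge> 2 * R" using W(3)[OF True] that by linarith
    then show ?thesis using step_eq_0(1)[OF _ j1, of "\<rho> x / R"] R True by (simp add: \<Psi>_def field_simps)
  qed (simp add: \<Psi>_def)
  let ?Z = "- RM.mcball x0 (2 * R + 1)"
  have oZ: "open ?Z" using closed_mcball by (rule open_Compl)
  have z': "0 = \<Psi> x" if "x \<in> ?Z" for x using z[of x] that by auto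
  have Cz: "C1_on ?Z \<Psi>" by (rule C1_on_cong(1)[OF C1_on_const(1)[OF oZ] z'])
  have eW: "?\<theta> (\<rho> x) = \<Psi> x" if "x \<in> W" for x using that by (simp add: \<Psi>_def)
  have CW: "C1_on W \<Psi>" by (rule C1_on_cong(1)[OF C(1) eW])
  have "RM.mcball x0 (2 * R + 1) \<subseteq> RM.mcball x0 (2 * R + 2)" by auto
  then have "W \<union> ?Z = UNIV" using W(1) by blast
  then have C1: "C1_on UNIV \<Psi>" using C1_on_Un[OF CW Cz] by simp
  \<comment> \<open>The power of \<Psi> equals 1 on the inner ball, so the vanishing of the gradient
    there is put into the slope bound separately.\<close>
  define \<Lambda> where "\<Lambda> x = (if rdist x0 x < R - 1 then 0 else 12 * real j / R * \<Psi> x powr ((p - 1) / p))" for x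
  have sl: "slope_le \<Psi> x (\<Lambda> x)" for x
  proof (cases "x \<in> W")
    case True
    have s0: "slope_le (\<lambda>x. ?\<theta> (\<rho> x)) x (\<bar>?\<theta>' (\<rho> x)\<bar> * 3)" by (rule C(2)[OF True W(4)[OF True]])
    have s: "slope_le \<Psi> x (\<bar>?\<theta>' (\<rho> x)\<bar> * 3)" by (rule C1_on_cong(2)[OF C(1) eW True s0])
    have "\<bar>?\<theta>' (\<rho> x)\<bar> * 3 \<le> \<Lambda> x"
    proof (cases "rdist x0 x < R - 1")
      case rl: True
      then have "\<rho> x \<le> R" using W(3)[OF True] by linarith
      then have "step_deriv j (\<rho> x / R) = 0" using R by (intro step_eq_1) simp
      then show ?thesis using rl by (simp add: \<Lambda>_def)
    next
      case False
      have "\<bar>?\<theta>' (\<rho> x)\<bar> * 3 = 3 / R * \<bar>step_deriv j (\<rho> x / R)\<bar>" using R by (simp add: abs_mult)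
      also have "\<dots> \<le> 3 / R * (4 * real j * step j (\<rho> x / R) powr ((p - 1) / p))"
        using R by (intro mult_left_mono step_deriv_bound[OF p j]) auto
      finally show ?thesis using False True by (simp add: \<Lambda>_def \<Psi>_def)
    qed
    then show ?thesis by (rule slope_le_mono[OF s])
  next
    case False
    then have xZ: "x \<in> ?Z" using \<open>W \<union> ?Z = UNIV\<close> by blast
    have "\<Lambda> x = 0" using z'[OF xZ] by (simp add: \<Lambda>_def)
    then show ?thesis
      using C1_on_cong(2)[OF C1_on_const(1)[OF oZ] z' xZ C1_on_const(2)] by simp
  qed
  obtain Y where Y: "has_gradient \<Psi> Y" "\<And>x. tnorm g x (Y x) \<le> \<Lambda> x" by (rule has_gradient_exists[OF C1 sl]) (rule that)
  show ?thesis
  proof (rule that[OF Y(1)])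
    show "0 \<le> \<Psi> x" "\<Psi> x \<le> 1" for x using step_bounds by (auto simp: \<Psi>_def)
    show "\<Psi> x = 1" if r: "rdist x0 x < R - 1" for x
    proof -
      have x: "x \<in> W" using W(1) r R by (auto simp: subset_iff)
      then have "\<rho> x \<le> R" using W(3)[OF x] r by linarith
      then show ?thesis using R x step_eq_1(1)[of "\<rho> x / R" j] by (simp add: \<Psi>_def)
    qed
    show "tnorm g x (Y x) \<le> 0" if "rdist x0 x < R - 1" for x using Y(2)[of x] that by (simp add: \<Lambda>_def)
    show "\<Psi> x = 0" if "rdist x0 x > 2 * R + 1" for x by (rule z[OF that])
    show "tnorm g x (Y x) \<le> 12 * real j / R * \<Psi> x powr ((p - 1) / p)" for x
    proof -
      have "\<Lambda> x \<le> 12 * real j / R * \<Psi> x powr ((p - 1) / p)" using R by (simp add: \<Lambda>_def)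
      then show ?thesis using Y(2)[of x] by linarith
    qed
  qed
qed

end

section \<open>The flux inequality\<close>

text \<open>If z \<le> l s, then l s replaces z inside its power, otherwise z / l replaces s; each
  case produces one summand of the right side.\<close>

lemma weighted_young:
  assumes p: "p > 1" and s: "0 \<le> s" and z: "0 \<le> z" and l: "0 < (l::real)"
  shows "s powr (1/p) * z powr (1 - 1/p) \<le> l powr (1 - 1/p) * s + l powr (- (1/p)) * z"
proof (cases "z \<le> l * s")
  case True
  have "s powr (1/p) * z powr (1 - 1/p) \<le> s powr (1/p) * (l * s) powr (1 - 1/p)"
    using p z True by (intro mult_left_mono powr_mono2) auto
  also have "\<dots> = l powr (1 - 1/p) * (s powr (1/p) * s powr (1 - 1/p))" using s l by (simp add: powr_mult)
  also have "s powr (1/p) * s powr (1 - 1/p) = s" using s by (simp add: powr_add[symmetric])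
  finally show ?thesis using z by (simp add: add_increasing2)
next
  case False
  have "s powr (1/p) * z powr (1 - 1/p) \<le> (z / l) powr (1/p) * z powr (1 - 1/p)"
    using p s z l False by (intro mult_right_mono powr_mono2) (auto simp: field_simps)
  also have "\<dots> = l powr (- (1/p)) * (z powr (1/p) * z powr (1 - 1/p))"
    using z l by (simp add: powr_divide powr_minus divide_simps)
  also have "z powr (1/p) * z powr (1 - 1/p) = z" using z by (simp add: powr_add[symmetric])
  finally show ?thesis using s by (simp add: add_increasing)
qed

text \<open>With \<open>a = q - p + 1\<close>, \<open>\<alpha> = max a 2\<close> and \<open>\<beta> = min a 1\<close> take \<open>h(t) = t\<^sup>\<alpha> (1 + t)\<^bsup>\<beta> - \<alpha>\<^esup>\<close> for
  \<open>t > 0\<close>: the power \<open>t\<^sup>a\<close>, made \<open>C\<^sup>1\<close> at 0 and of at most linear growth. The last property follows from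
  \<open>h(t) \<le> t\<^sup>a\<close> and \<open>\<beta> h(t) \<le> t h'(t)\<close>.\<close>

lemma test_profile_exists:
  assumes p: "p > 1" and q: "q > p - 1"
  obtains h h' :: "real \<Rightarrow> real" and B c where
    "\<And>t. (h has_real_derivative h' t) (at t)" "continuous_on UNIV h'" "\<And>t. \<bar>h' t\<bar> \<le> B"
    "\<And>t. 0 \<le> h t" "\<And>t. t \<le> 0 \<Longrightarrow> h t = 0 \<and> h' t = 0" "\<And>t. t > 0 \<Longrightarrow> h' t > 0" "c > 0"
    "\<And>t. h t \<le> c * (max t 0 powr q) powr (1/p) * h' t powr (1 - 1/p)"
proof -
  define a where "a = q - p + 1"
  define al where "al = max a 2"
  define be where "be = min a 1"
  have a: "a > 0" "be > 0" "be \<le> 1" "be \<le> a" "a \<le> al" "2 \<le> al" using q by (auto simp: a_def al_def be_def)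
  define h where "h t = (if t \<le> 0 then 0 else t powr al * (1 + t) powr (be - al))" for t :: real
  \<comment> \<open>The logarithmic derivative t h'(t) / h(t). It moves from \<open>al\<close> near
    0 to \<open>be\<close> at infinity, and these bounds compare h' with h / t.\<close>
  define k where "k t = al + (be - al) * (t / (1 + t))" for t :: real
  define h' where "h' t = (if t \<le> 0 then 0 else h t / t * k t)" for t :: real
  have k: "be \<le> k t" "k t \<le> al" if "t > 0" for t
  proof -
    have t: "0 \<le> t / (1 + t)" "t / (1 + t) \<le> 1" using that by auto
    have "(be - al) * (t / (1 + t)) \<ge> (be - al) * 1" using t a by (intro mult_left_mono_neg) auto
    then show "be \<le> k t" by (simp add: k_def)
    have "(be - al) * (t / (1 + t)) \<le> 0" using t a by (intro mult_nonpos_nonneg) auto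
    then show "k t \<le> al" by (simp add: k_def)
  qed
  have h0: "h t \<ge> 0" for t by (simp add: h_def)
  have hpos: "h t > 0" if "t > 0" for t using that by (simp add: h_def)
  \<comment> \<open>Every power between the two extreme exponents dominates h: exponent 1 yields the
    bounded slope, exponent 2 the regularity at 0, and exponent a the final estimate.\<close>
  have hle: "h t \<le> t powr b" if "t > 0" "be \<le> b" "b \<le> al" for t b
  proof -
    have "h t = t powr b * t powr (al - b) * (1 + t) powr (be - al)" using that by (simp add: h_def powr_add[symmetric])
    also have "\<dots> \<le> t powr b * (1 + t) powr (al - b) * (1 + t) powr (be - al)"
      using that by (intro mult_right_mono mult_left_mono powr_mono2) auto
    also have "\<dots> = t powr b * (1 + t) powr (be - b)" using that by (simp add: powr_add[symmetric] mult.assoc)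
    also have "\<dots> \<le> t powr b * 1"
    proof (intro mult_left_mono)
      show "(1 + t) powr (be - b) \<le> 1" using powr_mono[of "be - b" 0 "1 + t"] that by simp
    qed simp
    finally show ?thesis by simp
  qed
  have h1: "h t \<le> t" if "t > 0" for t using hle[of t 1] that a by simp
  have h2: "h t \<le> t\<^sup>2" if "t > 0" for t using hle[of t 2] that a by (simp add: powr_numeral)
  have der_pos: "(h has_real_derivative h' t) (at t)" if t: "t > 0" for t
  proof -
    have "((\<lambda>t. t powr al * (1 + t) powr (be - al)) has_real_derivative
        t powr al * ((be - al) * (1 + t) powr (be - al - 1)) + (al * t powr (al - 1)) * (1 + t) powr (be - al)) (at t)"
      using t by (auto intro!: derivative_eq_intros)
    also have "t powr al * ((be - al) * (1 + t) powr (be - al - 1)) + (al * t powr (al - 1)) * (1 + t) powr (be - al) = h' t"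
    proof -
      have 1: "(1 + t) powr (be - al - 1) = (1 + t) powr (be - al) / (1 + t)" "t powr (al - 1) = t powr al / t"
        using t by (simp_all add: powr_diff)
      have 2: "X * (b * (Y / (1 + t))) + al * (X / t) * Y = X * Y / t * (al + b * (t / (1 + t)))" for X Y b
        using t by (simp add: field_simps)
      show ?thesis unfolding 1 2 using t by (simp add: h'_def h_def k_def)
    qed
    finally show ?thesis
      by (rule has_field_derivative_transform_within_open[where S="{0<..}"]) (use t in \<open>auto simp: h_def\<close>)
  qed
  have der: "(h has_real_derivative h' t) (at t)" for t
  proof -
    consider "t < 0" | "t = 0" | "t > 0" by linarith
    then show ?thesis
    proof cases
      case 1
      have "((\<lambda>_. 0) has_real_derivative h' t) (at t)" using 1 by (simp add: h'_def)
      then show ?thesis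
        by (rule has_field_derivative_transform_within_open[where S="{..<0}"]) (use 1 in \<open>auto simp: h_def\<close>)
    next
      case 2
      have "((\<lambda>s. (h (0 + s) - h 0) / s) \<longlongrightarrow> 0) (at 0)"
      proof (rule Lim_null_comparison)
        show "((\<lambda>s. \<bar>s\<bar>) \<longlongrightarrow> (0::real)) (at 0)" by (intro tendsto_rabs_zero tendsto_ident_at)
        have "norm ((h (0 + s) - h 0) / s) \<le> \<bar>s\<bar>" for s
        proof (cases "s > 0")
          case True
          then show ?thesis using h2[OF True] h0[of s] by (simp add: h_def[of 0] divide_simps power2_eq_square)
        qed (simp add: h_def)
        then show "\<forall>\<^sub>F s in at 0. norm ((h (0 + s) - h 0) / s) \<le> \<bar>s\<bar>" by (intro always_eventually allI)
      qed
      then show ?thesis using 2 by (simp add: DERIV_def h'_def)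
    next
      case 3 then show ?thesis by (rule der_pos)
    qed
  qed
  have h'_le: "h' t \<le> al * (h t / t)" "h' t \<ge> be * (h t / t)" if "t > 0" for t
    using mult_left_mono[OF k(1)[OF that], of "h t / t"] mult_left_mono[OF k(2)[OF that], of "h t / t"] that h0[of t]
    by (simp_all add: h'_def mult.commute)
  have h'0: "h' t \<ge> 0" for t using h'_le(2)[of t] h0[of t] a by (cases "t > 0") (auto simp: h'_def intro: order_trans[rotated])
  have h'B: "\<bar>h' t\<bar> \<le> al" for t
  proof (cases "t > 0")
    case True
    have "h' t \<le> al * (h t / t)" by (rule h'_le(1)[OF True])
    also have "\<dots> \<le> al * 1" using True a h1[OF True] by (intro mult_left_mono) auto
    finally show ?thesis using h'0[of t] by simp
  qed (use a in \<open>simp add: h'_def\<close>)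
  have cont: "isCont h' t" for t
  proof -
    consider "t < 0" | "t = 0" | "t > 0" by linarith
    then show ?thesis
    proof cases
      case 1
      have "\<forall>\<^sub>F s in nhds t. h' s = 0"
        using eventually_nhds_in_open[of "{..<0}" t] 1 by (auto elim!: eventually_mono simp: h'_def)
      then show ?thesis using isCont_cong[of h' "\<lambda>_. 0" t] by simp
    next
      case 2
      have "(h' \<longlongrightarrow> 0) (at 0)"
      proof (rule Lim_null_comparison)
        have "((\<lambda>s. al * \<bar>s\<bar>) \<longlongrightarrow> al * \<bar>0\<bar>) (at 0)" by (intro tendsto_intros)
        then show "((\<lambda>s. al * \<bar>s\<bar>) \<longlongrightarrow> 0) (at 0)" by simp
        have "norm (h' s) \<le> al * \<bar>s\<bar>" for s
        proof (cases "s > 0")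
          case True
          have "h s / s \<le> s" using h2[OF True] True by (simp add: divide_simps power2_eq_square)
          then have "al * (h s / s) \<le> al * s" using a by (intro mult_left_mono) auto
          then show ?thesis using h'_le(1)[OF True] h'0[of s] True by simp
        next
          case False
          then have "h' s = 0" by (simp add: h'_def)
          moreover have "0 \<le> al * \<bar>s\<bar>" by (intro mult_nonneg_nonneg) (use a in auto)
          ultimately show ?thesis by (simp only: norm_zero)
        qed
        then show "\<forall>\<^sub>F s in at 0. norm (h' s) \<le> al * \<bar>s\<bar>" by (intro always_eventually allI)
      qed
      then show ?thesis using 2 by (simp add: isCont_def h'_def)
    next
      case 3
      have "isCont (\<lambda>s. h s / s * k s) t"
        unfolding k_def using 3 by (intro continuous_intros DERIV_isCont[OF der]) auto
      moreover have ev: "\<forall>\<^sub>F s in nhds t. h s / s * k s = h' s"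
        using eventually_nhds_in_open[of "{0<..}" t] 3 by (auto elim!: eventually_mono simp: h'_def)
      ultimately show ?thesis using isCont_cong[OF ev] by blast
    qed
  qed
  have key: "h t \<le> be powr (- (1 - 1/p)) * (max t 0 powr q) powr (1/p) * h' t powr (1 - 1/p)" for t
  proof (cases "t > 0")
    case True
    have hh: "h t \<le> t * h' t / be" using h'_le(2)[OF True] True a by (simp add: field_simps)
    \<comment> \<open>The first factor is estimated by t^a, the second by t h'(t) /
      \<open>be\<close>; the exponents of t add up to (a + p - 1)/p = q/p.\<close>
    have "h t = h t powr (1/p) * h t powr (1 - 1/p)" using h0[of t] by (simp add: powr_add[symmetric])
    also have "\<dots> \<le> (t powr a) powr (1/p) * (t * h' t / be) powr (1 - 1/p)"
      using hle[OF True, of a] hh h0[of t] a p by (intro mult_mono powr_mono2) auto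
    also have "\<dots> = be powr (- (1 - 1/p)) * (t powr (a / p) * t powr (1 - 1/p)) * h' t powr (1 - 1/p)"
    proof -
      have "(t * h' t / be) powr (1 - 1/p) = t powr (1 - 1/p) * h' t powr (1 - 1/p) / be powr (1 - 1/p)"
        using True h'0[of t] a by (simp add: powr_mult powr_divide)
      moreover have "be powr (- (1 - 1/p)) = 1 / be powr (1 - 1/p)" by (rule powr_minus_divide)
      ultimately show ?thesis unfolding powr_powr by (simp only: times_divide_eq_left times_divide_eq_right mult_1 mult_1_right mult.assoc)
    qed
    also have "t powr (a / p) * t powr (1 - 1/p) = t powr (q / p)"
      unfolding powr_add[symmetric] using p by (simp add: a_def field_simps)
    finally show ?thesis using True by (simp add: powr_powr)
  qed (simp add: h_def)
  show ?thesis
  proof (rule that[OF der _ h'B h0])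
    show "continuous_on UNIV h'" using cont by (simp add: continuous_at_imp_continuous_on)
    show "h t = 0 \<and> h' t = 0" if "t \<le> 0" for t using that by (simp add: h_def h'_def)
    show "h' t > 0" if "t > 0" for t
      using h'_le(2)[OF that] mult_pos_pos[OF a(2) divide_pos_pos[OF hpos[OF that] that]] by linarith
    show "be powr (- (1 - 1/p)) > 0" using a by simp
  qed (rule key)
qed

text \<open>The first use of the hypothesis, with \<open>\<mu> = 2 K\<close>, bounds the integral of \<open>w\<close>; then the
  last integral is a tail of a convergent one, and \<open>\<mu>\<close> may be sent to 0.\<close>

lemma absorption:
  fixes w r :: "'a \<Rightarrow> real"
  assumes p: "p > 1" and K: "K > 0" and w: "w \<in> borel_measurable M" "\<And>x. w x \<ge> 0"
    and r: "r \<in> borel_measurable M"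
    and step: "\<And>R. R \<ge> R0 \<Longrightarrow> \<exists>\<psi>. integrable M (\<lambda>x. \<psi> x * w x) \<and> (\<forall>x. 0 \<le> \<psi> x \<and> \<psi> x \<le> 1 \<and> (r x < R - 1 \<longrightarrow> \<psi> x = 1)) \<and>
      (\<forall>\<mu>>0. (LINT x|M. \<psi> x * w x) \<le> K * \<mu> powr (p - 1) + K / \<mu> * (LINT x|M. indicator {x. r x \<ge> R - 1} x * (\<psi> x * w x)))"
  shows "AE x in M. w x = 0"
proof -
  let ?f = "\<lambda>n::nat. \<lambda>x. if r x < real n then w x else 0"
  have fm[measurable]: "?f n \<in> borel_measurable M" for n using r w(1) by measurable
  \<comment> \<open>For \<mu> = 2 K the last term carries the factor 1/2 and is absorbed by the left
    side, which doubles the first term.\<close>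
  define C where "C = 2 * (K * (2 * K) powr (p - 1))"
  obtain n0 :: nat where n0: "R0 \<le> real n0" using real_arch_simple by blast
  have step': "\<exists>\<psi>. integrable M (\<lambda>x. \<psi> x * w x) \<and> (\<forall>x. 0 \<le> \<psi> x \<and> \<psi> x \<le> 1 \<and> (r x < real n \<longrightarrow> \<psi> x = 1)) \<and>
      (\<forall>\<mu>>0. (LINT x|M. \<psi> x * w x) \<le> K * \<mu> powr (p - 1) + K / \<mu> * (LINT x|M. indicator {x. r x \<ge> real n} x * (\<psi> x * w x)))"
    if "n \<ge> n0" for n
    using step[of "real n + 1"] n0 that by simp
  have indi: "integrable M (\<lambda>x. indicator {x. r x \<ge> real n} x * f x)" if "integrable M f" for n and f :: "'a \<Rightarrow> real"
  proof (rule Bochner_Integration.integrable_bound[OF that])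
    have "(\<lambda>x. if r x \<ge> real n then f x else 0) \<in> borel_measurable M"
      using r borel_measurable_integrable[OF that] by measurable
    then show "(\<lambda>x. indicator {x. r x \<ge> real n} x * f x) \<in> borel_measurable M"
      by (rule measurable_cong[THEN iffD1, rotated]) (auto simp: indicator_def)
  qed (auto simp: indicator_def)
  have b1: "(\<integral>\<^sup>+x. ennreal (?f n x) \<partial>M) \<le> ennreal C" if n: "n \<ge> n0" for n
  proof -
    obtain \<psi> where \<psi>: "integrable M (\<lambda>x. \<psi> x * w x)" "\<And>x. 0 \<le> \<psi> x" "\<And>x. \<psi> x \<le> 1" "\<And>x. r x < real n \<Longrightarrow> \<psi> x = 1"
      "\<And>\<mu>. \<mu> > 0 \<Longrightarrow> (LINT x|M. \<psi> x * w x) \<le> K * \<mu> powr (p - 1) + K / \<mu> * (LINT x|M. indicator {x. r x \<ge> real n} x * (\<psi> x * w x))"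
      using step'[OF n] by blast
    let ?z = "LINT x|M. \<psi> x * w x"
    have "(LINT x|M. indicator {x. r x \<ge> real n} x * (\<psi> x * w x)) \<le> ?z"
      using \<psi>(2) w(2) by (intro integral_mono indi \<psi>(1)) (auto simp: indicator_def)
    then have "K / (2 * K) * (LINT x|M. indicator {x. r x \<ge> real n} x * (\<psi> x * w x)) \<le> K / (2 * K) * ?z"
      using K by (intro mult_left_mono) auto
    then have "?z \<le> C" using \<psi>(5)[of "2 * K"] K by (simp add: C_def)
    have "(\<integral>\<^sup>+x. ennreal (?f n x) \<partial>M) \<le> (\<integral>\<^sup>+x. ennreal (\<psi> x * w x) \<partial>M)"
      using \<psi>(2,4) w(2) by (intro nn_integral_mono ennreal_leI) auto
    also have "\<dots> = ennreal ?z" using \<psi>(1,2) w(2) by (intro nn_integral_eq_integral) auto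
    also have "\<dots> \<le> ennreal C" using \<open>?z \<le> C\<close> by (rule ennreal_leI)
    finally show ?thesis .
  qed
  have SUPw: "(SUP n. ennreal (?f n x)) = ennreal (w x)" for x
  proof (rule antisym)
    show "(SUP n. ennreal (?f n x)) \<le> ennreal (w x)" using w(2) by (intro SUP_least ennreal_leI) auto
    obtain n :: nat where "r x < real n" using reals_Archimedean2 by blast
    then have "ennreal (w x) = ennreal (?f n x)" by simp
    also have "\<dots> \<le> (SUP n. ennreal (?f n x))" by (rule SUP_upper) simp
    finally show "ennreal (w x) \<le> (SUP n. ennreal (?f n x))" .
  qed
  have inc: "incseq (\<lambda>n x. ennreal (?f n x))"
    using w(2) by (auto simp: incseq_def le_fun_def intro!: ennreal_leI)
  have "(\<integral>\<^sup>+x. ennreal (w x) \<partial>M) = (SUP n. (\<integral>\<^sup>+x. ennreal (?f n x) \<partial>M))"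
    unfolding SUPw[symmetric] by (rule nn_integral_monotone_convergence_SUP[OF inc]) measurable
  also have "\<dots> \<le> ennreal C"
  proof (rule SUP_least)
    fix n
    have "(\<integral>\<^sup>+x. ennreal (?f n x) \<partial>M) \<le> (\<integral>\<^sup>+x. ennreal (?f (max n n0) x) \<partial>M)"
      using w(2) by (intro nn_integral_mono ennreal_leI) auto
    also have "\<dots> \<le> ennreal C" by (rule b1) simp
    finally show "(\<integral>\<^sup>+x. ennreal (?f n x) \<partial>M) \<le> ennreal C" .
  qed
  finally have "(\<integral>\<^sup>+x. ennreal (w x) \<partial>M) < \<infinity>" by (simp add: le_less_trans)
  then have wi: "integrable M w" using w by (intro integrableI_nonneg) auto
  let ?J = "LINT x|M. w x"
  have fi: "integrable M (?f n)" for n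
    using w(2) by (intro Bochner_Integration.integrable_bound[OF wi]) auto
  have lim: "(\<lambda>n. LINT x|M. ?f n x) \<longlonglongrightarrow> ?J"
  proof (rule integral_dominated_convergence[OF w(1) fm wi])
    show "AE x in M. (\<lambda>n. ?f n x) \<longlonglongrightarrow> w x"
    proof (rule AE_I2)
      fix x
      obtain n :: nat where "r x < real n" using reals_Archimedean2 by blast
      then have "\<forall>\<^sub>F m in sequentially. ?f m x = w x"
        unfolding eventually_sequentially by (intro exI[of _ n]) auto
      then show "(\<lambda>n. ?f n x) \<longlonglongrightarrow> w x" by (rule tendsto_eventually)
    qed
  qed (use w(2) in auto)
  have main: "?J \<le> K * \<mu> powr (p - 1)" if \<mu>: "\<mu> > 0" for \<mu>
  proof -
    have "(\<lambda>n. K * \<mu> powr (p - 1) + K / \<mu> * (?J - (LINT x|M. ?f n x))) \<longlonglongrightarrow> K * \<mu> powr (p - 1) + K / \<mu> * (?J - ?J)"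
      by (intro tendsto_intros lim)
    then have l2: "(\<lambda>n. K * \<mu> powr (p - 1) + K / \<mu> * (?J - (LINT x|M. ?f n x))) \<longlonglongrightarrow> K * \<mu> powr (p - 1)" by simp
    show ?thesis
    proof (rule LIMSEQ_le[OF lim l2], intro exI[of _ n0] allI impI)
      fix n assume n: "n0 \<le> n"
      obtain \<psi> where \<psi>: "integrable M (\<lambda>x. \<psi> x * w x)" "\<And>x. 0 \<le> \<psi> x" "\<And>x. \<psi> x \<le> 1" "\<And>x. r x < real n \<Longrightarrow> \<psi> x = 1"
        "\<And>\<mu>. \<mu> > 0 \<Longrightarrow> (LINT x|M. \<psi> x * w x) \<le> K * \<mu> powr (p - 1) + K / \<mu> * (LINT x|M. indicator {x. r x \<ge> real n} x * (\<psi> x * w x))"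
        using step'[OF n] by blast
      have 1: "(LINT x|M. ?f n x) \<le> (LINT x|M. \<psi> x * w x)"
        using \<psi>(2,4) w(2) by (intro integral_mono fi \<psi>(1)) auto
      have "(LINT x|M. indicator {x. r x \<ge> real n} x * (\<psi> x * w x)) \<le> (LINT x|M. w x - ?f n x)"
      proof (rule integral_mono[OF indi[OF \<psi>(1)] Bochner_Integration.integrable_diff[OF wi fi]])
        fix x
        show "indicator {x. r x \<ge> real n} x * (\<psi> x * w x) \<le> w x - ?f n x"
          using mult_right_mono[OF \<psi>(3)[of x] w(2)[of x]] by (auto simp: indicator_def)
      qed
      also have "(LINT x|M. w x - ?f n x) = ?J - (LINT x|M. ?f n x)" by (rule Bochner_Integration.integral_diff[OF wi fi])
      finally have "K / \<mu> * (LINT x|M. indicator {x. r x \<ge> real n} x * (\<psi> x * w x)) \<le> K / \<mu> * (?J - (LINT x|M. ?f n x))"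
        using K \<mu> by (intro mult_left_mono) auto
      then show "(LINT x|M. ?f n x) \<le> K * \<mu> powr (p - 1) + K / \<mu> * (?J - (LINT x|M. ?f n x))"
        using 1 \<psi>(5)[OF \<mu>] by linarith
    qed
  qed
  have "?J \<le> 0"
  proof (rule ccontr)
    assume J: "\<not> ?J \<le> 0"
    \<comment> \<open>For this \<mu> the bound K \<mu>^(p-1) is half of the integral, which
      contradicts its positivity.\<close>
    have "(?J / (2 * K)) powr (1 / (p - 1)) > 0" using J K by simp
    from main[OF this] show False using J K p by (simp add: powr_powr)
  qed
  moreover have "?J \<ge> 0" using w(2) by (intro integral_nonneg_AE) auto
  ultimately have "?J = 0" by simp
  then show ?thesis using integral_nonneg_eq_0_iff_AE[OF wi] w(2) by simp
qed

text \<open>Z is a pointwise limit of functions with finite range. For these the composition is a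
  finite sum of measurable pieces, and continuity in the second argument carries the limit off a
  null set.\<close>

lemma caratheodory_measurable:
  fixes G :: "'a::euclidean_space \<Rightarrow> 'b::euclidean_space \<Rightarrow> 'c::euclidean_space"
  assumes S: "S \<in> sets lebesgue"
    and cont: "AE y in lebesgue_on S. continuous_on UNIV (G y)"
    and meas: "\<And>z. (\<lambda>y. G y z) \<in> borel_measurable (lebesgue_on S)"
    and Z: "Z \<in> borel_measurable (lebesgue_on S)"
  shows "(\<lambda>y. G y (Z y)) \<in> borel_measurable (lebesgue_on S)"
proof -
  obtain h where h: "\<And>n::nat. h n \<in> borel_measurable (lebesgue_on S)" "\<And>n. finite (range (h n))" "\<And>y. (\<lambda>n. h n y) \<longlonglongrightarrow> Z y"
    using borel_measurable_simple_function_limit[THEN iffD1, OF Z] by blast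
  have AEc: "AE y in lebesgue. y \<in> S \<longrightarrow> continuous_on UNIV (G y)"
    using cont S by (simp add: AE_restrict_space_iff)
  then obtain N where N: "N \<in> null_sets lebesgue" "{y. \<not> (y \<in> S \<longrightarrow> continuous_on UNIV (G y))} \<subseteq> N"
    unfolding eventually_ae_filter by auto
  have Ns: "N \<in> sets lebesgue" using N(1) by auto
  have SN: "S - N \<in> sets lebesgue" using S Ns by blast
  have Gh: "(\<lambda>y. indicator S y *\<^sub>R G y (h n y)) \<in> borel_measurable lebesgue" for n
  proof -
    have "(\<lambda>y. indicator {y \<in> S. h n y = z} y *\<^sub>R G y z) \<in> borel_measurable lebesgue" for z
    proof -
      have "h n -` {z} \<inter> space (lebesgue_on S) \<in> sets (lebesgue_on S)" by (rule measurable_sets[OF h(1)]) simp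
      then have "{y \<in> S. h n y = z} \<in> sets lebesgue"
        using S by (auto simp: sets_restrict_space_iff vimage_def Int_def conj_commute space_restrict_space)
      moreover have "(\<lambda>y. indicator S y *\<^sub>R G y z) \<in> borel_measurable lebesgue"
        using meas[of z] S by (simp add: borel_measurable_restrict_space_iff)
      ultimately have "(\<lambda>y. indicator {y \<in> S. h n y = z} y *\<^sub>R (indicator S y *\<^sub>R G y z)) \<in> borel_measurable lebesgue"
        by (rule borel_measurable_scaleR[OF borel_measurable_indicator])
      then show ?thesis
        by (rule measurable_cong[THEN iffD1, rotated]) (auto simp: indicator_def)
    qed
    then have "(\<lambda>y. \<Sum>z\<in>range (h n). indicator {y \<in> S. h n y = z} y *\<^sub>R G y z) \<in> borel_measurable lebesgue"
      by (intro borel_measurable_sum)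
    moreover have "(\<Sum>z\<in>range (h n). indicator {y \<in> S. h n y = z} y *\<^sub>R G y z) = indicator S y *\<^sub>R G y (h n y)" for y
    proof -
      have "(\<Sum>z\<in>range (h n). indicator {y \<in> S. h n y = z} y *\<^sub>R G y z) = (\<Sum>z\<in>range (h n). if h n y = z then indicator S y *\<^sub>R G y z else 0)"
        by (intro sum.cong) (auto simp: indicator_def)
      then show ?thesis using h(2)[of n] by simp
    qed
    ultimately show ?thesis by simp
  qed
  have "(\<lambda>y. indicator (S - N) y *\<^sub>R G y (Z y)) \<in> borel_measurable lebesgue"
  proof (rule borel_measurable_LIMSEQ_metric)
    show "(\<lambda>y. indicator (S - N) y *\<^sub>R (indicator S y *\<^sub>R G y (h n y))) \<in> borel_measurable lebesgue" for n
      by (rule borel_measurable_scaleR[OF borel_measurable_indicator[OF SN] Gh])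
    fix y
    show "(\<lambda>n. indicator (S - N) y *\<^sub>R (indicator S y *\<^sub>R G y (h n y))) \<longlonglongrightarrow> indicator (S - N) y *\<^sub>R G y (Z y)"
    proof (cases "y \<in> S - N")
      case True
      then have "continuous_on UNIV (G y)" using N(2) by blast
      then have "isCont (G y) (Z y)" by (simp add: continuous_on_eq_continuous_at)
      then have "(\<lambda>n. G y (h n y)) \<longlonglongrightarrow> G y (Z y)" by (rule isCont_tendsto_compose[OF _ h(3)])
      then show ?thesis using True by simp
    qed simp
  qed
  moreover have "AE y in lebesgue. indicator (S - N) y *\<^sub>R G y (Z y) = indicator S y *\<^sub>R G y (Z y)"
    using AE_not_in[OF N(1)] by eventually_elim (simp add: indicator_def)
  ultimately have "(\<lambda>y. indicator S y *\<^sub>R G y (Z y)) \<in> borel_measurable lebesgue"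
    by (rule borel_measurable_AE)
  then show ?thesis using S by (simp add: borel_measurable_restrict_space_iff)
qed

section \<open>Measurability of the flux, admissible test functions and the vanishing of the
  flux\<close>

context riem_volume
begin

text \<open>Measurable sets are defined through their images in all charts. The component in chart c
  is therefore examined in every chart d, where the transition formula writes it with continuous
  coefficients in terms of the component in d.\<close>

lemma chart_measurableI:
  assumes V: "\<And>x. V x \<in> tangent_space \<A> x"
    and m: "\<And>d. d \<in> \<A> \<Longrightarrow> (\<lambda>y. V (chart_inv d y) d) \<in> borel_measurable (lebesgue_on (chart_map d ` dom_of d))"
  shows "chart_measurable UNIV V"
  unfolding chart_measurable_def
proof (intro conjI ballI V)
  fix c assume c: "c \<in> \<A>"
  have sc: "UNIV \<inter> dom_of c \<in> sets vol" using dom_sets_vol[OF c] by simp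
  show "(\<lambda>x. V x c) \<in> borel_measurable (restrict_space vol (UNIV \<inter> dom_of c))"
  proof (rule measurableI)
    fix B :: "(real^'n) set" assume B: "B \<in> sets borel"
    have "{x \<in> dom_of c. V x c \<in> B} \<in> sets vol" unfolding sets_vol
    proof (intro CollectI ballI)
      fix d assume d: "d \<in> \<A>"
      let ?O = "chart_map d ` (dom_of c \<inter> dom_of d)"
      have oO: "open ?O" by (rule open_chart_image[OF d open_dom[OF c]])
      have OW: "?O \<subseteq> chart_map d ` dom_of d" by blast
      have OL: "?O \<in> sets lebesgue" by (rule open_lebesgue[OF oO])
      have m': "(\<lambda>y. V (chart_inv d y) d) \<in> borel_measurable (lebesgue_on ?O)"
      proof -
        have "(\<lambda>y. V (chart_inv d y) d) \<in> borel_measurable (restrict_space (lebesgue_on (chart_map d ` dom_of d)) ?O)"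
          by (rule measurable_restrict_space1[OF m[OF d]])
        moreover have "sets (restrict_space (lebesgue_on (chart_map d ` dom_of d)) ?O) = sets (lebesgue_on ?O)"
          using OW by (simp add: sets_restrict_restrict_space Int_absorb1)
        ultimately show ?thesis using measurable_cong_sets by blast
      qed
      have mi: "(\<lambda>y. V (chart_inv d y) d $ i) \<in> borel_measurable (lebesgue_on ?O)" for i
        by (rule measurable_compose[OF m']) (intro borel_measurable_continuous_onI continuous_intros)
      have ti: "(\<lambda>y. transition_deriv d c (chart_inv d y) (axis i 1)) \<in> borel_measurable (lebesgue_on ?O)" for i
        by (rule continuous_imp_measurable_on_sets_lebesgue[OF transition(2)[OF d c] OL])
      have eq: "V (chart_inv d y) c = (\<Sum>i\<in>UNIV. V (chart_inv d y) d $ i *\<^sub>R transition_deriv d c (chart_inv d y) (axis i 1))"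
        if y: "y \<in> ?O" for y
      proof -
        let ?x = "chart_inv d y"
        have x: "?x \<in> dom_of c" "?x \<in> dom_of d" using y d by auto
        have l: "linear (transition_deriv d c ?x)" by (rule transition_linear[OF d c x(2,1)])
        have "V ?x c = transition_deriv d c ?x (V ?x d)" by (rule tangent_coord_transition[OF V d c x(2,1)])
        also note linear_axis_expansion[OF l]
        finally show ?thesis .
      qed
      have "(\<lambda>y. \<Sum>i\<in>UNIV. V (chart_inv d y) d $ i *\<^sub>R transition_deriv d c (chart_inv d y) (axis i 1)) \<in> borel_measurable (lebesgue_on ?O)"
        by (intro borel_measurable_sum borel_measurable_scaleR mi ti)
      then have "(\<lambda>y. V (chart_inv d y) c) \<in> borel_measurable (lebesgue_on ?O)"
        by (rule measurable_cong[THEN iffD2, rotated]) (simp add: eq space_restrict_space)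
      then have "(\<lambda>y. V (chart_inv d y) c) -` B \<inter> space (lebesgue_on ?O) \<in> sets (lebesgue_on ?O)"
        using B by (rule measurable_sets)
      then have "(\<lambda>y. V (chart_inv d y) c) -` B \<inter> ?O \<in> sets lebesgue"
        using OL by (simp add: sets_restrict_space_iff space_restrict_space)
      moreover have "chart_map d ` ({x \<in> dom_of c. V x c \<in> B} \<inter> dom_of d) = (\<lambda>y. V (chart_inv d y) c) -` B \<inter> ?O"
        unfolding chart_image_eq[OF d] by auto
      ultimately show "chart_map d ` ({x \<in> dom_of c. V x c \<in> B} \<inter> dom_of d) \<in> sets lebesgue" by simp
    qed
    moreover have "(\<lambda>x. V x c) -` B \<inter> space (restrict_space vol (UNIV \<inter> dom_of c)) = {x \<in> dom_of c. V x c \<in> B}"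
      by (auto simp: space_restrict_space space_vol)
    ultimately show "(\<lambda>x. V x c) -` B \<inter> space (restrict_space vol (UNIV \<inter> dom_of c)) \<in> sets (restrict_space vol (UNIV \<inter> dom_of c))"
      using sc by (simp add: sets_restrict_space_iff)
  qed simp
qed

text \<open>In a chart the field is the local representation of the operator at the pair of u and
  the coordinates of X, to which the Caratheodory conditions apply.\<close>

lemma chart_measurable_operator:
  assumes A: "caratheodory_operator \<A> A" and u: "u \<in> borel_measurable vol" and X: "chart_measurable UNIV X"
  shows "chart_measurable UNIV (\<lambda>x. A x (u x) (X x))"
proof (rule chart_measurableI)
  have tX: "X x \<in> tangent_space \<A> x" for x by (rule chart_measurableD(1)[OF X UNIV_I])
  show "A x (u x) (X x) \<in> tangent_space \<A> x" for x
    using A tX[of x] unfolding caratheodory_operator_def by blast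
  fix d assume d: "d \<in> \<A>"
  let ?W = "chart_map d ` dom_of d"
  have um: "(\<lambda>y. u (chart_inv d y)) \<in> borel_measurable (lebesgue_on ?W)"
    by (rule measurable_compose[OF measurable_chart_inv[OF d] measurable_restrict_space1[OF u]])
  have "(\<lambda>x. X x d) \<in> borel_measurable (restrict_space vol (dom_of d))"
    using chart_measurableD(2)[OF X d] by simp
  then have xm: "(\<lambda>y. X (chart_inv d y) d) \<in> borel_measurable (lebesgue_on ?W)"
    by (rule measurable_compose[OF measurable_chart_inv[OF d]])
  let ?G = "\<lambda>y. \<lambda>(s, v). local_rep \<A> A d y s v"
  note Ad = A[unfolded caratheodory_operator_def, THEN conjunct2, THEN bspec, OF d]
  have "(\<lambda>y. ?G y (u (chart_inv d y), X (chart_inv d y) d)) \<in> borel_measurable (lebesgue_on ?W)"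
  proof (rule caratheodory_measurable[OF range_lebesgue[OF d] Ad[THEN conjunct1]])
    show "(\<lambda>y. ?G y z) \<in> borel_measurable (lebesgue_on ?W)" for z
      using Ad[THEN conjunct2, THEN spec, THEN spec, of "fst z" "snd z"] by (simp add: case_prod_beta)
    show "(\<lambda>y. (u (chart_inv d y), X (chart_inv d y) d)) \<in> borel_measurable (lebesgue_on ?W)"
      by (intro borel_measurable_Pair um xm)
  qed
  then show "(\<lambda>y. A (chart_inv d y) (u (chart_inv d y)) (X (chart_inv d y)) d) \<in> borel_measurable (lebesgue_on ?W)"
  proof (rule measurable_cong[THEN iffD1, rotated])
    fix y assume "y \<in> space (lebesgue_on ?W)"
    then have x: "chart_inv d y \<in> dom_of d" using chart_inv_dom[OF d] by (simp add: space_restrict_space)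
    have "tvec_of \<A> d (chart_inv d y) (X (chart_inv d y) d) = X (chart_inv d y)"
      by (rule tangent_eq_tvec_of[OF d x tX])
    then show "?G y (u (chart_inv d y), X (chart_inv d y) d) = A (chart_inv d y) (u (chart_inv d y)) (X (chart_inv d y)) d"
      by (simp add: local_rep_def)
  qed
qed

text \<open>Twice the larger of the two summands dominates f, and the p-th powers of both are
  integrable over the ball.\<close>

lemma Lp_on_dominated:
  assumes p: "p > 0" and \<Omega>: "open \<Omega>" "\<Omega> \<subseteq> RM.mball x0 R" and f: "f \<in> borel_measurable vol"
    and a: "a \<ge> 0" "b \<ge> 0" and bd: "\<And>x. \<bar>f x\<bar> \<le> a * \<bar>v x\<bar> + b * \<bar>w x\<bar>"
    and v: "v \<in> Lp_on vol p (RM.mball x0 R)" and w: "w \<in> Lp_on vol p (RM.mball x0 R)"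
  shows "f \<in> Lp_on vol p \<Omega>"
proof -
  let ?B = "RM.mball x0 R"
  have B: "?B \<in> sets vol" "\<Omega> \<in> sets vol" using open_sets_vol open_mball \<Omega>(1) by auto
  have i: "integrable vol (\<lambda>x. indicator ?B x *\<^sub>R (\<bar>v x\<bar> powr p))" "integrable vol (\<lambda>x. indicator ?B x *\<^sub>R (\<bar>w x\<bar> powr p))"
    using v w B by (auto simp: Lp_on_def integrable_restrict_space)
  have pw: "\<bar>f x\<bar> powr p \<le> (2 * a) powr p * \<bar>v x\<bar> powr p + (2 * b) powr p * \<bar>w x\<bar> powr p" for x
  proof (cases "a * \<bar>v x\<bar> \<le> b * \<bar>w x\<bar>")
    case True
    then have "\<bar>f x\<bar> powr p \<le> ((2 * b) * \<bar>w x\<bar>) powr p" using bd[of x] p by (intro powr_mono2) auto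
    then show ?thesis using a by (simp add: powr_mult add_increasing)
  next
    case False
    then have "\<bar>f x\<bar> powr p \<le> ((2 * a) * \<bar>v x\<bar>) powr p" using bd[of x] p by (intro powr_mono2) auto
    then show ?thesis using a by (simp add: powr_mult add_increasing2)
  qed
  have "integrable vol (\<lambda>x. indicator \<Omega> x *\<^sub>R (\<bar>f x\<bar> powr p))"
  proof (rule Bochner_Integration.integrable_bound)
    show "integrable vol (\<lambda>x. (2 * a) powr p * (indicator ?B x *\<^sub>R (\<bar>v x\<bar> powr p)) + (2 * b) powr p * (indicator ?B x *\<^sub>R (\<bar>w x\<bar> powr p)))"
      using i by (intro Bochner_Integration.integrable_add integrable_mult_right)
    show "(\<lambda>x. indicator \<Omega> x *\<^sub>R (\<bar>f x\<bar> powr p)) \<in> borel_measurable vol"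
      using f B by measurable
    show "AE x in vol. norm (indicator \<Omega> x *\<^sub>R (\<bar>f x\<bar> powr p))
      \<le> norm ((2 * a) powr p * (indicator ?B x *\<^sub>R (\<bar>v x\<bar> powr p)) + (2 * b) powr p * (indicator ?B x *\<^sub>R (\<bar>w x\<bar> powr p)))"
    proof (rule AE_I2)
      fix x show "norm (indicator \<Omega> x *\<^sub>R (\<bar>f x\<bar> powr p))
        \<le> norm ((2 * a) powr p * (indicator ?B x *\<^sub>R (\<bar>v x\<bar> powr p)) + (2 * b) powr p * (indicator ?B x *\<^sub>R (\<bar>w x\<bar> powr p)))"
      proof (cases "x \<in> \<Omega>")
        case True
        then have "x \<in> ?B" using \<Omega>(2) by blast
        then have "indicator ?B x = (1::real)" by (rule indicator_simps(1))
        then show ?thesis using pw[of x] True by simp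
      qed simp
    qed
  qed
  then show ?thesis using f B by (simp add: Lp_on_def integrable_restrict_space measurable_restrict_space1)
qed

lemma Lp_on_zero: "(\<lambda>_. 0) \<in> Lp_on vol p \<Omega>" by (simp add: Lp_on_def)

lemma W1p_locI:
  assumes p: "p > 0" and \<phi>: "weak_gradient \<A> g vol UNIV \<phi> Z" "\<phi> \<in> borel_measurable vol"
    and u: "u \<in> W1p_loc \<A> g vol p" and a: "a \<ge> 0" "b \<ge> 0"
    and bd: "\<And>x. \<bar>\<phi> x\<bar> \<le> a * \<bar>u x\<bar>" "\<And>x. tnorm g x (Z x) \<le> a * tnorm g x (grad \<A> g vol u x) + b * \<bar>u x\<bar>"
  shows "\<phi> \<in> W1p_loc \<A> g vol p"
  unfolding W1p_loc_def W1p_def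
proof (intro CollectI allI impI conjI exI[of _ Z])
  fix \<Omega> :: "'a set" assume "open \<Omega> \<and> compact (closure \<Omega>)"
  then have \<Omega>: "open \<Omega>" "compact (closure \<Omega>)" by auto
  fix x0 :: 'a
  \<comment> \<open>Any base point will do: the compact closure lies in some ball around it.\<close>
  obtain n :: nat where "closure \<Omega> \<subseteq> RM.mball undefined (real n)" by (rule compact_in_mball[OF \<Omega>(2)])
  then have sub: "\<Omega> \<subseteq> RM.mball undefined (real n)" using closure_subset by blast
  note W = W1p_loc_weak_gradient(2,3)[OF u, of undefined "real n"]
  show "\<phi> \<in> Lp_on vol p \<Omega>"
    using bd(1) by (intro Lp_on_dominated[OF p \<Omega>(1) sub \<phi>(2) a(1) order_refl[of 0] _ W(2) Lp_on_zero]) simp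
  show "weak_gradient \<A> g vol \<Omega> \<phi> Z" by (rule weak_gradient_subset[OF \<phi>(1) \<Omega>(1)]) simp
  have Zm: "chart_measurable UNIV Z" by (rule weak_gradientD(1)[OF \<phi>(1)])
  have Zt: "Z x \<in> tangent_space \<A> x" for x by (rule chart_measurableD(1)[OF Zm UNIV_I])
  show "(\<lambda>x. tnorm g x (Z x)) \<in> Lp_on vol p \<Omega>"
  proof (rule Lp_on_dominated[OF p \<Omega>(1) sub _ a _ W])
    show "(\<lambda>x. tnorm g x (Z x)) \<in> borel_measurable vol"
      by (rule measurable_restrict_UNIV[OF measurable_tnorm[OF open_UNIV Zm]])
    fix x
    have "a * tnorm g x (grad \<A> g vol u x) \<le> a * \<bar>tnorm g x (grad \<A> g vol u x)\<bar>" using a by (intro mult_left_mono) auto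
    then show "\<bar>tnorm g x (Z x)\<bar> \<le> a * \<bar>tnorm g x (grad \<A> g vol u x)\<bar> + b * \<bar>u x\<bar>"
      using bd(2)[of x] tnorm_nonneg[OF Zt, of x] by linarith
  qed
qed

text \<open>The product \<Psi> h(u) is an admissible test function: \<Psi> vanishes off a compact
  ball, and h and h' vanish for t \<le> 0, so value and gradient vanish where u \<le> 0. The
  representative chosen by \<open>grad\<close> agrees with the product formula almost
  everywhere.\<close>

lemma flux_inequality:
  assumes p: "p > 0" and A: "caratheodory_operator \<A> A" and u: "u \<in> W1p_loc \<A> g vol p" and wn: "weakly_nonneg_on \<A> g vol p A u {x. u x > 0}"
    and h: "\<And>t. (h has_real_derivative h' t) (at t)" "continuous_on UNIV h'" "\<And>t. \<bar>h' t\<bar> \<le> B"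
      "\<And>t. 0 \<le> h t" "\<And>t. t \<le> 0 \<Longrightarrow> h t = 0 \<and> h' t = 0"
    and \<Psi>: "has_gradient \<Psi> Y" "\<And>x. 0 \<le> \<Psi> x" "\<And>x. \<Psi> x \<le> 1" "\<And>x. tnorm g x (Y x) \<le> L"
      "\<And>x. rdist x0 x > \<rho> \<Longrightarrow> \<Psi> x = 0"
  shows "(LINT x|vol. g x (A x (u x) (grad \<A> g vol u x))
      (\<lambda>c. (\<Psi> x * h' (u x)) *\<^sub>R grad \<A> g vol u x c + h (u x) *\<^sub>R Y x c)) \<le> 0"
proof -
  let ?X = "grad \<A> g vol u" and ?\<phi> = "\<lambda>x. \<Psi> x * h (u x)"
  let ?Z = "\<lambda>x c. (\<Psi> x * h' (u x)) *\<^sub>R ?X x c + h (u x) *\<^sub>R Y x c"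
  note X = W1p_loc_weak_gradient(1)[OF u]
  have h00: "h 0 = 0" using h(5)[of 0] by simp
  have \<Psi>1: "\<bar>\<Psi> x\<bar> \<le> 1" for x using \<Psi>(2,3)[of x] by simp
  note P = weak_gradient_product_chain[OF X \<Psi>(1) \<Psi>1 \<Psi>(4) h(1,2,3) h00]
  have B0: "B \<ge> 0" using h(3)[of 0] by linarith
  have "Y undefined \<in> tangent_space \<A> undefined"
    using \<Psi>(1) by (intro chart_measurableD(1)[of UNIV]) (simp_all add: has_gradient_def)
  then have L0: "L \<ge> 0" using tnorm_nonneg[of "Y undefined" undefined] \<Psi>(4)[of undefined] by linarith
  have loc: "?\<phi> \<in> W1p_loc \<A> g vol p"
    by (rule W1p_locI[OF p P(1) P(4) u _ _ P(2,3)]) (use B0 L0 in auto)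
  have gr: "AE x in vol. grad \<A> g vol ?\<phi> x = ?Z x"
    using weak_gradient_unique[OF open_UNIV W1p_loc_weak_gradient(1)[OF loc] P(1)] by simp
  have "?\<phi> \<in> D_plus \<A> g vol p {x. u x > 0}" unfolding D_plus_def W1p_c_def
  proof (intro CollectI conjI loc exI[of _ "RM.mcball x0 \<rho>"] Hopf_Rinow)
    show "AE x in vol. x \<notin> RM.mcball x0 \<rho> \<longrightarrow> ?\<phi> x = 0" using \<Psi>(5) by (intro AE_I2) auto
    show "AE x in vol. 0 \<le> ?\<phi> x" using \<Psi>(2) h(4) by (intro AE_I2) simp
    show "AE x in vol. x \<notin> {x. u x > 0} \<longrightarrow> ?\<phi> x = 0 \<and> grad \<A> g vol ?\<phi> x = zero_tvec"
      using gr
    proof eventually_elim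
      case (elim x)
      show ?case
      proof
        assume "x \<notin> {x. u x > 0}"
        then have "h (u x) = 0" "h' (u x) = 0" using h(5)[of "u x"] by auto
        then show "?\<phi> x = 0 \<and> grad \<A> g vol ?\<phi> x = zero_tvec" unfolding elim by (simp add: zero_tvec_def)
      qed
    qed
  qed
  with wn have "- (LINT x|vol. g x (A x (u x) (?X x)) (grad \<A> g vol ?\<phi> x)) \<ge> 0"
    unfolding weakly_nonneg_on_def by blast
  moreover have "(LINT x|vol. g x (A x (u x) (?X x)) (grad \<A> g vol ?\<phi> x)) = (LINT x|vol. g x (A x (u x) (?X x)) (?Z x))"
  proof (rule integral_cong_AE)
    have um: "u \<in> borel_measurable vol" using weak_gradientD(2)[OF X] by (intro measurable_locally_integrable) auto
    note Vm = chart_measurable_operator[OF A um weak_gradientD(1)[OF X]]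
    show "(\<lambda>x. g x (A x (u x) (?X x)) (grad \<A> g vol ?\<phi> x)) \<in> borel_measurable vol"
      by (rule measurable_restrict_UNIV[OF measurable_g[OF open_UNIV Vm weak_gradientD(1)[OF W1p_loc_weak_gradient(1)[OF loc]]]])
    show "(\<lambda>x. g x (A x (u x) (?X x)) (?Z x)) \<in> borel_measurable vol"
      by (rule measurable_restrict_UNIV[OF measurable_g[OF open_UNIV Vm weak_gradientD(1)[OF P(1)]]])
  qed (use gr in eventually_elim, simp)
  ultimately show ?thesis by simp
qed

text \<open>The growth hypothesis enters through a single integral, that of u_+^q over the ball of
  radius 2R + 2; the rest is a pointwise estimate of the term that contains the gradient of the
  cutoff.\<close>

lemma flux_vanishes:
  assumes p: "1 < p" and q: "q > p - 1" and A: "caratheodory_operator \<A> A" "weakly_coercive \<A> g p A"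
    and u: "u \<in> W1p_loc \<A> g vol p" and wn: "weakly_nonneg_on \<A> g vol p A u {x. u x > 0}"
    and growth: "\<And>R. R \<ge> R1 \<Longrightarrow> (\<integral>\<^sup>+x\<in>RM.mball x0 R. ennreal (max (u x) 0 powr q) \<partial>vol) \<le> ennreal (C * R powr p)"
    and C: "C \<ge> 0"
  shows "AE x in vol. u x > 0 \<longrightarrow> A x (u x) (grad \<A> g vol u x) = zero_tvec"
proof -
  define X where "X = grad \<A> g vol u"
  define V where "V x = A x (u x) (X x)" for x
  define F where "F x = g x (V x) (X x)" for x
  note wX = W1p_loc_weak_gradient(1)[OF u, folded X_def]
  have Xm: "chart_measurable UNIV X" by (rule weak_gradientD(1)[OF wX])
  have tX: "X x \<in> tangent_space \<A> x" for x by (rule chart_measurableD(1)[OF Xm UNIV_I])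
  have um[measurable]: "u \<in> borel_measurable vol" using weak_gradientD(2)[OF wX] by (intro measurable_locally_integrable) auto
  have Vm: "chart_measurable UNIV V" unfolding V_def by (rule chart_measurable_operator[OF A(1) um Xm])
  have tV: "V x \<in> tangent_space \<A> x" for x by (rule chart_measurableD(1)[OF Vm UNIV_I])
  obtain k where k: "k > 0" "\<And>x. F x \<ge> 0" "\<And>x. tnorm g x (V x) \<le> k * F x powr (1 - 1/p)"
  proof -
    have e: "(p - 1) / p = 1 - 1/p" using p by (simp add: field_simps)
    show ?thesis using A(2) tX that unfolding weakly_coercive_def e F_def V_def by blast
  qed
  have Fm[measurable]: "F \<in> borel_measurable vol"
    unfolding F_def by (rule measurable_restrict_UNIV[OF measurable_g[OF open_UNIV Vm Xm]])
  have FX: "F x \<le> k powr p * tnorm g x (X x) powr p" for x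
  proof (cases "F x = 0")
    case False
    then have F0: "F x > 0" using k(2)[of x] by simp
    have "F x powr (1/p) * F x powr (1 - 1/p) = F x" using F0 by (simp add: powr_add[symmetric])
    also have "F x \<le> tnorm g x (V x) * tnorm g x (X x)"
      using tangent_Cauchy_Schwarz[OF tV tX, of x] unfolding F_def by linarith
    also have "\<dots> \<le> (k * F x powr (1 - 1/p)) * tnorm g x (X x)" by (rule mult_right_mono[OF k(3) tnorm_nonneg[OF tX]])
    finally have "F x powr (1/p) * F x powr (1 - 1/p) \<le> (k * tnorm g x (X x)) * F x powr (1 - 1/p)" by (simp add: mult_ac)
    then have "F x powr (1/p) \<le> k * tnorm g x (X x)" using F0 by simp
    then have "(F x powr (1/p)) powr p \<le> (k * tnorm g x (X x)) powr p" using p by (intro powr_mono2) auto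
    then show ?thesis using F0 p k(1) tnorm_nonneg[OF tX, of x] by (simp add: powr_powr powr_mult)
  qed simp
  obtain h h' :: "real \<Rightarrow> real" and B c where h:
    "\<And>t. (h has_real_derivative h' t) (at t)" "continuous_on UNIV h'" "\<And>t. \<bar>h' t\<bar> \<le> B"
    "\<And>t. 0 \<le> h t" "\<And>t. t \<le> 0 \<Longrightarrow> h t = 0 \<and> h' t = 0" and h'pos: "\<And>t. t > 0 \<Longrightarrow> h' t > 0" and c: "c > 0"
    and hc: "\<And>t. h t \<le> c * (max t 0 powr q) powr (1/p) * h' t powr (1 - 1/p)"
    using test_profile_exists[OF p q] by metis
  have h'0: "h' t \<ge> 0" for t using h'pos[of t] h(5)[of t] by (cases "t > 0") auto
  have hm[measurable]: "h \<in> borel_measurable borel" "h' \<in> borel_measurable borel"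
    using h(1,2) by (auto intro!: borel_measurable_continuous_onI continuous_at_imp_continuous_on DERIV_isCont)
  obtain j :: nat where "p / 2 \<le> real j" using real_arch_simple by blast
  then have j: "p \<le> 2 * real j" by simp
  define w where "w x = h' (u x) * F x" for x
  have w0: "w x \<ge> 0" for x by (simp add: w_def h'0 k(2))
  have wm[measurable]: "w \<in> borel_measurable vol" unfolding w_def by measurable
  have rm[measurable]: "(\<lambda>x. rdist x0 x) \<in> borel_measurable vol"
    by (intro measurable_vol_borel borel_measurable_continuous_onI continuous_rdist)
  \<comment> \<open>The product of the constants of coercivity, of the profile h and of the cutoff
    gradient.\<close>
  define M where "M = k * c * (12 * real j)"
  have M0: "M > 0" using k(1) c p j by (simp add: M_def)
  \<comment> \<open>The factor 4^p comes from 2R + 2 \<le> 4R. The summand M covers the annulus term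
    and keeps K positive even for C = 0.\<close>
  define K where "K = M * C * 4 powr p + M"
  have K: "K > 0" "M \<le> K" "M * C * 4 powr p \<le> K" using M0 C by (auto simp: K_def add_nonneg_pos)
  define s where "s x = max (u x) 0 powr q" for x
  have s0: "s x \<ge> 0" for x by (simp add: s_def)
  have sm[measurable]: "s \<in> borel_measurable vol" unfolding s_def by measurable
  have "AE x in vol. w x = 0"
  proof (rule absorption[OF p K(1) wm w0 rm])
    fix R assume R: "R \<ge> max 1 R1"
    then have R0: "R > 0" "R \<ge> 1" "R \<ge> R1" by auto
    \<comment> \<open>An open ball that contains the support of the cutoff, which reaches at most to
      distance 2R + 1.\<close>
    let ?B = "RM.mball x0 (2 * R + 2)"
    have Bm[measurable]: "?B \<in> sets vol" by (rule open_sets_vol[OF open_mball])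
    obtain \<Psi> Y where \<Psi>: "has_gradient \<Psi> Y" "\<And>x. 0 \<le> \<Psi> x" "\<And>x. \<Psi> x \<le> 1"
      "\<And>x. rdist x0 x < R - 1 \<Longrightarrow> \<Psi> x = 1" "\<And>x. rdist x0 x < R - 1 \<Longrightarrow> tnorm g x (Y x) \<le> 0"
      "\<And>x. rdist x0 x > 2 * R + 1 \<Longrightarrow> \<Psi> x = 0"
      "\<And>x. tnorm g x (Y x) \<le> 12 * real j / R * \<Psi> x powr ((p - 1) / p)"
      by (rule cutoff_exists[OF p j R0(1), of x0]) (rule that)
    have Ym: "chart_measurable UNIV Y" using \<Psi>(1) by (simp add: has_gradient_def)
    have tY: "Y x \<in> tangent_space \<A> x" for x by (rule chart_measurableD(1)[OF Ym UNIV_I])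
    have \<Psi>m[measurable]: "\<Psi> \<in> borel_measurable vol"
      using \<Psi>(1) by (intro measurable_vol_borel borel_measurable_continuous_onI) (simp add: has_gradient_def)
    have YL: "tnorm g x (Y x) \<le> 12 * real j / R" for x
    proof -
      have "\<Psi> x powr ((p - 1) / p) \<le> 1 powr ((p - 1) / p)" using \<Psi>(2,3) p by (intro powr_mono2) auto
      then have "12 * real j / R * \<Psi> x powr ((p - 1) / p) \<le> 12 * real j / R * 1" using R0 by (intro mult_left_mono) auto
      then show ?thesis using \<Psi>(7)[of x] by simp
    qed
    define z where "z x = \<Psi> x * w x" for x
    define T where "T x = h (u x) * g x (V x) (Y x)" for x
    have z0: "z x \<ge> 0" for x by (simp add: z_def \<Psi>(2) w0)
    have zm[measurable]: "z \<in> borel_measurable vol" unfolding z_def by measurable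
    have Tm[measurable]: "T \<in> borel_measurable vol"
      unfolding T_def using measurable_restrict_UNIV[OF measurable_g[OF open_UNIV Vm Ym]] by measurable
    have "integrable vol (\<lambda>x. indicator ?B x *\<^sub>R (\<bar>tnorm g x (X x)\<bar> powr p))"
      using W1p_loc_weak_gradient(2)[OF u, of x0 "2 * R + 2"] Bm by (simp add: Lp_on_def integrable_restrict_space X_def)
    then have Xi: "integrable vol (\<lambda>x. (B * k powr p) * (indicator ?B x *\<^sub>R (\<bar>tnorm g x (X x)\<bar> powr p)))"
      by (rule integrable_mult_right)
    have zi: "integrable vol z"
    proof (rule Bochner_Integration.integrable_bound[OF Xi zm], rule AE_I2)
      fix x
      show "norm (z x) \<le> norm ((B * k powr p) * (indicator ?B x *\<^sub>R (\<bar>tnorm g x (X x)\<bar> powr p)))"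
      proof (cases "rdist x0 x > 2 * R + 1")
        case True
        then show ?thesis by (simp add: z_def \<Psi>(6))
      next
        case False
        then have xB: "indicator ?B x = (1::real)" by (intro indicator_simps(1)) simp
        have "z x \<le> 1 * (B * F x)" unfolding z_def w_def
          using \<Psi>(2,3)[of x] h(3)[of "u x"] h'0[of "u x"] k(2)[of x] by (intro mult_mono) auto
        also have "\<dots> \<le> B * (k powr p * tnorm g x (X x) powr p)"
          using mult_left_mono[OF FX[of x], of B] h(3)[of 0] by simp
        finally show ?thesis unfolding xB using z0[of x] tnorm_nonneg[OF tX, of x] by (simp add: mult.assoc)
      qed
    qed
    have nns: "(\<integral>\<^sup>+x. ennreal (indicator ?B x * s x) \<partial>vol) \<le> ennreal (C * (2 * R + 2) powr p)"
    proof -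
      have "(\<integral>\<^sup>+x. ennreal (indicator ?B x * s x) \<partial>vol) = (\<integral>\<^sup>+x\<in>?B. ennreal (s x) \<partial>vol)"
        by (intro nn_integral_cong) (auto simp: indicator_def)
      then show ?thesis using growth[of "2 * R + 2"] R0 by (simp add: s_def)
    qed
    have si: "integrable vol (\<lambda>x. indicator ?B x * s x)"
      using nns s0 by (intro integrableI_nonneg) (auto intro: le_less_trans)
    have sI: "(LINT x|vol. indicator ?B x * s x) \<le> C * (4 * R) powr p"
    proof -
      have "ennreal (LINT x|vol. indicator ?B x * s x) \<le> ennreal (C * (2 * R + 2) powr p)"
        using nns s0 by (subst nn_integral_eq_integral[OF si, symmetric]) auto
      then have "(LINT x|vol. indicator ?B x * s x) \<le> C * (2 * R + 2) powr p" using C by (simp add: ennreal_le_iff)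
      also have "\<dots> \<le> C * (4 * R) powr p" using C R0 p by (intro mult_left_mono powr_mono2) auto
      finally show ?thesis .
    qed
    let ?I = "\<lambda>x. indicator {x. rdist x0 x \<ge> R - 1} x :: real"
    \<comment> \<open>The powers 1 - 1/p of F from coercivity, of h'(u) from the profile and of
      \<Psi> from the cutoff combine to that of z = \<Psi> h'(u) F. The indicator appears because
      the cutoff gradient vanishes on the inner ball.\<close>
    have Tb: "\<bar>T x\<bar> \<le> M / R * (?I x * (s x powr (1/p) * z x powr (1 - 1/p)))" for x
    proof (cases "rdist x0 x < R - 1")
      case True
      then have "tnorm g x (Y x) = 0" using \<Psi>(5)[OF True] tnorm_nonneg[OF tY, of x] by simp
      then have "\<bar>g x (V x) (Y x)\<bar> \<le> 0" using tangent_Cauchy_Schwarz[OF tV tY, of x] by simp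
      then show ?thesis using M0 R0 by (simp add: T_def)
    next
      case False
      have e: "(p - 1) / p = 1 - 1/p" using p by (simp add: field_simps)
      have "\<bar>T x\<bar> \<le> h (u x) * (tnorm g x (V x) * tnorm g x (Y x))"
        unfolding T_def abs_mult using tangent_Cauchy_Schwarz[OF tV tY, of x] h(4)[of "u x"] by (simp add: mult_left_mono)
      also have "\<dots> \<le> (c * s x powr (1/p) * h' (u x) powr (1 - 1/p)) * ((k * F x powr (1 - 1/p)) * (12 * real j / R * \<Psi> x powr (1 - 1/p)))"
        using hc[of "u x", folded s_def] k(3)[of x] \<Psi>(7)[of x, unfolded e] h(4)[of "u x"] tnorm_nonneg[OF tV, of x] tnorm_nonneg[OF tY, of x] k(1) R0 c
        by (intro mult_mono) auto
      also have "\<dots> = M / R * (s x powr (1/p) * (\<Psi> x powr (1 - 1/p) * h' (u x) powr (1 - 1/p) * F x powr (1 - 1/p)))"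
        by (simp add: M_def)
      also have "\<Psi> x powr (1 - 1/p) * h' (u x) powr (1 - 1/p) * F x powr (1 - 1/p) = z x powr (1 - 1/p)"
        using \<Psi>(2)[of x] h'0[of "u x"] k(2)[of x] by (simp add: z_def w_def powr_mult)
      finally show ?thesis using False by simp
    qed
    have Tb2: "\<bar>T x\<bar> \<le> M * \<mu> powr (p - 1) * R powr (- p) * (indicator ?B x * s x) + M / \<mu> * (?I x * z x)" if \<mu>: "\<mu> > 0" for \<mu> x
    proof (cases "rdist x0 x > 2 * R + 1")
      case True
      then have "z x = 0" by (simp add: z_def \<Psi>(6))
      then have "T x = 0" using Tb[of x] p by simp
      then show ?thesis using M0 \<mu> s0[of x] z0[of x] by simp
    next
      case False
      then have xB: "indicator ?B x = (1::real)" by (intro indicator_simps(1)) simp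
      \<comment> \<open>With this weight Young's coefficients are (\<mu>/R)^(p-1) and R/\<mu>; the
        factor M/R turns them into M \<mu>^(p-1) R^(-p) and M/\<mu>.\<close>
      define l where "l = (\<mu> / R) powr p"
      have l: "l > 0" "l powr (1 - 1/p) = (\<mu> / R) powr (p - 1)" "l powr (- (1/p)) = R / \<mu>"
        using \<mu> R0 p by (simp_all add: l_def powr_powr right_diff_distrib powr_minus powr_one)
      have "M / R * (?I x * (s x powr (1/p) * z x powr (1 - 1/p))) \<le> M / R * (?I x * (l powr (1 - 1/p) * s x + l powr (- (1/p)) * z x))"
        using M0 R0 by (intro mult_left_mono weighted_young[OF p s0 z0 l(1)]) auto
      also have "\<dots> = M / R * (\<mu> / R) powr (p - 1) * (?I x * s x) + M / \<mu> * (?I x * z x)"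
        unfolding l(2,3) using R0 by (simp add: algebra_simps)
      also have "M / R * (\<mu> / R) powr (p - 1) = M * \<mu> powr (p - 1) * R powr (- p)"
      proof -
        have "R powr (- p) = R powr (- 1 + - (p - 1))" by simp
        also have "\<dots> = R powr (- 1) * R powr (- (p - 1))" by (rule powr_add)
        also have "\<dots> = 1 / R * (1 / R powr (p - 1))" using R0 by (simp only: powr_minus_divide powr_one)
        finally show ?thesis using \<mu> R0 by (simp add: powr_divide)
      qed
      also have "M * \<mu> powr (p - 1) * R powr (- p) * (?I x * s x) \<le> M * \<mu> powr (p - 1) * R powr (- p) * (indicator ?B x * s x)"
        unfolding xB using M0 s0[of x] by (intro mult_left_mono) (auto simp: indicator_def)
      finally show ?thesis using Tb[of x] by linarith
    qed
    have Im[measurable]: "(\<lambda>x. ?I x * z x) \<in> borel_measurable vol"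
    proof -
      have "(\<lambda>x. if rdist x0 x \<ge> R - 1 then z x else 0) \<in> borel_measurable vol" by measurable
      then show ?thesis by (rule measurable_cong[THEN iffD1, rotated]) (auto simp: indicator_def)
    qed
    have Ii: "integrable vol (\<lambda>x. ?I x * z x)"
      by (rule Bochner_Integration.integrable_bound[OF zi Im]) (auto simp: indicator_def)
    have bi: "integrable vol (\<lambda>x. M * \<mu> powr (p - 1) * R powr (- p) * (indicator ?B x * s x) + M / \<mu> * (?I x * z x))" for \<mu>
      by (intro Bochner_Integration.integrable_add integrable_mult_right si Ii)
    \<comment> \<open>Integrability of both summands is what allows the integral in the flux
      inequality to be split.\<close>
    have Ti: "integrable vol T"
      by (rule Bochner_Integration.integrable_bound[OF bi[of 1] Tm], rule AE_I2) (use Tb2[of 1] in \<open>force intro: order_trans[OF _ abs_ge_self]\<close>)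
    have "(LINT x|vol. g x (V x) (\<lambda>c. (\<Psi> x * h' (u x)) *\<^sub>R X x c + h (u x) *\<^sub>R Y x c)) \<le> 0"
      unfolding V_def X_def by (rule flux_inequality[OF _ A(1) u wn h \<Psi>(1,2,3) YL \<Psi>(6)]) (use p in auto)
    also have "(\<lambda>x. g x (V x) (\<lambda>c. (\<Psi> x * h' (u x)) *\<^sub>R X x c + h (u x) *\<^sub>R Y x c)) = (\<lambda>x. z x + T x)"
      unfolding g_lincomb_right[OF tX tY tV] by (simp add: z_def T_def w_def F_def mult.assoc)
    also have "(LINT x|vol. z x + T x) = (LINT x|vol. z x) + (LINT x|vol. T x)"
      by (rule Bochner_Integration.integral_add[OF zi Ti])
    finally have zT: "(LINT x|vol. z x) \<le> - (LINT x|vol. T x)" by simp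
    have main: "(LINT x|vol. z x) \<le> K * \<mu> powr (p - 1) + K / \<mu> * (LINT x|vol. ?I x * z x)" if \<mu>: "\<mu> > 0" for \<mu>
    proof -
      have "- (LINT x|vol. T x) = (LINT x|vol. - T x)" by simp
      also have "\<dots> \<le> (LINT x|vol. M * \<mu> powr (p - 1) * R powr (- p) * (indicator ?B x * s x) + M / \<mu> * (?I x * z x))"
      proof (rule integral_mono[OF _ bi])
        show "integrable vol (\<lambda>x. - T x)" using Ti by simp
        show "- T x \<le> M * \<mu> powr (p - 1) * R powr (- p) * (indicator ?B x * s x) + M / \<mu> * (?I x * z x)" for x
          using Tb2[OF \<mu>, of x] by linarith
      qed
      also have "\<dots> = M * \<mu> powr (p - 1) * R powr (- p) * (LINT x|vol. indicator ?B x * s x) + M / \<mu> * (LINT x|vol. ?I x * z x)"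
        by (subst Bochner_Integration.integral_add[OF integrable_mult_right[OF si] integrable_mult_right[OF Ii]]) (simp only: integral_mult_right_zero)
      finally have 1: "(LINT x|vol. z x) \<le> M * \<mu> powr (p - 1) * R powr (- p) * (LINT x|vol. indicator ?B x * s x) + M / \<mu> * (LINT x|vol. ?I x * z x)"
        using zT by linarith
      have "M * \<mu> powr (p - 1) * R powr (- p) * (LINT x|vol. indicator ?B x * s x) \<le> M * \<mu> powr (p - 1) * R powr (- p) * (C * (4 * R) powr p)"
        using M0 by (intro mult_left_mono sI) auto
      also have "\<dots> = (M * C * 4 powr p) * \<mu> powr (p - 1)"
        using R0 by (simp add: powr_mult powr_minus)
      also have "\<dots> \<le> K * \<mu> powr (p - 1)" using K(3) by (intro mult_right_mono) auto
      finally have 2: "M * \<mu> powr (p - 1) * R powr (- p) * (LINT x|vol. indicator ?B x * s x) \<le> K * \<mu> powr (p - 1)" .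
      have "(LINT x|vol. ?I x * z x) \<ge> 0" using z0 by (intro integral_nonneg_AE) auto
      then have 3: "M / \<mu> * (LINT x|vol. ?I x * z x) \<le> K / \<mu> * (LINT x|vol. ?I x * z x)"
        using K(2) \<mu> by (intro mult_right_mono divide_right_mono) auto
      show ?thesis using 1 2 3 by linarith
    qed
    show "\<exists>\<psi>. integrable vol (\<lambda>x. \<psi> x * w x) \<and> (\<forall>x. 0 \<le> \<psi> x \<and> \<psi> x \<le> 1 \<and> (rdist x0 x < R - 1 \<longrightarrow> \<psi> x = 1)) \<and>
      (\<forall>\<mu>>0. (LINT x|vol. \<psi> x * w x) \<le> K * \<mu> powr (p - 1) + K / \<mu> * (LINT x|vol. indicator {x. rdist x0 x \<ge> R - 1} x * (\<psi> x * w x)))"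
      using zi main \<Psi>(2,3,4) unfolding z_def by blast
  qed
  then show ?thesis
  proof eventually_elim
    case (elim x)
    show ?case
    proof
      assume "u x > 0"
      \<comment> \<open>Where u > 0 the factor h'(u) is positive, so F vanishes, and the upper bound
        in weak coercivity makes the flux itself vanish.\<close>
      then have "F x = 0" using elim h'pos[of "u x"] by (simp add: w_def)
      then have "tnorm g x (V x) = 0" using k(3)[of x] tnorm_nonneg[OF tV, of x] by simp
      then show "A x (u x) (grad \<A> g vol u x) = zero_tvec"
        using tnorm_eq_0[OF tV] by (simp add: V_def X_def)
    qed
  qed
qed

end

section \<open>Passage to the upper limits\<close>

lemma Limsup_ennreal_not_top:
  fixes f :: "'b \<Rightarrow> ennreal"
  assumes "Limsup G f \<noteq> \<infinity>"
  obtains C :: real where "C \<ge> 0" "\<forall>\<^sub>F x in G. f x \<le> ennreal C"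
proof -
  have "Limsup G f < top" using assms by (simp add: top.not_eq_extremum)
  then obtain r where r: "Limsup G f < r" "r < top" using dense by blast
  obtain C where C: "0 \<le> C" "r = ennreal C" using r(2) by (cases r) auto
  have "\<forall>\<^sub>F x in G. f x < r" by (rule Limsup_lessD[OF r(1)])
  then have "\<forall>\<^sub>F x in G. f x \<le> ennreal C" by eventually_elim (simp add: C)
  with C(1) show ?thesis by (rule that)
qed

text \<open>If the logarithmic quotient stayed below p eventually, then f(R) \<le> R^p eventually,
  and the first upper limit would be at most 1. An infinite value of f(R) is excluded because its
  logarithm is infinite as well.\<close>

lemma Limsup_log_ge:
  fixes f :: "real \<Rightarrow> ennreal"
  assumes L: "Limsup at_top (\<lambda>R. f R / ennreal (R powr p)) = \<infinity>"
  shows "Limsup at_top (\<lambda>R. ln_ennreal (f R) / ereal (ln R)) \<ge> ereal p"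
proof (rule ccontr)
  assume "\<not> ?thesis"
  then have "Limsup at_top (\<lambda>R. ln_ennreal (f R) / ereal (ln R)) < ereal p" by simp
  then have "\<forall>\<^sub>F R in at_top. ln_ennreal (f R) / ereal (ln R) < ereal p" by (rule Limsup_lessD)
  then have "\<forall>\<^sub>F R in at_top. f R / ennreal (R powr p) \<le> 1"
    using eventually_gt_at_top[of "1::real"]
  proof eventually_elim
    case (elim R)
    have lR: "ln R > 0" using elim(2) by simp
    have P: "R powr p > 0" using elim(2) by simp
    have "f R \<le> ennreal (R powr p)"
    proof (rule ccontr)
      assume "\<not> f R \<le> ennreal (R powr p)"
      then have gt: "ennreal (R powr p) < f R" by simp
      show False
      proof (cases "f R")
        case (real y)
        then have y: "R powr p < y" using gt by (simp add: ennreal_less_iff)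
        then have y0: "y > 0" using P by linarith
        have "ln_ennreal (f R) = ereal (ln y)" using real y0 by (simp add: ln_ennreal_def)
        then have "ln y / ln R < p" using elim(1) lR by simp
        then have "ln y < p * ln R" using lR by (simp add: divide_less_eq)
        moreover have "p * ln R < ln y" using y P y0 elim(2) by (metis ln_less_cancel_iff ln_powr)
        ultimately show False by simp
      next
        case top
        then have "ln_ennreal (f R) = \<infinity>" by (simp add: ln_ennreal_def)
        then show False using elim(1) lR by simp
      qed
    qed
    then have "f R / ennreal (R powr p) \<le> ennreal (R powr p) / ennreal (R powr p)" by (rule divide_right_mono_ennreal)
    also have "\<dots> = 1" using P by (simp add: ennreal_divide_self)
    finally show ?case .
  qed
  then have "Limsup at_top (\<lambda>R. f R / ennreal (R powr p)) \<le> 1" by (rule Limsup_bounded)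
  then show False using L by (simp add: top_unique)
qed

theorem theorem5:
  fixes \<A> :: "('a::{t2_space, second_countable_topology}, 'n::finite) chart set"
    and g :: "('a, 'n) metric"
    and vol :: "'a measure"
    and A :: "('a, 'n) operator"
    and u :: "'a \<Rightarrow> real"
    and p q :: real
    and x\<^sub>0 :: 'a
    and E\<^sub>0 :: "'a set"
  assumes "riemannian_manifold \<A> g"
    and "connected (UNIV :: 'a set)"
    and "complete_manifold \<A> g"
    and "riemannian_volume \<A> g vol"
    and "1 < p"
    and "caratheodory_operator \<A> A"
    and "weakly_coercive \<A> g p A"
    and "u \<in> W1p_loc \<A> g vol p"
    and "emeasure vol {x. u x > 0} > 0"
    and "weakly_nonneg_on \<A> g vol p A u {x. u x > 0}"
    and "E\<^sub>0 \<in> sets vol" and "E\<^sub>0 \<subseteq> {x. u x > 0}" and "emeasure vol E\<^sub>0 > 0"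
    and "\<forall>x\<in>E\<^sub>0. A x (u x) (grad \<A> g vol u x) \<noteq> zero_tvec"
    and "q > p - 1"
  shows "Limsup at_top (\<lambda>R. (\<integral>\<^sup>+x\<in>geodesic_ball \<A> g x\<^sub>0 R. ennreal (max (u x) 0 powr q) \<partial>vol)
           / ennreal (R powr p)) = \<infinity>
       \<and> Limsup at_top (\<lambda>R. ln_ennreal (\<integral>\<^sup>+x\<in>geodesic_ball \<A> g x\<^sub>0 R. ennreal (max (u x) 0 powr q) \<partial>vol)
           / ereal (ln R)) \<ge> ereal p"
proof -
  interpret riem_volume \<A> g vol
    using assms(1-4) by unfold_locales
  let ?I = "\<lambda>R. (\<integral>\<^sup>+x\<in>geodesic_ball \<A> g x\<^sub>0 R. ennreal (max (u x) 0 powr q) \<partial>vol)"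
  have L: "Limsup at_top (\<lambda>R. ?I R / ennreal (R powr p)) = \<infinity>"
  proof (rule ccontr)
    assume "Limsup at_top (\<lambda>R. ?I R / ennreal (R powr p)) \<noteq> \<infinity>"
    then obtain C :: real where C: "C \<ge> 0" "\<forall>\<^sub>F R in at_top. ?I R / ennreal (R powr p) \<le> ennreal C"
      by (rule Limsup_ennreal_not_top)
    obtain R1 where R1: "\<And>R. R \<ge> R1 \<Longrightarrow> ?I R / ennreal (R powr p) \<le> ennreal C"
      using C(2) unfolding eventually_at_top_linorder by blast
    \<comment> \<open>The maximum with 1 makes R^p positive, so that the division can be undone in
      the extended nonnegative reals.\<close>
    have growth: "?I R \<le> ennreal (C * R powr p)" if R: "R \<ge> max R1 1" for R
    proof -
      have P: "R powr p > 0" using R by simp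
      have "?I R = ?I R / ennreal (R powr p) * ennreal (R powr p)"
        using P by (subst ennreal_divide_times) (simp add: ennreal_divide_self)
      also have "\<dots> \<le> ennreal C * ennreal (R powr p)" using R by (intro mult_right_mono R1) auto
      also have "\<dots> = ennreal (C * R powr p)" using C(1) by (simp add: ennreal_mult)
      finally show ?thesis .
    qed
    have "AE x in vol. u x > 0 \<longrightarrow> A x (u x) (grad \<A> g vol u x) = zero_tvec"
      by (rule flux_vanishes[OF assms(5,15,6,7,8,10) growth C(1)])
    \<comment> \<open>The flux is nonzero on all of \<open>E\<^sub>0\<close>, so this measurable set
      would be null.\<close>
    then have "AE x in vol. x \<notin> E\<^sub>0"
      by eventually_elim (use assms(12,14) in blast)
    then have "emeasure vol E\<^sub>0 = 0"
      using assms(11) by (simp add: AE_iff_measurable[of E\<^sub>0] space_vol)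
    then show False using assms(13) by simp
  qed
  show ?thesis by (rule conjI[OF L Limsup_log_ge[OF L]])
qed

end
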